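(* Let $N\ge3$, let $m,n\ge2$ be integers with $m+n=N+1$, $G=O(m)\times O(n)$, $\alpha:=\frac m2-1$, $\beta:=\frac n2-1$, and for $i\in\mathbb N_0=\{0,1,2,\dots\}$ let $\Phi_i:=P_i^{(\alpha,\beta)}\circ f:\mathbb S^N\to\mathbb R$, where $f(x,y)=|x|^2-|y|^2$ for $(x,y)\in\mathbb S^N\subset\mathbb R^m\times\mathbb R^n$. Then the sequence $(\Phi_i)$ is an orthogonal basis of $L^2_g(\mathbb S^N)^G$ and of $H^1_g(\mathbb S^N)^G$ consisting of $G$-invariant eigenfunctions of the eigenvalue problem $$-\Delta_g\Phi_i=\lambda_i\Phi_i\quad\text{on }\mathbb S^N$$ associated to the simple eigenvalues (simple among $G$-invariant eigenfunctions) $\lambda_i=2i(N-1+2i)$, $i\in\mathbb N_0$. Moreover, $(\Phi_i)$ is also an orthogonal basis of $H^s_g(\mathbb S^N)^G$ for $s\in(0,1)$, and $\Phi_i$ is an eigenfunction of the conformal fractional Laplacian $\mathscr P_g^s$, namely, $$\mathscr P_g^s\Phi_i=\varphi_{N,s}(\lambda_i)\Phi_i\quad\text{on }\mathbb S^N,$$ where $\varphi_{N,s}$ satisfies $C^{-1}(1+\lambda_i^s)\le\varphi_{N,s}(\lambda_i)\le C(1+\lambda_i^s)$ for all $i\in\mathbb N_0$ and for some $C>1$.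
   Context: $G=O(m)\times O(n)\subset O(N+1)$ acts on the unit sphere $\mathbb S^N\subset\mathbb R^{N+1}=\mathbb R^m\times\mathbb R^n$ with round metric $g$, volume element $dV_g$ and Laplace–Beltrami operator $\Delta_g$. A superscript $G$ denotes the subspace of $G$-invariant functions ($u(\gamma z)=u(z)$ for all $\gamma\in G$). $H^1_g(\mathbb S^N)$ is the usual Sobolev space with its standard inner product. For $s\in(0,1)$, $c_{N,s}=4^s\pi^{-N/2}\frac{\Gamma(\frac N2+s)}{\Gamma(2-s)}s(1-s)$, $A_{N,s}=\frac{\Gamma(\frac N2+s)}{\Gamma(\frac N2-s)}$ and $u$ smooth, $\mathscr P_g^su(z)=c_{N,s}\,\mathrm{p.v.}\int_{\mathbb S^N}\frac{u(z)-u(\zeta)}{|z-\zeta|^{N+2s}}dV_g(\zeta)+A_{N,s}u(z)$. $H^s_g(\mathbb S^N)$ is the closure of $C^\infty(\mathbb S^N)$ in $L_g^2(\mathbb S^N)$ for the norm induced by $\langle u,v\rangle_{H^s_g(\mathbb S^N)}=\frac{c_{N,s}}2\iint_{\mathbb S^N\times\mathbb S^N}\frac{(u(z)-u(\zeta))(v(z)-v(\zeta))}{|z-\zeta|^{N+2s}}dV_g(z)dV_g(\zeta)+A_{N,s}\int_{\mathbb S^N}uv\,dV_g$. $\varphi_{N,s}$ is the Fourier symbol of $\mathscr P_g^s$: a positive function such that every smooth eigenfunction of $-\Delta_g$ on $\mathbb S^N$ with eigenvalue $\lambda$ is an eigenfunction of $\mathscr P_g^s$ with eigenvalue $\varphi_{N,s}(\lambda)$.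 For $\alpha,\beta>-1$, the $i$-th Jacobi polynomial $P_i^{(\alpha,\beta)}$ is the unique monic polynomial satisfying the Jacobi equation $(1-t^2)x''+[\beta-\alpha-(\alpha+\beta+2)t]x'+i(i+\alpha+\beta+1)x=0$.
   Formalization: Φ_i is taken as P_i^{(β,α)}∘f instead of P_i^{(α,β)}∘f: with the stated Jacobi equation and f=|x|²−|y|², the printed order fails for m≠n (already at i=1, Φ_1 is not an eigenfunction); for m=n the two agree. *)

theory Defs
  imports
    "HOL-Analysis.Analysis"
    "HOL-Computational_Algebra.Polynomial"
begin

section \<open>The round unit sphere of a Euclidean space\<close>

text \<open>
  Throughout, functions and vector fields on the unit sphere are total functions on the ambient
  space \<open>'a\<close>, of which only the values on \<open>sphere 0 1\<close> matter. The sphere has dimension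
  \<open>N = DIM('a) - 1\<close>.
\<close>

subsection \<open>Volume element\<close>

text \<open>
  The Riemannian volume of a Borel set \<open>A\<close> of the unit sphere is \<open>DIM('a)\<close> times the Lebesgue
  measure of the cone of all \<open>r *\<^sub>R a\<close> with \<open>a \<in> A\<close> and \<open>0 < r < 1\<close> (polar coordinates). The origin
  is removed because \<open>sgn 0 = 0\<close> is not on the sphere.
\<close>
definition sphere_vol :: "'a::euclidean_space measure" where
  "sphere_vol = scale_measure (of_nat DIM('a))
     (distr (restrict_space lborel (ball 0 1 - {0})) (restrict_space borel (sphere 0 1)) sgn)"

lemma space_sphere_vol [simp]: "space (sphere_vol :: 'a::euclidean_space measure) = sphere 0 1"
  by (simp add: sphere_vol_def space_scale_measure space_restrict_space)

lemma sets_sphere_vol: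
  "sets (sphere_vol :: 'a::euclidean_space measure) = sets (restrict_space borel (sphere 0 1))"
  by (simp add: sphere_vol_def)

lemma emeasure_sphere_vol:
  fixes A :: "'a::euclidean_space set"
  assumes "A \<in> sets borel" "A \<subseteq> sphere 0 1"
  shows "emeasure sphere_vol A =
    of_nat DIM('a) * emeasure lborel {x \<in> ball 0 1 - {0}. sgn x \<in> A}"
proof -
  let ?M = "restrict_space lborel (ball 0 1 - {0}) :: 'a measure"
  let ?S = "restrict_space borel (sphere 0 1) :: 'a measure"
  have sgn_eq: "(sgn :: 'a \<Rightarrow> 'a) = (\<lambda>x. x /\<^sub>R norm x)"
    by (auto simp: sgn_div_norm)
  have "(sgn :: 'a \<Rightarrow> 'a) \<in> borel_measurable borel"
    unfolding sgn_eq by measurable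
  hence "(sgn :: 'a \<Rightarrow> 'a) \<in> borel_measurable ?M"
    by (intro measurable_restrict_space1) (simp add: measurable_lborel1)
  hence meas: "(sgn :: 'a \<Rightarrow> 'a) \<in> measurable ?M ?S"
    by (intro measurable_restrict_space2) (auto simp: space_restrict_space norm_sgn)
  have A: "A \<in> sets ?S"
    using assms by (auto simp: sets_restrict_space)
  have sub: "sgn -` A \<inter> space ?M \<subseteq> ball 0 1 - {0}"
    by (auto simp: space_restrict_space)
  have "emeasure sphere_vol A = of_nat DIM('a) * emeasure ?M (sgn -` A \<inter> space ?M)"
    by (simp add: sphere_vol_def emeasure_distr[OF meas A])
  also have "emeasure ?M (sgn -` A \<inter> space ?M) = emeasure lborel (sgn -` A \<inter> space ?M)"
    using sub by (intro emeasure_restrict_space) auto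
  also have "sgn -` A \<inter> space ?M = {x \<in> ball 0 1 - {0}. sgn x \<in> A}"
    by (auto simp: space_restrict_space)
  finally show ?thesis .
qed


subsection \<open>Smooth functions, gradient, divergence and the Laplace--Beltrami operator\<close>

primrec Ck_on :: "nat \<Rightarrow> 'a::euclidean_space set \<Rightarrow> ('a \<Rightarrow> real) \<Rightarrow> bool" where
  "Ck_on 0 U u \<longleftrightarrow> continuous_on U u"
| "Ck_on (Suc k) U u \<longleftrightarrow> (\<forall>x\<in>U. u differentiable (at x)) \<and>
     (\<forall>b\<in>Basis. Ck_on k U (\<lambda>x. frechet_derivative u (at x) b))"

definition smooth_on_sphere :: "('a::euclidean_space \<Rightarrow> real) \<Rightarrow> bool" where
  "smooth_on_sphere u \<longleftrightarrow>
     (\<exists>U v. open U \<and> sphere 0 1 \<subseteq> U \<and> (\<forall>k. Ck_on k U v) \<and> (\<forall>z\<in>sphere 0 1. v z = u z))"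

text \<open>
  A derivative within the sphere at \<open>z\<close> is determined by the function only on the tangent space
  \<open>{w. w \<bullet> z = 0}\<close>; the normalisations \<open>v \<bullet> z = 0\<close> and \<open>L z = 0\<close> below single out one candidate.
\<close>
definition sphere_grad :: "('a::euclidean_space \<Rightarrow> real) \<Rightarrow> 'a \<Rightarrow> 'a" where
  "sphere_grad u z =
     (THE v. v \<bullet> z = 0 \<and> (u has_derivative (\<lambda>h. v \<bullet> h)) (at z within sphere 0 1))"

definition sphere_deriv :: "('a::euclidean_space \<Rightarrow> 'a) \<Rightarrow> 'a \<Rightarrow> 'a \<Rightarrow> 'a" where
  "sphere_deriv X z =
     (THE L. L z = 0 \<and> (X has_derivative L) (at z within sphere 0 1))"

text \<open>
  The Levi-Civita connection of the round metric is the tangential part of the ambient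
  derivative, and the normal direction contributes \<open>L z \<bullet> z = 0\<close>. Hence, for a tangential field,
  the trace over an orthonormal basis of the ambient space is the Riemannian divergence.
\<close>
definition sphere_div :: "('a::euclidean_space \<Rightarrow> 'a) \<Rightarrow> 'a \<Rightarrow> real" where
  "sphere_div X z = (\<Sum>b\<in>Basis. sphere_deriv X z b \<bullet> b)"

definition laplace_beltrami :: "('a::euclidean_space \<Rightarrow> real) \<Rightarrow> 'a \<Rightarrow> real" where
  "laplace_beltrami u = sphere_div (sphere_grad u)"

definition lb_eigenfunction :: "real \<Rightarrow> ('a::euclidean_space \<Rightarrow> real) \<Rightarrow> bool" where
  "lb_eigenfunction \<mu> u \<longleftrightarrow> smooth_on_sphere u \<and> (\<exists>z\<in>sphere 0 1. u z \<noteq> 0) \<and>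
     (\<forall>z\<in>sphere 0 1. - laplace_beltrami u z = \<mu> * u z)"


subsection \<open>The Lebesgue space and the Sobolev space of order one\<close>

definition L2_sphere :: "('a::euclidean_space \<Rightarrow> real) set" where
  "L2_sphere = {u \<in> borel_measurable sphere_vol. integrable sphere_vol (\<lambda>z. (u z)\<^sup>2)}"

definition L2_inner :: "('a::euclidean_space \<Rightarrow> real) \<Rightarrow> ('a \<Rightarrow> real) \<Rightarrow> real" where
  "L2_inner u v = (LINT z|sphere_vol. u z * v z)"

definition weak_grad :: "('a::euclidean_space \<Rightarrow> real) \<Rightarrow> ('a \<Rightarrow> 'a) \<Rightarrow> bool" where
  "weak_grad u X \<longleftrightarrow>
     X \<in> borel_measurable sphere_vol \<and> integrable sphere_vol (\<lambda>z. (norm (X z))\<^sup>2) \<and>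
     (AE z in sphere_vol. X z \<bullet> z = 0) \<and>
     (\<forall>Y. (\<forall>b\<in>Basis. smooth_on_sphere (\<lambda>z. Y z \<bullet> b)) \<and> (\<forall>z\<in>sphere 0 1. Y z \<bullet> z = 0) \<longrightarrow>
        (LINT z|sphere_vol. u z * sphere_div Y z) = - (LINT z|sphere_vol. X z \<bullet> Y z))"

definition H1_sphere :: "('a::euclidean_space \<Rightarrow> real) set" where
  "H1_sphere = {u \<in> L2_sphere. \<exists>X. weak_grad u X}"

text \<open>Weak gradients are unique up to null sets, so the choice does not affect the integral.\<close>
definition H1_inner :: "('a::euclidean_space \<Rightarrow> real) \<Rightarrow> ('a \<Rightarrow> real) \<Rightarrow> real" where
  "H1_inner u v =
     (LINT z|sphere_vol. (SOME X. weak_grad u X) z \<bullet> (SOME X. weak_grad v X) z) +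
     (LINT z|sphere_vol. u z * v z)"


subsection \<open>Fractional Sobolev spaces and the conformal fractional Laplacian\<close>

definition frac_c :: "nat \<Rightarrow> real \<Rightarrow> real" where
  "frac_c N s = 4 powr s * pi powr (- (real N / 2)) *
     (Gamma (real N / 2 + s) / Gamma (2 - s)) * s * (1 - s)"

definition frac_A :: "nat \<Rightarrow> real \<Rightarrow> real" where
  "frac_A N s = Gamma (real N / 2 + s) / Gamma (real N / 2 - s)"

definition Hs_inner :: "real \<Rightarrow> ('a::euclidean_space \<Rightarrow> real) \<Rightarrow> ('a \<Rightarrow> real) \<Rightarrow> real" where
  "Hs_inner s u v = (let N = DIM('a) - 1 in
     frac_c N s / 2 *
       (LINT (z, \<zeta>)|(sphere_vol \<Otimes>\<^sub>M sphere_vol).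
          (u z - u \<zeta>) * (v z - v \<zeta>) / norm (z - \<zeta>) powr (real N + 2 * s)) +
     frac_A N s * (LINT z|sphere_vol. u z * v z))"

text \<open>
  The square of the norm induced by \<open>Hs_inner\<close>, with value \<open>\<infinity>\<close> (instead of the value \<open>0\<close> of a
  Bochner integral) for functions of infinite energy.
\<close>
definition Hs_sqnorm :: "real \<Rightarrow> ('a::euclidean_space \<Rightarrow> real) \<Rightarrow> ennreal" where
  "Hs_sqnorm s u = (let N = DIM('a) - 1 in
     ennreal (frac_c N s / 2) *
       (\<integral>\<^sup>+ (z, \<zeta>). ennreal ((u z - u \<zeta>)\<^sup>2 / norm (z - \<zeta>) powr (real N + 2 * s))
          \<partial>(sphere_vol \<Otimes>\<^sub>M sphere_vol)) +
     ennreal (frac_A N s) * (\<integral>\<^sup>+ z. ennreal ((u z)\<^sup>2) \<partial>sphere_vol))"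

definition Hs_sphere :: "real \<Rightarrow> ('a::euclidean_space \<Rightarrow> real) set" where
  "Hs_sphere s = {u \<in> L2_sphere. \<exists>w :: nat \<Rightarrow> 'a \<Rightarrow> real.
     (\<forall>k. smooth_on_sphere (w k)) \<and> (\<lambda>k. Hs_sqnorm s (\<lambda>z. u z - w k z)) \<longlonglongrightarrow> 0}"

text \<open>
  \<open>has_conf_frac_lap s u z y\<close>: the principal value defining the conformal fractional Laplacian of
  order \<open>s\<close> of \<open>u\<close> at \<open>z\<close> exists, and the resulting value of the operator is \<open>y\<close>.
\<close>
definition has_conf_frac_lap ::
    "real \<Rightarrow> ('a::euclidean_space \<Rightarrow> real) \<Rightarrow> 'a \<Rightarrow> real \<Rightarrow> bool" where
  "has_conf_frac_lap s u z y \<longleftrightarrow> (let N = DIM('a) - 1 in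
     ((\<lambda>\<epsilon>. frac_c N s *
          (LINT \<zeta>:{\<zeta> \<in> sphere 0 1. \<epsilon> < norm (z - \<zeta>)}|sphere_vol.
             (u z - u \<zeta>) / norm (z - \<zeta>) powr (real N + 2 * s)) +
        frac_A N s * u z) \<longlongrightarrow> y) (at_right 0))"

text \<open>
  A Fourier symbol of the conformal fractional Laplacian on the unit sphere of \<open>'a\<close>; its values on
  the spectrum are determined by this property.
\<close>
definition is_fourier_symbol :: "'a::euclidean_space itself \<Rightarrow> real \<Rightarrow> (real \<Rightarrow> real) \<Rightarrow> bool" where
  "is_fourier_symbol T s \<phi> \<longleftrightarrow> (\<forall>\<mu>\<ge>0. \<phi> \<mu> > 0) \<and>
     (\<forall>\<mu> (u :: 'a \<Rightarrow> real). lb_eigenfunction \<mu> u \<longrightarrow>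
        (\<forall>z\<in>sphere 0 1. has_conf_frac_lap s u z (\<phi> \<mu> * u z)))"


section \<open>Invariant functions\<close>

definition OxO ::
    "('a::real_inner \<times> 'b::real_inner \<Rightarrow> 'a \<times> 'b) set" where
  "OxO = {map_prod A B | A B. orthogonal_transformation A \<and> orthogonal_transformation B}"

definition invariant_on_sphere ::
    "('a::euclidean_space \<Rightarrow> 'a) set \<Rightarrow> ('a \<Rightarrow> real) \<Rightarrow> bool" where
  "invariant_on_sphere G u \<longleftrightarrow> (\<forall>\<gamma>\<in>G. \<forall>z\<in>sphere 0 1. u (\<gamma> z) = u z)"

text \<open>Invariance of an element of a function space, that is, of a function up to null sets.\<close>
definition invariants ::
    "('a::euclidean_space \<Rightarrow> 'a) set \<Rightarrow> ('a \<Rightarrow> real) set \<Rightarrow> ('a \<Rightarrow> real) set" where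
  "invariants G V = {u \<in> V. \<forall>\<gamma>\<in>G. AE z in sphere_vol. u (\<gamma> z) = u z}"


section \<open>Orthogonal bases\<close>

definition orthogonal_basis ::
    "('a \<Rightarrow> real) set \<Rightarrow> (('a \<Rightarrow> real) \<Rightarrow> ('a \<Rightarrow> real) \<Rightarrow> real) \<Rightarrow> (nat \<Rightarrow> 'a \<Rightarrow> real) \<Rightarrow> bool" where
  "orthogonal_basis V ip e \<longleftrightarrow>
     (\<forall>i. e i \<in> V \<and> ip (e i) (e i) \<noteq> 0) \<and>
     (\<forall>i j. i \<noteq> j \<longrightarrow> ip (e i) (e j) = 0) \<and>
     (\<forall>u\<in>V. \<exists>c :: nat \<Rightarrow> real.
        (\<lambda>k. let r = (\<lambda>z. u z - (\<Sum>i<k. c i * e i z)) in ip r r) \<longlonglongrightarrow> 0)"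


section \<open>Jacobi polynomials\<close>

text \<open>The degree need not be prescribed: for \<open>a, b > -1\<close> the equation forces it to be \<open>i\<close>.\<close>
definition jacobi_poly :: "nat \<Rightarrow> real \<Rightarrow> real \<Rightarrow> real poly" where
  "jacobi_poly i a b = (THE p. lead_coeff p = 1 \<and>
     (\<forall>t. (1 - t\<^sup>2) * poly (pderiv (pderiv p)) t +
          (b - a - (a + b + 2) * t) * poly (pderiv p) t +
          real i * (real i + a + b + 1) * poly p t = 0))"

text \<open>
  On the unit sphere of \<open>\<real>\<^sup>m \<times> \<real>\<^sup>n\<close> write \<open>t = |x|\<^sup>2 - |y|\<^sup>2\<close> (this is \<open>sqnorm_diff\<close>). The
  Laplace--Beltrami operator maps \<open>w(t)\<close> to
  \<open>4 (1 - t\<^sup>2) w''(t) + (2 (m - n) - 2 (m + n) t) w'(t)\<close>. With \<open>\<alpha> = m / 2 - 1\<close> and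
  \<open>\<beta> = n / 2 - 1\<close>, the eigenvalue equation is therefore the Jacobi equation with the parameters
  in the order \<open>a = \<beta>\<close>, \<open>b = \<alpha>\<close>, so \<open>jacobi_poly i \<beta> \<alpha>\<close> is to be composed with \<open>sqnorm_diff\<close>.
  In the order \<open>\<alpha>\<close>, \<open>\<beta>\<close>, which one also finds in the literature, the composition fails to be an
  eigenfunction for \<open>m \<noteq> n\<close> and \<open>i = 1\<close>; for \<open>m = n\<close> the order is immaterial.
\<close>
definition sqnorm_diff :: "'a::real_normed_vector \<times> 'b::real_normed_vector \<Rightarrow> real" where
  "sqnorm_diff z = (norm (fst z))\<^sup>2 - (norm (snd z))\<^sup>2"

end

theory Submission
  imports Defs
begin

text \<open>
  Write \<open>t = |x|\<^sup>2 - |y|\<^sup>2\<close>. The rotation generators \<open>x\<^sub>a \<partial>\<^sub>b - x\<^sub>b \<partial>\<^sub>a\<close> have mean zero by rotation invariance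
  of the measure, and every tangential divergence is a sum of such terms; this gives Green's formula
  and hence the orthogonality of eigenfunctions and the identification of weak gradients.
  An invariant function orthogonal to all polynomials in \<open>t\<close> is orthogonal to all exponentials
  \<open>exp (w \<bullet> z)\<close>, because its integral against them depends only on the norms of the two components
  of \<open>w\<close> and averaging over \<open>w\<close> produces a function of \<open>t\<close>. So it vanishes, which is completeness
  in \<open>L\<^sup>2\<close> and yields the simplicity of the eigenvalues.

  In the two Sobolev spaces the inner product with \<open>\<Phi>\<^sub>i\<close> is a multiple of the one in \<open>L\<^sup>2\<close>, so the
  \<open>L\<^sup>2\<close> expansion of a function is also its expansion there: by Bessel's inequality it converges in
  the stronger norm, and its limit can only be the function itself. For \<open>H\<^sup>s\<close> the proportionality
  holds since integral operators with a kernel depending on \<open>z \<bullet> \<zeta>\<close> commute with the Laplacian;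
  it is applied to regularised kernels increasing to \<open>|z - \<zeta>|\<close> to the power \<open>- N - 2 s\<close>.

  The symbol at \<open>k (k + N - 1)\<close> is read off from the eigenfunction \<open>u = Re (x\<^sub>a + i x\<^sub>b)\<^sup>k\<close> at the
  point where it attains its maximum \<open>1\<close>. There \<open>0 \<le> 1 - u \<le> min 2 (k\<^sup>2 d\<^sup>2 / 2)\<close> with \<open>d\<close> the distance to
  that point, and \<open>1 - u\<close> is bounded below on a set of measure of order \<open>k\<close> to the power \<open>-N\<close> at distance of
  order \<open>1 / k\<close>, so the singular integral is of order \<open>k\<close> to the power \<open>2 s\<close>.
\<close>


section \<open>Rotation invariance of the sphere measure\<close>

text \<open>Three obstacles shape the proof. The measure on the sphere is defined by Lebesgue
  measure of cones, so no charts are used: sizes of subsets of the sphere are estimated by boxes in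
  or around their cones, and integration by parts rests on rotations alone. Elements of the Sobolev
  spaces have only weak gradients or finite energy, and no density theorem is proved; in every
  pairing the second entry is the smooth function \<open>jacobi_fun i\<close>, onto which all
  derivatives are moved. Finally, the eigenvalues of the zonal integral operators are never
  computed: they exist because orthogonality to all other \<open>jacobi_fun j\<close> and
  completeness leave only multiples of \<open>jacobi_fun i\<close>. The symbol may be evaluated on
  any eigenfunction with the given eigenvalue, and \<open>jacobi_fun i\<close> is a poor choice,
  since nothing is known about its oscillation. At a maximum of a suitable eigenfunction the
  integrand is nonnegative, so the principal value involves no cancellation and can be bounded from
  both sides.\<close>

lemma orthogonal_transformation_transitive:
  fixes x y :: "'a::euclidean_space"
  assumes "norm x = norm y"
  obtains A where "orthogonal_transformation A" "A x = y"
proof (cases "x = y")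
  case True
  show ?thesis using that[of "\<lambda>x. x"] True by simp
next
  case False
  define w where "w = x - y"
  \<comment> \<open>Reflection in the hyperplane orthogonal to \<open>x - y\<close>; it exchanges
    two vectors of equal norm.\<close>
  define A where "A = (\<lambda>v. v - (2 * (v \<bullet> w) / (w \<bullet> w)) *\<^sub>R w)"
  have ww: "w \<bullet> w \<noteq> 0" using False by (simp add: w_def)
  have xy: "x \<bullet> x = y \<bullet> y" using assms by (simp add: norm_eq_sqrt_inner)
  define c where "c = 2 / (w \<bullet> w)"
  have c: "c * (w \<bullet> w) = 2" using ww by (simp add: c_def)
  have A_eq: "A v = v - (c * (v \<bullet> w)) *\<^sub>R w" for v by (simp add: A_def c_def)
  have "A u \<bullet> A v = u \<bullet> v" for u v
  proof -
    have "A u \<bullet> A v = u \<bullet> v - 2 * (c * (u \<bullet> w) * (v \<bullet> w)) + c * (u \<bullet> w) * (v \<bullet> w) * (c * (w \<bullet> w))"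
      unfolding A_eq by (simp add: inner_diff_left inner_diff_right inner_commute[of w v] algebra_simps)
    thus ?thesis by (simp add: c)
  qed
  moreover have "linear A"
    unfolding A_def by (rule linearI) (auto simp: inner_add_left algebra_simps add_divide_distrib)
  ultimately have "orthogonal_transformation A" by (simp add: orthogonal_transformation_def)
  moreover have "2 * (x \<bullet> w) = w \<bullet> w"
    using xy by (simp add: w_def inner_diff_left inner_diff_right inner_commute[of y x])
  hence "A x = y" using ww by (simp add: A_def w_def)
  ultimately show ?thesis using that by blast
qed

lemma nn_integral_lborel_shift:
  fixes c :: "'a::euclidean_space"
  assumes [measurable]: "f \<in> borel_measurable borel"
  shows "(\<integral>\<^sup>+x. f (c + x) \<partial>lborel) = (\<integral>\<^sup>+x. f x \<partial>lborel)"
proof -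
  have "(\<integral>\<^sup>+x. f x \<partial>lborel) = (\<integral>\<^sup>+x. f x \<partial>distr lborel borel ((+) c))"
    by (simp add: lborel_distr_plus)
  also have "\<dots> = (\<integral>\<^sup>+x. f (c + x) \<partial>lborel)"
    by (subst nn_integral_distr) auto
  finally show ?thesis ..
qed

lemma continuous_on_orthogonal:
  fixes A :: "'a::euclidean_space \<Rightarrow> 'a"
  shows "orthogonal_transformation A \<Longrightarrow> continuous_on S A"
  by (intro linear_continuous_on) (simp add: orthogonal_transformation_linear linear_linear flip: linear_conv_bounded_linear)

lemma measurable_orthogonal:
  fixes A :: "'a::euclidean_space \<Rightarrow> 'a"
  assumes "orthogonal_transformation A"
  shows "A \<in> borel_measurable borel"
  using continuous_on_orthogonal[OF assms] by (rule borel_measurable_continuous_onI)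

text \<open>Integrate \<open>indicator E (A x + y) * indicator B y\<close> over \<open>x\<close> and \<open>y\<close>, with \<open>B\<close> the unit ball,
  in both orders.\<close>
lemma distr_lborel_orthogonal:
  fixes A :: "'a::euclidean_space \<Rightarrow> 'a"
  assumes A: "orthogonal_transformation A"
  shows "distr lborel borel A = lborel"
proof (rule measure_eqI)
  show "sets (distr lborel borel A) = sets (lborel :: 'a measure)" by simp
next
  fix E :: "'a set" assume "E \<in> sets (distr lborel borel A)"
  hence E[measurable]: "E \<in> sets borel" by simp
  note [measurable] = measurable_orthogonal[OF A]
  have lin: "linear A" and nrm: "\<And>x. norm (A x) = norm x"
    using A by (auto simp: orthogonal_transformation)
  have bij: "bij A" using A by (rule orthogonal_transformation_bij)
  let ?B = "ball 0 1 :: 'a set"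
  have [measurable]: "?B \<in> sets borel" by simp
  define I where "I = (\<integral>\<^sup>+y. \<integral>\<^sup>+x. indicator E (A x + y) * indicator ?B y \<partial>lborel \<partial>lborel)"
  have inner1: "(\<integral>\<^sup>+x. indicator E (A x + y) \<partial>lborel) = emeasure (distr lborel borel A) E" for y
  proof -
    obtain c where c: "A c = y" using bij by (metis bij_pointE)
    have "(\<integral>\<^sup>+x. indicator E (A x + y) \<partial>lborel) = (\<integral>\<^sup>+x. indicator E (A (c + x)) \<partial>lborel)"
      using c lin by (simp add: linear_add add.commute)
    also have "\<dots> = (\<integral>\<^sup>+x. indicator E (A x) \<partial>lborel)"
      by (rule nn_integral_lborel_shift) measurable
    also have "\<dots> = (\<integral>\<^sup>+x. indicator E x \<partial>distr lborel borel A)"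
      by (subst nn_integral_distr) auto
    finally show ?thesis by simp
  qed
  have I1: "I = emeasure (distr lborel borel A) E * emeasure lborel ?B"
    unfolding I_def by (simp add: nn_integral_multc nn_integral_cmult inner1 del: nn_integral_indicator_singleton)
  have "I = (\<integral>\<^sup>+x. \<integral>\<^sup>+y. indicator E (A x + y) * indicator ?B y \<partial>lborel \<partial>lborel)"
    unfolding I_def by (rule lborel_pair.Fubini') (measurable)
  \<comment> \<open>Translating \<open>y\<close> by \<open>A x\<close> takes \<open>A\<close> out of
    the arbitrary set \<open>E\<close> and puts it into the ball, which it preserves up to a
    translation.\<close>
  also have "\<dots> = (\<integral>\<^sup>+x. \<integral>\<^sup>+y. indicator E y * indicator ?B (y - A x) \<partial>lborel \<partial>lborel)"
  proof (rule nn_integral_cong)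
    fix x
    show "(\<integral>\<^sup>+y. indicator E (A x + y) * indicator ?B y \<partial>lborel) =
          (\<integral>\<^sup>+y. indicator E y * indicator ?B (y - A x) \<partial>lborel)"
      using nn_integral_lborel_shift[of "\<lambda>y. indicator E y * indicator ?B (y - A x)" "A x"] by simp
  qed
  also have "\<dots> = (\<integral>\<^sup>+y. \<integral>\<^sup>+x. indicator E y * indicator ?B (y - A x) \<partial>lborel \<partial>lborel)"
    by (rule lborel_pair.Fubini') (measurable)
  also have "\<dots> = (\<integral>\<^sup>+y. indicator E y * emeasure lborel ?B \<partial>lborel)"
  proof (rule nn_integral_cong)
    fix y
    obtain c where c: "A c = y" using bij by (metis bij_pointE)
    have "indicator ?B (y - A x) = (indicator ?B (- c + x) :: ennreal)" for x
    proof -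
      have "norm (y - A x) = norm (- c + x)"
        using nrm[of "c - x"] c lin by (simp add: linear_diff norm_minus_commute)
      thus ?thesis by (simp add: indicator_def)
    qed
    hence "(\<integral>\<^sup>+x. indicator ?B (y - A x) \<partial>lborel) = (\<integral>\<^sup>+x. indicator ?B (- c + x) \<partial>lborel)" by simp
    also have "\<dots> = (\<integral>\<^sup>+x. indicator ?B x \<partial>lborel)" by (rule nn_integral_lborel_shift) measurable
    finally show "(\<integral>\<^sup>+x. indicator E y * indicator ?B (y - A x) \<partial>lborel) = indicator E y * emeasure lborel ?B"
      by (simp add: nn_integral_cmult)
  qed
  also have "\<dots> = emeasure lborel E * emeasure lborel ?B"
    by (simp add: nn_integral_multc)
  finally have "emeasure lborel ?B * emeasure (distr lborel borel A) E = emeasure lborel ?B * emeasure lborel E"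
    using I1 by (simp add: mult.commute)
  moreover have "emeasure lborel ?B \<noteq> 0"
    using open_not_negligible[of ?B] by (auto simp: negligible_iff_null_sets null_sets_def)
  moreover have "emeasure lborel ?B \<noteq> \<infinity>"
    using emeasure_lborel_ball_finite[of "0::'a" 1] by simp
  ultimately show "emeasure (distr lborel borel A) E = emeasure lborel E"
    by (simp add: ennreal_mult_cancel_left)
qed

lemma measurable_sphere_vol_orthogonal:
  fixes A :: "'a::euclidean_space \<Rightarrow> 'a"
  assumes A: "orthogonal_transformation A"
  shows "A \<in> measurable sphere_vol sphere_vol"
proof -
  have "A \<in> measurable (restrict_space borel (sphere 0 1)) (restrict_space borel (sphere 0 1))"
    using measurable_orthogonal[OF A] A
    by (intro measurable_restrict_space2 measurable_restrict_space1)
       (auto simp: space_restrict_space orthogonal_transformation)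
  thus ?thesis using sets_sphere_vol measurable_cong_sets by blast
qed

lemma sets_sphere_volD:
  assumes "X \<in> sets (sphere_vol :: 'a::euclidean_space measure)"
  shows "X \<in> sets borel" "X \<subseteq> sphere 0 1"
  using assms by (auto simp: sets_sphere_vol sets_restrict_space)

lemma sets_sphere_volI:
  assumes "X \<in> sets borel" "X \<subseteq> sphere 0 1"
  shows "X \<in> sets (sphere_vol :: 'a::euclidean_space measure)"
  using assms by (auto simp: sets_sphere_vol sets_restrict_space)

lemma sgn_borel_measurable [measurable]: "(sgn :: 'a::euclidean_space \<Rightarrow> 'a) \<in> borel_measurable borel"
proof -
  have "(sgn :: 'a \<Rightarrow> 'a) = (\<lambda>x. x /\<^sub>R norm x)" by (auto simp: sgn_div_norm)
  thus ?thesis by simp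
qed

text \<open>An orthogonal map commutes with \<open>sgn\<close>, so the cone over a preimage is the
  preimage of the cone, and Lebesgue measure is preserved.\<close>

lemma distr_sphere_vol_orthogonal:
  fixes A :: "'a::euclidean_space \<Rightarrow> 'a"
  assumes A: "orthogonal_transformation A"
  shows "distr sphere_vol sphere_vol A = sphere_vol"
proof (rule measure_eqI)
  fix X assume "X \<in> sets (distr sphere_vol sphere_vol A)"
  hence X: "X \<in> sets sphere_vol" by simp
  note Xb[measurable] = sets_sphere_volD(1)[OF X]
  note [measurable] = measurable_orthogonal[OF A]
  have nrm: "\<And>x. norm (A x) = norm x" and lin: "linear A"
    using A by (auto simp: orthogonal_transformation)
  have sg: "sgn (A x) = A (sgn x)" for x
    using lin nrm by (simp add: sgn_div_norm linear_cmul)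
  have m: "A -` X \<inter> sphere 0 1 \<in> sets borel"
    using measurable_sets[OF measurable_orthogonal[OF A] Xb] by auto
  have "emeasure (distr sphere_vol sphere_vol A) X = emeasure sphere_vol (A -` X \<inter> sphere 0 1)"
    by (subst emeasure_distr[OF measurable_sphere_vol_orthogonal[OF A] X]) simp
  also have "\<dots> = of_nat DIM('a) * emeasure lborel {x \<in> ball 0 1 - {0}. sgn x \<in> A -` X \<inter> sphere 0 1}"
    using m by (intro emeasure_sphere_vol) auto
  also have "{x \<in> ball 0 1 - {0}. sgn x \<in> A -` X \<inter> sphere 0 1} = A -` {x \<in> ball 0 1 - {0}. sgn x \<in> X} \<inter> space lborel"
    using nrm sg by (auto simp: norm_sgn) (metis norm_eq_zero norm_zero nrm)+
  also have "emeasure lborel \<dots> = emeasure (distr lborel borel A) {x \<in> ball 0 1 - {0}. sgn x \<in> X}"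
    by (intro emeasure_distr[symmetric]) (auto simp: measurable_orthogonal[OF A])
  also have "of_nat DIM('a) * \<dots> = emeasure sphere_vol X"
    using sets_sphere_volD[OF X] by (simp add: distr_lborel_orthogonal[OF A] emeasure_sphere_vol)
  finally show "emeasure (distr sphere_vol sphere_vol A) X = emeasure sphere_vol X" .
qed simp

lemma integral_sphere_vol_orthogonal:
  fixes A :: "'a::euclidean_space \<Rightarrow> 'a" and f :: "'a \<Rightarrow> 'b::{banach,second_countable_topology}"
  assumes "orthogonal_transformation A" "f \<in> borel_measurable sphere_vol"
  shows "(LINT z|sphere_vol. f (A z)) = (LINT z|sphere_vol. f z)"
  using integral_distr[OF measurable_sphere_vol_orthogonal[OF assms(1)] assms(2)]
  by (simp add: distr_sphere_vol_orthogonal[OF assms(1)])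

lemma AE_sphere_vol_orthogonal:
  fixes A :: "'a::euclidean_space \<Rightarrow> 'a"
  assumes "orthogonal_transformation A" "AE z in sphere_vol. P z"
  shows "AE z in sphere_vol. P (A z)"
  by (rule AE_distrD[OF measurable_sphere_vol_orthogonal[OF assms(1)]])
     (subst distr_sphere_vol_orthogonal[OF assms(1)], rule assms(2))

section \<open>Finiteness, positivity on open sets, and the size of spherical caps\<close>

lemma emeasure_sphere_vol_finite: "emeasure (sphere_vol :: 'a::euclidean_space measure) (sphere 0 1) < \<infinity>"
proof -
  have "emeasure lborel {x \<in> ball 0 1 - {0::'a}. sgn x \<in> sphere 0 1} \<le> emeasure lborel (ball (0::'a) 1)"
    by (rule emeasure_mono) auto
  also have "\<dots> < \<infinity>" by (rule emeasure_lborel_ball_finite)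
  finally show ?thesis
    by (subst emeasure_sphere_vol) (auto simp: ennreal_mult_less_top of_nat_less_top)
qed

lemma finite_measure_sphere_vol: "finite_measure (sphere_vol :: 'a::euclidean_space measure)"
  using emeasure_sphere_vol_finite by (intro finite_measureI) (auto simp: top.not_eq_extremum)

interpretation sphere_vol: finite_measure "sphere_vol :: 'a::euclidean_space measure"
  by (rule finite_measure_sphere_vol)

lemma borel_measurable_sphere_vol:
  assumes "f \<in> borel_measurable borel"
  shows "f \<in> borel_measurable sphere_vol"
  using measurable_restrict_space1[OF assms] measurable_cong_sets[OF sets_sphere_vol refl] by blast

lemma continuous_on_sphere_measurable:
  fixes f :: "'a::euclidean_space \<Rightarrow> 'b::topological_space"
  assumes "continuous_on (sphere 0 1) f"
  shows "f \<in> borel_measurable sphere_vol"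
  using borel_measurable_continuous_on_restrict[OF assms] measurable_cong_sets[OF sets_sphere_vol refl]
  by blast

lemma continuous_on_sphere_bound:
  fixes f :: "'a::euclidean_space \<Rightarrow> 'b::real_normed_vector"
  assumes "continuous_on (sphere 0 1) f"
  obtains B where "B > 0" "\<And>z. z \<in> sphere 0 1 \<Longrightarrow> norm (f z) \<le> B"
proof -
  have "bounded (f ` sphere 0 1)"
    using assms by (intro compact_imp_bounded compact_continuous_image) auto
  thus ?thesis using that by (auto simp: bounded_pos)
qed

lemma continuous_on_sphere_integrable:
  fixes f :: "'a::euclidean_space \<Rightarrow> 'b::{banach,second_countable_topology}"
  assumes "continuous_on (sphere 0 1) f"
  shows "integrable sphere_vol f"
proof -
  obtain B where "\<And>z. z \<in> sphere 0 1 \<Longrightarrow> norm (f z) \<le> B"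
    using continuous_on_sphere_bound[OF assms] by blast
  thus ?thesis
    by (intro sphere_vol.integrable_const_bound[of _ B] continuous_on_sphere_measurable assms) auto
qed

text \<open>The cone over a nonempty relatively open subset of the sphere contains a nonempty open
  set, so such a subset is not null. This turns almost everywhere identities between continuous
  functions into pointwise ones.\<close>

lemma sphere_vol_open_pos:
  fixes w :: "'a::euclidean_space \<Rightarrow> 'b::real_normed_vector"
  assumes w: "continuous_on (sphere 0 1) w" and AE: "AE z in sphere_vol. w z = 0"
    and z: "z \<in> sphere 0 1"
  shows "w z = 0"
proof (rule ccontr)
  assume nz: "w z \<noteq> 0"
  define X where "X = {z \<in> sphere 0 1. w z \<noteq> 0}"
  have "openin (top_of_set (sphere 0 1)) (sphere 0 1 \<inter> w -` (- {0}))"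
    by (rule continuous_openin_preimage_gen[OF w]) auto
  moreover have "sphere 0 1 \<inter> w -` (- {0}) = X" by (auto simp: X_def)
  ultimately have "openin (top_of_set (sphere 0 1)) X" by simp
  then obtain T where T: "open T" "X = sphere 0 1 \<inter> T" by (auto simp: openin_open)
  hence Xb: "X \<in> sets borel" by auto
  have Xs: "X \<in> sets sphere_vol" using Xb by (intro sets_sphere_volI) (auto simp: X_def)
  have "AE z in sphere_vol. z \<notin> X" using AE by eventually_elim (auto simp: X_def)
  hence "emeasure sphere_vol X = 0"
    using AE_iff_null_sets[OF Xs] by auto
  hence "emeasure lborel {x \<in> ball 0 1 - {0}. sgn x \<in> X} = 0"
    using emeasure_sphere_vol[OF Xb sets_sphere_volD(2)[OF Xs]] by simp
  moreover have eq: "{x \<in> ball 0 1 - {0}. sgn x \<in> X} = (ball 0 1 - {0}) \<inter> sgn -` T"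
    by (auto simp: T(2) norm_sgn)
  moreover have op: "open ((ball 0 1 - {0}) \<inter> (sgn :: 'a \<Rightarrow> 'a) -` T)"
    by (rule continuous_open_preimage[OF _ _ T(1)]) (auto intro!: continuous_intros simp: open_Diff)
  ultimately have "(ball 0 1 - {0}) \<inter> (sgn :: 'a \<Rightarrow> 'a) -` T = {}"
    using open_not_negligible[OF op] by (auto simp: negligible_iff_null_sets null_sets_def)
  moreover have "(1/2) *\<^sub>R z \<in> {x \<in> ball 0 1 - {0}. sgn x \<in> X}"
    using z nz by (auto simp: X_def sgn_scaleR sgn_div_norm)
  ultimately show False unfolding eq by (metis empty_iff)
qed

text \<open>After rotating the centre to a basis vector \<open>e\<close>, the cone over the cap lies
  in a box of half-width \<open>1\<close> along \<open>e\<close> and \<open>r\<close> in all other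
  directions. The constant is crude, but the power of \<open>r\<close> is the right one.\<close>

lemma sphere_vol_cap_bound:
  fixes z :: "'a::euclidean_space"
  assumes z: "z \<in> sphere 0 1" and r: "r \<ge> 0"
  shows "emeasure sphere_vol {w \<in> sphere 0 1. norm (z - w) < r} \<le>
         ennreal (real DIM('a) * 2 ^ DIM('a) * r ^ (DIM('a) - 1))"
proof -
  obtain e :: 'a where e: "e \<in> Basis" by (meson nonempty_Basis ex_in_conv)
  obtain A where A: "orthogonal_transformation A" "A e = z"
    using orthogonal_transformation_transitive[of e z] z e by auto
  have nrm: "\<And>x. norm (A x) = norm x" and lin: "linear A"
    using A by (auto simp: orthogonal_transformation)
  define l where "l = (\<Sum>b\<in>Basis. (if b = e then 1 else r) *\<^sub>R b)"
  have l: "l \<bullet> b = (if b = e then 1 else r)" if "b \<in> Basis" for b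
    using that by (simp add: l_def)
  have X: "{w \<in> sphere 0 1. norm (z - w) < r} \<in> sets borel" by measurable
  have X': "{w \<in> sphere 0 1. norm (e - w) < r} \<in> sets borel" by measurable
  have "emeasure sphere_vol {w \<in> sphere 0 1. norm (z - w) < r}
      = emeasure (distr sphere_vol sphere_vol A) {w \<in> sphere 0 1. norm (z - w) < r}"
    by (simp add: distr_sphere_vol_orthogonal[OF A(1)])
  also have "\<dots> = emeasure sphere_vol (A -` {w \<in> sphere 0 1. norm (z - w) < r} \<inter> space sphere_vol)"
    by (intro emeasure_distr measurable_sphere_vol_orthogonal A sets_sphere_volI X) auto
  also have "A -` {w \<in> sphere 0 1. norm (z - w) < r} \<inter> space sphere_vol = {w \<in> sphere 0 1. norm (e - w) < r}"
  proof -
    have "norm (z - A w) = norm (e - w)" for w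
      using nrm[of "e - w"] lin A(2) by (simp add: linear_diff)
    thus ?thesis using nrm by auto
  qed
  also have "emeasure sphere_vol \<dots> = of_nat DIM('a) * emeasure lborel
      {x \<in> ball 0 1 - {0}. sgn x \<in> {w \<in> sphere 0 1. norm (e - w) < r}}"
    using X' by (intro emeasure_sphere_vol) auto
  also have "\<dots> \<le> of_nat DIM('a) * emeasure lborel (cbox (- l) l)"
  proof (intro mult_left_mono emeasure_mono subsetI)
    fix x assume x: "x \<in> {x \<in> ball 0 1 - {0}. sgn x \<in> {w \<in> sphere 0 1. norm (e - w) < r}}"
    have "\<bar>x \<bullet> b\<bar> \<le> l \<bullet> b" if b: "b \<in> Basis" for b
    proof (cases "b = e")
      case True
      have "\<bar>x \<bullet> b\<bar> \<le> norm x" using b by (rule Basis_le_norm)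
      thus ?thesis using x True b by (auto simp: l)
    next
      case False
      have "\<bar>x \<bullet> b\<bar> = norm x * \<bar>sgn x \<bullet> b\<bar>"
        using x by (simp add: sgn_div_norm abs_mult)
      \<comment> \<open>Off the axis \<open>e\<close> has no component, so the coordinate is bounded
        by the chord to the centre.\<close>
      also have "sgn x \<bullet> b = (sgn x - e) \<bullet> b"
        using False b e by (simp add: inner_diff_left inner_Basis)
      also have "norm x * \<bar>(sgn x - e) \<bullet> b\<bar> \<le> 1 * norm (sgn x - e)"
        using x b by (intro mult_mono Basis_le_norm) auto
      also have "\<dots> \<le> r" using x by (auto simp: norm_minus_commute)
      finally show ?thesis using False b by (simp add: l)
    qed
    thus "x \<in> cbox (- l) l" by (auto simp: mem_box abs_le_iff minus_le_iff)
  qed auto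
  also have "emeasure lborel (cbox (- l) l) = ennreal (\<Prod>b\<in>Basis. 2 * (if b = e then 1 else r))"
    using r by (auto simp: emeasure_lborel_cbox_eq l inner_add_left intro!: prod.cong arg_cong[where f=ennreal])
  also have "(\<Prod>b\<in>Basis. 2 * (if b = e then 1 else r)) = 2 ^ DIM('a) * (\<Prod>b\<in>Basis. (if b = e then 1 else r))"
    by (simp add: prod.distrib)
  also have "(\<Prod>b\<in>Basis. (if b = e then 1 else r)) = (\<Prod>b\<in>Basis - {e}. r)"
    using e by (subst prod.remove[of _ e]) (auto intro!: prod.cong)
  also have "\<dots> = r ^ (DIM('a) - 1)" using e by (simp add: card_Diff_singleton)
  also have "of_nat DIM('a) * ennreal (2 ^ DIM('a) * r ^ (DIM('a) - 1)) =
      ennreal (real DIM('a) * 2 ^ DIM('a) * r ^ (DIM('a) - 1))"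
    by (simp add: ennreal_of_nat_eq_real_of_nat ennreal_mult'' [symmetric] r mult.assoc)
  finally show ?thesis .
qed


section \<open>Square-integrable functions and orthogonal series\<close>

text \<open>Vector values and arbitrary measures are allowed so that one completeness argument
  serves \<open>L^2\<close>, the pairs of a function and its weak gradient, and the difference
  quotients on pairs of points.\<close>

definition sqint :: "'x measure \<Rightarrow> ('x \<Rightarrow> 'b::euclidean_space) \<Rightarrow> bool" where
  "sqint M f \<longleftrightarrow> f \<in> borel_measurable M \<and> integrable M (\<lambda>x. (norm (f x))\<^sup>2)"

lemma sqint_measurable [measurable_dest]: "sqint M f \<Longrightarrow> f \<in> borel_measurable M"
  by (simp add: sqint_def)

lemma sqint_integrable: "sqint M f \<Longrightarrow> integrable M (\<lambda>x. (norm (f x))\<^sup>2)"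
  by (simp add: sqint_def)

lemma two_inner_le: "2 * \<bar>a \<bullet> b\<bar> \<le> (norm a)\<^sup>2 + (norm b)\<^sup>2"
proof -
  have "2 * \<bar>a \<bullet> b\<bar> \<le> 2 * (norm a * norm b)" using Cauchy_Schwarz_ineq2[of a b] by simp
  also have "\<dots> \<le> (norm a)\<^sup>2 + (norm b)\<^sup>2" using sum_squares_bound[of "norm a" "norm b"] by simp
  finally show ?thesis .
qed

lemma norm_add_sq_le: "(norm (a + b))\<^sup>2 \<le> 2 * (norm a)\<^sup>2 + 2 * (norm (b::'b::real_inner))\<^sup>2"
proof -
  have "(norm (a + b))\<^sup>2 = (norm a)\<^sup>2 + (norm b)\<^sup>2 + 2 * (a \<bullet> b)"
    by (simp add: power2_norm_eq_inner inner_add_left inner_add_right inner_commute)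
  thus ?thesis using two_inner_le[of a b] by linarith
qed

lemma sqint_inner:
  assumes "sqint M f" "sqint M g"
  shows "integrable M (\<lambda>x. f x \<bullet> g x)"
proof (rule Bochner_Integration.integrable_bound)
  show "integrable M (\<lambda>x. (norm (f x))\<^sup>2 + (norm (g x))\<^sup>2)"
    using assms by (auto simp: sqint_def)
  show "(\<lambda>x. f x \<bullet> g x) \<in> borel_measurable M" using assms by (auto simp: sqint_def)
  show "AE x in M. norm (f x \<bullet> g x) \<le> norm ((norm (f x))\<^sup>2 + (norm (g x))\<^sup>2)"
  proof (rule AE_I2)
    fix x show "norm (f x \<bullet> g x) \<le> norm ((norm (f x))\<^sup>2 + (norm (g x))\<^sup>2)"
      using two_inner_le[of "f x" "g x"] by simp
  qed
qed

lemma sqint_add: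
  assumes "sqint M f" "sqint M g"
  shows "sqint M (\<lambda>x. f x + g x)"
  unfolding sqint_def
proof
  show "(\<lambda>x. f x + g x) \<in> borel_measurable M" using assms by (auto simp: sqint_def)
  show "integrable M (\<lambda>x. (norm (f x + g x))\<^sup>2)"
  proof (rule Bochner_Integration.integrable_bound)
    show "integrable M (\<lambda>x. 2 * (norm (f x))\<^sup>2 + 2 * (norm (g x))\<^sup>2)"
      using assms by (auto simp: sqint_def)
    show "(\<lambda>x. (norm (f x + g x))\<^sup>2) \<in> borel_measurable M" using assms by (auto simp: sqint_def)
  qed (auto simp: norm_add_sq_le)
qed

lemma sqint_scale: "sqint M f \<Longrightarrow> sqint M (\<lambda>x. c *\<^sub>R f x)"
  by (auto simp: sqint_def power_mult_distrib)

lemma sqint_diff: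
  assumes "sqint M f" "sqint M g"
  shows "sqint M (\<lambda>x. f x - g x)"
  using sqint_add[OF assms(1) sqint_scale[OF assms(2), of "-1"]] by simp

lemma sqint_zero: "sqint M (\<lambda>x. 0)"
  by (simp add: sqint_def)

lemma sqint_sum: "finite I \<Longrightarrow> (\<And>i. i \<in> I \<Longrightarrow> sqint M (f i)) \<Longrightarrow> sqint M (\<lambda>x. \<Sum>i\<in>I. f i x)"
  by (induction I rule: finite_induct) (auto intro: sqint_zero sqint_add)

lemma integral_norm_add_sq_le:
  assumes "sqint M f" "sqint M g"
  shows "(LINT x|M. (norm (f x + g x))\<^sup>2) \<le> 2 * (LINT x|M. (norm (f x))\<^sup>2) + 2 * (LINT x|M. (norm (g x))\<^sup>2)"
proof -
  have "(LINT x|M. (norm (f x + g x))\<^sup>2) \<le> (LINT x|M. 2 * (norm (f x))\<^sup>2 + 2 * (norm (g x))\<^sup>2)"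
    using assms sqint_add[OF assms]
    by (intro integral_mono) (auto simp: norm_add_sq_le sqint_def)
  thus ?thesis using assms by (simp add: sqint_def)
qed

lemma sqint_AE_subseq:
  assumes f: "\<And>n. sqint M (f n)" and w: "sqint M w"
    and lim: "(\<lambda>n. LINT x|M. (norm (f n x - w x))\<^sup>2) \<longlonglongrightarrow> 0"
  obtains r :: "nat \<Rightarrow> nat" where "strict_mono r" "AE x in M. (\<lambda>n. f (r n) x) \<longlonglongrightarrow> w x"
proof -
  have "\<exists>r::nat\<Rightarrow>nat. strict_mono r \<and> (AE x in M. (\<lambda>n. (norm (f (r n) x - w x))\<^sup>2) \<longlonglongrightarrow> 0)"
    using sqint_diff[OF f w] lim
    by (intro tendsto_L1_AE_subseq) (auto simp: sqint_def)
  then obtain r :: "nat \<Rightarrow> nat" where r: "strict_mono r"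
    "AE x in M. (\<lambda>n. (norm (f (r n) x - w x))\<^sup>2) \<longlonglongrightarrow> 0" by blast
  have "AE x in M. (\<lambda>n. f (r n) x) \<longlonglongrightarrow> w x"
    using r(2)
  proof eventually_elim
    fix x assume "(\<lambda>n. (norm (f (r n) x - w x))\<^sup>2) \<longlonglongrightarrow> 0"
    hence "(\<lambda>n. sqrt ((norm (f (r n) x - w x))\<^sup>2)) \<longlonglongrightarrow> sqrt 0"
      by (rule tendsto_real_sqrt)
    thus "(\<lambda>n. f (r n) x) \<longlonglongrightarrow> w x"
      by (simp add: tendsto_norm_zero_iff LIM_zero_iff)
  qed
  with r(1) show ?thesis using that by blast
qed

text \<open>The Riesz-Fischer theorem. A rapidly Cauchy subsequence converges almost everywhere, and
  Fatou's lemma shows that the whole sequence converges to the pointwise limit in the mean.\<close>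

lemma sqint_complete:
  fixes f :: "nat \<Rightarrow> 'x \<Rightarrow> 'b::euclidean_space"
  assumes f: "\<And>n. sqint M (f n)"
    and cauchy: "\<And>e. e > 0 \<Longrightarrow> \<exists>n. \<forall>k\<ge>n. \<forall>l\<ge>n. (LINT x|M. (norm (f k x - f l x))\<^sup>2) \<le> e"
  obtains w where "sqint M w" "(\<lambda>k. LINT x|M. (norm (f k x - w x))\<^sup>2) \<longlonglongrightarrow> 0"
proof -
  note [measurable] = sqint_measurable[OF f]
  have "\<exists>n. \<forall>k\<ge>n. \<forall>l\<ge>n. (LINT x|M. (norm (f k x - f l x))\<^sup>2) \<le> (1/4) ^ j" for j :: nat
    by (rule cauchy) simp
  then obtain n where n: "\<And>j k l. k \<ge> n j \<Longrightarrow> l \<ge> n j \<Longrightarrow> (LINT x|M. (norm (f k x - f l x))\<^sup>2) \<le> (1/4) ^ j"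
    by metis
  \<comment> \<open>Summing the thresholds yields an index above all of \<open>n 0\<close>, ...,
    \<open>n j\<close> at once.\<close>
  define r where "r j = (\<Sum>i\<le>j. n i)" for j :: nat
  have rn: "r j \<ge> n i" if "i \<le> j" for i j
    unfolding r_def using that by (intro member_le_sum) auto
  have nn: "(\<integral>\<^sup>+x. ennreal ((norm (f k x - f l x))\<^sup>2) \<partial>M) = ennreal (LINT x|M. (norm (f k x - f l x))\<^sup>2)" for k l
    using sqint_diff[OF f[of k] f[of l]] by (intro nn_integral_eq_integral) (auto simp: sqint_def)
  \<comment> \<open>The weight leaves integrals of at most \<open>(1/2) ^ j\<close>, still summable,
    while boundedness of \<open>d j x\<close> forces the increments to decay geometrically, like
    \<open>(1 / sqrt 2) ^ j\<close>.\<close>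
  define d where "d j x = 2 ^ j * (norm (f (r (Suc j)) x - f (r j) x))\<^sup>2" for j x
  have d_nonneg: "0 \<le> d j x" for j x by (simp add: d_def)
  have [measurable]: "d j \<in> borel_measurable M" for j unfolding d_def by measurable
  have "(\<integral>\<^sup>+x. (\<Sum>j. ennreal (d j x)) \<partial>M) = (\<Sum>j. \<integral>\<^sup>+x. ennreal (d j x) \<partial>M)"
    by (intro nn_integral_suminf) auto
  also have "\<dots> \<le> (\<Sum>j. ennreal ((1/2) ^ j))"
  proof (rule suminf_le)
    fix j
    have "(\<integral>\<^sup>+x. ennreal (d j x) \<partial>M) = ennreal (2 ^ j) * ennreal (LINT x|M. (norm (f (r (Suc j)) x - f (r j) x))\<^sup>2)"
      unfolding d_def nn[symmetric] by (subst nn_integral_cmult[symmetric]) (auto simp: ennreal_mult)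
    also have "\<dots> \<le> ennreal (2 ^ j) * ennreal ((1/4) ^ j)"
      by (intro mult_left_mono ennreal_leI n rn) auto
    also have "\<dots> = ennreal ((1/2) ^ j)"
      by (simp add: ennreal_mult[symmetric] power_mult_distrib[symmetric])
    finally show "(\<integral>\<^sup>+x. ennreal (d j x) \<partial>M) \<le> ennreal ((1/2) ^ j)" .
  qed auto
  also have "\<dots> = ennreal (\<Sum>j. (1/2) ^ j)"
    by (intro suminf_ennreal2) auto
  also have "\<dots> < \<infinity>" by simp
  finally have "AE x in M. (\<Sum>j. ennreal (d j x)) \<noteq> \<infinity>"
    by (intro nn_integral_PInf_AE) auto
  hence conv: "AE x in M. (\<lambda>j. f (r j) x) \<longlonglongrightarrow> lim (\<lambda>j. f (r j) x)"
  proof eventually_elim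
    fix x assume "(\<Sum>j. ennreal (d j x)) \<noteq> \<infinity>"
    hence "summable (\<lambda>j. d j x)"
      using d_nonneg by (intro summable_suminf_not_top) auto
    hence "(\<lambda>j. d j x) \<longlonglongrightarrow> 0" by (rule summable_LIMSEQ_zero)
    hence "\<forall>\<^sub>F j in sequentially. d j x < 1" by (rule order_tendstoD) simp
    hence ev: "\<forall>\<^sub>F j in sequentially. norm (f (r (Suc j)) x - f (r j) x) \<le> (1 / sqrt 2) ^ j"
    proof eventually_elim
      fix j assume "d j x < 1"
      hence "(norm (f (r (Suc j)) x - f (r j) x))\<^sup>2 \<le> (1/2) ^ j"
        by (simp add: d_def field_simps)
      also have "\<dots> = ((1 / sqrt 2) ^ j)\<^sup>2"
        by (simp add: power_divide power_mult[symmetric] mult.commute[of j]) (simp add: power_mult)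
      finally show "norm (f (r (Suc j)) x - f (r j) x) \<le> (1 / sqrt 2) ^ j"
        by (rule power2_le_imp_le) simp
    qed
    have "summable (\<lambda>j. f (r (Suc j)) x - f (r j) x)"
      by (rule summable_comparison_test_ev[OF ev]) (auto intro!: summable_geometric)
    hence "convergent (\<lambda>k. \<Sum>j<k. f (r (Suc j)) x - f (r j) x)"
      by (simp add: summable_iff_convergent)
    hence "convergent (\<lambda>k. (f (r k) x - f (r 0) x) + f (r 0) x)"
      by (intro convergent_add) (auto simp: sum_lessThan_telescope[of "\<lambda>j. f (r j) x"] convergent_const)
    hence "convergent (\<lambda>k. f (r k) x)" by simp
    thus "(\<lambda>j. f (r j) x) \<longlonglongrightarrow> lim (\<lambda>j. f (r j) x)"
      by (simp add: convergent_LIMSEQ_iff)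
  qed
  define w where "w x = lim (\<lambda>j. f (r j) x)" for x
  have wm[measurable]: "w \<in> borel_measurable M" unfolding w_def by measurable
  \<comment> \<open>Fatou's lemma along the subsequence turns the Cauchy bound into a bound on the
    distance to \<open>w\<close>.\<close>
  have bound: "(\<integral>\<^sup>+x. ennreal ((norm (f k x - w x))\<^sup>2) \<partial>M) \<le> ennreal ((1/4) ^ m)" if k: "k \<ge> n m" for k m
  proof -
    have "(\<integral>\<^sup>+x. ennreal ((norm (f k x - w x))\<^sup>2) \<partial>M) =
          (\<integral>\<^sup>+x. liminf (\<lambda>j. ennreal ((norm (f k x - f (r j) x))\<^sup>2)) \<partial>M)"
    proof (rule nn_integral_cong_AE, use conv in eventually_elim)
      fix x assume "(\<lambda>j. f (r j) x) \<longlonglongrightarrow> lim (\<lambda>j. f (r j) x)"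
      hence "(\<lambda>j. ennreal ((norm (f k x - f (r j) x))\<^sup>2)) \<longlonglongrightarrow> ennreal ((norm (f k x - w x))\<^sup>2)"
        unfolding w_def by (intro tendsto_intros) auto
      thus "ennreal ((norm (f k x - w x))\<^sup>2) = liminf (\<lambda>j. ennreal ((norm (f k x - f (r j) x))\<^sup>2))"
        by (intro lim_imp_Liminf[symmetric]) auto
    qed
    also have "\<dots> \<le> liminf (\<lambda>j. \<integral>\<^sup>+x. ennreal ((norm (f k x - f (r j) x))\<^sup>2) \<partial>M)"
      by (rule nn_integral_liminf) measurable
    also have "\<dots> \<le> liminf (\<lambda>j. ennreal ((1/4) ^ m))"
    proof (rule Liminf_mono)
      show "\<forall>\<^sub>F j in sequentially. (\<integral>\<^sup>+x. ennreal ((norm (f k x - f (r j) x))\<^sup>2) \<partial>M) \<le> ennreal ((1/4) ^ m)"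
        using eventually_ge_at_top[of m]
        by eventually_elim (auto simp: nn intro!: ennreal_leI n k rn)
    qed
    finally show ?thesis by (simp add: Liminf_const)
  qed
  have sq: "sqint M (\<lambda>x. f k x - w x)" if "k \<ge> n m" for k m
    using bound[OF that] unfolding sqint_def
    by (intro conjI integrableI_bounded) (auto simp: less_top[symmetric] top_unique)
  have w: "sqint M w"
    using sqint_diff[OF f[of "n 0"] sq[OF order_refl[of "n 0"]]] by simp
  have b: "(LINT x|M. (norm (f k x - w x))\<^sup>2) \<le> (1/4) ^ m" if "k \<ge> n m" for k m
    using bound[OF that] sq[OF that]
    by (subst (asm) nn_integral_eq_integral) (auto simp: sqint_def)
  have "(\<lambda>k. LINT x|M. (norm (f k x - w x))\<^sup>2) \<longlonglongrightarrow> 0"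
  proof (rule LIMSEQ_I)
    fix e :: real assume "e > 0"
    then obtain m where m: "(1/4) ^ m < e" using real_arch_pow_inv[of e "1/4"] by auto
    have "norm ((LINT x|M. (norm (f k x - w x))\<^sup>2) - 0) < e" if "k \<ge> n m" for k
    proof -
      have "0 \<le> (LINT x|M. (norm (f k x - w x))\<^sup>2)" by (intro integral_nonneg_AE) auto
      thus ?thesis using b[OF that] m by simp
    qed
    thus "\<exists>k0. \<forall>k\<ge>k0. norm ((LINT x|M. (norm (f k x - w x))\<^sup>2) - 0) < e" by blast
  qed
  thus ?thesis using that w by blast
qed

lemma integral_norm_sum_orthogonal:
  fixes e :: "nat \<Rightarrow> 'x \<Rightarrow> 'b::euclidean_space"
  assumes e: "\<And>i. sqint M (e i)"
    and orth: "\<And>i j. i \<noteq> j \<Longrightarrow> (LINT x|M. e i x \<bullet> e j x) = 0"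
    and I: "finite I"
  shows "(LINT x|M. (norm (\<Sum>i\<in>I. c i *\<^sub>R e i x))\<^sup>2) = (\<Sum>i\<in>I. (c i)\<^sup>2 * (LINT x|M. e i x \<bullet> e i x))"
proof -
  have "(LINT x|M. (norm (\<Sum>i\<in>I. c i *\<^sub>R e i x))\<^sup>2) =
        (LINT x|M. (\<Sum>i\<in>I. \<Sum>j\<in>I. c i * c j * (e i x \<bullet> e j x)))"
    by (intro Bochner_Integration.integral_cong refl)
       (simp add: power2_norm_eq_inner inner_sum_left inner_sum_right sum_distrib_left mult_ac inner_commute)
  also have "\<dots> = (\<Sum>i\<in>I. \<Sum>j\<in>I. c i * c j * (LINT x|M. e i x \<bullet> e j x))"
    by (simp add: sqint_inner[OF e e])
  also have "\<dots> = (\<Sum>i\<in>I. \<Sum>j\<in>I. if j = i then c i * c i * (LINT x|M. e i x \<bullet> e i x) else 0)"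
    by (intro sum.cong refl) (auto simp: orth)
  also have "\<dots> = (\<Sum>i\<in>I. (c i)\<^sup>2 * (LINT x|M. e i x \<bullet> e i x))"
    using I by (simp add: power2_eq_square)
  finally show ?thesis .
qed

text \<open>Bessel's inequality makes the partial sums Cauchy. The coefficients enter through an
  equation and not as quotients, so that the \<open>L^2\<close> coefficients can be used in all
  three spaces. Nothing is said about \<open>w = u\<close>; that needs completeness of the system
  and is settled separately for each space.\<close>

lemma orthogonal_series_converges:
  fixes e :: "nat \<Rightarrow> 'x \<Rightarrow> 'b::euclidean_space"
  assumes u: "sqint M u" and e: "\<And>i. sqint M (e i)"
    and orth: "\<And>i j. i \<noteq> j \<Longrightarrow> (LINT x|M. e i x \<bullet> e j x) = 0"
    and c: "\<And>i. (LINT x|M. u x \<bullet> e i x) = c i * (LINT x|M. e i x \<bullet> e i x)"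
  obtains w where "sqint M w" "(\<lambda>k. LINT x|M. (norm ((\<Sum>i<k. c i *\<^sub>R e i x) - w x))\<^sup>2) \<longlonglongrightarrow> 0"
proof -
  define S where "S k x = (\<Sum>i<k. c i *\<^sub>R e i x)" for k :: nat and x
  define a where "a i = (c i)\<^sup>2 * (LINT x|M. e i x \<bullet> e i x)" for i
  have S: "sqint M (S k)" for k unfolding S_def by (intro sqint_sum sqint_scale e) auto
  have a_nonneg: "0 \<le> a i" for i unfolding a_def by (intro mult_nonneg_nonneg integral_nonneg_AE) auto
  have SS: "(LINT x|M. (norm (S k x))\<^sup>2) = (\<Sum>i<k. a i)" for k
    unfolding S_def a_def by (rule integral_norm_sum_orthogonal[OF e orth]) auto
  have uS: "(LINT x|M. u x \<bullet> S k x) = (\<Sum>i<k. a i)" for k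
    unfolding S_def a_def by (simp add: inner_sum_right sqint_inner[OF u e] c power2_eq_square mult.assoc)
  have "(\<Sum>i<k. a i) \<le> (LINT x|M. (norm (u x))\<^sup>2)" for k
  proof -
    have "0 \<le> (LINT x|M. (norm (u x - S k x))\<^sup>2)" by (intro integral_nonneg_AE) auto
    also have "\<dots> = (LINT x|M. (norm (u x))\<^sup>2 + (norm (S k x))\<^sup>2 - 2 * (u x \<bullet> S k x))"
      by (intro Bochner_Integration.integral_cong refl)
         (simp add: power2_norm_eq_inner inner_diff_left inner_diff_right inner_commute)
    also have "\<dots> = (LINT x|M. (norm (u x))\<^sup>2) + (\<Sum>i<k. a i) - 2 * (\<Sum>i<k. a i)"
      using sqint_integrable[OF u] sqint_integrable[OF S] sqint_inner[OF u S] by (simp add: SS uS)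
    finally show ?thesis by simp
  qed
  hence "summable a" by (intro summableI_nonneg_bounded a_nonneg)
  have "\<exists>n. \<forall>k\<ge>n. \<forall>l\<ge>n. (LINT x|M. (norm (S k x - S l x))\<^sup>2) \<le> \<epsilon>" if "\<epsilon> > 0" for \<epsilon>
  proof -
    obtain n where n: "\<And>k l. k \<ge> n \<Longrightarrow> norm (sum a {k..<l}) < \<epsilon>"
      using \<open>summable a\<close> \<open>\<epsilon> > 0\<close> unfolding summable_Cauchy by meson
    have le: "(LINT x|M. (norm (S l x - S k x))\<^sup>2) \<le> \<epsilon>" if "n \<le> k" "k \<le> l" for k l
    proof -
      have "S l x - S k x = (\<Sum>i\<in>{k..<l}. c i *\<^sub>R e i x)" for x
        unfolding S_def using that(2) sum_diff_nat_ivl[of 0 k l "\<lambda>i. c i *\<^sub>R e i x"] by (simp add: atLeast0LessThan)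
      hence "(LINT x|M. (norm (S l x - S k x))\<^sup>2) = sum a {k..<l}"
        unfolding a_def using integral_norm_sum_orthogonal[OF e orth, where I="{k..<l}" and c=c] by simp
      thus ?thesis using n[of k l] that by simp
    qed
    have "(LINT x|M. (norm (S k x - S l x))\<^sup>2) \<le> \<epsilon>" if "n \<le> k" "n \<le> l" for k l
      using le[of k l] le[of l k] that by (cases "k \<le> l") (auto simp: norm_minus_commute)
    thus ?thesis by blast
  qed
  from sqint_complete[OF S this] obtain w where
    "sqint M w" "(\<lambda>k. LINT x|M. (norm (S k x - w x))\<^sup>2) \<longlonglongrightarrow> 0" .
  thus ?thesis using that unfolding S_def by blast
qed

text \<open>Young's inequality with a parameter \<open>t\<close> takes the place of the
  Cauchy-Schwarz inequality for integrals.\<close>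

lemma sqint_inner_limit:
  assumes f: "\<And>n. sqint M (f n)" and w: "sqint M w" and g: "sqint M g"
    and lim: "(\<lambda>n. LINT x|M. (norm (f n x - w x))\<^sup>2) \<longlonglongrightarrow> 0"
  shows "(\<lambda>n. LINT x|M. f n x \<bullet> g x) \<longlonglongrightarrow> (LINT x|M. w x \<bullet> g x)"
proof (rule LIMSEQ_I)
  fix e :: real assume e: "e > 0"
  define G where "G = (LINT x|M. (norm (g x))\<^sup>2)"
  have G: "0 \<le> G" unfolding G_def by (intro integral_nonneg_AE) auto
  \<comment> \<open>Chosen so that the fixed term \<open>G / t\<close> is below \<open>e\<close>;
    the other term is made smaller than \<open>e\<close> by taking \<open>n\<close> large.\<close>
  define t where "t = (G + 1) / e"
  have t: "t > 0" using G e by (simp add: t_def)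
  have *: "2 * \<bar>(LINT x|M. f n x \<bullet> g x) - (LINT x|M. w x \<bullet> g x)\<bar> \<le> t * (LINT x|M. (norm (f n x - w x))\<^sup>2) + G / t" for n
  proof -
    have "(LINT x|M. f n x \<bullet> g x) - (LINT x|M. w x \<bullet> g x) = (LINT x|M. (f n x - w x) \<bullet> g x)"
      using sqint_inner[OF f g] sqint_inner[OF w g] by (simp add: inner_diff_left)
    also have "2 * \<bar>\<dots>\<bar> \<le> 2 * (LINT x|M. \<bar>(f n x - w x) \<bullet> g x\<bar>)"
      using integral_abs_bound by auto
    also have "\<dots> = (LINT x|M. 2 * \<bar>(f n x - w x) \<bullet> g x\<bar>)" by simp
    also have "\<dots> \<le> (LINT x|M. t * (norm (f n x - w x))\<^sup>2 + (norm (g x))\<^sup>2 / t)"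
    proof (rule integral_mono)
      show "integrable M (\<lambda>x. 2 * \<bar>(f n x - w x) \<bullet> g x\<bar>)"
        using sqint_inner[OF sqint_diff[OF f w] g] by auto
      show "integrable M (\<lambda>x. t * (norm (f n x - w x))\<^sup>2 + (norm (g x))\<^sup>2 / t)"
        using sqint_diff[OF f w] g by (auto simp: sqint_def)
      fix x
      have "2 * \<bar>(f n x - w x) \<bullet> g x\<bar> = 2 * \<bar>(sqrt t *\<^sub>R (f n x - w x)) \<bullet> ((1 / sqrt t) *\<^sub>R g x)\<bar>"
        using t by simp
      also have "\<dots> \<le> (norm (sqrt t *\<^sub>R (f n x - w x)))\<^sup>2 + (norm ((1 / sqrt t) *\<^sub>R g x))\<^sup>2"
        by (rule two_inner_le)
      also have "\<dots> = t * (norm (f n x - w x))\<^sup>2 + (norm (g x))\<^sup>2 / t"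
        using t by (simp add: power_mult_distrib power_divide)
      finally show "2 * \<bar>(f n x - w x) \<bullet> g x\<bar> \<le> t * (norm (f n x - w x))\<^sup>2 + (norm (g x))\<^sup>2 / t" .
    qed
    also have "\<dots> = t * (LINT x|M. (norm (f n x - w x))\<^sup>2) + G / t"
      using sqint_diff[OF f w] g by (simp add: sqint_def G_def)
    finally show ?thesis .
  qed
  have "\<forall>\<^sub>F n in sequentially. (LINT x|M. (norm (f n x - w x))\<^sup>2) < e / t"
    using lim t e by (intro order_tendstoD) auto
  then obtain n0 where n0: "\<And>n. n \<ge> n0 \<Longrightarrow> (LINT x|M. (norm (f n x - w x))\<^sup>2) < e / t"
    by (auto simp: eventually_sequentially)
  have "G / t < e" using G e by (simp add: t_def field_simps)
  have "norm ((LINT x|M. f n x \<bullet> g x) - (LINT x|M. w x \<bullet> g x)) < e" if "n \<ge> n0" for n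
  proof -
    have "t * (LINT x|M. (norm (f n x - w x))\<^sup>2) < e"
      using n0[OF that] t by (simp add: field_simps)
    thus ?thesis using *[of n] \<open>G / t < e\<close> by simp
  qed
  thus "\<exists>n0. \<forall>n\<ge>n0. norm ((LINT x|M. f n x \<bullet> g x) - (LINT x|M. w x \<bullet> g x)) < e" by blast
qed

section \<open>Square-integrable functions on the sphere and families of test functions that detect
  them\<close>

lemma L2_sphere_iff_sqint: "u \<in> L2_sphere \<longleftrightarrow> sqint sphere_vol u"
  by (simp add: L2_sphere_def sqint_def)

lemma continuous_on_sphere_sqint:
  fixes f :: "'a::euclidean_space \<Rightarrow> 'b::euclidean_space"
  assumes "continuous_on (sphere 0 1) f"
  shows "sqint sphere_vol f"
  unfolding sqint_def using assms
  by (intro conjI continuous_on_sphere_measurable continuous_on_sphere_integrable continuous_intros)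

lemma sqint_sphere_integrable:
  fixes u :: "'a::euclidean_space \<Rightarrow> real"
  assumes "sqint sphere_vol u"
  shows "integrable sphere_vol u"
  using sqint_inner[OF assms continuous_on_sphere_sqint[of "\<lambda>_. 1"]] by simp

lemma integrable_mult_continuous_sphere:
  fixes g :: "'a::euclidean_space \<Rightarrow> real"
  assumes g: "integrable sphere_vol g" and p: "continuous_on (sphere 0 1) p"
  shows "integrable sphere_vol (\<lambda>z. g z * p z)"
proof -
  obtain B where B: "B > 0" "\<And>z. z \<in> sphere 0 1 \<Longrightarrow> norm (p z) \<le> B"
    using continuous_on_sphere_bound[OF p] by blast
  show ?thesis
  proof (rule Bochner_Integration.integrable_bound)
    show "integrable sphere_vol (\<lambda>z. B * g z)" using g by simp
    show "(\<lambda>z. g z * p z) \<in> borel_measurable sphere_vol"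
      using g continuous_on_sphere_measurable[OF p] by simp
    show "AE z in sphere_vol. norm (g z * p z) \<le> norm (B * g z)"
    proof (rule AE_I2)
      fix z :: 'a assume "z \<in> space sphere_vol"
      hence "\<bar>p z\<bar> * \<bar>g z\<bar> \<le> B * \<bar>g z\<bar>" using B(2)[of z] by (intro mult_right_mono) auto
      thus "norm (g z * p z) \<le> norm (B * g z)" using B(1) by (simp add: abs_mult mult.commute)
    qed
  qed
qed

text \<open>Continuous cut-offs decrease to the indicator of a closed set, so the integrals of
  \<open>g\<close> over closed sets vanish. Closed sets are stable under intersection and generate
  the Borel sets; Dynkin's theorem extends this to all Borel sets.\<close>

lemma AE_zero_if_orthogonal_continuous:
  fixes g :: "'a::euclidean_space \<Rightarrow> real"
  assumes g: "integrable sphere_vol g"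
    and orth: "\<And>p. continuous_on (sphere 0 1) p \<Longrightarrow> (LINT z|sphere_vol. g z * p z) = 0"
  shows "AE z in sphere_vol. g z = 0"
proof -
  let ?M = "sphere_vol :: 'a measure"
  let ?P = "\<lambda>A. (LINT z:(A \<inter> sphere 0 1)|?M. g z) = 0"
  have Ms: "A \<inter> sphere 0 1 \<in> sets ?M" if "A \<in> sets borel" for A
    using that by (intro sets_sphere_volI) auto
  have int: "set_integrable ?M (A \<inter> sphere 0 1) g" if "A \<in> sets borel" for A
    unfolding set_integrable_def using Ms[OF that] g by (intro integrable_mult_indicator) auto
  have total: "(LINT z|?M. g z) = 0" using orth[of "\<lambda>_. 1"] by simp
  have Int_stable_closed: "Int_stable (Collect closed :: 'a set set)" by (auto simp: Int_stable_def)
  have closed_Pow: "(Collect closed :: 'a set set) \<subseteq> Pow UNIV" by simp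
  have P: "?P A" if "A \<in> sigma_sets UNIV (Collect closed)" for A :: "'a set"
    using Int_stable_closed closed_Pow that
  proof (induction rule: sigma_sets_induct_disjoint)
    case (basic C)
    hence C: "closed C" by simp
    show ?case
    \<comment> \<open>The function \<open>infdist\<close> to the empty set is \<open>0\<close> by
      convention, so the cut-offs below would be constantly \<open>1\<close>.\<close>
    proof (cases "C = {}")
      case True thus ?thesis by (simp add: set_lebesgue_integral_def)
    next
      case False
      \<comment> \<open>Equal to \<open>1\<close> on \<open>C\<close> and, for \<open>n > 0\<close>,
        zero at distance at least \<open>1 / n\<close> from it.\<close>
      define p where "p n z = max 0 (1 - real n * infdist z C)" for n :: nat and z :: 'a
      have pc: "continuous_on X (p n)" for n X unfolding p_def by (intro continuous_intros)
      have "(\<lambda>n. LINT z|?M. p n z *\<^sub>R g z) \<longlonglongrightarrow> (LINT z|?M. indicator (C \<inter> sphere 0 1) z *\<^sub>R g z)"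
      proof (rule integral_dominated_convergence[where w="\<lambda>z. norm (g z)"])
        show "(\<lambda>z. indicator (C \<inter> sphere 0 1) z *\<^sub>R g z) \<in> borel_measurable ?M"
          using int[of C] C by (auto simp: set_integrable_def)
        show "(\<lambda>z. p n z *\<^sub>R g z) \<in> borel_measurable ?M" for n
          using integrable_mult_continuous_sphere[OF g pc] by (auto simp: mult.commute)
        show "integrable ?M (\<lambda>z. norm (g z))" using g by simp
        show "AE z in ?M. norm (p n z *\<^sub>R g z) \<le> norm (g z)" for n
        proof (rule AE_I2)
          fix z
          have "\<bar>p n z\<bar> \<le> 1" using infdist_nonneg[of z C] by (auto simp: p_def max_def)
          thus "norm (p n z *\<^sub>R g z) \<le> norm (g z)" by (simp add: abs_mult mult_left_le_one_le)
        qed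
        show "AE z in ?M. (\<lambda>n. p n z *\<^sub>R g z) \<longlonglongrightarrow> indicator (C \<inter> sphere 0 1) z *\<^sub>R g z"
        proof (rule AE_I2)
          fix z assume z: "z \<in> space ?M"
          have "(\<lambda>n. p n z) \<longlonglongrightarrow> indicator (C \<inter> sphere 0 1) z"
          proof (cases "z \<in> C")
            case True thus ?thesis using z by (simp add: p_def)
          next
            case nC: False
            hence pos: "infdist z C > 0" using C False by (intro infdist_pos_not_in_closed)
            obtain m where m: "real m > 1 / infdist z C" using reals_Archimedean2 by blast
            have "p n z = 0" if "n \<ge> m" for n
            proof -
              have "1 < real m * infdist z C" using m pos by (simp add: field_simps)
              also have "\<dots> \<le> real n * infdist z C" using that pos by (intro mult_right_mono) auto
              finally show ?thesis by (simp add: p_def)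
            qed
            hence "\<forall>\<^sub>F n in sequentially. p n z = 0" by (auto simp: eventually_sequentially)
            thus ?thesis using nC by (simp add: tendsto_eventually)
          qed
          thus "(\<lambda>n. p n z *\<^sub>R g z) \<longlonglongrightarrow> indicator (C \<inter> sphere 0 1) z *\<^sub>R g z"
            by (intro tendsto_intros)
        qed
      qed
      moreover have "(LINT z|?M. p n z *\<^sub>R g z) = 0" for n
        using orth[OF pc, of n] by (simp add: mult.commute)
      ultimately show ?thesis
        unfolding set_lebesgue_integral_def by (simp add: LIMSEQ_const_iff)
    qed
  next
    case empty show ?case by (simp add: set_lebesgue_integral_def)
  next
    case (compl A)
    hence A: "A \<in> sets borel" by (simp add: borel_eq_closed)
    have "(LINT z:((UNIV - A) \<inter> sphere 0 1)|?M. g z) = (LINT z:(sphere 0 1)|?M. g z) - (LINT z:(A \<inter> sphere 0 1)|?M. g z)"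
    proof -
      have "(LINT z:(((UNIV - A) \<inter> sphere 0 1) \<union> (A \<inter> sphere 0 1))|?M. g z) =
        (LINT z:((UNIV - A) \<inter> sphere 0 1)|?M. g z) + (LINT z:(A \<inter> sphere 0 1)|?M. g z)"
        using A by (intro set_integral_Un int) auto
      moreover have "((UNIV - A) \<inter> sphere 0 1) \<union> (A \<inter> sphere 0 1) = sphere 0 1" by auto
      ultimately show ?thesis by simp
    qed
    also have "(LINT z:(sphere 0 1)|?M. g z) = (LINT z|?M. g z)"
      unfolding set_lebesgue_integral_def by (intro Bochner_Integration.integral_cong) auto
    finally show ?case using compl total by simp
  next
    case (union A)
    have A: "A i \<in> sets borel" for i using union by (auto simp: borel_eq_closed)
    have "(LINT z:(\<Union>i. A i \<inter> sphere 0 1)|?M. g z) = (\<Sum>i. LINT z:(A i \<inter> sphere 0 1)|?M. g z)"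
    proof (rule lebesgue_integral_countable_add)
      show "A i \<inter> sphere 0 1 \<in> sets ?M" for i by (rule Ms[OF A])
      show "(A i \<inter> sphere 0 1) \<inter> (A j \<inter> sphere 0 1) = {}" if "i \<noteq> j" for i j
        using union(1) that by (auto simp: disjoint_family_on_def)
      have "(\<Union>i. A i) \<in> sets borel" using A by auto
      from int[OF this] show "set_integrable ?M (\<Union>i. A i \<inter> sphere 0 1) g"
        by (simp add: Int_UN_distrib2)
    qed
    thus ?case using union by (simp add: Int_UN_distrib2)
  qed
  show ?thesis
  proof (rule density_unique_real)
    show "integrable ?M g" by (rule g)
    show "integrable ?M (\<lambda>_. 0::real)" by simp
    fix A assume "A \<in> sets ?M"
    note A = sets_sphere_volD[OF this]
    have "?P A" using A by (intro P) (simp add: borel_eq_closed)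
    moreover have "A \<inter> sphere 0 1 = A" using A by auto
    ultimately show "(LINT z:A|?M. g z) = (LINT z:A|?M. 0)" by (simp add: set_lebesgue_integral_def)
  qed
qed

text \<open>Uniform approximation suffices because \<open>g\<close> is integrable. The measure is
  arbitrary since the lemma is applied on the sphere and on pairs of points.\<close>

lemma integral_mult_eq_0_approx:
  fixes g p :: "'x \<Rightarrow> real"
  assumes g: "integrable M g" and gp: "integrable M (\<lambda>x. g x * p x)"
    and approx: "\<And>e. e > 0 \<Longrightarrow> \<exists>q. (\<forall>x\<in>space M. \<bar>p x - q x\<bar> < e) \<and>
      integrable M (\<lambda>x. g x * q x) \<and> (LINT x|M. g x * q x) = 0"
  shows "(LINT x|M. g x * p x) = 0"
proof -
  define I where "I = (LINT x|M. \<bar>g x\<bar>)"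
  have I: "I \<ge> 0" unfolding I_def by (intro integral_nonneg_AE) auto
  have "\<bar>LINT x|M. g x * p x\<bar> \<le> 0 + e" if e: "e > 0" for e
  proof -
    \<comment> \<open>The norm \<open>I\<close> may be \<open>0\<close>, hence \<open>I + 1\<close>
      in the denominator.\<close>
    obtain q where q: "\<forall>x\<in>space M. \<bar>p x - q x\<bar> < e / (I + 1)"
      "integrable M (\<lambda>x. g x * q x)" "(LINT x|M. g x * q x) = 0"
      using approx[of "e / (I + 1)"] e I by auto
    have "(LINT x|M. g x * p x) = (LINT x|M. g x * p x - g x * q x)" using gp q by simp
    also have "\<bar>\<dots>\<bar> \<le> (LINT x|M. \<bar>g x * p x - g x * q x\<bar>)" by (rule integral_abs_bound)
    also have "\<dots> \<le> (LINT x|M. \<bar>g x\<bar> * (e / (I + 1)))"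
    proof (rule integral_mono)
      show "integrable M (\<lambda>x. \<bar>g x * p x - g x * q x\<bar>)" using gp q by auto
      show "integrable M (\<lambda>x. \<bar>g x\<bar> * (e / (I + 1)))" using g by auto
      fix x assume "x \<in> space M"
      hence "\<bar>g x\<bar> * \<bar>p x - q x\<bar> \<le> \<bar>g x\<bar> * (e / (I + 1))"
        using q(1) by (intro mult_left_mono) (auto intro: less_imp_le)
      thus "\<bar>g x * p x - g x * q x\<bar> \<le> \<bar>g x\<bar> * (e / (I + 1))"
        by (simp add: abs_mult[symmetric] right_diff_distrib)
    qed
    also have "\<dots> = I * (e / (I + 1))" by (simp add: I_def)
    also have "\<dots> \<le> e" using I e by (simp add: field_simps)
    finally show ?thesis by simp
  qed
  hence "\<bar>LINT x|M. g x * p x\<bar> \<le> 0" by (rule field_le_epsilon)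
  thus ?thesis by simp
qed

text \<open>Here \<open>R\<close> will be the set of polynomials, to identify weak gradients, and
  \<open>exp_sums\<close>, to prove completeness.\<close>

lemma AE_zero_if_orthogonal_dense:
  fixes g :: "'a::euclidean_space \<Rightarrow> real"
  assumes g: "integrable sphere_vol g"
    and cont: "\<And>q. q \<in> R \<Longrightarrow> continuous_on (sphere 0 1) q"
    and dense: "\<And>p e. continuous_on (sphere 0 1) p \<Longrightarrow> e > 0 \<Longrightarrow> \<exists>q\<in>R. \<forall>z\<in>sphere 0 1. \<bar>p z - q z\<bar> < e"
    and orth: "\<And>q. q \<in> R \<Longrightarrow> (LINT z|sphere_vol. g z * q z) = 0"
  shows "AE z in sphere_vol. g z = 0"
proof (rule AE_zero_if_orthogonal_continuous[OF g])
  fix p :: "'a \<Rightarrow> real" assume p: "continuous_on (sphere 0 1) p"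
  show "(LINT z|sphere_vol. g z * p z) = 0"
  proof (rule integral_mult_eq_0_approx[OF g integrable_mult_continuous_sphere[OF g p]])
    fix e :: real assume "e > 0"
    then obtain q where q: "q \<in> R" "\<forall>z\<in>sphere 0 1. \<bar>p z - q z\<bar> < e" using dense[OF p] by blast
    thus "\<exists>q. (\<forall>z\<in>space sphere_vol. \<bar>p z - q z\<bar> < e) \<and> integrable sphere_vol (\<lambda>z. g z * q z) \<and>
        (LINT z|sphere_vol. g z * q z) = 0"
      by (intro exI[of _ q] conjI integrable_mult_continuous_sphere g cont orth) simp_all
  qed
qed

lemma continuous_on_real_polynomial_function:
  "real_polynomial_function p \<Longrightarrow> continuous_on S p"
  by (simp add: continuous_on_polymonial_function real_polynomial_function_eq)

lemma Weierstrass_poly: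
  fixes h :: "real \<Rightarrow> real"
  assumes "continuous_on {a..b} h" "e > 0"
  obtains p where "\<And>t. t \<in> {a..b} \<Longrightarrow> \<bar>h t - poly p t\<bar> < e"
proof -
  obtain q where q: "real_polynomial_function q" "\<And>t. t \<in> {a..b} \<Longrightarrow> \<bar>h t - q t\<bar> < e"
    using Stone_Weierstrass_real_polynomial_function[OF compact_Icc assms] by blast
  then obtain c n where "q = (\<lambda>t. \<Sum>i\<le>n. c i * t ^ i)"
    by (auto simp: real_polynomial_function_iff_sum)
  hence "q = poly (\<Sum>i\<le>n. monom (c i) i)" by (auto simp: poly_sum poly_monom)
  thus ?thesis using q(2) that by blast
qed

lemma AE_zero_if_orthogonal_polynomials:
  fixes g :: "'a::euclidean_space \<Rightarrow> real"
  assumes g: "integrable sphere_vol g"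
    and orth: "\<And>p. real_polynomial_function p \<Longrightarrow> (LINT z|sphere_vol. g z * p z) = 0"
  shows "AE z in sphere_vol. g z = 0"
proof (rule AE_zero_if_orthogonal_dense[OF g, where R="Collect real_polynomial_function"])
  fix p :: "'a \<Rightarrow> real" and e :: real assume "continuous_on (sphere 0 1) p" "e > 0"
  then obtain q where "real_polynomial_function q" "\<And>x. x \<in> sphere 0 1 \<Longrightarrow> \<bar>p x - q x\<bar> < e"
    using Stone_Weierstrass_real_polynomial_function[of "sphere 0 1" p e] by auto
  thus "\<exists>q\<in>Collect real_polynomial_function. \<forall>z\<in>sphere 0 1. \<bar>p z - q z\<bar> < e" by blast
qed (auto simp: orth continuous_on_real_polynomial_function)


section \<open>Smooth functions\<close>

lemma frechet_derivative_eqI: "(u has_derivative D) (at x) \<Longrightarrow> frechet_derivative u (at x) = D"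
  by (metis frechet_derivative_at)

text \<open>The derivatives in \<open>Ck_on\<close> are full derivatives \<open>at x\<close>, so
  they are determined by the values on \<open>U\<close> only because \<open>U\<close> is
  open.\<close>

lemma Ck_on_cong:
  assumes "open U" "\<And>x. x \<in> U \<Longrightarrow> u x = v x"
  shows "Ck_on k U u \<longleftrightarrow> Ck_on k U v"
  using assms(2)
proof (induction k arbitrary: u v)
  case 0
  thus ?case by (simp cong: continuous_on_cong)
next
  case (Suc k)
  have d: "(u has_derivative D) (at x) \<longleftrightarrow> (v has_derivative D) (at x)" if "x \<in> U" for x D
    using has_derivative_transform_within_open[OF _ assms(1) that, where f=u and g=v and t=UNIV]
      has_derivative_transform_within_open[OF _ assms(1) that, where f=v and g=u and t=UNIV] Suc.prems by auto
  hence df: "u differentiable (at x) \<longleftrightarrow> v differentiable (at x)" if "x \<in> U" for x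
    using that by (auto simp: differentiable_def)
  have "frechet_derivative u (at x) = frechet_derivative v (at x)" if "x \<in> U" for x
    using d[OF that] by (simp add: frechet_derivative_def)
  hence "Ck_on k U (\<lambda>x. frechet_derivative u (at x) b) \<longleftrightarrow> Ck_on k U (\<lambda>x. frechet_derivative v (at x) b)" for b
    by (intro Suc.IH) auto
  thus ?case using df by auto
qed

lemma Ck_on_SucI:
  assumes "open U" "\<And>x. x \<in> U \<Longrightarrow> (u has_derivative D x) (at x)"
    and "\<And>b. b \<in> Basis \<Longrightarrow> Ck_on k U (\<lambda>x. D x b)"
  shows "Ck_on (Suc k) U u"
proof -
  have "Ck_on k U (\<lambda>x. frechet_derivative u (at x) b)" if "b \<in> Basis" for b
    using assms(3)[OF that] frechet_derivative_eqI[OF assms(2)]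
    by (subst Ck_on_cong[OF assms(1), of _ "\<lambda>x. D x b"]) auto
  thus ?thesis using assms(2) by (auto simp: differentiable_def)
qed

lemma Ck_on_Suc_derivative:
  "Ck_on (Suc k) U u \<Longrightarrow> x \<in> U \<Longrightarrow> (u has_derivative frechet_derivative u (at x)) (at x)"
  by (auto simp: frechet_derivative_works)

lemma Ck_on_Suc_imp: "Ck_on (Suc k) U u \<Longrightarrow> Ck_on k U u"
proof (induction k arbitrary: u)
  case 0
  thus ?case
    by (auto intro!: continuous_at_imp_continuous_on differentiable_imp_continuous_within)
next
  case (Suc k)
  have "Ck_on (Suc k) U (\<lambda>x. frechet_derivative u (at x) b)" if "b \<in> Basis" for b
    using Suc.prems that by simp
  hence "Ck_on k U (\<lambda>x. frechet_derivative u (at x) b)" if "b \<in> Basis" for b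
    using Suc.IH that by blast
  thus ?case using Suc.prems by simp
qed

lemma Ck_on_subset: "Ck_on k U u \<Longrightarrow> V \<subseteq> U \<Longrightarrow> Ck_on k V u"
  by (induction k arbitrary: u) (auto intro: continuous_on_subset)

lemma Ck_on_const: "open U \<Longrightarrow> Ck_on k U (\<lambda>x. c)"
proof (induction k arbitrary: c)
  case (Suc k)
  show ?case by (rule Ck_on_SucI[where D="\<lambda>x h. 0"]) (auto simp: Suc)
qed auto

lemma Ck_on_add:
  assumes "open U" "Ck_on k U u" "Ck_on k U v"
  shows "Ck_on k U (\<lambda>x. u x + v x)"
  using assms(2,3)
proof (induction k arbitrary: u v)
  case (Suc k)
  show ?case
    by (rule Ck_on_SucI[OF assms(1)])
       (rule has_derivative_add Ck_on_Suc_derivative[OF Suc.prems(1)] Ck_on_Suc_derivative[OF Suc.prems(2)]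
         Suc.IH; use Suc.prems in simp)+
qed (auto intro: continuous_intros)

lemma Ck_on_mult:
  assumes "open U" "Ck_on k U u" "Ck_on k U v"
  shows "Ck_on k U (\<lambda>x. u x * v x)"
  using assms(2,3)
proof (induction k arbitrary: u v)
  case (Suc k)
  show ?case
  proof (rule Ck_on_SucI[OF assms(1)])
    fix x assume x: "x \<in> U"
    show "((\<lambda>x. u x * v x) has_derivative
      (\<lambda>h. u x * frechet_derivative v (at x) h + frechet_derivative u (at x) h * v x)) (at x)"
      by (rule has_derivative_mult[OF Ck_on_Suc_derivative[OF Suc.prems(1) x] Ck_on_Suc_derivative[OF Suc.prems(2) x]])
  next
    fix b :: 'a assume b: "b \<in> Basis"
    have "Ck_on k U u" "Ck_on k U v" using Suc.prems Ck_on_Suc_imp by blast+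
    moreover have "Ck_on k U (\<lambda>x. frechet_derivative u (at x) b)" "Ck_on k U (\<lambda>x. frechet_derivative v (at x) b)"
      using Suc.prems b by auto
    ultimately show "Ck_on k U (\<lambda>x. u x * frechet_derivative v (at x) b + frechet_derivative u (at x) b * v x)"
      by (intro Ck_on_add Suc.IH assms)
  qed
qed (auto intro: continuous_intros)

lemma Ck_on_linear:
  assumes "open U" "bounded_linear f"
  shows "Ck_on k U f"
proof (cases k)
  case 0
  thus ?thesis using assms by (simp add: linear_continuous_on)
next
  case (Suc j)
  show ?thesis unfolding Suc
    by (rule Ck_on_SucI[where D="\<lambda>x. f"]) (auto simp: assms Ck_on_const bounded_linear_imp_has_derivative)
qed

lemma Ck_on_real_polynomial_function:
  assumes "open U" "real_polynomial_function p"
  shows "Ck_on k U p"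
  using assms(2) by (induction) (auto intro: Ck_on_linear Ck_on_const Ck_on_add Ck_on_mult assms(1))

abbreviation smooth_on :: "'a::euclidean_space set \<Rightarrow> ('a \<Rightarrow> real) \<Rightarrow> bool" where
  "smooth_on U v \<equiv> \<forall>k. Ck_on k U v"

lemma smooth_on_partial: "smooth_on U v \<Longrightarrow> b \<in> Basis \<Longrightarrow> smooth_on U (\<lambda>x. frechet_derivative v (at x) b)"
  by (metis Ck_on.simps(2))

lemma smooth_on_sphere_polynomial: "real_polynomial_function p \<Longrightarrow> smooth_on_sphere p"
  unfolding smooth_on_sphere_def
  by (intro exI[of _ UNIV] exI[of _ p]) (auto intro: Ck_on_real_polynomial_function)

lemma smooth_on_sphere_const: "smooth_on_sphere (\<lambda>_. c)"
  by (intro smooth_on_sphere_polynomial real_polynomial_function.intros)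

lemma smooth_on_sphere_inner: "smooth_on_sphere (\<lambda>z. z \<bullet> b)"
  by (intro smooth_on_sphere_polynomial real_polynomial_function.intros bounded_linear_inner_left)

lemma smooth_on_sphere_cong:
  "(\<And>z. z \<in> sphere 0 1 \<Longrightarrow> u z = v z) \<Longrightarrow> smooth_on_sphere u \<longleftrightarrow> smooth_on_sphere v"
  by (simp add: smooth_on_sphere_def)

lemma smooth_on_sphere_add:
  assumes "smooth_on_sphere u" "smooth_on_sphere v"
  shows "smooth_on_sphere (\<lambda>z. u z + v z)"
proof -
  obtain U f where U: "open U" "sphere 0 1 \<subseteq> U" "smooth_on U f" "\<forall>z\<in>sphere 0 1. f z = u z"
    using assms(1) unfolding smooth_on_sphere_def by blast
  obtain V g where V: "open V" "sphere 0 1 \<subseteq> V" "smooth_on V g" "\<forall>z\<in>sphere 0 1. g z = v z"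
    using assms(2) unfolding smooth_on_sphere_def by blast
  have "Ck_on k (U \<inter> V) (\<lambda>z. f z + g z)" for k
    using U V by (intro Ck_on_add) (auto intro: Ck_on_subset)
  thus ?thesis unfolding smooth_on_sphere_def using U V
    by (intro exI[of _ "U \<inter> V"] exI[of _ "\<lambda>z. f z + g z"]) auto
qed

lemma smooth_on_sphere_mult:
  assumes "smooth_on_sphere u" "smooth_on_sphere v"
  shows "smooth_on_sphere (\<lambda>z. u z * v z)"
proof -
  obtain U f where U: "open U" "sphere 0 1 \<subseteq> U" "smooth_on U f" "\<forall>z\<in>sphere 0 1. f z = u z"
    using assms(1) unfolding smooth_on_sphere_def by blast
  obtain V g where V: "open V" "sphere 0 1 \<subseteq> V" "smooth_on V g" "\<forall>z\<in>sphere 0 1. g z = v z"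
    using assms(2) unfolding smooth_on_sphere_def by blast
  have "Ck_on k (U \<inter> V) (\<lambda>z. f z * g z)" for k
    using U V by (intro Ck_on_mult) (auto intro: Ck_on_subset)
  thus ?thesis unfolding smooth_on_sphere_def using U V
    by (intro exI[of _ "U \<inter> V"] exI[of _ "\<lambda>z. f z * g z"]) auto
qed

lemma smooth_on_sphere_diff:
  assumes "smooth_on_sphere u" "smooth_on_sphere v"
  shows "smooth_on_sphere (\<lambda>z. u z - v z)"
  using smooth_on_sphere_add[OF assms(1) smooth_on_sphere_mult[OF smooth_on_sphere_const[of "-1"] assms(2)]]
  by simp

lemma smooth_on_sphere_sum:
  "finite I \<Longrightarrow> (\<And>i. i \<in> I \<Longrightarrow> smooth_on_sphere (u i)) \<Longrightarrow> smooth_on_sphere (\<lambda>z. \<Sum>i\<in>I. u i z)"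
  by (induction I rule: finite_induct) (auto intro: smooth_on_sphere_const smooth_on_sphere_add)


section \<open>Differential calculus on the sphere\<close>

text \<open>The function \<open>(x \<bullet> x - 1) / 2\<close> vanishes on the sphere and has
  derivative \<open>z \<bullet> h\<close> at \<open>z\<close>. Subtracting its product with
  \<open>D z\<close> leaves the function unchanged on the sphere and removes the normal part of the
  derivative, which produces the candidate required by the normalisations of
  \<open>sphere_grad\<close> and \<open>sphere_deriv\<close>.\<close>

lemma has_derivative_within_sphere_tangential:
  fixes f :: "'a::euclidean_space \<Rightarrow> 'b::real_normed_vector"
  assumes D: "(f has_derivative D) (at z within sphere 0 1)" and z: "z \<in> sphere 0 1"
  shows "(f has_derivative (\<lambda>h. D (h - (h \<bullet> z) *\<^sub>R z))) (at z within sphere 0 1)"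
proof -
  have lin: "linear D" using D by (auto dest: has_derivative_linear)
  have "((\<lambda>x. f x - ((x \<bullet> x - 1) / 2) *\<^sub>R D z) has_derivative
         (\<lambda>h. D h - ((z \<bullet> h + h \<bullet> z) / 2) *\<^sub>R D z)) (at z within sphere 0 1)"
    by (auto intro!: derivative_eq_intros D)
  moreover have "D h - ((z \<bullet> h + h \<bullet> z) / 2) *\<^sub>R D z = D (h - (h \<bullet> z) *\<^sub>R z)" for h
    using lin by (simp add: linear_diff linear_cmul inner_commute)
  ultimately have "((\<lambda>x. f x - ((x \<bullet> x - 1) / 2) *\<^sub>R D z) has_derivative
         (\<lambda>h. D (h - (h \<bullet> z) *\<^sub>R z))) (at z within sphere 0 1)" by simp
  thus ?thesis
    by (rule has_derivative_transform[OF z, rotated]) (auto simp: norm_eq_1)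
qed

text \<open>Composing with the great circle \<open>cos t *\<^sub>R z + sin t *\<^sub>R v\<close>
  reduces the claim to uniqueness of derivatives in one real variable. In the normal direction
  uniqueness fails.\<close>

lemma has_derivative_within_sphere_unique:
  fixes f :: "'a::euclidean_space \<Rightarrow> 'b::real_normed_vector"
  assumes L: "(f has_derivative L) (at z within sphere 0 1)"
    and L': "(f has_derivative L') (at z within sphere 0 1)"
    and z: "z \<in> sphere 0 1" and w: "w \<bullet> z = 0"
  shows "L w = L' w"
proof (cases "w = 0")
  case True
  thus ?thesis using L L' by (metis has_derivative_linear linear_0)
next
  case False
  define v where "v = sgn w"
  have vz: "v \<bullet> z = 0" "v \<bullet> v = 1" "z \<bullet> z = 1"
    using w False z by (auto simp: v_def sgn_div_norm norm_eq_1 norm_sgn simp flip: power2_norm_eq_inner)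
  define c where "c t = cos t *\<^sub>R z + sin t *\<^sub>R v" for t :: real
  have c0: "c 0 = z" by (simp add: c_def)
  have cS: "range c \<subseteq> sphere 0 1"
  proof -
    have "c t \<bullet> c t = 1" for t
      using vz sin_cos_squared_add[of t]
      by (simp add: c_def inner_add_left inner_add_right inner_commute[of z v] power2_eq_square algebra_simps)
    thus ?thesis by (auto simp: norm_eq_1)
  qed
  have dc: "(c has_derivative (\<lambda>t. t *\<^sub>R v)) (at 0)"
    unfolding c_def by (auto intro!: derivative_eq_intros)
  have "(f has_derivative L) (at (c 0) within c ` UNIV)" "(f has_derivative L') (at (c 0) within c ` UNIV)"
    using has_derivative_subset[OF L cS] has_derivative_subset[OF L' cS] by (simp_all add: c0)
  hence "((\<lambda>t. f (c t)) has_derivative (\<lambda>t. L (t *\<^sub>R v))) (at 0)"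
        "((\<lambda>t. f (c t)) has_derivative (\<lambda>t. L' (t *\<^sub>R v))) (at 0)"
    using has_derivative_in_compose[OF dc] by auto
  hence "(\<lambda>t. L (t *\<^sub>R v)) = (\<lambda>t. L' (t *\<^sub>R v))" by (rule has_derivative_unique)
  hence "L (norm w *\<^sub>R v) = L' (norm w *\<^sub>R v)" by metis
  thus ?thesis using False by (simp add: v_def sgn_div_norm)
qed

text \<open>Any representative \<open>g\<close> of the derivative will do, for instance the gradient
  of an extension; it is projected to the tangent space.\<close>

lemma sphere_grad_eq:
  fixes u :: "'a::euclidean_space \<Rightarrow> real"
  assumes z: "z \<in> sphere 0 1" and d: "(u has_derivative (\<lambda>h. g \<bullet> h)) (at z within sphere 0 1)"
  shows "sphere_grad u z = g - (g \<bullet> z) *\<^sub>R z"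
  unfolding sphere_grad_def
proof (rule the_equality)
  have zz: "z \<bullet> z = 1" using z by (simp add: norm_eq_1)
  have "(\<lambda>h. (g - (g \<bullet> z) *\<^sub>R z) \<bullet> h) = (\<lambda>h. g \<bullet> (h - (h \<bullet> z) *\<^sub>R z))"
    by (auto simp: inner_diff_left inner_diff_right inner_commute)
  thus "(g - (g \<bullet> z) *\<^sub>R z) \<bullet> z = 0 \<and> (u has_derivative (\<lambda>h. (g - (g \<bullet> z) *\<^sub>R z) \<bullet> h)) (at z within sphere 0 1)"
    using has_derivative_within_sphere_tangential[OF d z] zz by (simp add: inner_diff_left)
  fix v assume v: "v \<bullet> z = 0 \<and> (u has_derivative (\<lambda>h. v \<bullet> h)) (at z within sphere 0 1)"
  \<comment> \<open>The difference of the two candidates is itself tangential, so it may be tested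
    against itself.\<close>
  define w where "w = v - (g - (g \<bullet> z) *\<^sub>R z)"
  have wz: "w \<bullet> z = 0" using v zz by (simp add: w_def inner_diff_left)
  have "v \<bullet> w = g \<bullet> w"
    using has_derivative_within_sphere_unique[OF _ d z wz] v by blast
  also have "\<dots> = (g - (g \<bullet> z) *\<^sub>R z) \<bullet> w"
    using wz by (simp add: inner_diff_left inner_commute[of z w])
  finally have "w \<bullet> w = 0" by (simp add: w_def inner_diff_left)
  thus "v = g - (g \<bullet> z) *\<^sub>R z" by (simp add: w_def)
qed

lemma sphere_deriv_eq:
  fixes X :: "'a::euclidean_space \<Rightarrow> 'a"
  assumes z: "z \<in> sphere 0 1" and D: "(X has_derivative D) (at z within sphere 0 1)"
  shows "sphere_deriv X z = (\<lambda>h. D (h - (h \<bullet> z) *\<^sub>R z))"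
  unfolding sphere_deriv_def
proof (rule the_equality)
  have zz: "z \<bullet> z = 1" using z by (simp add: norm_eq_1)
  have lin: "linear D" using D by (rule has_derivative_linear)
  show "D (z - (z \<bullet> z) *\<^sub>R z) = 0 \<and>
    (X has_derivative (\<lambda>h. D (h - (h \<bullet> z) *\<^sub>R z))) (at z within sphere 0 1)"
    using has_derivative_within_sphere_tangential[OF D z] zz lin by (simp add: linear_0)
  fix L assume L: "L z = 0 \<and> (X has_derivative L) (at z within sphere 0 1)"
  show "L = (\<lambda>h. D (h - (h \<bullet> z) *\<^sub>R z))"
  proof
    fix h
    have linL: "linear L" using L by (blast dest: has_derivative_linear)
    have "L h = L (h - (h \<bullet> z) *\<^sub>R z)" using L linL by (simp add: linear_diff linear_cmul)
    also have "\<dots> = D (h - (h \<bullet> z) *\<^sub>R z)"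
      using L D zz by (intro has_derivative_within_sphere_unique[OF _ D z]) (auto simp: inner_diff_left)
    finally show "L h = D (h - (h \<bullet> z) *\<^sub>R z)" .
  qed
qed

text \<open>The tangential divergence is the ambient trace of a representative \<open>D\<close>
  without its normal-normal entry.\<close>

lemma sphere_div_eq:
  fixes X :: "'a::euclidean_space \<Rightarrow> 'a"
  assumes z: "z \<in> sphere 0 1" and D: "(X has_derivative D) (at z within sphere 0 1)"
  shows "sphere_div X z = (\<Sum>b\<in>Basis. D b \<bullet> b) - D z \<bullet> z"
proof -
  have lin: "linear D" using D by (rule has_derivative_linear)
  have "sphere_div X z = (\<Sum>b\<in>Basis. D b \<bullet> b - (D z \<bullet> b) * (z \<bullet> b))"
    unfolding sphere_div_def sphere_deriv_eq[OF assms]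
    using lin by (simp add: linear_diff linear_cmul inner_diff_left inner_commute[of _ z] mult.commute)
  also have "\<dots> = (\<Sum>b\<in>Basis. D b \<bullet> b) - D z \<bullet> z"
    by (simp add: sum_subtractf euclidean_inner[of "D z" z])
  finally show ?thesis .
qed

text \<open>The familiar formula: ambient Laplacian minus second radial derivative minus
  \<open>DIM('a) - 1\<close> times the radial derivative. It comes from differentiating the
  projected gradient \<open>g x - (g x \<bullet> x) *\<^sub>R x\<close> and needs derivatives within
  the sphere only.\<close>

lemma laplace_beltrami_eq:
  fixes u :: "'a::euclidean_space \<Rightarrow> real"
  assumes u: "\<And>x. x \<in> sphere 0 1 \<Longrightarrow> (u has_derivative (\<lambda>h. g x \<bullet> h)) (at x within sphere 0 1)"
    and z: "z \<in> sphere 0 1" and H: "(g has_derivative H) (at z within sphere 0 1)"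
  shows "laplace_beltrami u z = (\<Sum>b\<in>Basis. H b \<bullet> b) - H z \<bullet> z - real (DIM('a) - 1) * (g z \<bullet> z)"
proof -
  have zz: "z \<bullet> z = 1" using z by (simp add: norm_eq_1)
  have "((\<lambda>x. g x - (g x \<bullet> x) *\<^sub>R x) has_derivative
     (\<lambda>h. H h - ((g z \<bullet> z) *\<^sub>R h + (g z \<bullet> h + H h \<bullet> z) *\<^sub>R z))) (at z within sphere 0 1)"
    by (auto intro!: derivative_eq_intros H)
  hence "(sphere_grad u has_derivative
     (\<lambda>h. H h - ((g z \<bullet> z) *\<^sub>R h + (g z \<bullet> h + H h \<bullet> z) *\<^sub>R z))) (at z within sphere 0 1)"
    by (rule has_derivative_transform[OF z, rotated]) (simp add: sphere_grad_eq[OF _ u])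
  from sphere_div_eq[OF z this]
  have "laplace_beltrami u z = (\<Sum>b\<in>Basis. (H b - ((g z \<bullet> z) *\<^sub>R b + (g z \<bullet> b + H b \<bullet> z) *\<^sub>R z)) \<bullet> b)
      - (H z - ((g z \<bullet> z) *\<^sub>R z + (g z \<bullet> z + H z \<bullet> z) *\<^sub>R z)) \<bullet> z"
    by (simp add: laplace_beltrami_def)
  also have "(\<Sum>b\<in>Basis. (H b - ((g z \<bullet> z) *\<^sub>R b + (g z \<bullet> b + H b \<bullet> z) *\<^sub>R z)) \<bullet> b) =
     (\<Sum>b\<in>Basis. H b \<bullet> b) - real DIM('a) * (g z \<bullet> z) - (\<Sum>b\<in>Basis. (g z \<bullet> b) * (z \<bullet> b))
       - (\<Sum>b\<in>Basis. (H b \<bullet> z) * (z \<bullet> b))"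
    by (simp add: inner_diff_left inner_add_left sum_subtractf sum.distrib algebra_simps inner_Basis)
  also have "(\<Sum>b\<in>Basis. (g z \<bullet> b) * (z \<bullet> b)) = g z \<bullet> z" by (rule euclidean_inner[symmetric])
  also have "(\<Sum>b\<in>Basis. (H b \<bullet> z) * (z \<bullet> b)) = H z \<bullet> z"
  proof -
    have lin: "linear H" using H by (rule has_derivative_linear)
    have "H z = H (\<Sum>b\<in>Basis. (z \<bullet> b) *\<^sub>R b)" by (simp add: euclidean_representation)
    also have "\<dots> = (\<Sum>b\<in>Basis. (z \<bullet> b) *\<^sub>R H b)" using lin by (simp add: linear_sum linear_cmul)
    finally have "H z \<bullet> z = (\<Sum>b\<in>Basis. (z \<bullet> b) *\<^sub>R H b) \<bullet> z" by simp
    thus ?thesis by (simp add: inner_sum_left mult.commute)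
  qed
  also have "(H z - ((g z \<bullet> z) *\<^sub>R z + (g z \<bullet> z + H z \<bullet> z) *\<^sub>R z)) \<bullet> z = - 2 * (g z \<bullet> z)"
    by (simp add: inner_diff_left inner_add_left zz)
  finally show ?thesis by (simp add: of_nat_diff DIM_positive Suc_leI algebra_simps)
qed

text \<open>The derivative is an explicit argument because it is not unique in the normal direction;
  any convenient ambient representative may be supplied.\<close>

definition C1_sphere :: "('a::euclidean_space \<Rightarrow> 'b::real_normed_vector) \<Rightarrow> ('a \<Rightarrow> 'a \<Rightarrow> 'b) \<Rightarrow> bool" where
  "C1_sphere X D \<longleftrightarrow> (\<forall>z\<in>sphere 0 1. (X has_derivative D z) (at z within sphere 0 1)) \<and>
     (\<forall>h. continuous_on (sphere 0 1) (\<lambda>z. D z h))"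

lemma C1_sphere_deriv: "C1_sphere X D \<Longrightarrow> z \<in> sphere 0 1 \<Longrightarrow> (X has_derivative D z) (at z within sphere 0 1)"
  by (simp add: C1_sphere_def)

lemma C1_sphere_linear: "C1_sphere X D \<Longrightarrow> z \<in> sphere 0 1 \<Longrightarrow> linear (D z)"
  by (blast dest: C1_sphere_deriv has_derivative_linear)

lemma C1_sphere_continuous_deriv: "C1_sphere X D \<Longrightarrow> continuous_on (sphere 0 1) (\<lambda>z. D z h)"
  by (simp add: C1_sphere_def)

lemma C1_sphere_continuous: "C1_sphere X D \<Longrightarrow> continuous_on (sphere 0 1) X"
  by (auto simp: C1_sphere_def continuous_on_eq_continuous_within dest: has_derivative_continuous)

lemma C1_sphere_scaleR:
  assumes "C1_sphere u d" "C1_sphere X D"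
  shows "C1_sphere (\<lambda>z. u z *\<^sub>R X z) (\<lambda>z h. u z *\<^sub>R D z h + d z h *\<^sub>R X z)"
  using assms C1_sphere_continuous[OF assms(1)] C1_sphere_continuous[OF assms(2)]
  unfolding C1_sphere_def
  by (auto intro!: derivative_intros continuous_intros)

text \<open>The field \<open>g\<close> is the ambient gradient of a smooth extension, hence in
  general not tangential.\<close>

lemma smooth_on_sphere_C1_grad:
  fixes u :: "'a::euclidean_space \<Rightarrow> real"
  assumes "smooth_on_sphere u"
  obtains g where "C1_sphere u (\<lambda>z h. g z \<bullet> h)" "\<And>b. b \<in> Basis \<Longrightarrow> smooth_on_sphere (\<lambda>z. g z \<bullet> b)"
proof -
  obtain U v where U: "open U" "sphere 0 1 \<subseteq> U" "smooth_on U v" "\<forall>z\<in>sphere 0 1. v z = u z"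
    using assms unfolding smooth_on_sphere_def by blast
  define g where "g x = (\<Sum>b\<in>Basis. frechet_derivative v (at x) b *\<^sub>R b)" for x
  have gb: "g x \<bullet> b = frechet_derivative v (at x) b" if "b \<in> Basis" for x b
    using that by (simp add: g_def)
  have v: "(v has_derivative frechet_derivative v (at x)) (at x)" if "x \<in> U" for x
    using U(3) that Ck_on_Suc_derivative by blast
  have gh: "frechet_derivative v (at x) h = g x \<bullet> h" if "x \<in> U" for x h
  proof -
    have lin: "linear (frechet_derivative v (at x))" using v[OF that] by (rule has_derivative_linear)
    have "frechet_derivative v (at x) h = frechet_derivative v (at x) (\<Sum>b\<in>Basis. (h \<bullet> b) *\<^sub>R b)"
      by (simp add: euclidean_representation)
    also have "\<dots> = (\<Sum>b\<in>Basis. (h \<bullet> b) * (g x \<bullet> b))"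
      using lin by (simp add: linear_sum linear_cmul gb)
    also have "\<dots> = g x \<bullet> h" by (simp add: euclidean_inner[of "g x" h] mult.commute)
    finally show ?thesis .
  qed
  have s: "smooth_on_sphere (\<lambda>z. g z \<bullet> b)" if "b \<in> Basis" for b
    unfolding smooth_on_sphere_def
    using U smooth_on_partial[OF U(3) that] gb[OF that] by (intro exI[of _ U] exI[of _ "\<lambda>x. frechet_derivative v (at x) b"]) auto
  have "continuous_on U (\<lambda>z. frechet_derivative v (at z) b)" if "b \<in> Basis" for b
    using smooth_on_partial[OF U(3) that] Ck_on.simps(1) by blast
  hence "continuous_on U g" unfolding g_def by (intro continuous_intros) auto
  hence "continuous_on (sphere 0 1) g" using U(2) by (rule continuous_on_subset)
  moreover have "(u has_derivative (\<lambda>h. g z \<bullet> h)) (at z within sphere 0 1)" if z: "z \<in> sphere 0 1" for z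
  proof -
    have "frechet_derivative v (at z) = (\<lambda>h. g z \<bullet> h)" using gh U(2) z by blast
    hence "(v has_derivative (\<lambda>h. g z \<bullet> h)) (at z within sphere 0 1)"
      using v[of z] U(2) z has_derivative_at_withinI by fastforce
    thus ?thesis by (rule has_derivative_transform[OF z, rotated]) (simp add: U(4))
  qed
  ultimately have "C1_sphere u (\<lambda>z h. g z \<bullet> h)"
    unfolding C1_sphere_def by (auto intro!: continuous_intros)
  thus ?thesis using that s by blast
qed

lemma smooth_on_sphere_continuous: "smooth_on_sphere u \<Longrightarrow> continuous_on (sphere 0 1) u"
  by (metis smooth_on_sphere_C1_grad C1_sphere_continuous)

lemma smooth_field_C1:
  fixes Y :: "'a::euclidean_space \<Rightarrow> 'a"
  assumes "\<And>b. b \<in> Basis \<Longrightarrow> smooth_on_sphere (\<lambda>z. Y z \<bullet> b)"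
  obtains D where "C1_sphere Y D"
proof -
  have "\<exists>d. C1_sphere (\<lambda>z. Y z \<bullet> b) d" if "b \<in> Basis" for b
    using smooth_on_sphere_C1_grad[OF assms[OF that]] by metis
  then obtain d where d: "\<And>b. b \<in> Basis \<Longrightarrow> C1_sphere (\<lambda>z. Y z \<bullet> b) (d b)" by metis
  have "C1_sphere (\<lambda>z. \<Sum>b\<in>Basis. (Y z \<bullet> b) *\<^sub>R b) (\<lambda>z h. \<Sum>b\<in>Basis. d b z h *\<^sub>R b)"
    using d unfolding C1_sphere_def
    by (auto intro!: has_derivative_sum has_derivative_scaleR_left continuous_intros)
  thus ?thesis using that by (simp add: euclidean_representation)
qed


section \<open>The divergence theorem\<close>

text \<open>The plane rotations generated by \<open>J\<close> preserve the measure, so the mean of \<open>u\<close> does not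
  change along their flow.\<close>
lemma integral_rotation_derivative:
  fixes u :: "'a::euclidean_space \<Rightarrow> real"
  assumes u: "C1_sphere u d" and a: "a \<in> Basis" and b: "b \<in> Basis" and ab: "a \<noteq> b"
  defines "J \<equiv> \<lambda>x. (x \<bullet> a) *\<^sub>R b - (x \<bullet> b) *\<^sub>R a"
  shows "(LINT z|sphere_vol. d z (J z)) = 0"
proof -
  have ip: "a \<bullet> a = 1" "b \<bullet> b = 1" "a \<bullet> b = 0" "b \<bullet> a = 0"
    using a b ab by (auto simp: inner_Basis)
  \<comment> \<open>Rotation by the angle \<open>t\<close> in the plane of \<open>a\<close> and
    \<open>b\<close>, the identity on its orthogonal complement; \<open>J\<close> is its
    generator.\<close>
  define R where "R t x = x + (cos t - 1) *\<^sub>R ((x \<bullet> a) *\<^sub>R a + (x \<bullet> b) *\<^sub>R b) + sin t *\<^sub>R J x" for t :: real and x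
  have Ra: "R t x \<bullet> a = cos t * (x \<bullet> a) - sin t * (x \<bullet> b)" for t x
    by (simp add: R_def J_def inner_add_left inner_diff_left ip algebra_simps)
  have Rb: "R t x \<bullet> b = cos t * (x \<bullet> b) + sin t * (x \<bullet> a)" for t x
    by (simp add: R_def J_def inner_add_left inner_diff_left ip algebra_simps)
  have orth: "orthogonal_transformation (R t)" for t
    unfolding orthogonal_transformation_def
  proof (intro conjI allI)
    show "linear (R t)"
      by (rule linearI) (auto simp: R_def J_def inner_add_left algebra_simps)
    fix x y
    obtain c s where cs: "c = cos t" "s = sin t" by simp
    have "R t x \<bullet> R t y = R t x \<bullet> y + (cos t - 1) * ((y \<bullet> a) * (R t x \<bullet> a) + (y \<bullet> b) * (R t x \<bullet> b))
        + sin t * ((y \<bullet> a) * (R t x \<bullet> b) - (y \<bullet> b) * (R t x \<bullet> a))"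
      by (subst (2) R_def) (simp add: J_def inner_add_right inner_diff_right)
    also have "R t x \<bullet> y = x \<bullet> y + (cos t - 1) * ((x \<bullet> a) * (y \<bullet> a) + (x \<bullet> b) * (y \<bullet> b))
        + sin t * ((x \<bullet> a) * (y \<bullet> b) - (x \<bullet> b) * (y \<bullet> a))"
      by (simp add: R_def J_def inner_add_left inner_diff_left inner_commute[of a y] inner_commute[of b y])
    also have "\<dots> + (cos t - 1) * ((y \<bullet> a) * (R t x \<bullet> a) + (y \<bullet> b) * (R t x \<bullet> b))
        + sin t * ((y \<bullet> a) * (R t x \<bullet> b) - (y \<bullet> b) * (R t x \<bullet> a)) =
        x \<bullet> y + ((x \<bullet> a) * (y \<bullet> a) + (x \<bullet> b) * (y \<bullet> b)) * ((cos t)\<^sup>2 + (sin t)\<^sup>2 - 1)"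
      unfolding Ra Rb cs[symmetric] by (simp add: power2_eq_square algebra_simps)
    finally show "R t x \<bullet> R t y = x \<bullet> y" by simp
  qed
  have RS: "R t z \<in> sphere 0 1" if "z \<in> sphere 0 1" for t z
    using that orth[of t] by (simp add: orthogonal_transformation)
  have R0: "R 0 z = z" for z by (simp add: R_def)
  have dR: "((\<lambda>t. R t z) has_derivative (\<lambda>h. h *\<^sub>R J (R t z))) (at t)" for t z
  proof -
    have "((\<lambda>t. R t z) has_derivative (\<lambda>h. (h * - sin t) *\<^sub>R ((z \<bullet> a) *\<^sub>R a + (z \<bullet> b) *\<^sub>R b) + (h * cos t) *\<^sub>R J z)) (at t)"
      unfolding R_def by (auto intro!: derivative_eq_intros)
    moreover have "(h * - sin t) *\<^sub>R ((z \<bullet> a) *\<^sub>R a + (z \<bullet> b) *\<^sub>R b) + (h * cos t) *\<^sub>R J z = h *\<^sub>R J (R t z)" for h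
      unfolding J_def Ra Rb by (simp add: algebra_simps)
    ultimately show ?thesis by simp
  qed
  have du: "((\<lambda>t. u (R t z)) has_real_derivative d (R t z) (J (R t z))) (at t)" if z: "z \<in> sphere 0 1" for t z
  proof -
    have "(u has_derivative d (R t z)) (at (R t z) within range (\<lambda>t. R t z))"
      using C1_sphere_deriv[OF u RS[OF z]] by (rule has_derivative_subset) (use RS z in auto)
    from has_derivative_in_compose[OF dR this]
    have "((\<lambda>t. u (R t z)) has_derivative (\<lambda>h. d (R t z) (h *\<^sub>R J (R t z)))) (at t)" .
    thus ?thesis
      using C1_sphere_linear[OF u RS[OF z]] by (simp add: has_field_derivative_def linear_cmul mult.commute[of _ "d _ _"])
  qed
  have contJ: "continuous_on (sphere 0 1) (\<lambda>z. d z (J z))"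
  proof -
    have "continuous_on (sphere 0 1) (\<lambda>z. (z \<bullet> a) * d z b - (z \<bullet> b) * d z a)"
      by (intro continuous_intros C1_sphere_continuous_deriv[OF u])
    thus ?thesis
      by (rule continuous_on_eq) (use C1_sphere_linear[OF u] in \<open>auto simp: J_def linear_diff linear_cmul\<close>)
  qed
  obtain B where B: "B > 0" "\<And>z. z \<in> sphere 0 1 \<Longrightarrow> norm (d z (J z)) \<le> B"
    using continuous_on_sphere_bound[OF contJ] by blast
  have um: "u \<in> borel_measurable sphere_vol" and ui: "integrable sphere_vol u"
    using C1_sphere_continuous[OF u] by (auto intro: continuous_on_sphere_measurable continuous_on_sphere_integrable)
  have uRm: "(\<lambda>z. u (R t z)) \<in> borel_measurable sphere_vol" for t
    using measurable_compose[OF measurable_sphere_vol_orthogonal[OF orth] um] .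
  have uR_cont: "continuous_on (sphere 0 1) (\<lambda>z. u (R t z))" for t
    using RS by (intro continuous_on_compose2[OF C1_sphere_continuous[OF u] continuous_on_orthogonal[OF orth]]) auto
  \<comment> \<open>Difference quotients along the flow. Their integrals vanish by invariance of the
    measure, and the mean value theorem bounds them by \<open>B\<close>, so that dominated
    convergence applies.\<close>
  define q where "q n z = (u (R (1 / Suc n) z) - u z) * Suc n" for n z
  have q0: "(LINT z|sphere_vol. q n z) = 0" for n
  proof -
    have "(LINT z|sphere_vol. u (R (1 / Suc n) z) - u z) =
      (LINT z|sphere_vol. u (R (1 / Suc n) z)) - (LINT z|sphere_vol. u z)"
      by (intro Bochner_Integration.integral_diff ui continuous_on_sphere_integrable uR_cont)
    thus ?thesis unfolding q_def
      using integral_sphere_vol_orthogonal[OF orth um] by simp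
  qed
  have "(\<lambda>n. LINT z|sphere_vol. q n z) \<longlonglongrightarrow> (LINT z|sphere_vol. d z (J z))"
  proof (rule integral_dominated_convergence[where w="\<lambda>_. B"])
    show "(\<lambda>z. d z (J z)) \<in> borel_measurable sphere_vol" by (rule continuous_on_sphere_measurable[OF contJ])
    show "q n \<in> borel_measurable sphere_vol" for n unfolding q_def using uRm um by simp
    show "integrable sphere_vol (\<lambda>_. B)" by simp
    show "AE z in sphere_vol. (\<lambda>n. q n z) \<longlonglongrightarrow> d z (J z)"
    proof (rule AE_I2)
      fix z :: 'a assume "z \<in> space sphere_vol"
      hence z: "z \<in> sphere 0 1" by simp
      have "(\<lambda>n. (u (R (0 + 1 / Suc n) z) - u (R 0 z)) / (1 / Suc n)) \<longlonglongrightarrow> d (R 0 z) (J (R 0 z))"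
      proof -
        have "filterlim (\<lambda>n. 1 / real (Suc n)) (at 0) sequentially"
          using LIMSEQ_Suc[OF lim_1_over_n[where 'a=real]] by (simp add: filterlim_at)
        from filterlim_compose[OF du[OF z, of 0, unfolded DERIV_def] this] show ?thesis .
      qed
      thus "(\<lambda>n. q n z) \<longlonglongrightarrow> d z (J z)" by (simp add: q_def R0)
    qed
    show "AE z in sphere_vol. norm (q n z) \<le> B" for n
    proof (rule AE_I2)
      fix z :: 'a assume "z \<in> space sphere_vol"
      hence z: "z \<in> sphere 0 1" by simp
      have "\<exists>t>0. t < 1 / Suc n \<and> u (R (1 / Suc n) z) - u (R 0 z) = (1 / Suc n - 0) * d (R t z) (J (R t z))"
        by (rule MVT2) (auto intro: du[OF z])
      then obtain t where "u (R (1 / Suc n) z) - u z = (1 / Suc n) * d (R t z) (J (R t z))"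
        by (auto simp: R0)
      hence "q n z = d (R t z) (J (R t z))" by (simp add: q_def field_simps)
      thus "norm (q n z) \<le> B" using B(2)[OF RS[OF z]] by simp
    qed
  qed
  thus ?thesis by (simp add: q0 LIMSEQ_const_iff)
qed

text \<open>The generator of the plane of \<open>a\<close> and \<open>b\<close> is applied to the
  function \<open>(z \<bullet> a) * (Y z \<bullet> b)\<close>. Summed over all \<open>a\<close> and
  \<open>b\<close>, the first-order terms form the divergence, using
  \<open>z \<bullet> z = 1\<close>, and the terms without derivatives are multiples of
  \<open>Y z \<bullet> z = 0\<close>.\<close>

lemma divergence_theorem_sphere:
  fixes Y :: "'a::euclidean_space \<Rightarrow> 'a"
  assumes Y: "C1_sphere Y D" and tan: "\<And>z. z \<in> sphere 0 1 \<Longrightarrow> Y z \<bullet> z = 0"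
  shows "(LINT z|sphere_vol. sphere_div Y z) = 0"
proof -
  define J where "J a b x = (x \<bullet> a) *\<^sub>R b - (x \<bullet> b) *\<^sub>R a" for a b x :: 'a
  define d where "d a b z h = (z \<bullet> a) * (D z h \<bullet> b) + (h \<bullet> a) * (Y z \<bullet> b)" for a b z h :: 'a
  have C1: "C1_sphere (\<lambda>z. (z \<bullet> a) * (Y z \<bullet> b)) (d a b)" for a b
  proof -
    have "C1_sphere (\<lambda>z. z \<bullet> a) (\<lambda>z h. h \<bullet> a)"
      unfolding C1_sphere_def by (auto intro!: derivative_intros continuous_intros)
    moreover have "C1_sphere (\<lambda>z. Y z \<bullet> b) (\<lambda>z h. D z h \<bullet> b)"
      using Y unfolding C1_sphere_def by (auto intro!: derivative_intros continuous_intros)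
    ultimately show ?thesis using C1_sphere_scaleR by (fastforce simp: d_def[abs_def])
  qed
  have zero: "(LINT z|sphere_vol. d a b z (J a b z)) = 0" if "a \<in> Basis" "b \<in> Basis" for a b
  proof (cases "a = b")
    case True
    have "d a b z (J a b z) = 0" if "z \<in> sphere 0 1" for z
      using C1_sphere_linear[OF Y that] True by (simp add: d_def J_def linear_0)
    hence "(LINT z|sphere_vol. d a b z (J a b z)) = (LINT z|(sphere_vol::'a measure). 0)"
      by (intro Bochner_Integration.integral_cong) auto
    thus ?thesis by simp
  next
    case False
    show ?thesis using integral_rotation_derivative[OF C1 that False] by (simp add: J_def)
  qed
  have int: "integrable sphere_vol (\<lambda>z. d a b z (J a b z))" for a b
  proof (rule continuous_on_sphere_integrable)
    have "continuous_on (sphere 0 1) (\<lambda>z. (z \<bullet> a) * d a b z b - (z \<bullet> b) * d a b z a)"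
      by (intro continuous_intros C1_sphere_continuous_deriv[OF C1])
    thus "continuous_on (sphere 0 1) (\<lambda>z. d a b z (J a b z))"
      by (rule continuous_on_eq) (use C1_sphere_linear[OF C1] in \<open>auto simp: J_def linear_diff linear_cmul\<close>)
  qed
  have "sphere_div Y z = (\<Sum>a\<in>Basis. \<Sum>b\<in>Basis. d a b z (J a b z))" if z: "z \<in> sphere 0 1" for z
  proof -
    have lin: "linear (D z)" by (rule C1_sphere_linear[OF Y z])
    have zz: "z \<bullet> z = 1" using z by (simp add: norm_eq_1)
    have "d a b z (J a b z) = (z \<bullet> a) * (z \<bullet> a) * (D z b \<bullet> b) - (z \<bullet> b) * ((z \<bullet> a) * (D z a \<bullet> b))
        + ((if b = a then (z \<bullet> a) * (Y z \<bullet> a) else 0) - (z \<bullet> b) * (Y z \<bullet> b))"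
      if "a \<in> Basis" "b \<in> Basis" for a b
      using lin that by (simp add: d_def J_def linear_diff linear_cmul inner_diff_left inner_Basis algebra_simps)
    hence "(\<Sum>a\<in>Basis. \<Sum>b\<in>Basis. d a b z (J a b z)) =
      (\<Sum>a\<in>Basis. \<Sum>b\<in>Basis. (z \<bullet> a) * (z \<bullet> a) * (D z b \<bullet> b) - (z \<bullet> b) * ((z \<bullet> a) * (D z a \<bullet> b))
        + ((if b = a then (z \<bullet> a) * (Y z \<bullet> a) else 0) - (z \<bullet> b) * (Y z \<bullet> b)))"
      by (intro sum.cong refl) auto
    also have "\<dots> = (\<Sum>a\<in>Basis. \<Sum>b\<in>Basis. (z \<bullet> a) * (z \<bullet> a) * (D z b \<bullet> b))
        - (\<Sum>a\<in>Basis. \<Sum>b\<in>Basis. (z \<bullet> b) * ((z \<bullet> a) * (D z a \<bullet> b)))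
        + ((\<Sum>a\<in>Basis. (z \<bullet> a) * (Y z \<bullet> a)) - (\<Sum>a\<in>(Basis::'a set). \<Sum>b\<in>Basis. (z \<bullet> b) * (Y z \<bullet> b)))"
      by (simp add: sum.distrib sum_subtractf)
    also have "(\<Sum>b\<in>Basis. (z \<bullet> b) * (Y z \<bullet> b)) = 0"
      using tan[OF z] euclidean_inner[of z "Y z"] by (simp add: inner_commute)
    also have "(\<Sum>a\<in>Basis. \<Sum>b\<in>Basis. (z \<bullet> a) * (z \<bullet> a) * (D z b \<bullet> b)) = (\<Sum>b\<in>Basis. D z b \<bullet> b)"
      using euclidean_inner[of z z] zz by (simp add: sum_distrib_left[symmetric] sum_distrib_right[symmetric])
    also have "(\<Sum>a\<in>Basis. \<Sum>b\<in>Basis. (z \<bullet> b) * ((z \<bullet> a) * (D z a \<bullet> b))) = D z z \<bullet> z"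
    proof -
      have "D z z = D z (\<Sum>a\<in>Basis. (z \<bullet> a) *\<^sub>R a)" by (simp add: euclidean_representation)
      also have "\<dots> = (\<Sum>a\<in>Basis. (z \<bullet> a) *\<^sub>R D z a)" using lin by (simp add: linear_sum linear_cmul)
      finally have "D z z \<bullet> z = (\<Sum>b\<in>Basis. ((\<Sum>a\<in>Basis. (z \<bullet> a) *\<^sub>R D z a) \<bullet> b) * (z \<bullet> b))"
        by (simp add: euclidean_inner[of _ z])
      also have "\<dots> = (\<Sum>b\<in>Basis. \<Sum>a\<in>Basis. (z \<bullet> b) * ((z \<bullet> a) * (D z a \<bullet> b)))"
        by (simp add: inner_sum_left sum_distrib_left mult.commute)
      finally show ?thesis by (subst sum.swap) simp
    qed
    finally show ?thesis using sphere_div_eq[OF z C1_sphere_deriv[OF Y z]] by simp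
  qed
  hence "(LINT z|sphere_vol. sphere_div Y z) =
    (LINT z|(sphere_vol::'a measure). (\<Sum>a\<in>Basis. \<Sum>b\<in>Basis. d a b z (J a b z)))"
    by (intro Bochner_Integration.integral_cong) auto
  also have "\<dots> = (\<Sum>a\<in>Basis. \<Sum>b\<in>Basis. LINT z|(sphere_vol::'a measure). d a b z (J a b z))"
    using int by simp
  also have "\<dots> = 0" using zero by simp
  finally show ?thesis .
qed

lemma sphere_div_continuous:
  fixes Y :: "'a::euclidean_space \<Rightarrow> 'a"
  assumes Y: "C1_sphere Y D"
  shows "continuous_on (sphere 0 1) (sphere_div Y)"
proof -
  have "continuous_on (sphere 0 1) (\<lambda>z. (\<Sum>b\<in>Basis. D z b \<bullet> b) - (\<Sum>b\<in>Basis. (z \<bullet> b) *\<^sub>R D z b) \<bullet> z)"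
    by (intro continuous_intros C1_sphere_continuous_deriv[OF Y])
  thus ?thesis
  proof (rule continuous_on_eq)
    fix z :: 'a assume z: "z \<in> sphere 0 1"
    have lin: "linear (D z)" by (rule C1_sphere_linear[OF Y z])
    have "D z z = D z (\<Sum>a\<in>Basis. (z \<bullet> a) *\<^sub>R a)" by (simp add: euclidean_representation)
    also have "\<dots> = (\<Sum>a\<in>Basis. (z \<bullet> a) *\<^sub>R D z a)" using lin by (simp add: linear_sum linear_cmul)
    finally show "(\<Sum>b\<in>Basis. D z b \<bullet> b) - (\<Sum>b\<in>Basis. (z \<bullet> b) *\<^sub>R D z b) \<bullet> z = sphere_div Y z"
      using sphere_div_eq[OF z C1_sphere_deriv[OF Y z]] by simp
  qed
qed

text \<open>The divergence theorem for \<open>u z *\<^sub>R Y z\<close>. The gradient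
  \<open>g\<close> need not be tangential, since \<open>Y\<close> does not see its normal
  part.\<close>

lemma green_sphere:
  fixes Y :: "'a::euclidean_space \<Rightarrow> 'a" and u :: "'a \<Rightarrow> real"
  assumes u: "C1_sphere u (\<lambda>z h. g z \<bullet> h)" and Y: "C1_sphere Y D"
    and tan: "\<And>z. z \<in> sphere 0 1 \<Longrightarrow> Y z \<bullet> z = 0"
  shows "(LINT z|sphere_vol. u z * sphere_div Y z) = - (LINT z|sphere_vol. g z \<bullet> Y z)"
proof -
  let ?D = "\<lambda>z h. u z *\<^sub>R D z h + (g z \<bullet> h) *\<^sub>R Y z"
  have uY: "C1_sphere (\<lambda>z. u z *\<^sub>R Y z) ?D" by (rule C1_sphere_scaleR[OF u Y])
  have eq: "sphere_div (\<lambda>z. u z *\<^sub>R Y z) z = u z * sphere_div Y z + g z \<bullet> Y z" if z: "z \<in> sphere 0 1" for z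
  proof -
    have "sphere_div (\<lambda>z. u z *\<^sub>R Y z) z = (\<Sum>b\<in>Basis. ?D z b \<bullet> b) - ?D z z \<bullet> z"
      by (rule sphere_div_eq[OF z C1_sphere_deriv[OF uY z]])
    also have "\<dots> = u z * ((\<Sum>b\<in>Basis. D z b \<bullet> b) - D z z \<bullet> z) + (\<Sum>b\<in>Basis. (g z \<bullet> b) * (Y z \<bullet> b))"
      using tan[OF z] by (simp add: inner_add_left sum.distrib sum_distrib_left right_diff_distrib)
    finally show ?thesis
      using sphere_div_eq[OF z C1_sphere_deriv[OF Y z]] euclidean_inner[of "g z" "Y z"] by simp
  qed
  have gi: "continuous_on (sphere 0 1) g"
  proof -
    have "continuous_on (sphere 0 1) (\<lambda>z. \<Sum>b\<in>Basis. (g z \<bullet> b) *\<^sub>R b)"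
      by (intro continuous_intros C1_sphere_continuous_deriv[OF u])
    thus ?thesis by (simp add: euclidean_representation)
  qed
  note cont = C1_sphere_continuous[OF u] C1_sphere_continuous[OF Y] sphere_div_continuous[OF Y] gi
  have "0 = (LINT z|sphere_vol. sphere_div (\<lambda>z. u z *\<^sub>R Y z) z)"
    using divergence_theorem_sphere[OF uY] tan by simp
  also have "\<dots> = (LINT z|sphere_vol. u z * sphere_div Y z + g z \<bullet> Y z)"
    by (intro Bochner_Integration.integral_cong) (auto simp: eq)
  also have "\<dots> = (LINT z|sphere_vol. u z * sphere_div Y z) + (LINT z|sphere_vol. g z \<bullet> Y z)"
    by (intro Bochner_Integration.integral_add continuous_on_sphere_integrable continuous_intros cont)
  finally show ?thesis by linarith
qed


section \<open>Jacobi polynomials\<close>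

definition jacobi_op :: "real \<Rightarrow> real \<Rightarrow> real poly \<Rightarrow> real poly" where
  "jacobi_op a b p = [:1, 0, -1:] * pderiv (pderiv p) + [:b - a, - (a + b + 2):] * pderiv p"

lemma jacobi_equation_iff:
  "(\<forall>t. (1 - t\<^sup>2) * poly (pderiv (pderiv p)) t + (b - a - (a + b + 2) * t) * poly (pderiv p) t + e * poly p t = 0)
   \<longleftrightarrow> jacobi_op a b p + smult e p = 0"
proof -
  have "poly (jacobi_op a b p + smult e p) t =
    (1 - t\<^sup>2) * poly (pderiv (pderiv p)) t + (b - a - (a + b + 2) * t) * poly (pderiv p) t + e * poly p t" for t
    by (simp add: jacobi_op_def power2_eq_square algebra_simps)
  thus ?thesis by (metis poly_0 poly_all_0_iff_0)
qed

text \<open>In the monomial basis the operator is triangular with diagonal entries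
  \<open>- n (n + a + b + 1)\<close>, which ties each eigenvalue to one degree.\<close>

lemma coeff_jacobi_op:
  "coeff (jacobi_op a b p) n = real (n + 1) * real (n + 2) * coeff p (n + 2) + (b - a) * real (n + 1) * coeff p (n + 1)
     - real n * (real n + a + b + 1) * coeff p n"
proof -
  consider "n = 0" | "n = 1" | k where "n = Suc (Suc k)" by (metis One_nat_def not0_implies_Suc)
  thus ?thesis
  proof cases
    case 1
    thus ?thesis by (simp add: jacobi_op_def coeff_pderiv coeff_pCons eval_nat_numeral)
  next
    case 2
    thus ?thesis by (simp add: jacobi_op_def coeff_pderiv coeff_pCons eval_nat_numeral algebra_simps)
  next
    case 3
    thus ?thesis by (simp add: jacobi_op_def coeff_pderiv coeff_pCons algebra_simps)
  qed
qed

lemma jacobi_eigenvalue_diff: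
  "real i * (real i + a + b + 1) - real k * (real k + a + b + 1) = (real i - real k) * (real i + real k + a + b + 1)"
  by (simp add: algebra_simps)

text \<open>Different indices have sum at least \<open>1\<close>, which is just enough against
  \<open>a + b > -2\<close>.\<close>

lemma jacobi_eigenvalue_inj:
  assumes "a > -1" "b > -1" "real i * (real i + a + b + 1) = real k * (real k + a + b + 1)"
  shows "i = k"
proof (rule ccontr)
  assume ne: "i \<noteq> k"
  hence "real i + real k \<ge> 1" by linarith
  hence "real i + real k + a + b + 1 > 0" using assms by linarith
  thus False using assms(3) ne jacobi_eigenvalue_diff[of i a b k] by simp
qed

text \<open>At the index \<open>degree p\<close> the equation involves the leading coefficient only,
  so \<open>i\<close> and \<open>degree p\<close> have the same eigenvalue.\<close>

lemma jacobi_solution_degree: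
  assumes ab: "a > -1" "b > -1" and p: "p \<noteq> 0"
    and eq: "jacobi_op a b p + smult (real i * (real i + a + b + 1)) p = 0"
  shows "degree p = i"
proof -
  have "coeff (jacobi_op a b p + smult (real i * (real i + a + b + 1)) p) (degree p) = 0"
    using eq by simp
  hence "(real i * (real i + a + b + 1) - real (degree p) * (real (degree p) + a + b + 1)) * lead_coeff p = 0"
    by (simp add: coeff_jacobi_op coeff_eq_0 algebra_simps)
  thus ?thesis using p jacobi_eigenvalue_inj[OF ab, of i "degree p"] by simp
qed

text \<open>In the variable \<open>1 - t\<close> the Jacobi equation becomes a two-term recursion for the coefficients.\<close>
lemma jacobi_solution_exists:
  assumes ab: "a > -1" "b > -1"
  obtains p where "p \<noteq> 0" "jacobi_op a b p + smult (real i * (real i + a + b + 1)) p = 0"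
proof -
  define e where "e k = real k * (real k + a + b + 1)" for k
  \<comment> \<open>Coefficients of a hypergeometric series in \<open>(1 - t) / 2\<close>, up to the
    powers of \<open>2\<close>; the hypothesis \<open>a > -1\<close> keeps the denominators
    positive.\<close>
  define c where "c = rec_nat 1 (\<lambda>k r. - (e i - e k) / (2 * (real k + 1) * (real k + a + 1)) * r)"
  have c0: "c 0 = 1" and cS: "c (Suc k) = - (e i - e k) / (2 * (real k + 1) * (real k + a + 1)) * c k" for k
    by (simp_all add: c_def)
  have rec: "2 * (real k + 1) * (real k + a + 1) * c (Suc k) = - (e i - e k) * c k" for k
    using ab by (simp add: cS)
  define q where "q = (\<Sum>k\<le>i. monom (c k) k)"
  have cq: "coeff q n = (if n \<le> i then c n else 0)" for n
    by (simp add: q_def coeff_sum)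
  have rec': "2 * (real n + 1) * (real n + a + 1) * coeff q (Suc n) + (e i - e n) * coeff q n = 0" for n
  proof -
    have "2 * (real n + 1) * (real n + a + 1) * c (Suc n) + (e i - e n) * c n = 0"
      using rec[of n] by (simp add: algebra_simps)
    \<comment> \<open>At \<open>n = i\<close> the factor \<open>e i - e n\<close> vanishes, which is
      why cutting the series off after degree \<open>i\<close> respects the recursion.\<close>
    thus ?thesis by (cases n i rule: linorder_cases) (auto simp: cq)
  qed
  \<comment> \<open>The left-hand side of the Jacobi equation after the substitution
    \<open>x = 1 - t\<close>, where \<open>1 - t^2 = x (2 - x)\<close>.\<close>
  define L where "L = [:0, 2, -1:] * pderiv (pderiv q) + [:2 * a + 2, - (a + b + 2):] * pderiv q + smult (e i) q"
  have "coeff L n = 2 * (real n + 1) * (real n + a + 1) * coeff q (Suc n) + (e i - e n) * coeff q n" for n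
  proof -
    consider "n = 0" | "n = 1" | k where "n = Suc (Suc k)" by (metis One_nat_def not0_implies_Suc)
    thus ?thesis
    proof cases
      case 1
      thus ?thesis by (simp add: L_def e_def coeff_pderiv coeff_pCons eval_nat_numeral algebra_simps)
    next
      case 2
      thus ?thesis by (simp add: L_def e_def coeff_pderiv coeff_pCons eval_nat_numeral algebra_simps)
    next
      case 3
      thus ?thesis by (simp add: L_def e_def coeff_pderiv coeff_pCons algebra_simps)
    qed
  qed
  hence "L = 0" using rec' by (simp add: poly_eq_iff)
  hence L: "poly L x = 0" for x by simp
  define p where "p = pcompose q [:1, -1:]"
  have "poly (jacobi_op a b p + smult (e i) p) t = poly L (1 - t)" for t
    by (simp add: p_def L_def jacobi_op_def pderiv_pcompose pderiv_mult pderiv_minus poly_pcompose pderiv_pCons)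
       (simp add: algebra_simps)
  hence "poly (jacobi_op a b p + smult (e i) p) = poly 0" using L by auto
  hence "jacobi_op a b p + smult (e i) p = 0" by (simp only: poly_eq_poly_eq_iff)
  \<comment> \<open>The value at \<open>t = 1\<close> is the constant coefficient
    \<open>c 0 = 1\<close>.\<close>
  moreover have "p \<noteq> 0"
  proof
    assume "p = 0"
    hence "poly p 1 = 0" by simp
    hence "coeff q 0 = 0" by (simp add: p_def poly_pcompose poly_0_coeff_0)
    thus False by (simp add: cq c0)
  qed
  ultimately show ?thesis using that by (simp add: e_def)
qed

lemma jacobi_poly:
  assumes ab: "a > -1" "b > -1"
  shows "lead_coeff (jacobi_poly i a b) = 1"
    and "jacobi_op a b (jacobi_poly i a b) + smult (real i * (real i + a + b + 1)) (jacobi_poly i a b) = 0"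
    and "degree (jacobi_poly i a b) = i"
proof -
  let ?e = "real i * (real i + a + b + 1)"
  let ?P = "\<lambda>p. lead_coeff p = 1 \<and> jacobi_op a b p + smult ?e p = 0"
  obtain q where q: "q \<noteq> 0" "jacobi_op a b q + smult ?e q = 0"
    using jacobi_solution_exists[OF ab, of i] by blast
  define p where "p = smult (inverse (lead_coeff q)) q"
  have "jacobi_op a b p + smult ?e p = smult (inverse (lead_coeff q)) (jacobi_op a b q + smult ?e q)"
    by (simp add: p_def jacobi_op_def pderiv_smult smult_add_right algebra_simps del: mult_pCons_left)
  hence p: "?P p" using q by (simp add: p_def)
  \<comment> \<open>A nonzero difference of two monic solutions would solve the equation too and
    hence have degree \<open>i\<close>, but the leading terms cancel.\<close>
  have uniq: "p1 = p2" if "?P p1" "?P p2" for p1 p2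
  proof (rule ccontr)
    assume ne: "p1 \<noteq> p2"
    have nz: "p1 \<noteq> 0" "p2 \<noteq> 0" using that by auto
    have "jacobi_op a b (p1 - p2) + smult ?e (p1 - p2) = 0"
    proof -
      have "jacobi_op a b (p1 - p2) + smult ?e (p1 - p2) =
        (jacobi_op a b p1 + smult ?e p1) - (jacobi_op a b p2 + smult ?e p2)"
        by (simp add: jacobi_op_def pderiv_diff smult_diff_right algebra_simps del: mult_pCons_left)
      thus ?thesis using that by simp
    qed
    hence "degree (p1 - p2) = i" using ne by (intro jacobi_solution_degree[OF ab]) auto
    moreover have "degree p1 = i" "degree p2 = i"
      using that nz by (auto intro: jacobi_solution_degree[OF ab])
    ultimately have "lead_coeff (p1 - p2) = 0" using that by simp
    hence "p1 - p2 = 0" by (simp only: leading_coeff_0_iff)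
    thus False using ne by simp
  qed
  have "jacobi_poly i a b = (THE p. ?P p)"
    unfolding jacobi_poly_def jacobi_equation_iff ..
  moreover have "(THE p. ?P p) = p" by (rule the_equality[where P="?P", OF p]) (rule uniq[OF _ p])
  ultimately have eq: "?P (jacobi_poly i a b)" using p by simp
  thus "lead_coeff (jacobi_poly i a b) = 1"
    and "jacobi_op a b (jacobi_poly i a b) + smult ?e (jacobi_poly i a b) = 0" by auto
  have "jacobi_poly i a b \<noteq> 0" using eq by (metis lead_coeff_1 leading_coeff_0_iff one_neq_zero)
  thus "degree (jacobi_poly i a b) = i"
    using jacobi_solution_degree[OF ab] eq by blast
qed


section \<open>Eigenfunctions of the Laplace--Beltrami operator\<close>

lemma real_polynomial_function_poly_compose:
  assumes "real_polynomial_function f"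
  shows "real_polynomial_function (\<lambda>x. poly p (f x))"
  by (induction p) (auto intro!: real_polynomial_function.intros(2-4) assms)

lemma real_polynomial_function_inner_self:
  fixes L :: "'a::real_normed_vector \<Rightarrow> 'b::euclidean_space"
  assumes "bounded_linear L"
  shows "real_polynomial_function (\<lambda>x. L x \<bullet> L x)"
proof -
  have "real_polynomial_function (\<lambda>x. \<Sum>b\<in>Basis. (L x \<bullet> b) * (L x \<bullet> b))"
    using assms by (intro real_polynomial_function_sum real_polynomial_function.intros bounded_linear_inner_left_comp) auto
  thus ?thesis by (simp add: euclidean_inner[of "L _" "L _"])
qed

lemma real_polynomial_function_sqnorm_diff:
  "real_polynomial_function (sqnorm_diff :: 'a::euclidean_space \<times> 'b::euclidean_space \<Rightarrow> real)"
proof -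
  have "real_polynomial_function (\<lambda>z::'a \<times> 'b. fst z \<bullet> fst z - snd z \<bullet> snd z)"
    by (intro real_polynomial_function_diff real_polynomial_function_inner_self bounded_linear_fst bounded_linear_snd)
  thus ?thesis by (simp add: sqnorm_diff_def[abs_def] power2_norm_eq_inner)
qed

lemma sum_Basis_prod:
  fixes F :: "'a::euclidean_space \<times> 'b::euclidean_space \<Rightarrow> real"
  shows "(\<Sum>b\<in>Basis. F b) = (\<Sum>i\<in>Basis. F (i, 0)) + (\<Sum>i\<in>Basis. F (0, i))"
proof -
  have "inj_on (\<lambda>i::'a. (i, 0::'b)) Basis" "inj_on (\<lambda>i::'b. (0::'a, i)) Basis"
    by (auto intro!: inj_onI)
  thus ?thesis
    unfolding Basis_prod_def by (subst sum.union_disjoint) (auto simp: sum.reindex o_def)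
qed

context
  fixes f :: "'a::euclidean_space \<times> 'b::euclidean_space \<Rightarrow> real" and J :: "'a \<times> 'b \<Rightarrow> 'a \<times> 'b"
  defines "f \<equiv> sqnorm_diff" and "J \<equiv> \<lambda>z. (fst z, - snd z)"
begin

lemma sqnorm_diff_derivative: "(f has_derivative (\<lambda>h. 2 * (J z \<bullet> h))) (at z within S)"
proof -
  have "f = (\<lambda>z. fst z \<bullet> fst z - snd z \<bullet> snd z)"
    by (auto simp: f_def sqnorm_diff_def power2_norm_eq_inner)
  thus ?thesis
    by (auto intro!: derivative_eq_intros simp: J_def inner_prod_def inner_commute)
qed

lemma poly_sqnorm_diff_derivative:
  "((\<lambda>z. poly p (f z)) has_derivative (\<lambda>h. ((2 * poly (pderiv p) (f z)) *\<^sub>R J z) \<bullet> h)) (at z within S)"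
proof -
  have "((\<lambda>z. poly p (f z)) has_derivative (\<lambda>h. poly (pderiv p) (f z) * (2 * (J z \<bullet> h)))) (at z within S)"
    using has_derivative_compose[OF sqnorm_diff_derivative, of "poly p" "\<lambda>h. poly (pderiv p) (f z) * h"]
      poly_DERIV[of p "f z"] by (simp add: has_field_derivative_def)
  thus ?thesis by (simp add: mult_ac)
qed

text \<open>The gradient is \<open>2 p'(t) J z\<close>, where \<open>J\<close> reflects the second
  factor. On the sphere \<open>J z\<close> is a unit vector with \<open>J z \<bullet> z = t\<close>,
  and the trace of \<open>J\<close> is the difference of the dimensions; these three facts give all
  coefficients.\<close>

lemma laplace_beltrami_poly_sqnorm_diff:
  fixes z :: "'a \<times> 'b"
  assumes z: "z \<in> sphere 0 1"
  shows "laplace_beltrami (\<lambda>z. poly p (f z)) z =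
    4 * (1 - (f z)\<^sup>2) * poly (pderiv (pderiv p)) (f z) +
    (2 * (real DIM('a) - real DIM('b)) - 2 * (real DIM('a) + real DIM('b)) * f z) * poly (pderiv p) (f z)"
proof -
  define g where "g x = (2 * poly (pderiv p) (f x)) *\<^sub>R J x" for x
  define H where "H h = (2 * poly (pderiv p) (f z)) *\<^sub>R J h
      + (2 * (((2 * poly (pderiv (pderiv p)) (f z)) *\<^sub>R J z) \<bullet> h)) *\<^sub>R J z" for h
  have "(J has_derivative J) (at z within sphere 0 1)"
    unfolding J_def by (auto intro!: derivative_eq_intros)
  hence H: "(g has_derivative H) (at z within sphere 0 1)"
    unfolding g_def H_def
    by (intro has_derivative_scaleR has_derivative_mult_right poly_sqnorm_diff_derivative)
  have JJ: "J z \<bullet> J z = 1" using z by (simp add: J_def inner_prod_def norm_eq_1)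
  have Jz: "J z \<bullet> z = f z" by (simp add: J_def f_def sqnorm_diff_def inner_prod_def power2_norm_eq_inner)
  have tr: "(\<Sum>b\<in>Basis. J b \<bullet> b) = real DIM('a) - real DIM('b)"
    by (simp add: sum_Basis_prod J_def inner_prod_def sum_negf)
  have "laplace_beltrami (\<lambda>z. poly p (f z)) z =
    (\<Sum>b\<in>Basis. H b \<bullet> b) - H z \<bullet> z - real (DIM('a \<times> 'b) - 1) * (g z \<bullet> z)"
    by (rule laplace_beltrami_eq[OF _ z H]) (unfold g_def, rule poly_sqnorm_diff_derivative)
  also have "(\<Sum>b\<in>Basis. H b \<bullet> b) = 2 * poly (pderiv p) (f z) * (\<Sum>b\<in>Basis. J b \<bullet> b)
      + 4 * poly (pderiv (pderiv p)) (f z) * (\<Sum>b\<in>Basis. (J z \<bullet> b) * (J z \<bullet> b))"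
    by (simp add: H_def inner_add_left sum.distrib sum_distrib_left mult_ac)
  also have "(\<Sum>b\<in>Basis. (J z \<bullet> b) * (J z \<bullet> b)) = 1" using JJ euclidean_inner[of "J z" "J z"] by simp
  also have "H z \<bullet> z = 2 * poly (pderiv p) (f z) * f z + 4 * poly (pderiv (pderiv p)) (f z) * (f z)\<^sup>2"
    by (simp add: H_def inner_add_left Jz power2_eq_square)
  also have "g z \<bullet> z = 2 * poly (pderiv p) (f z) * f z" by (simp add: g_def Jz)
  also have "real (DIM('a \<times> 'b) - 1) = real DIM('a) + real DIM('b) - 1"
    using DIM_positive[where 'a='a] by (simp add: of_nat_diff Suc_leI trans_le_add1)
  finally show ?thesis unfolding tr by (simp add: algebra_simps)
qed

end

lemma sqnorm_diff_surj:
  assumes "t \<in> {-1..1}"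
  obtains z :: "'a::euclidean_space \<times> 'b::euclidean_space" where "z \<in> sphere 0 1" "sqnorm_diff z = t"
proof -
  obtain a :: 'a where a: "a \<in> Basis" by (meson nonempty_Basis ex_in_conv)
  obtain b :: 'b where b: "b \<in> Basis" by (meson nonempty_Basis ex_in_conv)
  define z where "z = (sqrt ((1 + t) / 2) *\<^sub>R a, sqrt ((1 - t) / 2) *\<^sub>R b)"
  have "(norm (fst z))\<^sup>2 = (1 + t) / 2" "(norm (snd z))\<^sup>2 = (1 - t) / 2"
    using a b assms by (auto simp: z_def power_mult_distrib)
  hence "norm z = 1" "sqnorm_diff z = t"
    by (auto simp: norm_prod_def sqnorm_diff_def field_simps)
  thus ?thesis using that by (metis mem_sphere_0)
qed

lemma poly_sqnorm_diff_eq_0: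
  assumes "\<And>z. z \<in> sphere 0 1 \<Longrightarrow> poly p (sqnorm_diff (z :: 'a::euclidean_space \<times> 'b::euclidean_space)) = 0"
  shows "p = 0"
proof (rule ccontr)
  assume "p \<noteq> 0"
  hence "finite {t. poly p t = 0}" by (rule poly_roots_finite)
  moreover have "{-1..1} \<subseteq> {t. poly p t = 0}"
    using sqnorm_diff_surj[where 'a='a and 'b='b] assms by blast
  ultimately have "finite {-1..1::real}" using finite_subset by blast
  thus False using infinite_Icc[of "-1" "1::real"] by simp
qed

text \<open>Four times the Jacobi equation with parameters \<open>\<beta>\<close>,
  \<open>\<alpha>\<close>. The eigenvalue is \<open>4 i (i + \<alpha> + \<beta> + 1)\<close>, where
  \<open>\<alpha> + \<beta> + 2\<close> is half the dimension of the ambient space.\<close>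

lemma lb_eigenfunction_jacobi:
  fixes i :: nat
  defines "\<alpha> \<equiv> real DIM('a) / 2 - 1" and "\<beta> \<equiv> real DIM('b) / 2 - 1"
  assumes "\<Phi> = (\<lambda>z::'a::euclidean_space \<times> 'b::euclidean_space. poly (jacobi_poly i \<beta> \<alpha>) (sqnorm_diff z))"
  shows "lb_eigenfunction (2 * real i * (real DIM('a) + real DIM('b) - 2 + 2 * real i)) \<Phi>"
proof -
  let ?p = "jacobi_poly i \<beta> \<alpha>"
  have ab: "\<beta> > -1" "\<alpha> > -1" by (auto simp: \<alpha>_def \<beta>_def)
  note jac = jacobi_poly[OF ab, of i]
  have "smooth_on_sphere \<Phi>" unfolding assms(3)
    by (intro smooth_on_sphere_polynomial real_polynomial_function_poly_compose real_polynomial_function_sqnorm_diff)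
  moreover have "\<exists>z\<in>sphere 0 1. \<Phi> z \<noteq> 0"
  proof -
    have "?p \<noteq> 0" using jac(1) by auto
    thus ?thesis using poly_sqnorm_diff_eq_0[of ?p, where 'a='a and 'b='b] unfolding assms(3) by blast
  qed
  moreover have "- laplace_beltrami \<Phi> z = 2 * real i * (real DIM('a) + real DIM('b) - 2 + 2 * real i) * \<Phi> z"
    if z: "z \<in> sphere 0 1" for z
  proof -
    let ?t = "sqnorm_diff z"
    have "(1 - ?t\<^sup>2) * poly (pderiv (pderiv ?p)) ?t + (\<alpha> - \<beta> - (\<beta> + \<alpha> + 2) * ?t) * poly (pderiv ?p) ?t
      + (real i * (real i + \<beta> + \<alpha> + 1)) * poly ?p ?t = 0"
      using jacobi_equation_iff[of ?p \<alpha> \<beta> "real i * (real i + \<beta> + \<alpha> + 1)"] jac(2) by blast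
    hence "4 * (1 - ?t\<^sup>2) * poly (pderiv (pderiv ?p)) ?t + 4 * (\<alpha> - \<beta> - (\<beta> + \<alpha> + 2) * ?t) * poly (pderiv ?p) ?t
      = - (4 * real i * (real i + \<beta> + \<alpha> + 1)) * poly ?p ?t" by (simp add: algebra_simps)
    moreover have "laplace_beltrami \<Phi> z = 4 * (1 - ?t\<^sup>2) * poly (pderiv (pderiv ?p)) ?t +
      4 * (\<alpha> - \<beta> - (\<beta> + \<alpha> + 2) * ?t) * poly (pderiv ?p) ?t"
      unfolding assms(3) laplace_beltrami_poly_sqnorm_diff[OF z] by (simp add: \<alpha>_def \<beta>_def algebra_simps)
    ultimately have "- laplace_beltrami \<Phi> z = 4 * real i * (real i + \<beta> + \<alpha> + 1) * \<Phi> z"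
      by (simp add: assms(3))
    thus ?thesis by (simp add: \<alpha>_def \<beta>_def algebra_simps)
  qed
  ultimately show ?thesis by (auto simp: lb_eigenfunction_def)
qed

section \<open>Real parts of complex powers as eigenfunctions\<close>

lemma real_polynomial_function_Complex_power:
  fixes a b :: "'a::euclidean_space"
  shows "real_polynomial_function (\<lambda>z. Re (Complex (z \<bullet> a) (z \<bullet> b) ^ k)) \<and>
         real_polynomial_function (\<lambda>z. Im (Complex (z \<bullet> a) (z \<bullet> b) ^ k))"
proof (induction k)
  case (Suc k)
  thus ?case
    by (auto intro!: real_polynomial_function.intros(3,4) real_polynomial_function_diff
        real_polynomial_function.intros(1)[OF bounded_linear_inner_left])
qed (auto intro: real_polynomial_function.intros)

text \<open>The real part of a holomorphic power is harmonic and homogeneous of degree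
  \<open>k\<close>: the Hessian has trace \<open>0\<close>, and the two radial derivatives
  contribute \<open>k (k - 1)\<close> and \<open>k\<close>. With \<open>N = DIM('a) - 1\<close> the
  eigenvalue is \<open>k (k - 1) + N k\<close>.\<close>

lemma lb_eigenfunction_Re_power:
  fixes a b :: "'a::euclidean_space"
  assumes a: "a \<in> Basis" and b: "b \<in> Basis" and ab: "a \<noteq> b"
  shows "lb_eigenfunction (real k * (real k + real DIM('a) - 2)) (\<lambda>z. Re (Complex (z \<bullet> a) (z \<bullet> b) ^ k))"
proof -
  define w where "w z = Complex (z \<bullet> a) (z \<bullet> b)" for z :: 'a
  have ip: "a \<bullet> a = 1" "b \<bullet> b = 1" "a \<bullet> b = 0" "b \<bullet> a = 0"
    using a b ab by (auto simp: inner_Basis)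
  have w_alt: "w = (\<lambda>z. of_real (z \<bullet> a) + \<i> * of_real (z \<bullet> b))" by (auto simp: w_def complex_eq_iff)
  have dw: "(w has_derivative w) (at z within S)" for z S
    unfolding w_alt by (auto intro!: derivative_eq_intros)
  have dwk: "((\<lambda>z. w z ^ j) has_derivative (\<lambda>h. of_nat j * w h * w z ^ (j - 1))) (at z within S)" for z S j
    using has_derivative_power[OF dw] by (simp add: mult_ac)
  define g where "g z = (real k * Re (w z ^ (k - 1))) *\<^sub>R a - (real k * Im (w z ^ (k - 1))) *\<^sub>R b" for z
  define H where "H z h = (real k * Re (of_nat (k - 1) * w h * w z ^ (k - 1 - 1))) *\<^sub>R a
      - (real k * Im (of_nat (k - 1) * w h * w z ^ (k - 1 - 1))) *\<^sub>R b" for z h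
  let ?u = "\<lambda>z. Re (w z ^ k)"
  have du: "(?u has_derivative (\<lambda>h. g z \<bullet> h)) (at z within S)" for z S
  proof -
    have "(?u has_derivative (\<lambda>h. Re (of_nat k * w h * w z ^ (k - 1)))) (at z within S)"
      by (intro has_derivative_Re dwk)
    moreover have "Re (of_nat k * w h * w z ^ (k - 1)) = g z \<bullet> h" for h
      by (simp add: g_def w_def inner_diff_left inner_commute algebra_simps)
    ultimately show ?thesis by simp
  qed
  have dg: "(g has_derivative H z) (at z within S)" for z S
    unfolding g_def H_def
    by (intro has_derivative_diff has_derivative_scaleR_left has_derivative_mult_right has_derivative_Re has_derivative_Im dwk)
  have "smooth_on_sphere ?u"
    unfolding w_def using real_polynomial_function_Complex_power by (intro smooth_on_sphere_polynomial) blast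
  moreover have "a \<in> sphere 0 1" "?u a \<noteq> 0"
    using a by (auto simp: w_def ip Complex_eq)
  moreover have "- laplace_beltrami ?u z = real k * (real k + real DIM('a) - 2) * ?u z"
    if z: "z \<in> sphere 0 1" for z
  proof -
    have "laplace_beltrami ?u z = (\<Sum>c\<in>Basis. H z c \<bullet> c) - H z z \<bullet> z - real (DIM('a) - 1) * (g z \<bullet> z)"
      by (rule laplace_beltrami_eq[OF du z dg])
    also have "(\<Sum>c\<in>Basis. H z c \<bullet> c) = (\<Sum>c\<in>{a, b}. H z c \<bullet> c)"
      using a b by (intro sum.mono_neutral_right) (auto simp: H_def inner_diff_left inner_Basis)
    also have "\<dots> = 0"
      using ab by (simp add: H_def inner_diff_left ip w_def algebra_simps)
    also have "H z z \<bullet> z = real k * (real k - 1) * ?u z"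
    \<comment> \<open>For smaller \<open>k\<close> the exponent \<open>k - 1 - 1\<close> is
      truncated at \<open>0\<close>, harmlessly, because the factor \<open>k\<close> or
      \<open>k - 1\<close> in \<open>H\<close> vanishes.\<close>
    proof (cases "k \<ge> 2")
      case True
      then obtain j where j: "k = Suc (Suc j)" by (metis add_2_eq_Suc le_Suc_ex)
      have "H z z \<bullet> z = real k * real (k - 1) * Re (w z * w z ^ (k - 1 - 1) * w z)"
        by (simp add: H_def inner_diff_left w_def inner_commute algebra_simps)
      also have "w z * w z ^ (k - 1 - 1) * w z = w z ^ k" by (simp add: j)
      finally show ?thesis by (simp add: j)
    next
      case False
      hence "k = 0 \<or> k = 1" by linarith
      thus ?thesis by (auto simp: H_def)
    qed
    also have "g z \<bullet> z = real k * ?u z"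
    proof (cases k)
      case (Suc j)
      have "g z \<bullet> z = real k * Re (w z ^ (k - 1) * w z)"
        by (simp add: g_def inner_diff_left w_def inner_commute algebra_simps)
      thus ?thesis by (simp add: Suc mult.commute)
    qed (simp add: g_def)
    finally show ?thesis
      using DIM_positive[where 'a='a] by (simp add: of_nat_diff algebra_simps)
  qed
  ultimately show ?thesis unfolding lb_eigenfunction_def w_def by blast
qed


section \<open>Invariant functions are functions of \<open>|x|\<^sup>2 - |y|\<^sup>2\<close>\<close>

interpretation sphere_pair: pair_sigma_finite
  "sphere_vol :: 'a::euclidean_space measure" "sphere_vol :: 'b::euclidean_space measure"
  by (intro pair_sigma_finite.intro sphere_vol.sigma_finite_measure_axioms)

abbreviation sphere_vol2 :: "('a::euclidean_space \<times> 'b::euclidean_space) measure" where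
  "sphere_vol2 \<equiv> sphere_vol \<Otimes>\<^sub>M sphere_vol"

lemma finite_measure_sphere_pair:
  "finite_measure ((sphere_vol :: 'a::euclidean_space measure) \<Otimes>\<^sub>M (sphere_vol :: 'b::euclidean_space measure))"
  by (intro finite_measure_pair_measure finite_measure_sphere_vol)

interpretation sphere_pair_finite: finite_measure
  "(sphere_vol :: 'a::euclidean_space measure) \<Otimes>\<^sub>M (sphere_vol :: 'b::euclidean_space measure)"
  by (rule finite_measure_sphere_pair)

text \<open>Kernels are known to be continuous or Borel in the pair, whereas Fubini's theorem needs
  measurability for the product of the two sphere measures; this links the two
  sigma-algebras.\<close>

lemma measurable_sphere_pair_ident:
  "(\<lambda>p. p) \<in> measurable ((sphere_vol :: 'a::euclidean_space measure) \<Otimes>\<^sub>M (sphere_vol :: 'b::euclidean_space measure))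
     (restrict_space borel (sphere 0 1 \<times> sphere 0 1))"
proof (rule measurable_restrict_space2)
  have 1: "(\<lambda>p. fst p) \<in> borel_measurable ((sphere_vol :: 'a measure) \<Otimes>\<^sub>M (sphere_vol :: 'b measure))"
    by (rule measurable_compose[OF measurable_fst]) (rule borel_measurable_sphere_vol, simp)
  have 2: "(\<lambda>p. snd p) \<in> borel_measurable ((sphere_vol :: 'a measure) \<Otimes>\<^sub>M (sphere_vol :: 'b measure))"
    by (rule measurable_compose[OF measurable_snd]) (rule borel_measurable_sphere_vol, simp)
  show "(\<lambda>p. p) \<in> borel_measurable ((sphere_vol :: 'a measure) \<Otimes>\<^sub>M (sphere_vol :: 'b measure))"
    using borel_measurable_Pair[OF 1 2] by simp
qed (auto simp: space_pair_measure)

lemma measurable_sphere_pair_borel: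
  fixes K :: "'a::euclidean_space \<times> 'b::euclidean_space \<Rightarrow> 'c::topological_space"
  assumes "K \<in> borel_measurable borel"
  shows "K \<in> borel_measurable sphere_vol2"
  using measurable_compose[OF measurable_sphere_pair_ident measurable_restrict_space1[OF assms]] by simp

lemma measurable_sphere_pair_continuous:
  fixes K :: "'a::euclidean_space \<times> 'b::euclidean_space \<Rightarrow> 'c::topological_space"
  assumes "continuous_on (sphere 0 1 \<times> sphere 0 1) K"
  shows "K \<in> borel_measurable sphere_vol2"
  using measurable_compose[OF measurable_sphere_pair_ident borel_measurable_continuous_on_restrict[OF assms]]
  by simp

lemma integrable_sphere_pair_mult:
  fixes K :: "'a::euclidean_space \<times> 'b::euclidean_space \<Rightarrow> real"
  assumes g: "integrable sphere_vol2 g" and K: "continuous_on (sphere 0 1 \<times> sphere 0 1) K"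
  shows "integrable sphere_vol2 (\<lambda>p. K p * g p)"
proof -
  have "bounded (K ` (sphere 0 1 \<times> sphere 0 1))"
    using K by (intro compact_imp_bounded compact_continuous_image compact_Times) auto
  then obtain B where B: "\<And>p. p \<in> sphere 0 1 \<times> sphere 0 1 \<Longrightarrow> \<bar>K p\<bar> \<le> B"
    unfolding bounded_iff by (metis image_eqI real_norm_def)
  show ?thesis
  proof (rule Bochner_Integration.integrable_bound)
    show "integrable sphere_vol2 (\<lambda>p. B * g p)" using g by simp
    show "(\<lambda>p. K p * g p) \<in> borel_measurable sphere_vol2"
      using g measurable_sphere_pair_continuous[OF K] by simp
    show "AE p in sphere_vol2. norm (K p * g p) \<le> norm (B * g p)"
    proof (rule AE_I2)
      fix p :: "'a \<times> 'b" assume "p \<in> space sphere_vol2"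
      hence "\<bar>K p\<bar> \<le> B" by (intro B) (auto simp: space_pair_measure)
      hence "\<bar>K p\<bar> * \<bar>g p\<bar> \<le> \<bar>B\<bar> * \<bar>g p\<bar>" by (intro mult_right_mono) auto
      thus "norm (K p * g p) \<le> norm (B * g p)" by (simp add: abs_mult)
    qed
  qed
qed

lemma integrable_sphere_pair_fst:
  fixes u :: "'a::euclidean_space \<Rightarrow> real"
  assumes "integrable sphere_vol u"
  shows "integrable (sphere_vol \<Otimes>\<^sub>M (sphere_vol :: 'b::euclidean_space measure)) (\<lambda>p. u (fst p))"
proof (rule sphere_pair.Fubini_integrable)
  show "(\<lambda>p. u (fst p)) \<in> borel_measurable (sphere_vol \<Otimes>\<^sub>M (sphere_vol :: 'b measure))"
    using assms by (intro measurable_compose[OF measurable_fst]) auto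
qed (use assms in \<open>auto intro!: integrable_norm\<close>)

lemma OxO_orthogonal:
  fixes \<gamma> :: "'a::euclidean_space \<times> 'b::euclidean_space \<Rightarrow> 'a \<times> 'b"
  assumes "\<gamma> \<in> OxO"
  shows "orthogonal_transformation \<gamma>"
proof -
  obtain A B where AB: "\<gamma> = map_prod A B" "orthogonal_transformation A" "orthogonal_transformation B"
    using assms by (auto simp: OxO_def)
  thus ?thesis
    by (auto simp: orthogonal_transformation_def linear_iff inner_prod_def)
qed

lemma sqnorm_diff_OxO: "\<gamma> \<in> OxO \<Longrightarrow> sqnorm_diff (\<gamma> z) = sqnorm_diff z"
  for \<gamma> :: "'a::euclidean_space \<times> 'b::euclidean_space \<Rightarrow> 'a \<times> 'b"
  by (auto simp: OxO_def sqnorm_diff_def orthogonal_transformation_norm)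

lemma norm_from_sqnorm_diff:
  fixes z :: "'a::euclidean_space \<times> 'b::euclidean_space"
  assumes "z \<in> sphere 0 1"
  shows "norm (fst z) = sqrt ((1 + sqnorm_diff z) / 2)" "norm (snd z) = sqrt ((1 - sqnorm_diff z) / 2)"
    and "sqnorm_diff z \<in> {-1..1}"
proof -
  have "(norm (fst z))\<^sup>2 + (norm (snd z))\<^sup>2 = 1"
    using assms by (simp add: norm_prod_def real_sqrt_eq_1_iff)
  hence *: "(norm (fst z))\<^sup>2 = (1 + sqnorm_diff z) / 2" "(norm (snd z))\<^sup>2 = (1 - sqnorm_diff z) / 2"
    by (auto simp: sqnorm_diff_def)
  show "norm (fst z) = sqrt ((1 + sqnorm_diff z) / 2)" "norm (snd z) = sqrt ((1 - sqnorm_diff z) / 2)"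
    by (auto simp: *[symmetric])
  show "sqnorm_diff z \<in> {-1..1}"
  proof -
    have "0 \<le> (1 + sqnorm_diff z) / 2" "0 \<le> (1 - sqnorm_diff z) / 2"
      unfolding *[symmetric] by simp_all
    thus ?thesis by simp
  qed
qed

lemma integral_continuous_sqnorm_diff_eq_0:
  fixes u :: "'a::euclidean_space \<times> 'b::euclidean_space \<Rightarrow> real"
  assumes u: "integrable sphere_vol u"
    and orth: "\<And>p. (LINT z|sphere_vol. u z * poly p (sqnorm_diff z)) = 0"
    and h: "continuous_on {-1..1} h"
  shows "(LINT z|sphere_vol. u z * h (sqnorm_diff z)) = 0"
proof (rule integral_mult_eq_0_approx[OF u])
  have sq: "continuous_on (sphere 0 1) (sqnorm_diff :: 'a \<times> 'b \<Rightarrow> real)"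
    by (intro continuous_on_real_polynomial_function real_polynomial_function_sqnorm_diff)
  have "continuous_on (sphere 0 1) (\<lambda>z::'a \<times> 'b. h (sqnorm_diff z))"
    by (rule continuous_on_compose2[OF h sq]) (use norm_from_sqnorm_diff(3) in blast)
  thus "integrable sphere_vol (\<lambda>z. u z * h (sqnorm_diff z))"
    by (rule integrable_mult_continuous_sphere[OF u])
  fix e :: real assume "e > 0"
  then obtain p where p: "\<And>t. t \<in> {-1..1} \<Longrightarrow> \<bar>h t - poly p t\<bar> < e"
    using Weierstrass_poly[OF h] by blast
  show "\<exists>q. (\<forall>z\<in>space sphere_vol. \<bar>h (sqnorm_diff z) - q z\<bar> < e) \<and> integrable sphere_vol (\<lambda>z. u z * q z) \<and>
      (LINT z|sphere_vol. u z * q z) = 0"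
  proof (intro exI[of _ "\<lambda>z. poly p (sqnorm_diff z)"] conjI ballI orth integrable_mult_continuous_sphere u)
    fix z :: "'a \<times> 'b" assume "z \<in> space sphere_vol"
    thus "\<bar>h (sqnorm_diff z) - poly p (sqnorm_diff z)\<bar> < e" by (intro p norm_from_sqnorm_diff(3)) simp
  qed (intro continuous_intros sq)
qed

text \<open>A radial function of \<open>y\<close>, essentially a modified Bessel function of
  \<open>c * norm y\<close>. It is not divided by the total mass, which therefore appears as a
  factor in \<open>integral_exp_mean\<close>.\<close>

definition exp_mean :: "real \<Rightarrow> 'a::euclidean_space \<Rightarrow> real" where
  "exp_mean c y = (LINT \<eta>|sphere_vol. exp (c * (\<eta> \<bullet> y)))"

lemma exp_mean_orthogonal:
  fixes A :: "'a::euclidean_space \<Rightarrow> 'a"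
  assumes A: "orthogonal_transformation A"
  shows "exp_mean c (A y) = exp_mean c y"
proof -
  have "(LINT \<eta>|sphere_vol. exp (c * (A \<eta> \<bullet> A y))) = (LINT \<eta>|sphere_vol. exp (c * (\<eta> \<bullet> A y)))"
    by (rule integral_sphere_vol_orthogonal[OF A])
       (intro continuous_on_sphere_measurable continuous_intros)
  thus ?thesis using A by (simp add: exp_mean_def orthogonal_transformation_def)
qed

lemma exp_mean_eq_norm:
  fixes y e :: "'a::euclidean_space"
  assumes "norm e = 1"
  shows "exp_mean c y = exp_mean c (norm y *\<^sub>R e)"
proof -
  obtain A where "orthogonal_transformation A" "A y = norm y *\<^sub>R e"
    using orthogonal_transformation_transitive[of y "norm y *\<^sub>R e"] assms by auto
  thus ?thesis by (metis exp_mean_orthogonal)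
qed

lemma continuous_on_exp_mean: "continuous_on UNIV (exp_mean c :: 'a::euclidean_space \<Rightarrow> real)"
  unfolding continuous_on_sequentially
proof (intro allI ballI impI, elim conjE)
  fix y :: "nat \<Rightarrow> 'a" and y0 :: 'a assume y: "y \<longlonglongrightarrow> y0"
  then obtain M where M: "\<And>n. norm (y n) \<le> M"
    using convergent_imp_bounded bounded_iff by (metis rangeI)
  show "(exp_mean c \<circ> y) \<longlonglongrightarrow> exp_mean c y0"
    unfolding exp_mean_def o_def
  proof (rule integral_dominated_convergence[where w="\<lambda>_. exp (\<bar>c\<bar> * M)"])
    show "AE \<eta> in sphere_vol. (\<lambda>n. exp (c * (\<eta> \<bullet> y n))) \<longlonglongrightarrow> exp (c * (\<eta> \<bullet> y0))"
      by (intro AE_I2 tendsto_intros y)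
    show "AE \<eta> in sphere_vol. norm (exp (c * (\<eta> \<bullet> y n))) \<le> exp (\<bar>c\<bar> * M)" for n
    proof (rule AE_I2)
      fix \<eta> :: 'a assume "\<eta> \<in> space sphere_vol"
      hence "\<bar>\<eta> \<bullet> y n\<bar> \<le> M"
        using Cauchy_Schwarz_ineq2[of \<eta> "y n"] M[of n] by simp
      hence "\<bar>c * (\<eta> \<bullet> y n)\<bar> \<le> \<bar>c\<bar> * M" by (simp add: abs_mult mult_left_mono)
      thus "norm (exp (c * (\<eta> \<bullet> y n))) \<le> exp (\<bar>c\<bar> * M)" by simp
    qed
  qed (auto intro!: continuous_on_sphere_measurable continuous_intros)
qed

text \<open>Fubini's theorem: when the integral against
  \<open>exp (c * (\<eta> \<bullet> L z))\<close> is the same for all unit vectors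
  \<open>\<eta>\<close>, averaging over \<open>\<eta>\<close> replaces the exponential by its mean.
  The maps \<open>L\<close> will be the two projections.\<close>

lemma integral_exp_mean:
  fixes L :: "'z::euclidean_space \<Rightarrow> 'b::euclidean_space"
  assumes U: "integrable sphere_vol U" and L: "bounded_linear L"
    and const: "\<And>\<eta>. \<eta> \<in> sphere 0 1 \<Longrightarrow> (LINT z|sphere_vol. U z * exp (c * (\<eta> \<bullet> L z))) = I"
  shows "(LINT z|sphere_vol. U z * exp_mean c (L z)) = measure (sphere_vol :: 'b measure) (sphere 0 1) * I"
proof -
  have L1: "continuous_on (sphere 0 1 \<times> sphere 0 1) (\<lambda>p::'z \<times> 'b. L (fst p))"
    by (intro bounded_linear.continuous_on[OF L] continuous_intros)
  have int: "integrable sphere_vol2 (\<lambda>p. exp (c * (snd p \<bullet> L (fst p))) * U (fst p))"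
    by (intro integrable_sphere_pair_mult integrable_sphere_pair_fst U continuous_intros L1)
  have "(LINT z|sphere_vol. U z * exp_mean c (L z)) =
     (LINT z|sphere_vol. LINT \<eta>|sphere_vol. exp (c * (\<eta> \<bullet> L z)) * U z)"
    by (simp add: exp_mean_def mult.commute)
  also have "\<dots> = (LINT \<eta>|sphere_vol. LINT z|sphere_vol. exp (c * (\<eta> \<bullet> L z)) * U z)"
    using sphere_pair.Fubini_integral[of "\<lambda>\<eta> z. exp (c * (\<eta> \<bullet> L z)) * U z"]
      sphere_pair.integrable_product_swap[OF int]
      sphere_pair.Fubini_integral[of "\<lambda>z \<eta>. exp (c * (\<eta> \<bullet> L z)) * U z"] int
    by (simp add: case_prod_unfold)
  also have "\<dots> = (LINT \<eta>|(sphere_vol :: 'b measure). I)"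
    by (intro Bochner_Integration.integral_cong) (auto simp: const mult.commute)
  also have "\<dots> = measure (sphere_vol :: 'b measure) (sphere 0 1) * I" by simp
  finally show ?thesis .
qed

lemma measure_sphere_vol_pos: "measure (sphere_vol :: 'a::euclidean_space measure) (sphere 0 1) \<noteq> 0"
proof
  assume "measure (sphere_vol :: 'a measure) (sphere 0 1) = 0"
  hence "emeasure (sphere_vol :: 'a measure) (space sphere_vol) = 0"
    by (simp add: sphere_vol.emeasure_eq_measure)
  hence "AE z in (sphere_vol :: 'a measure). (1::real) = 0"
    by (intro AE_I[of _ _ "space sphere_vol"]) (auto intro!: sets_sphere_volI)
  moreover obtain b :: 'a where "b \<in> Basis" by (meson nonempty_Basis ex_in_conv)
  ultimately have "(1::real) = 0"
    using sphere_vol_open_pos[of "\<lambda>_::'a. 1::real" b] by auto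
  thus False by simp
qed

text \<open>Products of exponentials are exponentials, so these sums form an algebra that separates
  points. Unlike monomials, exponentials are permuted by the group: an orthogonal map acts on the
  parameter \<open>w\<close>.\<close>

inductive_set exp_sums :: "('a::euclidean_space \<Rightarrow> real) set" where
  exp: "(\<lambda>z. c * exp (w \<bullet> z)) \<in> exp_sums"
| add: "f \<in> exp_sums \<Longrightarrow> g \<in> exp_sums \<Longrightarrow> (\<lambda>z. f z + g z) \<in> exp_sums"

lemma exp_sums_exp_mult: "f \<in> exp_sums \<Longrightarrow> (\<lambda>z. (c * exp (w \<bullet> z)) * f z) \<in> exp_sums"
proof (induction rule: exp_sums.induct)
  case (exp d v)
  have "(\<lambda>z. c * exp (w \<bullet> z) * (d * exp (v \<bullet> z))) = (\<lambda>z. (c * d) * exp ((w + v) \<bullet> z))"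
    by (auto simp: inner_add_left exp_add)
  thus ?case by (simp only: exp_sums.exp)
next
  case (add f g)
  thus ?case using exp_sums.add by (fastforce simp: distrib_left)
qed

lemma exp_sums_mult: "f \<in> exp_sums \<Longrightarrow> g \<in> exp_sums \<Longrightarrow> (\<lambda>z. f z * g z) \<in> exp_sums"
proof (induction rule: exp_sums.induct)
  case (exp c w)
  thus ?case by (rule exp_sums_exp_mult)
next
  case (add f1 f2)
  thus ?case using exp_sums.add by (fastforce simp: distrib_right)
qed

lemma exp_sums_const: "(\<lambda>_. c) \<in> exp_sums"
  using exp_sums.exp[of c 0] by simp

lemma exp_sums_dense:
  fixes p :: "'a::euclidean_space \<Rightarrow> real"
  assumes p: "continuous_on (sphere 0 1) p" and e: "e > 0"
  shows "\<exists>q\<in>exp_sums. \<forall>z\<in>sphere 0 1. \<bar>p z - q z\<bar> < e"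
proof -
  interpret function_ring_on "exp_sums :: ('a \<Rightarrow> real) set" "sphere 0 1"
  proof
    fix x y :: 'a assume "x \<noteq> y"
    hence "(x - y) \<bullet> (x - y) \<noteq> 0" by simp
    hence "(x - y) \<bullet> x \<noteq> (x - y) \<bullet> y" by (simp add: inner_diff_right)
    thus "\<exists>f\<in>exp_sums. f x \<noteq> f y"
      by (intro bexI[of _ "\<lambda>z. 1 * exp ((x - y) \<bullet> z)"] exp_sums.exp) auto
  next
    fix f :: "'a \<Rightarrow> real" assume "f \<in> exp_sums"
    thus "continuous_on (sphere 0 1) f"
      by induction (auto intro!: continuous_intros)
  qed (auto intro: exp_sums.add exp_sums_mult exp_sums_const)
  show ?thesis by (rule Stone_Weierstrass_basic[OF p e])
qed

lemma AE_zero_if_invariant_orthogonal: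
  fixes u :: "'a::euclidean_space \<times> 'b::euclidean_space \<Rightarrow> real"
  assumes u: "u \<in> invariants OxO L2_sphere"
    and orth: "\<And>p. (LINT z|sphere_vol. u z * poly p (sqnorm_diff z)) = 0"
  shows "AE z in sphere_vol. u z = 0"
proof -
  have ui: "integrable sphere_vol u"
    using u by (auto simp: invariants_def L2_sphere_iff_sqint intro: sqint_sphere_integrable)
  hence um: "u \<in> borel_measurable sphere_vol" by auto
  \<comment> \<open>The Laplace transform of \<open>u\<close> on the sphere. It is defined
    pointwise, so the almost everywhere invariance of \<open>u\<close> becomes genuine invariance of
    \<open>F\<close>.\<close>
  define F where "F w = (LINT z|sphere_vol. u z * exp (w \<bullet> z))" for w
  have F_inv: "F (\<gamma> w) = F w" if \<gamma>: "\<gamma> \<in> OxO" for \<gamma> w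
  proof -
    note o = OxO_orthogonal[OF \<gamma>]
    have m: "(\<lambda>z. u z * exp (\<gamma> w \<bullet> z)) \<in> borel_measurable sphere_vol"
      by (intro borel_measurable_times um continuous_on_sphere_measurable continuous_intros)
    have "F (\<gamma> w) = (LINT z|sphere_vol. u (\<gamma> z) * exp (\<gamma> w \<bullet> \<gamma> z))"
      unfolding F_def by (rule integral_sphere_vol_orthogonal[OF o m, symmetric])
    also have "\<dots> = (LINT z|sphere_vol. u z * exp (w \<bullet> z))"
    proof (rule integral_cong_AE)
      show "(\<lambda>z. u (\<gamma> z) * exp (\<gamma> w \<bullet> \<gamma> z)) \<in> borel_measurable sphere_vol"
        using measurable_compose[OF measurable_sphere_vol_orthogonal[OF o] m] .
      show "(\<lambda>z. u z * exp (w \<bullet> z)) \<in> borel_measurable sphere_vol"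
        by (intro borel_measurable_times um continuous_on_sphere_measurable continuous_intros)
      have "AE z in sphere_vol. u (\<gamma> z) = u z" using u \<gamma> by (auto simp: invariants_def)
      thus "AE z in sphere_vol. u (\<gamma> z) * exp (\<gamma> w \<bullet> \<gamma> z) = u z * exp (w \<bullet> z)"
        by eventually_elim (use o in \<open>simp only: orthogonal_transformation_def\<close>)
    qed
    finally show ?thesis by (simp add: F_def)
  qed
  \<comment> \<open>Each orthogonal group is transitive on the spheres of its factor.\<close>
  have F_norm: "F (a, b) = F (a', b')" if "norm a = norm a'" "norm b = norm b'" for a a' :: 'a and b b' :: 'b
  proof -
    obtain A where A: "orthogonal_transformation A" "A a = a'"
      using orthogonal_transformation_transitive[OF \<open>norm a = norm a'\<close>] .
    obtain B where B: "orthogonal_transformation B" "B b = b'"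
      using orthogonal_transformation_transitive[OF \<open>norm b = norm b'\<close>] .
    have "map_prod A B \<in> OxO" using A B by (auto simp: OxO_def)
    from F_inv[OF this, of "(a, b)"] show ?thesis using A B by simp
  qed
  have F0: "F (a, b) = 0" for a :: 'a and b :: 'b
  proof -
    let ?m = "measure (sphere_vol :: 'a measure) (sphere 0 1)"
    let ?n = "measure (sphere_vol :: 'b measure) (sphere 0 1)"
    obtain e :: 'a where e: "norm e = 1" by (meson nonempty_Basis ex_in_conv norm_Basis)
    obtain e' :: 'b where e': "norm e' = 1" by (meson nonempty_Basis ex_in_conv norm_Basis)
    let ?Gb = "\<lambda>z::'a \<times> 'b. exp_mean (norm b) (snd z)"
    have int1: "integrable sphere_vol (\<lambda>z. u z * exp (a' \<bullet> fst z))" for a' :: 'a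
      by (intro integrable_mult_continuous_sphere ui continuous_intros)
    \<comment> \<open>The second component is averaged first, with the first one kept at an
      arbitrary vector \<open>a'\<close> of the norm of \<open>a\<close>; this freedom is what the
      average over the first component uses.\<close>
    have Gb: "(LINT z|sphere_vol. (u z * exp (a' \<bullet> fst z)) * ?Gb z) = ?n * F (a, b)"
      if a': "norm a' = norm a" for a'
    proof (rule integral_exp_mean[OF int1 bounded_linear_snd])
      fix \<eta> :: 'b assume "\<eta> \<in> sphere 0 1"
      hence "F (a', norm b *\<^sub>R \<eta>) = F (a, b)" using a' by (intro F_norm) auto
      thus "(LINT z|sphere_vol. (u z * exp (a' \<bullet> fst z)) * exp (norm b * (\<eta> \<bullet> snd z))) = F (a, b)"
        by (simp add: F_def inner_prod_def exp_add mult.assoc)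
    qed
    have Gbc: "continuous_on (sphere 0 1) ?Gb"
      by (rule continuous_on_compose2[OF continuous_on_exp_mean]) (auto intro: continuous_intros)
    have "(LINT z|sphere_vol. (u z * ?Gb z) * exp_mean (norm a) (fst z)) = ?m * (?n * F (a, b))"
    proof (rule integral_exp_mean[OF _ bounded_linear_fst])
      show "integrable sphere_vol (\<lambda>z. u z * ?Gb z)"
        by (rule integrable_mult_continuous_sphere[OF ui Gbc])
      fix \<eta> :: 'a assume "\<eta> \<in> sphere 0 1"
      hence "norm (norm a *\<^sub>R \<eta>) = norm a" by simp
      from Gb[OF this] show "(LINT z|sphere_vol. u z * ?Gb z * exp (norm a * (\<eta> \<bullet> fst z))) = ?n * F (a, b)"
        by (simp add: mult_ac)
    qed
    \<comment> \<open>After both averages the kernel depends only on the norms of the two components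
      of \<open>z\<close>, hence only on \<open>sqnorm_diff z\<close>, and continuously so; the
      hypothesis makes the integral vanish.\<close>
    also have "(LINT z|sphere_vol. (u z * ?Gb z) * exp_mean (norm a) (fst z)) =
      (LINT z|sphere_vol. u z * (exp_mean (norm a) (sqrt ((1 + sqnorm_diff z) / 2) *\<^sub>R e) *
         exp_mean (norm b) (sqrt ((1 - sqnorm_diff z) / 2) *\<^sub>R e')))"
    proof (rule Bochner_Integration.integral_cong[OF refl])
      fix z :: "'a \<times> 'b" assume "z \<in> space sphere_vol"
      hence z: "z \<in> sphere 0 1" by simp
      show "(u z * ?Gb z) * exp_mean (norm a) (fst z) = u z * (exp_mean (norm a) (sqrt ((1 + sqnorm_diff z) / 2) *\<^sub>R e) *
         exp_mean (norm b) (sqrt ((1 - sqnorm_diff z) / 2) *\<^sub>R e'))"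
        using exp_mean_eq_norm[OF e, of "norm a" "fst z"] exp_mean_eq_norm[OF e', of "norm b" "snd z"]
        unfolding norm_from_sqnorm_diff[OF z] by simp
    qed
    also have "\<dots> = 0"
      by (rule integral_continuous_sqnorm_diff_eq_0[OF ui orth, where h="\<lambda>t. exp_mean (norm a) (sqrt ((1 + t) / 2) *\<^sub>R e) *
         exp_mean (norm b) (sqrt ((1 - t) / 2) *\<^sub>R e')"])
         (auto intro!: continuous_intros continuous_on_compose2[OF continuous_on_exp_mean])
    finally show ?thesis
      using measure_sphere_vol_pos[where 'a='a] measure_sphere_vol_pos[where 'a='b] by simp
  qed
  show ?thesis
  proof (rule AE_zero_if_orthogonal_dense[OF ui, where R=exp_sums])
    fix q :: "'a \<times> 'b \<Rightarrow> real" assume "q \<in> exp_sums"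
    thus "continuous_on (sphere 0 1) q" by induction (auto intro!: continuous_intros)
  next
    fix q :: "'a \<times> 'b \<Rightarrow> real" assume "q \<in> exp_sums"
    hence "integrable sphere_vol (\<lambda>z. u z * q z) \<and> (LINT z|sphere_vol. u z * q z) = 0"
    proof induction
      case (exp c w)
      have "(LINT z|sphere_vol. u z * (c * exp (w \<bullet> z))) = c * F w"
        by (simp add: F_def mult.left_commute[of _ c])
      moreover have "integrable sphere_vol (\<lambda>z. u z * (c * exp (w \<bullet> z)))"
        by (intro integrable_mult_continuous_sphere ui continuous_intros)
      ultimately show ?case using F0[of "fst w" "snd w"] by simp
    qed (simp add: distrib_left)
    thus "(LINT z|sphere_vol. u z * q z) = 0" by blast
  qed (rule exp_sums_dense)
qed


section \<open>Green's formula and weak gradients\<close>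

lemma smooth_on_sphere_grad:
  fixes u :: "'a::euclidean_space \<Rightarrow> real"
  assumes "smooth_on_sphere u" and b: "b \<in> Basis"
  shows "smooth_on_sphere (\<lambda>z. sphere_grad u z \<bullet> b)"
proof -
  obtain g where g: "C1_sphere u (\<lambda>z h. g z \<bullet> h)" "\<And>b. b \<in> Basis \<Longrightarrow> smooth_on_sphere (\<lambda>z. g z \<bullet> b)"
    using smooth_on_sphere_C1_grad[OF assms(1)] by blast
  have "smooth_on_sphere (\<lambda>z. g z \<bullet> b - (\<Sum>c\<in>Basis. (g z \<bullet> c) * (z \<bullet> c)) * (z \<bullet> b))"
    using b by (intro smooth_on_sphere_diff smooth_on_sphere_mult smooth_on_sphere_sum g smooth_on_sphere_inner) auto
  moreover have "sphere_grad u z \<bullet> b = g z \<bullet> b - (\<Sum>c\<in>Basis. (g z \<bullet> c) * (z \<bullet> c)) * (z \<bullet> b)"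
    if z: "z \<in> sphere 0 1" for z
    using sphere_grad_eq[OF z C1_sphere_deriv[OF g(1) z]] by (simp add: inner_diff_left euclidean_inner[of "g z" z])
  ultimately show ?thesis by (subst smooth_on_sphere_cong)
qed

lemma sphere_grad_tangential:
  fixes u :: "'a::euclidean_space \<Rightarrow> real"
  assumes "smooth_on_sphere u" and z: "z \<in> sphere 0 1"
  shows "sphere_grad u z \<bullet> z = 0"
proof -
  obtain g where g: "C1_sphere u (\<lambda>z h. g z \<bullet> h)"
    using smooth_on_sphere_C1_grad[OF assms(1)] by blast
  show ?thesis using sphere_grad_eq[OF z C1_sphere_deriv[OF g z]] z
    by (simp add: inner_diff_left norm_eq_1)
qed

lemma sphere_grad_continuous:
  fixes u :: "'a::euclidean_space \<Rightarrow> real"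
  assumes "smooth_on_sphere u"
  shows "continuous_on (sphere 0 1) (sphere_grad u)"
proof -
  have "continuous_on (sphere 0 1) (\<lambda>z. \<Sum>b\<in>Basis. (sphere_grad u z \<bullet> b) *\<^sub>R b)"
    by (intro continuous_intros smooth_on_sphere_continuous smooth_on_sphere_grad assms)
  thus ?thesis by (simp add: euclidean_representation)
qed

lemma green_sphere_smooth:
  fixes u :: "'a::euclidean_space \<Rightarrow> real"
  assumes u: "smooth_on_sphere u" and Y: "\<And>b. b \<in> Basis \<Longrightarrow> smooth_on_sphere (\<lambda>z. Y z \<bullet> b)"
    and tan: "\<And>z. z \<in> sphere 0 1 \<Longrightarrow> Y z \<bullet> z = 0"
  shows "(LINT z|sphere_vol. u z * sphere_div Y z) = - (LINT z|sphere_vol. sphere_grad u z \<bullet> Y z)"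
proof -
  obtain g where g: "C1_sphere u (\<lambda>z h. g z \<bullet> h)" using smooth_on_sphere_C1_grad[OF u] by blast
  obtain D where D: "C1_sphere Y D" using smooth_field_C1[OF Y] .
  have "(LINT z|sphere_vol. g z \<bullet> Y z) = (LINT z|sphere_vol. sphere_grad u z \<bullet> Y z)"
  proof (rule Bochner_Integration.integral_cong[OF refl])
    fix z :: 'a assume "z \<in> space sphere_vol"
    hence z: "z \<in> sphere 0 1" by simp
    show "g z \<bullet> Y z = sphere_grad u z \<bullet> Y z"
      using tan[OF z] by (simp add: sphere_grad_eq[OF z C1_sphere_deriv[OF g z]] inner_diff_left inner_commute[of z])
  qed
  thus ?thesis using green_sphere[OF g D tan] by simp
qed

lemma green_laplace_beltrami:
  fixes u v :: "'a::euclidean_space \<Rightarrow> real"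
  assumes u: "smooth_on_sphere u" and v: "smooth_on_sphere v"
  shows "(LINT z|sphere_vol. u z * laplace_beltrami v z) = - (LINT z|sphere_vol. sphere_grad u z \<bullet> sphere_grad v z)"
  unfolding laplace_beltrami_def
  by (intro green_sphere_smooth u smooth_on_sphere_grad v sphere_grad_tangential)

lemma laplace_beltrami_symmetric:
  fixes u v :: "'a::euclidean_space \<Rightarrow> real"
  assumes "smooth_on_sphere u" "smooth_on_sphere v"
  shows "(LINT z|sphere_vol. u z * laplace_beltrami v z) = (LINT z|sphere_vol. laplace_beltrami u z * v z)"
  using green_laplace_beltrami[OF assms] green_laplace_beltrami[OF assms(2,1)]
  by (simp add: inner_commute mult.commute)

lemma lb_eigenfunction_orthogonal:
  fixes u v :: "'a::euclidean_space \<Rightarrow> real"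
  assumes u: "lb_eigenfunction \<mu> u" and v: "lb_eigenfunction \<nu> v" and ne: "\<mu> \<noteq> \<nu>"
  shows "(LINT z|sphere_vol. u z * v z) = 0"
proof -
  have su: "smooth_on_sphere u" and sv: "smooth_on_sphere v" using u v by (auto simp: lb_eigenfunction_def)
  have eu: "laplace_beltrami u z = - \<mu> * u z" and ev: "laplace_beltrami v z = - \<nu> * v z" if "z \<in> sphere 0 1" for z
  proof -
    have "- laplace_beltrami u z = \<mu> * u z" "- laplace_beltrami v z = \<nu> * v z"
      using u v that unfolding lb_eigenfunction_def by blast+
    thus "laplace_beltrami u z = - \<mu> * u z" "laplace_beltrami v z = - \<nu> * v z" by linarith+
  qed
  have "- \<nu> * (LINT z|sphere_vol. u z * v z) = (LINT z|sphere_vol. - \<nu> * (u z * v z))" by simp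
  also have "\<dots> = (LINT z|sphere_vol. u z * laplace_beltrami v z)"
    by (intro Bochner_Integration.integral_cong) (auto simp: ev)
  also have "\<dots> = (LINT z|sphere_vol. laplace_beltrami u z * v z)"
    by (rule laplace_beltrami_symmetric[OF su sv])
  also have "\<dots> = (LINT z|sphere_vol. - \<mu> * (u z * v z))"
    by (intro Bochner_Integration.integral_cong) (auto simp: eu)
  also have "\<dots> = - \<mu> * (LINT z|sphere_vol. u z * v z)" by simp
  finally show ?thesis using ne by simp
qed

lemma weak_grad_smooth:
  fixes u :: "'a::euclidean_space \<Rightarrow> real"
  assumes u: "smooth_on_sphere u"
  shows "weak_grad u (sphere_grad u)"
proof -
  have "sqint sphere_vol (sphere_grad u)"
    by (intro continuous_on_sphere_sqint sphere_grad_continuous u)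
  thus ?thesis
    unfolding weak_grad_def sqint_def
    using sphere_grad_tangential[OF u] green_sphere_smooth[OF u] by auto
qed

lemma weak_grad_sqint: "weak_grad u X \<Longrightarrow> sqint sphere_vol X"
  by (simp add: weak_grad_def sqint_def)

lemma weak_gradD:
  assumes "weak_grad u X" "\<And>b. b \<in> Basis \<Longrightarrow> smooth_on_sphere (\<lambda>z. Y z \<bullet> b)"
    "\<And>z. z \<in> sphere 0 1 \<Longrightarrow> Y z \<bullet> z = 0"
  shows "(LINT z|sphere_vol. u z * sphere_div Y z) = - (LINT z|sphere_vol. X z \<bullet> Y z)"
  using assms unfolding weak_grad_def by blast

lemma smooth_field_continuous:
  fixes Y :: "'a::euclidean_space \<Rightarrow> 'a"
  assumes "\<And>b. b \<in> Basis \<Longrightarrow> smooth_on_sphere (\<lambda>z. Y z \<bullet> b)"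
  shows "continuous_on (sphere 0 1) Y" "continuous_on (sphere 0 1) (sphere_div Y)"
  using smooth_field_C1[OF assms] C1_sphere_continuous sphere_div_continuous by metis+

text \<open>The fields \<open>p z *\<^sub>R (b - (b \<bullet> z) *\<^sub>R z)\<close> with
  polynomial \<open>p\<close> are admissible, and pairing one with a tangential difference
  \<open>Z\<close> gives the integral of \<open>p z * (Z z \<bullet> b)\<close>. So each component
  of \<open>Z\<close> is orthogonal to all polynomials.\<close>

lemma weak_grad_unique:
  fixes X X' :: "'a::euclidean_space \<Rightarrow> 'a"
  assumes X: "weak_grad u X" and X': "weak_grad u X'"
  shows "AE z in sphere_vol. X z = X' z"
proof -
  define Z where "Z z = X z - X' z" for z
  have Z: "sqint sphere_vol Z" unfolding Z_def by (intro sqint_diff weak_grad_sqint[OF X] weak_grad_sqint[OF X'])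
  have Ztan: "AE z in sphere_vol. Z z \<bullet> z = 0"
    using X X' unfolding weak_grad_def Z_def by (auto simp: inner_diff_left elim: AE_mp)
  have Zb: "AE z in sphere_vol. Z z \<bullet> b = 0" if b: "b \<in> Basis" for b
  proof (rule AE_zero_if_orthogonal_polynomials)
    have "sqint sphere_vol (\<lambda>z::'a. b)" by (intro continuous_on_sphere_sqint continuous_intros)
    from sqint_inner[OF Z this] show Zi: "integrable sphere_vol (\<lambda>z. Z z \<bullet> b)" .
    fix p :: "'a \<Rightarrow> real" assume p: "real_polynomial_function p"
    define Y where "Y z = p z *\<^sub>R (b - (b \<bullet> z) *\<^sub>R z)" for z
    have Ys: "smooth_on_sphere (\<lambda>z. Y z \<bullet> c)" if "c \<in> Basis" for c
    proof -
      have "smooth_on_sphere (\<lambda>z. p z * (b \<bullet> c - (z \<bullet> b) * (z \<bullet> c)))"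
        by (intro smooth_on_sphere_mult smooth_on_sphere_diff smooth_on_sphere_const smooth_on_sphere_inner
            smooth_on_sphere_polynomial p)
      moreover have "Y z \<bullet> c = p z * (b \<bullet> c - (z \<bullet> b) * (z \<bullet> c))" for z
        by (simp add: Y_def inner_diff_left inner_commute[of b z])
      ultimately show ?thesis by simp
    qed
    have Yt: "Y z \<bullet> z = 0" if "z \<in> sphere 0 1" for z
      using that by (simp add: Y_def inner_diff_left norm_eq_1)
    have Yc: "sqint sphere_vol Y"
      by (intro continuous_on_sphere_sqint smooth_field_continuous Ys)
    have "(LINT z|sphere_vol. X z \<bullet> Y z) = (LINT z|sphere_vol. X' z \<bullet> Y z)"
      using weak_gradD[OF X Ys Yt] weak_gradD[OF X' Ys Yt] by simp
    hence "(LINT z|sphere_vol. Z z \<bullet> Y z) = 0"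
      using sqint_inner[OF weak_grad_sqint[OF X] Yc] sqint_inner[OF weak_grad_sqint[OF X'] Yc]
      by (simp add: Z_def inner_diff_left)
    also have "(LINT z|sphere_vol. Z z \<bullet> Y z) = (LINT z|sphere_vol. (Z z \<bullet> b) * p z)"
    proof (rule integral_cong_AE)
      show "(\<lambda>z. Z z \<bullet> Y z) \<in> borel_measurable sphere_vol" using sqint_inner[OF Z Yc] by auto
      show "(\<lambda>z. (Z z \<bullet> b) * p z) \<in> borel_measurable sphere_vol"
        using integrable_mult_continuous_sphere[OF Zi continuous_on_real_polynomial_function[OF p]] by auto
      show "AE z in sphere_vol. Z z \<bullet> Y z = (Z z \<bullet> b) * p z"
        using Ztan by eventually_elim (simp add: Y_def inner_diff_right)
    qed
    finally show "(LINT z|sphere_vol. (Z z \<bullet> b) * p z) = 0" .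
  qed
  have "AE z in sphere_vol. \<forall>b\<in>Basis. Z z \<bullet> b = 0" using Zb by (intro AE_finite_allI) auto
  thus ?thesis by eventually_elim (auto simp: Z_def euclidean_eq_iff[of "X _"] inner_diff_left)
qed

text \<open>Almost everywhere uniqueness replaces the gradients selected by \<open>SOME\<close> by
  any given ones.\<close>

lemma H1_inner_eq:
  fixes u v :: "'a::euclidean_space \<Rightarrow> real"
  assumes X: "weak_grad u X" and Y: "weak_grad v Y"
  shows "H1_inner u v = (LINT z|sphere_vol. X z \<bullet> Y z) + (LINT z|sphere_vol. u z * v z)"
proof -
  have sX: "weak_grad u (SOME X. weak_grad u X)" using X by (rule someI[of "weak_grad u"])
  have sY: "weak_grad v (SOME X. weak_grad v X)" using Y by (rule someI[of "weak_grad v"])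
  have "(LINT z|sphere_vol. (SOME X. weak_grad u X) z \<bullet> (SOME X. weak_grad v X) z) =
    (LINT z|sphere_vol. X z \<bullet> Y z)"
  proof (rule integral_cong_AE)
    show "(\<lambda>z. (SOME X. weak_grad u X) z \<bullet> (SOME X. weak_grad v X) z) \<in> borel_measurable sphere_vol"
      using sqint_inner[OF weak_grad_sqint[OF sX] weak_grad_sqint[OF sY]] by auto
    show "(\<lambda>z. X z \<bullet> Y z) \<in> borel_measurable sphere_vol"
      using sqint_inner[OF weak_grad_sqint[OF X] weak_grad_sqint[OF Y]] by auto
    show "AE z in sphere_vol. (SOME X. weak_grad u X) z \<bullet> (SOME X. weak_grad v X) z = X z \<bullet> Y z"
      using weak_grad_unique[OF sX X] weak_grad_unique[OF sY Y] by eventually_elim simp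
  qed
  thus ?thesis by (simp add: H1_inner_def)
qed

lemma weak_grad_add_scale:
  fixes u v :: "'a::euclidean_space \<Rightarrow> real"
  assumes u: "sqint sphere_vol u" and X: "weak_grad u X" and v: "sqint sphere_vol v" and Y: "weak_grad v Y"
  shows "weak_grad (\<lambda>z. u z + c * v z) (\<lambda>z. X z + c *\<^sub>R Y z)"
proof -
  have sq: "sqint sphere_vol (\<lambda>z. X z + c *\<^sub>R Y z)"
    by (intro sqint_add sqint_scale weak_grad_sqint[OF X] weak_grad_sqint[OF Y])
  have tan: "AE z in sphere_vol. (X z + c *\<^sub>R Y z) \<bullet> z = 0"
    using X Y unfolding weak_grad_def by (auto simp: inner_add_left elim: AE_mp)
  have "(LINT z|sphere_vol. (u z + c * v z) * sphere_div W z) = - (LINT z|sphere_vol. (X z + c *\<^sub>R Y z) \<bullet> W z)"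
    if W: "\<And>b. b \<in> Basis \<Longrightarrow> smooth_on_sphere (\<lambda>z. W z \<bullet> b)" "\<And>z. z \<in> sphere 0 1 \<Longrightarrow> W z \<bullet> z = 0" for W
  proof -
    note Wc = smooth_field_continuous[OF W(1)]
    note i = integrable_mult_continuous_sphere[OF sqint_sphere_integrable[OF u] Wc(2)]
      integrable_mult_continuous_sphere[OF sqint_sphere_integrable[OF v] Wc(2)]
      sqint_inner[OF weak_grad_sqint[OF X] continuous_on_sphere_sqint[OF Wc(1)]]
      sqint_inner[OF weak_grad_sqint[OF Y] continuous_on_sphere_sqint[OF Wc(1)]]
    have "(LINT z|sphere_vol. (u z + c * v z) * sphere_div W z) =
      (LINT z|sphere_vol. u z * sphere_div W z) + c * (LINT z|sphere_vol. v z * sphere_div W z)"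
      using i by (simp add: distrib_right mult.assoc)
    also have "\<dots> = - ((LINT z|sphere_vol. X z \<bullet> W z) + c * (LINT z|sphere_vol. Y z \<bullet> W z))"
      using weak_gradD[OF X W] weak_gradD[OF Y W] by simp
    also have "\<dots> = - (LINT z|sphere_vol. (X z + c *\<^sub>R Y z) \<bullet> W z)"
      using i by (simp add: inner_add_left)
    finally show ?thesis .
  qed
  thus ?thesis using sq tan unfolding weak_grad_def sqint_def by blast
qed


section \<open>The orthogonal basis of Jacobi polynomials\<close>

definition jacobi_fun :: "nat \<Rightarrow> 'a::euclidean_space \<times> 'b::euclidean_space \<Rightarrow> real" where
  "jacobi_fun i z = poly (jacobi_poly i (real DIM('b) / 2 - 1) (real DIM('a) / 2 - 1)) (sqnorm_diff z)"

text \<open>The type argument carries the two dimensions, which the index alone does not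
  determine.\<close>

definition jacobi_eig :: "('a::euclidean_space \<times> 'b::euclidean_space) itself \<Rightarrow> nat \<Rightarrow> real" where
  "jacobi_eig _ i = 2 * real i * (real DIM('a) + real DIM('b) - 2 + 2 * real i)"

lemma lb_eigenfunction_jacobi_fun:
  "lb_eigenfunction (jacobi_eig TYPE('a::euclidean_space \<times> 'b::euclidean_space) i) (jacobi_fun i :: 'a \<times> 'b \<Rightarrow> real)"
  unfolding jacobi_eig_def by (rule lb_eigenfunction_jacobi) (simp add: jacobi_fun_def[abs_def])

lemma jacobi_fun_smooth: "smooth_on_sphere (jacobi_fun i)"
  using lb_eigenfunction_jacobi_fun unfolding lb_eigenfunction_def by blast

lemma jacobi_fun_continuous: "continuous_on (sphere 0 1) (jacobi_fun i)"
  by (intro smooth_on_sphere_continuous jacobi_fun_smooth)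

lemma jacobi_fun_sqint: "sqint sphere_vol (jacobi_fun i)"
  by (intro continuous_on_sphere_sqint jacobi_fun_continuous)

lemma jacobi_fun_OxO: "\<gamma> \<in> OxO \<Longrightarrow> jacobi_fun i (\<gamma> z) = jacobi_fun i z"
  by (simp add: jacobi_fun_def sqnorm_diff_OxO)

lemma jacobi_eig_nonneg: "jacobi_eig TYPE('a::euclidean_space \<times> 'b::euclidean_space) i \<ge> 0"
proof -
  have "real DIM('a) \<ge> 1" "real DIM('b) \<ge> 1" using DIM_positive by (simp_all add: Suc_leI)
  hence "real DIM('a) + real DIM('b) - 2 + 2 * real i \<ge> 0" by (smt (verit) of_nat_0_le_iff)
  thus ?thesis by (simp add: jacobi_eig_def)
qed

lemma jacobi_eig_inj:
  assumes "jacobi_eig TYPE('a::euclidean_space \<times> 'b::euclidean_space) i = jacobi_eig TYPE('a \<times> 'b) k"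
  shows "i = k"
proof (rule ccontr)
  assume ne: "i \<noteq> k"
  have "real DIM('a) \<ge> 1" "real DIM('b) \<ge> 1" using DIM_positive by (simp_all add: Suc_leI)
  moreover have "real i + real k \<ge> 1" using ne by linarith
  ultimately have "real DIM('a) + real DIM('b) - 2 + 2 * (real i + real k) > 0" by (smt (verit))
  moreover have "jacobi_eig TYPE('a \<times> 'b) i - jacobi_eig TYPE('a \<times> 'b) k =
    2 * (real i - real k) * (real DIM('a) + real DIM('b) - 2 + 2 * (real i + real k))"
    by (simp add: jacobi_eig_def algebra_simps)
  ultimately show False using assms ne by simp
qed

lemma jacobi_fun_orthogonal:
  "i \<noteq> j \<Longrightarrow> (LINT z|sphere_vol. jacobi_fun i z * jacobi_fun j (z :: 'a::euclidean_space \<times> 'b::euclidean_space)) = 0"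
  using lb_eigenfunction_orthogonal[OF lb_eigenfunction_jacobi_fun lb_eigenfunction_jacobi_fun, of i j] jacobi_eig_inj
  by blast

lemma jacobi_fun_sqnorm_pos:
  "(LINT z|sphere_vol. jacobi_fun i z * jacobi_fun i (z :: 'a::euclidean_space \<times> 'b::euclidean_space)) > 0"
proof -
  let ?P = "jacobi_fun i :: 'a \<times> 'b \<Rightarrow> real"
  have nn: "(LINT z|sphere_vol. ?P z * ?P z) \<ge> 0" by (intro integral_nonneg_AE) auto
  moreover have "(LINT z|sphere_vol. ?P z * ?P z) \<noteq> 0"
  proof
    assume "(LINT z|sphere_vol. ?P z * ?P z) = 0"
    hence "AE z in sphere_vol. ?P z * ?P z = 0"
      using sqint_inner[OF jacobi_fun_sqint jacobi_fun_sqint, of i i]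
      by (subst (asm) integral_nonneg_eq_0_iff_AE) auto
    hence "AE z in sphere_vol. ?P z = 0" by eventually_elim simp
    hence "?P z = 0" if "z \<in> sphere 0 1" for z
      using sphere_vol_open_pos[OF jacobi_fun_continuous] that by blast
    moreover have "\<exists>z\<in>sphere 0 1. ?P z \<noteq> 0"
      using lb_eigenfunction_jacobi_fun unfolding lb_eigenfunction_def by blast
    ultimately show False by blast
  qed
  ultimately show ?thesis by linarith
qed

text \<open>The Jacobi polynomial of index \<open>degree p\<close> has exactly that degree, so
  subtracting a multiple of it lowers the degree.\<close>

lemma integral_poly_sqnorm_diff_eq_0:
  fixes u :: "'a::euclidean_space \<times> 'b::euclidean_space \<Rightarrow> real"
  assumes u: "sqint sphere_vol u" and orth: "\<And>i. (LINT z|sphere_vol. u z * jacobi_fun i z) = 0"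
  shows "(LINT z|sphere_vol. u z * poly p (sqnorm_diff z)) = 0"
proof (induction "degree p" arbitrary: p rule: less_induct)
  case less
  show ?case
  proof (cases "p = 0")
    case False
    have ab: "real DIM('b) / 2 - 1 > -1" "real DIM('a) / 2 - 1 > -1" by auto
    let ?J = "jacobi_poly (degree p) (real DIM('b) / 2 - 1) (real DIM('a) / 2 - 1)"
    note J = jacobi_poly[OF ab, of "degree p"]
    define q where "q = p - smult (lead_coeff p) ?J"
    have cont: "continuous_on (sphere 0 1) (\<lambda>z::'a \<times> 'b. poly r (sqnorm_diff z))" for r
      by (intro continuous_on_real_polynomial_function real_polynomial_function_poly_compose
          real_polynomial_function_sqnorm_diff)
    note int = integrable_mult_continuous_sphere[OF sqint_sphere_integrable[OF u] cont]
    have "(LINT z|sphere_vol. u z * poly q (sqnorm_diff z)) = 0"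
    \<comment> \<open>The zero polynomial has degree \<open>0\<close>, so for constant
      \<open>p\<close> the degree would not drop.\<close>
    proof (cases "q = 0")
      case nz: False
      have "degree q \<le> degree p" unfolding q_def using J(3) by (intro degree_diff_le) auto
      moreover have "coeff q (degree p) = 0" using J by (simp add: q_def)
      hence "degree q \<noteq> degree p" using nz by (metis leading_coeff_0_iff)
      ultimately show ?thesis by (intro less) auto
    qed simp
    moreover have "poly p t = poly q t + lead_coeff p * poly ?J t" for t by (simp add: q_def)
    hence "(LINT z|sphere_vol. u z * poly p (sqnorm_diff z)) =
      (LINT z|sphere_vol. u z * poly q (sqnorm_diff z) + lead_coeff p * (u z * poly ?J (sqnorm_diff z)))"
      by (simp add: algebra_simps)
    moreover have "\<dots> = (LINT z|sphere_vol. u z * poly q (sqnorm_diff z)) +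
        lead_coeff p * (LINT z|sphere_vol. u z * poly ?J (sqnorm_diff z))"
      using int by simp
    ultimately show ?thesis using orth[of "degree p"] by (simp add: jacobi_fun_def)
  qed simp
qed

lemma jacobi_fun_complete:
  fixes u :: "'a::euclidean_space \<times> 'b::euclidean_space \<Rightarrow> real"
  assumes u: "u \<in> invariants OxO L2_sphere" and orth: "\<And>i. (LINT z|sphere_vol. u z * jacobi_fun i z) = 0"
  shows "AE z in sphere_vol. u z = 0"
  using u orth by (intro AE_zero_if_invariant_orthogonal integral_poly_sqnorm_diff_eq_0)
    (auto simp: invariants_def L2_sphere_iff_sqint)

definition jacobi_coeff :: "('a::euclidean_space \<times> 'b::euclidean_space \<Rightarrow> real) \<Rightarrow> nat \<Rightarrow> real" where
  "jacobi_coeff u i = (LINT z|sphere_vol. u z * jacobi_fun i z) / (LINT z|sphere_vol. jacobi_fun i z * jacobi_fun i (z :: 'a \<times> 'b))"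

lemma jacobi_coeff:
  fixes u :: "'a::euclidean_space \<times> 'b::euclidean_space \<Rightarrow> real"
  shows "(LINT z|sphere_vol. u z * jacobi_fun i z) = jacobi_coeff u i *
    (LINT z|sphere_vol. jacobi_fun i z * jacobi_fun i (z :: 'a \<times> 'b))"
  unfolding jacobi_coeff_def
  using less_imp_neq[OF jacobi_fun_sqnorm_pos[of i, where 'a='a and 'b='b]] by simp

lemma jacobi_fun_mult_integrable:
  "integrable sphere_vol (\<lambda>z :: 'a::euclidean_space \<times> 'b::euclidean_space. jacobi_fun i z * jacobi_fun j z)"
  by (intro continuous_on_sphere_integrable continuous_intros jacobi_fun_continuous)

text \<open>Along a subsequence the partial sums converge almost everywhere, both at
  \<open>z\<close> and at \<open>\<gamma> z\<close>, because \<open>\<gamma>\<close> preserves null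
  sets.\<close>

lemma invariants_L2_limit:
  fixes w :: "'a::euclidean_space \<times> 'b::euclidean_space \<Rightarrow> real"
  assumes w: "sqint sphere_vol w"
    and lim: "(\<lambda>k. LINT z|sphere_vol. (norm ((\<Sum>i<k. c i *\<^sub>R jacobi_fun i z) - w z))\<^sup>2) \<longlonglongrightarrow> 0"
  shows "w \<in> invariants OxO L2_sphere"
proof -
  define S where "S k z = (\<Sum>i<k. c i *\<^sub>R jacobi_fun i z)" for k :: nat and z :: "'a \<times> 'b"
  have S: "sqint sphere_vol (S k)" for k unfolding S_def by (intro sqint_sum sqint_scale jacobi_fun_sqint) auto
  obtain r where r: "strict_mono r" "AE z in sphere_vol. (\<lambda>n. S (r n) z) \<longlonglongrightarrow> w z"
    using sqint_AE_subseq[of sphere_vol S w, OF S w] lim unfolding S_def by blast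
  have "AE z in sphere_vol. w (\<gamma> z) = w z" if \<gamma>: "\<gamma> \<in> OxO" for \<gamma>
    using AE_sphere_vol_orthogonal[OF OxO_orthogonal[OF \<gamma>] r(2)] r(2)
  proof eventually_elim
    case (elim z)
    have "S k (\<gamma> z) = S k z" for k unfolding S_def using \<gamma> by (simp add: jacobi_fun_OxO)
    thus ?case using elim LIMSEQ_unique by auto
  qed
  thus ?thesis using w by (simp add: invariants_def L2_sphere_iff_sqint)
qed

text \<open>The series converges to some invariant \<open>w\<close> with the same coefficients as
  \<open>u\<close>; then \<open>u - w\<close> is orthogonal to every \<open>jacobi_fun i\<close>,
  and completeness gives \<open>u = w\<close> almost everywhere.\<close>

lemma jacobi_series_L2:
  fixes u :: "'a::euclidean_space \<times> 'b::euclidean_space \<Rightarrow> real"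
  assumes u: "u \<in> invariants OxO L2_sphere"
  shows "(\<lambda>k. LINT z|sphere_vol. (norm ((\<Sum>i<k. jacobi_coeff u i *\<^sub>R jacobi_fun i z) - u z))\<^sup>2) \<longlonglongrightarrow> 0"
proof -
  let ?c = "jacobi_coeff u"
  define S where "S k z = (\<Sum>i<k. ?c i *\<^sub>R jacobi_fun i z)" for k :: nat and z :: "'a \<times> 'b"
  have us: "sqint sphere_vol u" using u by (simp add: invariants_def L2_sphere_iff_sqint)
  have S: "sqint sphere_vol (S k)" for k unfolding S_def by (intro sqint_sum sqint_scale jacobi_fun_sqint) auto
  have o: "(LINT z|sphere_vol. jacobi_fun i z \<bullet> jacobi_fun j (z :: 'a \<times> 'b)) = 0" if "i \<noteq> j" for i j
    using jacobi_fun_orthogonal[OF that] by simp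
  have c: "(LINT z|sphere_vol. u z \<bullet> jacobi_fun i z) = ?c i * (LINT z|sphere_vol. jacobi_fun i z \<bullet> jacobi_fun i (z :: 'a \<times> 'b))" for i
    using jacobi_coeff[of u i] by simp
  obtain w where w: "sqint sphere_vol w" "(\<lambda>k. LINT z|sphere_vol. (norm (S k z - w z))\<^sup>2) \<longlonglongrightarrow> 0"
    using orthogonal_series_converges[OF us jacobi_fun_sqint o c] unfolding S_def .
  have winv: "w \<in> invariants OxO L2_sphere" using invariants_L2_limit[OF w(1)] w(2) unfolding S_def by blast
  have "(LINT z|sphere_vol. (u z - w z) * jacobi_fun i z) = 0" for i
  proof -
    have "(LINT z|sphere_vol. S k z \<bullet> jacobi_fun i z) = (LINT z|sphere_vol. u z * jacobi_fun i z)" if "k > i" for k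
    proof -
      have "(LINT z|sphere_vol. S k z \<bullet> jacobi_fun i z) = (\<Sum>j<k. ?c j * (LINT z|sphere_vol. jacobi_fun j z * jacobi_fun i (z :: 'a \<times> 'b)))"
        unfolding S_def
        by (simp add: inner_sum_left sum_distrib_right mult.assoc jacobi_fun_mult_integrable)
      also have "\<dots> = (\<Sum>j<k. if j = i then ?c i * (LINT z|sphere_vol. jacobi_fun i z * jacobi_fun i (z :: 'a \<times> 'b)) else 0)"
        by (intro sum.cong) (auto simp: jacobi_fun_orthogonal)
      also have "\<dots> = (LINT z|sphere_vol. u z * jacobi_fun i z)" using that jacobi_coeff[of u i] by simp
      finally show ?thesis .
    qed
    hence "(\<lambda>k. LINT z|sphere_vol. S k z \<bullet> jacobi_fun i z) \<longlonglongrightarrow> (LINT z|sphere_vol. u z * jacobi_fun i z)"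
      by (intro tendsto_eventually) (auto simp: eventually_at_top_dense)
    moreover have "(\<lambda>k. LINT z|sphere_vol. S k z \<bullet> jacobi_fun i z) \<longlonglongrightarrow> (LINT z|sphere_vol. w z \<bullet> jacobi_fun i z)"
      by (rule sqint_inner_limit[OF S w(1) jacobi_fun_sqint w(2)])
    ultimately have "(LINT z|sphere_vol. u z * jacobi_fun i z) = (LINT z|sphere_vol. w z * jacobi_fun i z)"
      using LIMSEQ_unique by auto
    thus ?thesis
      using sqint_inner[OF us jacobi_fun_sqint, of i] sqint_inner[OF w(1) jacobi_fun_sqint, of i]
      by (simp add: left_diff_distrib)
  qed
  moreover have "(\<lambda>z. u z - w z) \<in> invariants OxO L2_sphere"
  proof -
    have "AE z in sphere_vol. u (\<gamma> z) - w (\<gamma> z) = u z - w z" if "\<gamma> \<in> OxO" for \<gamma>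
    proof -
      have "AE z in sphere_vol. u (\<gamma> z) = u z" "AE z in sphere_vol. w (\<gamma> z) = w z"
        using u winv that by (auto simp: invariants_def)
      thus ?thesis by eventually_elim simp
    qed
    thus ?thesis using sqint_diff[OF us w(1)] by (simp add: invariants_def L2_sphere_iff_sqint)
  qed
  ultimately have AE: "AE z in sphere_vol. u z - w z = 0" by (intro jacobi_fun_complete)
  have "(LINT z|sphere_vol. (norm (S k z - w z))\<^sup>2) = (LINT z|sphere_vol. (norm (S k z - u z))\<^sup>2)" for k
  proof (rule integral_cong_AE)
    show "(\<lambda>z. (norm (S k z - w z))\<^sup>2) \<in> borel_measurable sphere_vol"
         "(\<lambda>z. (norm (S k z - u z))\<^sup>2) \<in> borel_measurable sphere_vol"
      using sqint_integrable[OF sqint_diff[OF S w(1)]] sqint_integrable[OF sqint_diff[OF S us]] by auto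
    show "AE z in sphere_vol. (norm (S k z - w z))\<^sup>2 = (norm (S k z - u z))\<^sup>2"
      using AE by eventually_elim simp
  qed
  thus ?thesis using w(2) by (simp add: S_def)
qed

lemma jacobi_fun_invariant: "jacobi_fun i \<in> invariants OxO L2_sphere"
  using jacobi_fun_sqint by (auto simp: invariants_def L2_sphere_iff_sqint jacobi_fun_OxO)

theorem orthogonal_basis_L2:
  "orthogonal_basis (invariants OxO L2_sphere) L2_inner
     (jacobi_fun :: nat \<Rightarrow> 'a::euclidean_space \<times> 'b::euclidean_space \<Rightarrow> real)"
  unfolding orthogonal_basis_def
proof (intro conjI allI ballI impI)
  fix u :: "'a \<times> 'b \<Rightarrow> real" assume u: "u \<in> invariants OxO L2_sphere"
  show "\<exists>c. (\<lambda>k. let r = \<lambda>z. u z - (\<Sum>i<k. c i * jacobi_fun i z) in L2_inner r r) \<longlonglongrightarrow> 0"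
    using jacobi_series_L2[OF u]
    by (intro exI[of _ "jacobi_coeff u"]) (simp add: L2_inner_def Let_def power2_eq_square[symmetric] power2_commute)
next
  fix i show "L2_inner (jacobi_fun i) (jacobi_fun i :: 'a \<times> 'b \<Rightarrow> real) \<noteq> 0"
    using jacobi_fun_sqnorm_pos[of i, where 'a='a and 'b='b] by (simp add: L2_inner_def)
qed (auto simp: jacobi_fun_invariant L2_inner_def jacobi_fun_orthogonal)

text \<open>The gradient of \<open>jacobi_fun i\<close> is an admissible test field in the
  definition of the weak gradient, so \<open>u\<close> need not be approximated by smooth
  functions.\<close>

lemma jacobi_fun_grad_inner:
  fixes u :: "'a::euclidean_space \<times> 'b::euclidean_space \<Rightarrow> real"
  assumes X: "weak_grad u X"
  shows "(LINT z|sphere_vol. X z \<bullet> sphere_grad (jacobi_fun i) z) =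
    jacobi_eig TYPE('a \<times> 'b) i * (LINT z|sphere_vol. u z * jacobi_fun i z)"
proof -
  have "(LINT z|sphere_vol. X z \<bullet> sphere_grad (jacobi_fun i) z) =
    - (LINT z|sphere_vol. u z * laplace_beltrami (jacobi_fun i) z)"
    using weak_gradD[OF X smooth_on_sphere_grad[OF jacobi_fun_smooth] sphere_grad_tangential[OF jacobi_fun_smooth]]
    by (simp add: laplace_beltrami_def)
  also have "(LINT z|sphere_vol. u z * laplace_beltrami (jacobi_fun i) z) =
    (LINT z|sphere_vol. - jacobi_eig TYPE('a \<times> 'b) i * (u z * jacobi_fun i z))"
  proof (rule Bochner_Integration.integral_cong[OF refl])
    fix z :: "'a \<times> 'b" assume "z \<in> space sphere_vol"
    hence "- laplace_beltrami (jacobi_fun i) z = jacobi_eig TYPE('a \<times> 'b) i * jacobi_fun i z"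
      using lb_eigenfunction_jacobi_fun[of i, where 'a='a and 'b='b] unfolding lb_eigenfunction_def by auto
    hence "laplace_beltrami (jacobi_fun i) z = - jacobi_eig TYPE('a \<times> 'b) i * jacobi_fun i z" by linarith
    thus "u z * laplace_beltrami (jacobi_fun i) z = - jacobi_eig TYPE('a \<times> 'b) i * (u z * jacobi_fun i z)" by simp
  qed
  finally show ?thesis by simp
qed

lemma H1_inner_jacobi_fun:
  fixes u :: "'a::euclidean_space \<times> 'b::euclidean_space \<Rightarrow> real"
  assumes X: "weak_grad u X"
  shows "H1_inner u (jacobi_fun i) =
    (jacobi_eig TYPE('a \<times> 'b) i + 1) * (LINT z|sphere_vol. u z * jacobi_fun i z)"
  using H1_inner_eq[OF X weak_grad_smooth[OF jacobi_fun_smooth], of i] jacobi_fun_grad_inner[OF X, of i]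
  by (simp add: algebra_simps)

text \<open>The weak gradient is a closed operator: both sides of its defining identity are
  continuous in the mean, and tangentiality passes to the limit along an almost everywhere
  convergent subsequence.\<close>

lemma weak_grad_limit:
  fixes w :: "'a::euclidean_space \<Rightarrow> real"
  assumes S: "\<And>k. sqint sphere_vol (S k)" and w: "sqint sphere_vol w"
    and G: "\<And>k. weak_grad (S k) (G k)" and Z: "sqint sphere_vol Z"
    and limS: "(\<lambda>k. LINT z|sphere_vol. (norm (S k z - w z))\<^sup>2) \<longlonglongrightarrow> 0"
    and limG: "(\<lambda>k. LINT z|sphere_vol. (norm (G k z - Z z))\<^sup>2) \<longlonglongrightarrow> 0"
  shows "weak_grad w Z"
proof -
  note Gs = weak_grad_sqint[OF G]
  obtain r where r: "strict_mono r" "AE z in sphere_vol. (\<lambda>n. G (r n) z) \<longlonglongrightarrow> Z z"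
    using sqint_AE_subseq[OF Gs Z limG] .
  have "AE z in sphere_vol. \<forall>k. G k z \<bullet> z = 0"
    using G by (subst AE_all_countable) (auto simp: weak_grad_def)
  with r(2) have tan: "AE z in sphere_vol. Z z \<bullet> z = 0"
  proof eventually_elim
    case (elim z)
    have "(\<lambda>n. G (r n) z \<bullet> z) \<longlonglongrightarrow> Z z \<bullet> z" by (intro tendsto_intros elim(1))
    thus ?case using elim(2) by (simp add: LIMSEQ_const_iff)
  qed
  have "(LINT z|sphere_vol. w z * sphere_div Y z) = - (LINT z|sphere_vol. Z z \<bullet> Y z)"
    if Y: "\<And>b. b \<in> Basis \<Longrightarrow> smooth_on_sphere (\<lambda>z. Y z \<bullet> b)" "\<And>z. z \<in> sphere 0 1 \<Longrightarrow> Y z \<bullet> z = 0" for Y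
  proof -
    note Yc = smooth_field_continuous[OF Y(1)]
    have "(\<lambda>k. LINT z|sphere_vol. S k z \<bullet> sphere_div Y z) \<longlonglongrightarrow> (LINT z|sphere_vol. w z \<bullet> sphere_div Y z)"
      by (rule sqint_inner_limit[OF S w continuous_on_sphere_sqint[OF Yc(2)] limS])
    moreover have "(LINT z|sphere_vol. S k z \<bullet> sphere_div Y z) = - (LINT z|sphere_vol. G k z \<bullet> Y z)" for k
      using weak_gradD[OF G Y] by simp
    moreover have "(\<lambda>k. - (LINT z|sphere_vol. G k z \<bullet> Y z)) \<longlonglongrightarrow> - (LINT z|sphere_vol. Z z \<bullet> Y z)"
      by (intro tendsto_minus sqint_inner_limit[OF Gs Z continuous_on_sphere_sqint[OF Yc(1)] limG])
    ultimately show ?thesis using LIMSEQ_unique by auto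
  qed
  thus ?thesis using Z tan unfolding weak_grad_def sqint_def by blast
qed

lemma sqint_Pair:
  assumes "sqint M f" "sqint M g"
  shows "sqint M (\<lambda>x. (f x, g x))"
  using assms unfolding sqint_def by (auto simp: norm_prod_def)

lemma sqint_fst_snd:
  assumes f: "sqint M (f :: _ \<Rightarrow> 'b::euclidean_space \<times> 'c::euclidean_space)"
  shows "sqint M (\<lambda>x. fst (f x))" "sqint M (\<lambda>x. snd (f x))"
    and "(LINT x|M. (norm (f x))\<^sup>2) = (LINT x|M. (norm (fst (f x)))\<^sup>2) + (LINT x|M. (norm (snd (f x)))\<^sup>2)"
proof -
  have fm[measurable]: "f \<in> borel_measurable M" and fi: "integrable M (\<lambda>x. (norm (f x))\<^sup>2)"
    using f by (auto simp: sqint_def)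
  have eq: "(norm (f x))\<^sup>2 = (norm (fst (f x)))\<^sup>2 + (norm (snd (f x)))\<^sup>2" for x by (simp add: norm_prod_def)
  have m: "(\<lambda>x. fst (f x)) \<in> borel_measurable M" "(\<lambda>x. snd (f x)) \<in> borel_measurable M"
    by (rule measurable_compose[OF fm], rule borel_measurable_continuous_onI, intro continuous_intros)+
  show 1: "sqint M (\<lambda>x. fst (f x))" "sqint M (\<lambda>x. snd (f x))"
    unfolding sqint_def using m
    by (auto intro!: Bochner_Integration.integrable_bound[OF fi] simp: eq)
  thus "(LINT x|M. (norm (f x))\<^sup>2) = (LINT x|M. (norm (fst (f x)))\<^sup>2) + (LINT x|M. (norm (snd (f x)))\<^sup>2)"
    unfolding eq by (simp add: sqint_def)
qed

lemma tendsto_0_of_le: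
  fixes a b :: "nat \<Rightarrow> real"
  assumes "b \<longlonglongrightarrow> 0" "\<And>k. 0 \<le> a k" "\<And>k. a k \<le> b k"
  shows "a \<longlonglongrightarrow> 0"
  by (rule tendsto_sandwich[of "\<lambda>_. 0" a _ b]) (use assms in auto)

text \<open>Sending \<open>u\<close> to the pair of \<open>u\<close> and its weak gradient is an
  isometry into square-integrable functions with values in a product space. There the pairs of
  \<open>jacobi_fun i\<close> are orthogonal, with the same coefficients as in \<open>L^2\<close>,
  so the series of pairs converges.\<close>

theorem orthogonal_basis_H1:
  "orthogonal_basis (invariants OxO H1_sphere) H1_inner
     (jacobi_fun :: nat \<Rightarrow> 'a::euclidean_space \<times> 'b::euclidean_space \<Rightarrow> real)"
  unfolding orthogonal_basis_def
proof (intro conjI allI ballI impI)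
  let ?J = "jacobi_fun :: nat \<Rightarrow> 'a \<times> 'b \<Rightarrow> real"
  let ?lam = "jacobi_eig TYPE('a \<times> 'b)"
  have wg: "weak_grad (?J i) (sphere_grad (?J i))" for i by (intro weak_grad_smooth jacobi_fun_smooth)
  have gs: "sqint sphere_vol (sphere_grad (?J i))" for i by (rule weak_grad_sqint[OF wg])
  {
    fix i
    show "?J i \<in> invariants OxO H1_sphere"
      using jacobi_fun_invariant[of i] wg[of i] by (auto simp: invariants_def H1_sphere_def)
    show "H1_inner (?J i) (?J i) \<noteq> 0"
      using H1_inner_jacobi_fun[OF wg, of i i] jacobi_fun_sqnorm_pos[of i, where 'a='a and 'b='b]
        jacobi_eig_nonneg[of i, where 'a='a and 'b='b] by auto
  }
  {
    fix i j :: nat assume "i \<noteq> j"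
    thus "H1_inner (?J i) (?J j) = 0"
      using H1_inner_jacobi_fun[OF wg, of i j] by (simp add: jacobi_fun_orthogonal)
  }
  fix u :: "'a \<times> 'b \<Rightarrow> real" assume uH: "u \<in> invariants OxO H1_sphere"
  then obtain X where X: "weak_grad u X" by (auto simp: invariants_def H1_sphere_def)
  have uL: "u \<in> invariants OxO L2_sphere" using uH by (auto simp: invariants_def H1_sphere_def)
  hence us: "sqint sphere_vol u" by (simp add: invariants_def L2_sphere_iff_sqint)
  let ?c = "jacobi_coeff u"
  define S where "S k z = (\<Sum>i<k. ?c i *\<^sub>R ?J i z)" for k z
  define G where "G k z = (\<Sum>i<k. ?c i *\<^sub>R sphere_grad (?J i) z)" for k z
  have S: "sqint sphere_vol (S k)" for k unfolding S_def by (intro sqint_sum sqint_scale jacobi_fun_sqint) auto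
  have SG: "weak_grad (S k) (G k)" for k
  proof (induction k)
    case 0
    have "weak_grad (\<lambda>z::'a \<times> 'b. 0) (\<lambda>z. 0)" by (simp add: weak_grad_def)
    thus ?case by (simp add: S_def[abs_def] G_def[abs_def])
  next
    case (Suc k)
    from weak_grad_add_scale[OF S Suc jacobi_fun_sqint wg, where c="?c k"]
    show ?case by (simp add: S_def[abs_def] G_def[abs_def])
  qed
  define f where "f z = (u z, X z)" for z
  define e where "e i z = (?J i z, sphere_grad (?J i) z)" for i z
  have f: "sqint sphere_vol f" unfolding f_def by (intro sqint_Pair us weak_grad_sqint[OF X])
  have e: "sqint sphere_vol (e i)" for i unfolding e_def by (intro sqint_Pair jacobi_fun_sqint gs)
  have fe: "(LINT z|sphere_vol. f z \<bullet> e i z) = (1 + ?lam i) * (LINT z|sphere_vol. u z * ?J i z)" for i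
    unfolding f_def e_def inner_Pair
    using sqint_inner[OF us jacobi_fun_sqint, of i] sqint_inner[OF weak_grad_sqint[OF X] gs, of i]
      jacobi_fun_grad_inner[OF X, of i]
    by (simp add: algebra_simps)
  have ee: "(LINT z|sphere_vol. e i z \<bullet> e j z) = (1 + ?lam j) * (LINT z|sphere_vol. ?J i z * ?J j z)" for i j
    unfolding e_def inner_Pair
    using sqint_inner[OF gs gs, of i j] jacobi_fun_grad_inner[OF wg, of i j]
    by (simp add: algebra_simps jacobi_fun_mult_integrable)
  have eo: "(LINT z|sphere_vol. e i z \<bullet> e j z) = 0" if "i \<noteq> j" for i j
    using that by (simp add: ee jacobi_fun_orthogonal)
  have fc: "(LINT z|sphere_vol. f z \<bullet> e i z) = ?c i * (LINT z|sphere_vol. e i z \<bullet> e i z)" for i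
    using jacobi_coeff[of u i] by (simp add: fe ee)
  obtain W where W: "sqint sphere_vol W"
    "(\<lambda>k. LINT z|sphere_vol. (norm ((\<Sum>i<k. ?c i *\<^sub>R e i z) - W z))\<^sup>2) \<longlonglongrightarrow> 0"
    using orthogonal_series_converges[OF f e eo fc] .
  define w where "w z = fst (W z)" for z
  define Z where "Z z = snd (W z)" for z
  have Ws: "sqint sphere_vol w" "sqint sphere_vol Z"
    using sqint_fst_snd[OF W(1)] by (simp_all add: w_def[abs_def] Z_def[abs_def])
  have Se: "(\<Sum>i<k. ?c i *\<^sub>R e i z) = (S k z, G k z)" for k z
    by (simp add: e_def S_def G_def prod_eq_iff fst_sum snd_sum)
  have G: "sqint sphere_vol (G k)" for k by (rule weak_grad_sqint[OF SG])
  have split: "(LINT z|sphere_vol. (norm ((S k z, G k z) - W z))\<^sup>2) =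
    (LINT z|sphere_vol. (norm (S k z - w z))\<^sup>2) + (LINT z|sphere_vol. (norm (G k z - Z z))\<^sup>2)" for k
    using sqint_fst_snd(3)[OF sqint_diff[OF sqint_Pair[OF S G] W(1)], of k k] by (simp add: w_def Z_def)
  have nn: "0 \<le> (LINT z|sphere_vol. (norm (S k z - w z))\<^sup>2)" "0 \<le> (LINT z|sphere_vol. (norm (G k z - Z z))\<^sup>2)" for k
    by (auto intro: integral_nonneg_AE)
  have limit: "(\<lambda>k. (LINT z|sphere_vol. (norm (S k z - w z))\<^sup>2) + (LINT z|sphere_vol. (norm (G k z - Z z))\<^sup>2)) \<longlonglongrightarrow> 0"
    using W(2) unfolding Se split .
  have limS: "(\<lambda>k. LINT z|sphere_vol. (norm (S k z - w z))\<^sup>2) \<longlonglongrightarrow> 0"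
    by (rule tendsto_0_of_le[OF limit]) (use nn in auto)
  have limG: "(\<lambda>k. LINT z|sphere_vol. (norm (G k z - Z z))\<^sup>2) \<longlonglongrightarrow> 0"
    by (rule tendsto_0_of_le[OF limit]) (use nn in auto)
  have Zw: "weak_grad w Z" by (rule weak_grad_limit[OF S Ws(1) SG Ws(2) limS limG])
  have limu: "(\<lambda>k. LINT z|sphere_vol. (norm (S k z - u z))\<^sup>2) \<longlonglongrightarrow> 0"
    using jacobi_series_L2[OF uL] unfolding S_def .
  \<comment> \<open>The first component of the limit is also the \<open>L^2\<close> limit of the
    partial sums, which is already known to be \<open>u\<close>.\<close>
  have "AE z in sphere_vol. (norm (u z - w z))\<^sup>2 = 0"
  proof -
    have "(LINT z|sphere_vol. (norm (u z - w z))\<^sup>2) \<le>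
      2 * (LINT z|sphere_vol. (norm (S k z - u z))\<^sup>2) + 2 * (LINT z|sphere_vol. (norm (S k z - w z))\<^sup>2)" for k
      using integral_norm_add_sq_le[OF sqint_diff[OF us S] sqint_diff[OF S Ws(1)], of k k]
      by (simp add: power2_commute)
    moreover have "(\<lambda>k. 2 * (LINT z|sphere_vol. (norm (S k z - u z))\<^sup>2) + 2 * (LINT z|sphere_vol. (norm (S k z - w z))\<^sup>2)) \<longlonglongrightarrow> 2 * 0 + 2 * 0"
      by (intro tendsto_intros limS limu)
    ultimately have "(LINT z|sphere_vol. (norm (u z - w z))\<^sup>2) \<le> 0"
      by (intro LIMSEQ_le_const) auto
    moreover have "(LINT z|sphere_vol. (norm (u z - w z))\<^sup>2) \<ge> 0" by (intro integral_nonneg_AE) auto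
    ultimately have "(LINT z|sphere_vol. (norm (u z - w z))\<^sup>2) = 0" by linarith
    thus ?thesis
      using sqint_integrable[OF sqint_diff[OF us Ws(1)]] by (subst (asm) integral_nonneg_eq_0_iff_AE) auto
  qed
  hence uw: "AE z in sphere_vol. u z = w z" by eventually_elim simp
  \<comment> \<open>Since \<open>w\<close> equals \<open>u\<close> almost everywhere,
    \<open>X\<close> is a weak gradient of \<open>w\<close> as well; uniqueness then identifies it
    with the second component \<open>Z\<close> of the limit.\<close>
  have "weak_grad w X"
  proof -
    have "(LINT z|sphere_vol. w z * sphere_div Y z) = - (LINT z|sphere_vol. X z \<bullet> Y z)"
      if Y: "\<And>b. b \<in> Basis \<Longrightarrow> smooth_on_sphere (\<lambda>z. Y z \<bullet> b)" "\<And>z. z \<in> sphere 0 1 \<Longrightarrow> Y z \<bullet> z = 0" for Y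
    proof -
      note Yc = smooth_field_continuous[OF Y(1)]
      have "(LINT z|sphere_vol. w z * sphere_div Y z) = (LINT z|sphere_vol. u z * sphere_div Y z)"
      proof (rule integral_cong_AE)
        show "(\<lambda>z. w z * sphere_div Y z) \<in> borel_measurable sphere_vol" "(\<lambda>z. u z * sphere_div Y z) \<in> borel_measurable sphere_vol"
          using integrable_mult_continuous_sphere[OF sqint_sphere_integrable[OF us] Yc(2)]
            integrable_mult_continuous_sphere[OF sqint_sphere_integrable[OF Ws(1)] Yc(2)] by auto
        show "AE z in sphere_vol. w z * sphere_div Y z = u z * sphere_div Y z"
          using uw by eventually_elim simp
      qed
      thus ?thesis using weak_gradD[OF X Y] by simp
    qed
    thus ?thesis using X unfolding weak_grad_def by blast
  qed
  hence XZ: "AE z in sphere_vol. X z = Z z" using Zw weak_grad_unique by blast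
  have H1: "H1_inner (\<lambda>z. u z - S k z) (\<lambda>z. u z - S k z) =
    (LINT z|sphere_vol. (norm (G k z - Z z))\<^sup>2) + (LINT z|sphere_vol. (norm (S k z - u z))\<^sup>2)" for k
  proof -
    have g: "weak_grad (\<lambda>z. u z - S k z) (\<lambda>z. X z - G k z)"
      using weak_grad_add_scale[OF us X S SG, of "-1" k] by simp
    have "(LINT z|sphere_vol. (X z - G k z) \<bullet> (X z - G k z)) = (LINT z|sphere_vol. (norm (G k z - Z z))\<^sup>2)"
    proof (rule integral_cong_AE)
      show "(\<lambda>z. (X z - G k z) \<bullet> (X z - G k z)) \<in> borel_measurable sphere_vol"
        using sqint_inner[OF weak_grad_sqint[OF g] weak_grad_sqint[OF g]] by auto
      show "(\<lambda>z. (norm (G k z - Z z))\<^sup>2) \<in> borel_measurable sphere_vol"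
        using sqint_integrable[OF sqint_diff[OF G Ws(2)]] by auto
      show "AE z in sphere_vol. (X z - G k z) \<bullet> (X z - G k z) = (norm (G k z - Z z))\<^sup>2"
        using XZ by eventually_elim (simp add: power2_norm_eq_inner norm_minus_commute[of "G k _"])
    qed
    thus ?thesis unfolding H1_inner_eq[OF g g]
      by (simp add: power2_eq_square[symmetric] power2_commute[of "u _"])
  qed
  have "(\<lambda>k. (LINT z|sphere_vol. (norm (G k z - Z z))\<^sup>2) + (LINT z|sphere_vol. (norm (S k z - u z))\<^sup>2)) \<longlonglongrightarrow> 0 + 0"
    by (intro tendsto_intros limG limu)
  thus "\<exists>c. (\<lambda>k. let r = \<lambda>z. u z - (\<Sum>i<k. c i * jacobi_fun i z) in H1_inner r r) \<longlonglongrightarrow> 0"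
    using H1 by (intro exI[of _ ?c]) (simp add: Let_def S_def)
qed

text \<open>Removing the multiple of \<open>jacobi_fun i\<close> leaves an invariant function
  orthogonal to every \<open>jacobi_fun j\<close>, for \<open>j \<noteq> i\<close> because the
  eigenvalues differ. Completeness makes it vanish almost everywhere, and continuity
  everywhere.\<close>

theorem jacobi_eigenvalue_simple:
  fixes u :: "'a::euclidean_space \<times> 'b::euclidean_space \<Rightarrow> real"
  assumes u: "lb_eigenfunction (jacobi_eig TYPE('a \<times> 'b) i) u" and inv: "invariant_on_sphere OxO u"
    and z: "z \<in> sphere 0 1"
  shows "u z = jacobi_coeff u i * jacobi_fun i z"
proof -
  let ?c = "jacobi_coeff u i"
  define r where "r z = u z - ?c * jacobi_fun i z" for z
  have uc: "continuous_on (sphere 0 1) u"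
    using u by (auto simp: lb_eigenfunction_def intro: smooth_on_sphere_continuous)
  have rc: "continuous_on (sphere 0 1) r"
    unfolding r_def by (intro continuous_intros uc jacobi_fun_continuous)
  have "r \<in> invariants OxO L2_sphere"
    using continuous_on_sphere_sqint[OF rc] inv
    by (auto simp: invariants_def L2_sphere_iff_sqint invariant_on_sphere_def r_def jacobi_fun_OxO intro!: AE_I2)
  moreover have "(LINT z|sphere_vol. r z * jacobi_fun j z) = 0" for j
  proof -
    have "(LINT z|sphere_vol. r z * jacobi_fun j z) =
      (LINT z|sphere_vol. u z * jacobi_fun j z) - ?c * (LINT z|sphere_vol. jacobi_fun i z * jacobi_fun j (z :: 'a \<times> 'b))"
      using sqint_inner[OF continuous_on_sphere_sqint[OF uc] jacobi_fun_sqint, of j]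
      by (simp add: r_def left_diff_distrib mult.assoc jacobi_fun_mult_integrable)
    also have "\<dots> = 0"
    proof (cases "j = i")
      case True thus ?thesis using jacobi_coeff[of u i] by simp
    next
      case False
      hence "jacobi_eig TYPE('a \<times> 'b) i \<noteq> jacobi_eig TYPE('a \<times> 'b) j" using jacobi_eig_inj by blast
      thus ?thesis using lb_eigenfunction_orthogonal[OF u lb_eigenfunction_jacobi_fun] False
        by (simp add: jacobi_fun_orthogonal)
    qed
    finally show ?thesis .
  qed
  ultimately have "AE z in sphere_vol. r z = 0" by (rule jacobi_fun_complete)
  hence "r z = 0" using sphere_vol_open_pos[OF rc _ z] by blast
  thus ?thesis by (simp add: r_def)
qed


section \<open>Integrals of the Riesz kernel\<close>

lemma powr_two_interval:
  assumes "x \<ge> (1::real)"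
  obtains j :: nat where "2 ^ j \<le> x" "x < 2 ^ Suc j"
proof -
  define j where "j = nat \<lfloor>log 2 x\<rfloor>"
  have l: "0 \<le> log 2 x" using assms by simp
  hence j: "real j \<le> log 2 x" "log 2 x < real j + 1" unfolding j_def by linarith+
  have "2 powr real j \<le> x" using j(1) assms by (simp add: le_log_iff)
  moreover have "x < 2 powr (real j + 1)" using j(2) assms by (simp add: log_less_iff)
  ultimately have "2 ^ j \<le> x" "x < 2 ^ Suc j"
    by (simp_all add: powr_realpow powr_add)
  thus ?thesis by (rule that)
qed

lemma cap_measurable: "{w \<in> sphere 0 1. norm (z - w) < r} \<in> sets (sphere_vol :: 'a::euclidean_space measure)"
  by (intro sets_sphere_volI) auto

text \<open>The function is majorised by the sum of \<open>c j\<close> times the indicators of caps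
  of radius \<open>r j\<close>. The radii may shrink or grow, which covers the integrals near to and
  far from the pole.\<close>

lemma dyadic_cap_sum:
  fixes z :: "'a::euclidean_space" and c r :: "nat \<Rightarrow> real"
  assumes z: "z \<in> sphere 0 1" and c: "\<And>j. c j \<ge> 0" and r: "\<And>j. r j \<ge> 0"
    and le: "\<And>w. w \<in> sphere 0 1 \<Longrightarrow> f w > 0 \<Longrightarrow> \<exists>j. norm (z - w) < r j \<and> f w \<le> c j"
    and sum: "(\<lambda>j. c j * r j ^ (DIM('a) - 1)) sums S"
  shows "(\<integral>\<^sup>+w. ennreal (f w) \<partial>sphere_vol) \<le> ennreal (real DIM('a) * 2 ^ DIM('a) * S)"
proof -
  let ?C = "real DIM('a) * 2 ^ DIM('a)"
  let ?cap = "\<lambda>j. {w \<in> sphere 0 1. norm (z - w) < r j}"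
  have "(\<integral>\<^sup>+w. ennreal (f w) \<partial>sphere_vol) \<le> (\<integral>\<^sup>+w. (\<Sum>j. ennreal (c j) * indicator (?cap j) w) \<partial>sphere_vol)"
  proof (rule nn_integral_mono)
    fix w :: 'a assume "w \<in> space sphere_vol"
    hence w: "w \<in> sphere 0 1" by simp
    show "ennreal (f w) \<le> (\<Sum>j. ennreal (c j) * indicator (?cap j) w)"
    proof (cases "f w > 0")
      case True
      then obtain j where j: "norm (z - w) < r j" "f w \<le> c j" using le[OF w] by blast
      define F where "F i = ennreal (c i) * indicator (?cap i) w" for i
      have "ennreal (f w) \<le> F j" unfolding F_def using j w by (simp add: ennreal_leI)
      also have "F j \<le> (\<Sum>i. F i)" using sum_le_suminf[of F "{j}"] by simp
      finally show ?thesis by (simp only: F_def)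
    qed (simp add: ennreal_neg)
  qed
  also have "\<dots> = (\<Sum>j. \<integral>\<^sup>+w. ennreal (c j) * indicator (?cap j) w \<partial>sphere_vol)"
    by (intro nn_integral_suminf borel_measurable_times_ennreal borel_measurable_indicator
        borel_measurable_const cap_measurable)
  also have "\<dots> \<le> (\<Sum>j. ennreal (?C * (c j * r j ^ (DIM('a) - 1))))"
  proof (rule suminf_le)
    fix j
    have "(\<integral>\<^sup>+w. ennreal (c j) * indicator (?cap j) w \<partial>sphere_vol) = ennreal (c j) * emeasure sphere_vol (?cap j)"
      using cap_measurable by (rule nn_integral_cmult_indicator)
    also have "\<dots> \<le> ennreal (c j) * ennreal (?C * r j ^ (DIM('a) - 1))"
      by (intro mult_left_mono sphere_vol_cap_bound z r) auto
    also have "\<dots> = ennreal (?C * (c j * r j ^ (DIM('a) - 1)))"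
      using c r by (simp add: ennreal_mult'[symmetric] mult_ac)
    finally show "(\<integral>\<^sup>+w. ennreal (c j) * indicator (?cap j) w \<partial>sphere_vol) \<le> ennreal (?C * (c j * r j ^ (DIM('a) - 1)))" .
  qed auto
  also have "\<dots> = ennreal (?C * S)"
  proof -
    have s: "(\<lambda>j. ?C * (c j * r j ^ (DIM('a) - 1))) sums (?C * S)" by (intro sums_mult sum)
    show ?thesis using s c r
      by (subst suminf_ennreal2) (auto simp: sums_iff)
  qed
  finally show ?thesis .
qed

lemma powr_geometric_sums:
  assumes a: "(a::real) > 0"
  shows "(\<lambda>j. (2 powr (- a)) ^ j) sums (1 / (1 - 2 powr (- a)))"
proof -
  have "2 powr (- a) < 2 powr (0::real)" using a by (subst powr_less_cancel_iff) auto
  thus ?thesis by (intro geometric_sums) simp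
qed

text \<open>Dyadic shells between \<open>R / 2 ^ Suc j\<close> and \<open>R / 2 ^ j\<close>; because
  \<open>q\<close> is below the dimension of the sphere, their contributions form a convergent
  geometric series.\<close>

lemma riesz_integral_near:
  fixes q :: real
  assumes q: "0 \<le> q" "q < real (DIM('a::euclidean_space) - 1)"
  obtains C where "C > 0" "\<And>(z::'a) R. z \<in> sphere 0 1 \<Longrightarrow> R > 0 \<Longrightarrow>
    (\<integral>\<^sup>+w. ennreal (if norm (z - w) < R then norm (z - w) powr (- q) else 0) \<partial>sphere_vol)
      \<le> ennreal (C * R powr (real (DIM('a) - 1) - q))"
proof -
  let ?N = "DIM('a) - 1" and ?B = "real DIM('a) * 2 ^ DIM('a)"
  define a where "a = real ?N - q"
  have a: "a > 0" using q by (simp add: a_def)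
  define G where "G = 1 / (1 - 2 powr (- a))"
  have "2 powr (- a) < 2 powr (0::real)" using a by (subst powr_less_cancel_iff) auto
  hence G: "G > 0" by (simp add: G_def)
  define C where "C = ?B * (2 powr q * G)"
  have "C > 0" using G DIM_positive[where 'a='a] by (simp add: C_def)
  moreover have "(\<integral>\<^sup>+w. ennreal (if norm (z - w) < R then norm (z - w) powr (- q) else 0) \<partial>sphere_vol)
      \<le> ennreal (C * R powr a)" if z: "z \<in> sphere 0 1" and R: "R > 0" for z :: 'a and R
  proof -
    define r where "r j = R / 2 ^ j" for j :: nat
    define c where "c j = (r j / 2) powr (- q)" for j
    have "c j * r j ^ ?N = (2 powr q * R powr a) * (2 powr (- a)) ^ j" for j
    proof -
      have rj: "r j = R * 2 powr (- real j)" by (simp add: r_def powr_minus powr_realpow divide_inverse)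
      have rp: "r j > 0" using R by (simp add: r_def)
      have "c j = r j powr (- q) * 2 powr q"
        using rp by (simp add: c_def powr_divide powr_minus field_simps)
      moreover have "r j powr (- q) * r j ^ ?N = r j powr a"
        using rp by (simp add: a_def powr_realpow[symmetric] powr_add[symmetric])
      moreover have "r j powr a = R powr a * (2 powr (- a)) ^ j"
        using R by (simp add: rj powr_mult powr_powr powr_realpow[symmetric] mult.commute)
      ultimately show ?thesis by (simp add: mult_ac)
    qed
    hence sum: "(\<lambda>j. c j * r j ^ ?N) sums (2 powr q * R powr a * G)"
      using sums_mult[OF powr_geometric_sums[OF a], of "2 powr q * R powr a"] by (simp add: G_def)
    have "(\<integral>\<^sup>+w. ennreal (if norm (z - w) < R then norm (z - w) powr (- q) else 0) \<partial>sphere_vol)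
      \<le> ennreal (?B * (2 powr q * R powr a * G))"
    proof (rule dyadic_cap_sum[OF z _ _ _ sum])
      fix w :: 'a
      assume "0 < (if norm (z - w) < R then norm (z - w) powr (- q) else 0)"
      hence d: "norm (z - w) < R" "norm (z - w) > 0" by (auto split: if_splits)
      hence "1 \<le> R / norm (z - w)" by simp
      then obtain j where j: "2 ^ j \<le> R / norm (z - w)" "R / norm (z - w) < 2 ^ Suc j"
        by (rule powr_two_interval)
      have "norm (z - w) \<le> r j" "r j / 2 < norm (z - w)"
        using j d by (auto simp: r_def field_simps)
      show "\<exists>j. norm (z - w) < r j \<and> (if norm (z - w) < R then norm (z - w) powr (- q) else 0) \<le> c j"
      \<comment> \<open>The caps are open. A point on the outer boundary of its shell is assigned to
        the next larger cap, whose constant it attains exactly; that cap exists since the distance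
        is less than \<open>r 0 = R\<close>.\<close>
      proof (cases "norm (z - w) = r j")
        case False
        have "norm (z - w) powr (- q) \<le> c j" unfolding c_def
          using \<open>r j / 2 < norm (z - w)\<close> q R by (intro powr_mono2') (auto simp: r_def)
        thus ?thesis using False \<open>norm (z - w) \<le> r j\<close> d by (intro exI[of _ j]) auto
      next
        case True
        then obtain i where i: "j = Suc i" using d by (cases j) (auto simp: r_def)
        have "norm (z - w) = r i / 2" using True i by (simp add: r_def)
        hence eq: "norm (z - w) powr (- q) = c i" by (simp only: c_def)
        have "norm (z - w) < r i" using \<open>norm (z - w) = r i / 2\<close> d by linarith
        with eq d show ?thesis by (intro exI[of _ i]) simp
      qed
    qed (use R in \<open>auto simp: c_def r_def\<close>)
    also have "?B * (2 powr q * R powr a * G) = C * R powr a" by (simp add: C_def mult_ac)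
    finally show ?thesis .
  qed
  ultimately show ?thesis using that unfolding a_def by blast
qed

text \<open>The same with shells between \<open>R * 2 ^ j\<close> and \<open>R * 2 ^ Suc j\<close>,
  whose contributions decrease because \<open>q\<close> exceeds the dimension of the sphere. No use
  is made of the bounded diameter, so the bound has the right homogeneity in
  \<open>R\<close>.\<close>

lemma riesz_integral_far:
  fixes q :: real
  assumes q: "q > real (DIM('a::euclidean_space) - 1)"
  obtains C where "C > 0" "\<And>(z::'a) R. z \<in> sphere 0 1 \<Longrightarrow> R > 0 \<Longrightarrow>
    (\<integral>\<^sup>+w. ennreal (if norm (z - w) \<ge> R then norm (z - w) powr (- q) else 0) \<partial>sphere_vol)
      \<le> ennreal (C * R powr (real (DIM('a) - 1) - q))"
proof -
  let ?N = "DIM('a) - 1" and ?B = "real DIM('a) * 2 ^ DIM('a)"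
  have q0: "q > 0" by (rule le_less_trans[OF of_nat_0_le_iff q])
  define a where "a = q - real ?N"
  have a: "a > 0" using q by (simp add: a_def)
  define G where "G = 1 / (1 - 2 powr (- a))"
  have "2 powr (- a) < 2 powr (0::real)" using a by (subst powr_less_cancel_iff) auto
  hence G: "G > 0" by (simp add: G_def)
  define C where "C = ?B * (2 ^ ?N * G)"
  have "C > 0" using G DIM_positive[where 'a='a] by (simp add: C_def)
  moreover have "(\<integral>\<^sup>+w. ennreal (if norm (z - w) \<ge> R then norm (z - w) powr (- q) else 0) \<partial>sphere_vol)
      \<le> ennreal (C * R powr (- a))" if z: "z \<in> sphere 0 1" and R: "R > 0" for z :: 'a and R
  proof -
    define r where "r j = R * 2 ^ Suc j" for j :: nat
    define c where "c j = (r j / 2) powr (- q)" for j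
    have "c j * r j ^ ?N = (2 ^ ?N * R powr (- a)) * (2 powr (- a)) ^ j" for j
    proof -
      let ?h = "R * 2 ^ j"
      have h: "?h > 0" using R by simp
      have rh: "r j = 2 * ?h" by (simp add: r_def)
      have "?h = R * 2 powr (real j)" by (simp add: powr_realpow)
      hence "?h powr (- a) = R powr (- a) * (2 powr (- a)) ^ j"
        using R by (simp add: powr_mult powr_powr powr_realpow[symmetric] mult.commute)
      moreover have "?h powr (- q) * ?h ^ ?N = ?h powr (- a)"
        using h by (simp add: a_def powr_realpow[symmetric] powr_add[symmetric])
      moreover have "c j * r j ^ ?N = 2 ^ ?N * (?h powr (- q) * ?h ^ ?N)"
        unfolding c_def rh power_mult_distrib by simp
      ultimately show ?thesis by simp
    qed
    hence sum: "(\<lambda>j. c j * r j ^ ?N) sums (2 ^ ?N * R powr (- a) * G)"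
      using sums_mult[OF powr_geometric_sums[OF a], of "2 ^ ?N * R powr (- a)"] by (simp add: G_def)
    have "(\<integral>\<^sup>+w. ennreal (if norm (z - w) \<ge> R then norm (z - w) powr (- q) else 0) \<partial>sphere_vol)
      \<le> ennreal (?B * (2 ^ ?N * R powr (- a) * G))"
    proof (rule dyadic_cap_sum[OF z _ _ _ sum])
      fix w :: 'a
      assume "0 < (if norm (z - w) \<ge> R then norm (z - w) powr (- q) else 0)"
      hence d: "norm (z - w) \<ge> R" by (auto split: if_splits)
      hence "1 \<le> norm (z - w) / R" using R by simp
      then obtain j where j: "2 ^ j \<le> norm (z - w) / R" "norm (z - w) / R < 2 ^ Suc j"
        by (rule powr_two_interval)
      have h: "norm (z - w) < r j" "r j / 2 \<le> norm (z - w)"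
        using j R by (auto simp: r_def field_simps)
      have "norm (z - w) powr (- q) \<le> c j" unfolding c_def
        using h(2) q0 R by (intro powr_mono2') (auto simp: r_def)
      thus "\<exists>j. norm (z - w) < r j \<and> (if norm (z - w) \<ge> R then norm (z - w) powr (- q) else 0) \<le> c j"
        using h d by (intro exI[of _ j]) auto
    qed (use R in \<open>auto simp: c_def r_def\<close>)
    also have "?B * (2 ^ ?N * R powr (- a) * G) = C * R powr (- a)" by (simp add: C_def mult_ac)
    finally show ?thesis .
  qed
  ultimately show ?thesis using that[of C] by (simp add: a_def)
qed

text \<open>The sphere is not convex, so the mean value inequality is applied to a smooth extension
  on a small ball around one of the points. For points at a larger distance boundedness of
  \<open>u\<close> suffices; the two summands of \<open>L\<close> belong to these cases.\<close>

lemma smooth_on_sphere_Lipschitz: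
  fixes u :: "'a::euclidean_space \<Rightarrow> real"
  assumes "smooth_on_sphere u"
  obtains L where "L > 0" "\<And>z w. z \<in> sphere 0 1 \<Longrightarrow> w \<in> sphere 0 1 \<Longrightarrow> \<bar>u z - u w\<bar> \<le> L * norm (z - w)"
proof -
  obtain U v where U: "open U" "sphere 0 1 \<subseteq> U" "smooth_on U v" "\<forall>z\<in>sphere 0 1. v z = u z"
    using assms unfolding smooth_on_sphere_def by blast
  obtain \<delta> where \<delta>: "\<delta> > 0" "(\<Union>z\<in>sphere 0 (1::real). ball z \<delta>) \<subseteq> U"
    using compact_subset_open_imp_ball_epsilon_subset[OF _ U(1,2)] by auto
  \<comment> \<open>A compact tube around the sphere inside \<open>U\<close>, on which the
    derivative of the extension is bounded.\<close>
  define K where "K = {x + y | x y. x \<in> sphere (0::'a) 1 \<and> y \<in> cball 0 (\<delta> / 2)}"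
  have "compact K" unfolding K_def by (intro compact_sums) auto
  have KU: "K \<subseteq> U"
  proof
    fix k assume "k \<in> K"
    then obtain x y where "k = x + y" "x \<in> sphere 0 1" "norm y \<le> \<delta> / 2" by (auto simp: K_def)
    hence "k \<in> ball x \<delta>" using \<delta>(1) by (simp add: dist_norm)
    thus "k \<in> U" using \<delta>(2) \<open>x \<in> sphere 0 1\<close> by blast
  qed
  define B where "B x = (\<Sum>b\<in>Basis. \<bar>frechet_derivative v (at x) b\<bar>)" for x
  have "continuous_on U (\<lambda>x. frechet_derivative v (at x) b)" if "b \<in> Basis" for b
    using smooth_on_partial[OF U(3) that] Ck_on.simps(1) by blast
  hence "continuous_on K B" unfolding B_def
    by (intro continuous_intros) (auto intro: continuous_on_subset[OF _ KU])
  hence "bounded (B ` K)" using \<open>compact K\<close> by (intro compact_imp_bounded compact_continuous_image)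
  then obtain M where M0: "M > 0" "\<forall>x\<in>K. norm (B x) \<le> M" by (auto simp: bounded_pos)
  have M: "M > 0" "\<And>x. x \<in> K \<Longrightarrow> B x \<le> M" using M0 by force+
  obtain A where A: "A > 0" "\<And>z. z \<in> sphere 0 1 \<Longrightarrow> norm (u z) \<le> A"
    using continuous_on_sphere_bound[OF smooth_on_sphere_continuous[OF assms]] by blast
  have dv: "(v has_derivative frechet_derivative v (at x)) (at x)" if "x \<in> U" for x
    using U(3) that Ck_on_Suc_derivative by blast
  have on: "onorm (frechet_derivative v (at x)) \<le> M" if x: "x \<in> K" for x
  proof (rule onorm_le)
    fix h
    have lin: "linear (frechet_derivative v (at x))" using dv KU x has_derivative_linear by blast
    have "frechet_derivative v (at x) h = (\<Sum>b\<in>Basis. (h \<bullet> b) *\<^sub>R frechet_derivative v (at x) b)"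
    proof -
      have "frechet_derivative v (at x) h = frechet_derivative v (at x) (\<Sum>b\<in>Basis. (h \<bullet> b) *\<^sub>R b)"
        by (simp add: euclidean_representation)
      thus ?thesis using lin by (simp add: linear_sum linear_cmul)
    qed
    also have "norm \<dots> \<le> (\<Sum>b\<in>Basis. norm h * \<bar>frechet_derivative v (at x) b\<bar>)"
      by (intro sum_norm_le) (auto simp: abs_mult Basis_le_norm intro!: mult_right_mono)
    also have "\<dots> = norm h * B x" by (simp add: B_def sum_distrib_left)
    also have "\<dots> \<le> M * norm h" using M(2)[OF x] by (subst mult.commute) (auto intro: mult_right_mono)
    finally show "norm (frechet_derivative v (at x) h) \<le> M * norm h" .
  qed
  define L where "L = M + 2 * A / (\<delta> / 2)"
  have "L > 0" using M A \<delta> by (simp add: L_def add_pos_pos)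
  moreover have "\<bar>u z - u w\<bar> \<le> L * norm (z - w)" if z: "z \<in> sphere 0 1" and w: "w \<in> sphere 0 1" for z w
  proof (cases "norm (z - w) \<le> \<delta> / 2")
    case True
    have sub: "cball z (\<delta> / 2) \<subseteq> K"
    proof
      fix x assume "x \<in> cball z (\<delta> / 2)"
      hence "x - z \<in> cball 0 (\<delta> / 2)" by (simp add: dist_norm norm_minus_commute)
      thus "x \<in> K" unfolding K_def using z by (intro CollectI exI[of _ z] exI[of _ "x - z"]) auto
    qed
    have "norm (v z - v w) \<le> M * norm (z - w)"
    proof (rule differentiable_bound[of "cball z (\<delta> / 2)"])
      fix x assume "x \<in> cball z (\<delta> / 2)"
      hence x: "x \<in> K" using sub by blast
      show "(v has_derivative frechet_derivative v (at x)) (at x within cball z (\<delta> / 2))"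
        using dv KU x has_derivative_at_withinI by blast
      show "onorm (frechet_derivative v (at x)) \<le> M" by (rule on[OF x])
    qed (use True \<delta> in \<open>auto simp: dist_norm\<close>)
    also have "\<dots> \<le> L * norm (z - w)"
      using A \<delta> by (intro mult_right_mono) (auto simp: L_def)
    finally show ?thesis using U(4) z w by simp
  next
    case False
    have "\<bar>u z - u w\<bar> \<le> 2 * A" using A(2)[OF z] A(2)[OF w] by auto
    also have "\<dots> = (2 * A / (\<delta> / 2)) * (\<delta> / 2)" using \<delta> by simp
    also have "\<dots> \<le> (2 * A / (\<delta> / 2)) * norm (z - w)"
      using False A \<delta> by (intro mult_left_mono) auto
    also have "\<dots> \<le> L * norm (z - w)"
      using M by (intro mult_right_mono) (auto simp: L_def)
    finally show ?thesis .
  qed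
  ultimately show ?thesis using that by blast
qed


section \<open>Zonal kernels\<close>

lemma inner_sphere_in_Icc: "z \<in> sphere 0 1 \<Longrightarrow> w \<in> sphere 0 1 \<Longrightarrow> z \<bullet> w \<in> {-1..1}"
  using Cauchy_Schwarz_ineq2[of z w] by (auto simp: abs_le_iff)

lemma continuous_on_zonal:
  fixes K :: "real \<Rightarrow> real"
  assumes "continuous_on {-1..1} K"
  shows "continuous_on (sphere 0 1 \<times> sphere 0 1) (\<lambda>p :: 'a::euclidean_space \<times> 'a. K (fst p \<bullet> snd p))"
  by (rule continuous_on_compose2[OF assms]) (use inner_sphere_in_Icc[where 'a='a] in \<open>auto intro!: continuous_intros\<close>)

lemma continuous_on_zonal_slice:
  fixes K :: "real \<Rightarrow> real" and z :: "'a::euclidean_space"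
  assumes "continuous_on {-1..1} K" and z: "z \<in> sphere 0 1"
  shows "continuous_on (sphere 0 1) (\<lambda>w. K (z \<bullet> w))"
  by (rule continuous_on_compose2[OF assms(1)]) (use inner_sphere_in_Icc[OF z] in \<open>auto intro!: continuous_intros\<close>)

lemma integrable_sphere_pair_continuous:
  fixes F :: "'a::euclidean_space \<times> 'b::euclidean_space \<Rightarrow> real"
  assumes "continuous_on (sphere 0 1 \<times> sphere 0 1) F"
  shows "integrable sphere_vol2 F"
  using integrable_sphere_pair_mult[OF _ assms, of "\<lambda>_. 1"] by simp

lemma smooth_zonal_poly: "smooth_on_sphere (\<lambda>z. poly q (z \<bullet> w))"
  by (intro smooth_on_sphere_polynomial real_polynomial_function_poly_compose
      real_polynomial_function.intros bounded_linear_inner_left)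

text \<open>The right-hand side is a Gegenbauer operator applied to \<open>q\<close>. It is again a
  function of \<open>z \<bullet> w\<close>, so it is symmetric in the two points.\<close>

lemma laplace_beltrami_zonal_poly:
  fixes w z :: "'a::euclidean_space" and q :: "real poly"
  assumes w: "w \<in> sphere 0 1" and z: "z \<in> sphere 0 1"
  defines "Q \<equiv> [:1, 0, -1:] * pderiv (pderiv q) - [:0, real (DIM('a) - 1):] * pderiv q"
  shows "laplace_beltrami (\<lambda>z. poly q (z \<bullet> w)) z = poly Q (z \<bullet> w)"
proof -
  have d: "((\<lambda>z. poly r (z \<bullet> w)) has_derivative (\<lambda>h. (poly (pderiv r) (x \<bullet> w) *\<^sub>R w) \<bullet> h)) (at x within S)" for r x S
  proof -
    have "((\<lambda>z. z \<bullet> w) has_derivative (\<lambda>h. h \<bullet> w)) (at x within S)" by (auto intro!: derivative_eq_intros)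
    from has_derivative_compose[OF this, of "poly r" "\<lambda>h. poly (pderiv r) (x \<bullet> w) * h"]
    have "((\<lambda>z. poly r (z \<bullet> w)) has_derivative (\<lambda>h. poly (pderiv r) (x \<bullet> w) * (h \<bullet> w))) (at x within S)"
      using poly_DERIV[of r "x \<bullet> w"] by (simp add: has_field_derivative_def)
    thus ?thesis by (simp add: inner_commute)
  qed
  define H where "H h = ((poly (pderiv (pderiv q)) (z \<bullet> w) *\<^sub>R w) \<bullet> h) *\<^sub>R w" for h
  have H: "((\<lambda>z. poly (pderiv q) (z \<bullet> w) *\<^sub>R w) has_derivative H) (at z within sphere 0 1)"
    unfolding H_def by (intro has_derivative_scaleR_left d)
  have ww: "(\<Sum>b\<in>Basis. (w \<bullet> b) * (w \<bullet> b)) = 1" using w euclidean_inner[of w w] by (simp add: norm_eq_1)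
  have "laplace_beltrami (\<lambda>z. poly q (z \<bullet> w)) z = (\<Sum>b\<in>Basis. H b \<bullet> b) - H z \<bullet> z
      - real (DIM('a) - 1) * ((poly (pderiv q) (z \<bullet> w) *\<^sub>R w) \<bullet> z)"
    by (rule laplace_beltrami_eq[OF d z H])
  also have "(\<Sum>b\<in>Basis. H b \<bullet> b) = poly (pderiv (pderiv q)) (z \<bullet> w)"
    using ww by (simp add: H_def mult.assoc sum_distrib_left[symmetric])
  finally show ?thesis by (simp add: H_def Q_def inner_commute algebra_simps)
qed

text \<open>On a zonal kernel the Laplacians in the two variables agree.\<close>
lemma zonal_poly_eigenfunction_orthogonal:
  fixes u v :: "'a::euclidean_space \<Rightarrow> real"
  assumes u: "lb_eigenfunction \<mu> u" and v: "lb_eigenfunction \<nu> v" and ne: "\<mu> \<noteq> \<nu>"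
  shows "(LINT p|sphere_vol2. poly q (fst p \<bullet> snd p) * (u (fst p) * v (snd p))) = 0"
proof -
  have su: "smooth_on_sphere u" and sv: "smooth_on_sphere v" using u v by (auto simp: lb_eigenfunction_def)
  note uc = smooth_on_sphere_continuous[OF su] and vc = smooth_on_sphere_continuous[OF sv]
  define Q where "Q = [:1, 0, -1:] * pderiv (pderiv q) - [:0, real (DIM('a) - 1):] * pderiv q"
  define I where "I r = (LINT p|sphere_vol2. poly r (fst p \<bullet> snd p) * (u (fst p) * v (snd p)))" for r
  have int: "integrable sphere_vol2 (\<lambda>p. poly r (fst p \<bullet> snd p) * (u (fst p) * v (snd p)))" for r
    by (intro integrable_sphere_pair_continuous continuous_intros
        continuous_on_compose2[OF uc] continuous_on_compose2[OF vc]) auto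
  have I1: "I r = (LINT w|sphere_vol. v w * (LINT z|sphere_vol. poly r (z \<bullet> w) * u z))" for r
  proof -
    have "I r = (LINT w|sphere_vol. LINT z|sphere_vol. poly r (z \<bullet> w) * (u z * v w))"
      unfolding I_def using sphere_pair.integral_snd[of "\<lambda>z w. poly r (z \<bullet> w) * (u z * v w)"] int[of r]
      by (simp add: case_prod_unfold)
    also have "\<dots> = (LINT w|sphere_vol. LINT z|sphere_vol. v w * (poly r (z \<bullet> w) * u z))" by (simp add: mult_ac)
    finally show ?thesis by simp
  qed
  have I2: "I r = (LINT z|sphere_vol. u z * (LINT w|sphere_vol. poly r (w \<bullet> z) * v w))" for r
  proof -
    have "I r = (LINT z|sphere_vol. LINT w|sphere_vol. poly r (z \<bullet> w) * (u z * v w))"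
      unfolding I_def using sphere_pair.integral_fst[of "\<lambda>z w. poly r (z \<bullet> w) * (u z * v w)"] int[of r]
      by (simp add: case_prod_unfold)
    also have "\<dots> = (LINT z|sphere_vol. LINT w|sphere_vol. u z * (poly r (w \<bullet> z) * v w))"
      by (simp add: mult_ac inner_commute)
    finally show ?thesis by simp
  qed
  have eig: "(LINT z|sphere_vol. poly Q (z \<bullet> w) * f z) = - \<kappa> * (LINT z|sphere_vol. poly q (z \<bullet> w) * f z)"
    if f: "lb_eigenfunction \<kappa> f" and w: "w \<in> sphere 0 1" for f :: "'a \<Rightarrow> real" and \<kappa> w
  proof -
    have sf: "smooth_on_sphere f" using f by (simp add: lb_eigenfunction_def)
    have "(LINT z|sphere_vol. poly Q (z \<bullet> w) * f z) = (LINT z|sphere_vol. laplace_beltrami (\<lambda>z. poly q (z \<bullet> w)) z * f z)"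
      by (intro Bochner_Integration.integral_cong) (auto simp: laplace_beltrami_zonal_poly[OF w] Q_def)
    also have "\<dots> = (LINT z|sphere_vol. poly q (z \<bullet> w) * laplace_beltrami f z)"
      by (rule laplace_beltrami_symmetric[OF smooth_zonal_poly sf, symmetric])
    also have "\<dots> = (LINT z|sphere_vol. - \<kappa> * (poly q (z \<bullet> w) * f z))"
    proof (rule Bochner_Integration.integral_cong[OF refl])
      fix z :: 'a assume "z \<in> space sphere_vol"
      hence "- laplace_beltrami f z = \<kappa> * f z" using f unfolding lb_eigenfunction_def by auto
      hence "laplace_beltrami f z = - \<kappa> * f z" by linarith
      thus "poly q (z \<bullet> w) * laplace_beltrami f z = - \<kappa> * (poly q (z \<bullet> w) * f z)" by simp
    qed
    finally show ?thesis by simp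
  qed
  \<comment> \<open>\<open>I Q\<close> is evaluated twice, with the Laplacian moved onto
    \<open>u\<close> and onto \<open>v\<close>; as \<open>\<mu> \<noteq> \<nu>\<close>, the two
    results force \<open>I q = 0\<close>.\<close>
  have "I Q = (LINT w|sphere_vol. - \<mu> * (v w * (LINT z|sphere_vol. poly q (z \<bullet> w) * u z)))"
    unfolding I1 by (intro Bochner_Integration.integral_cong) (auto simp: eig[OF u])
  also have "\<dots> = - \<mu> * I q" by (simp add: I1)
  finally have 1: "I Q = - \<mu> * I q" .
  have "I Q = (LINT z|sphere_vol. - \<nu> * (u z * (LINT w|sphere_vol. poly q (w \<bullet> z) * v w)))"
    unfolding I2 by (intro Bochner_Integration.integral_cong) (auto simp: eig[OF v])
  also have "\<dots> = - \<nu> * I q" by (simp add: I2)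
  finally have "I q = 0" using 1 ne by simp
  thus ?thesis by (simp add: I_def)
qed

lemma zonal_eigenfunction_orthogonal:
  fixes u v :: "'a::euclidean_space \<Rightarrow> real"
  assumes u: "lb_eigenfunction \<mu> u" and v: "lb_eigenfunction \<nu> v" and ne: "\<mu> \<noteq> \<nu>"
    and K: "continuous_on {-1..1} K"
  shows "(LINT p|sphere_vol2. K (fst p \<bullet> snd p) * (u (fst p) * v (snd p))) = 0"
proof -
  let ?f = "\<lambda>p. u (fst p) * v (snd p)"
  have su: "smooth_on_sphere u" and sv: "smooth_on_sphere v" using u v by (auto simp: lb_eigenfunction_def)
  have fi: "integrable sphere_vol2 ?f"
    by (intro integrable_sphere_pair_continuous continuous_intros continuous_on_compose2[OF smooth_on_sphere_continuous[OF su]]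
        continuous_on_compose2[OF smooth_on_sphere_continuous[OF sv]]) auto
  have int: "integrable sphere_vol2 (\<lambda>p. ?f p * h (fst p \<bullet> snd p))" if "continuous_on {-1..1} h" for h
    using integrable_sphere_pair_mult[OF fi continuous_on_zonal[OF that]] by (simp add: mult.commute)
  have "(LINT p|sphere_vol2. ?f p * K (fst p \<bullet> snd p)) = 0"
  proof (rule integral_mult_eq_0_approx[OF fi int[OF K]])
    fix e :: real assume "e > 0"
    then obtain q where q: "\<And>t. t \<in> {-1..1} \<Longrightarrow> \<bar>K t - poly q t\<bar> < e"
      using Weierstrass_poly[OF K] by blast
    show "\<exists>k. (\<forall>p\<in>space sphere_vol2. \<bar>K (fst p \<bullet> snd p) - k p\<bar> < e) \<and>
      integrable sphere_vol2 (\<lambda>p. ?f p * k p) \<and> (LINT p|sphere_vol2. ?f p * k p) = 0"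
    proof (intro exI[of _ "\<lambda>p. poly q (fst p \<bullet> snd p)"] conjI ballI)
      fix p :: "'a \<times> 'a" assume "p \<in> space sphere_vol2"
      thus "\<bar>K (fst p \<bullet> snd p) - poly q (fst p \<bullet> snd p)\<bar> < e"
        by (intro q inner_sphere_in_Icc) (auto simp: space_pair_measure)
    next
      show "integrable sphere_vol2 (\<lambda>p. ?f p * poly q (fst p \<bullet> snd p))"
        by (intro int continuous_intros)
      show "(LINT p|sphere_vol2. ?f p * poly q (fst p \<bullet> snd p)) = 0"
        using zonal_poly_eigenfunction_orthogonal[OF u v ne, of q] by (simp add: mult.commute)
    qed
  qed
  thus ?thesis by (simp add: mult.commute)
qed

text \<open>A Funk-Hecke statement for invariant functions. The integral operator with kernel
  \<open>K\<close> maps \<open>jacobi_fun i\<close> to an invariant function orthogonal to all other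
  \<open>jacobi_fun j\<close>, hence to a multiple of itself. Only the existence of the factor
  \<open>\<mu>\<close> is needed.\<close>

lemma jacobi_fun_zonal:
  fixes K :: "real \<Rightarrow> real"
  assumes K: "continuous_on {-1..1} K"
  obtains \<mu> where "\<And>u. integrable sphere_vol u \<Longrightarrow>
    (LINT p|sphere_vol2. K (fst p \<bullet> snd p) * (u (fst p) * jacobi_fun i (snd p))) =
     \<mu> * (LINT z|sphere_vol. u z * jacobi_fun i (z :: 'a::euclidean_space \<times> 'b::euclidean_space))"
proof -
  let ?J = "\<lambda>i. jacobi_fun i :: 'a \<times> 'b \<Rightarrow> real"
  define T where "T z = (LINT w|sphere_vol. K (z \<bullet> w) * ?J i w)" for z :: "'a \<times> 'b"
  have Jc: "continuous_on (sphere 0 1 \<times> sphere 0 1) (\<lambda>p :: ('a \<times> 'b) \<times> ('a \<times> 'b). ?J j (snd p))" for j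
    by (rule continuous_on_compose2[OF jacobi_fun_continuous]) (auto intro: continuous_intros)
  have KJc: "continuous_on (sphere 0 1 \<times> sphere 0 1) (\<lambda>p :: ('a \<times> 'b) \<times> ('a \<times> 'b). K (fst p \<bullet> snd p) * ?J i (snd p))"
    by (intro continuous_intros continuous_on_zonal K Jc)
  have pair: "(LINT p|sphere_vol2. K (fst p \<bullet> snd p) * (u (fst p) * ?J i (snd p))) = (LINT z|sphere_vol. u z * T z)"
    if u: "integrable sphere_vol u" for u
  proof -
    have int: "integrable sphere_vol2 (\<lambda>p. (K (fst p \<bullet> snd p) * ?J i (snd p)) * u (fst p))"
      by (intro integrable_sphere_pair_mult integrable_sphere_pair_fst u KJc)
    have "(LINT p|sphere_vol2. K (fst p \<bullet> snd p) * (u (fst p) * ?J i (snd p))) =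
      (LINT z|sphere_vol. LINT w|sphere_vol. (K (z \<bullet> w) * ?J i w) * u z)"
      using sphere_pair.integral_fst[of "\<lambda>z w. (K (z \<bullet> w) * ?J i w) * u z"] int
      by (simp add: case_prod_unfold mult_ac)
    thus ?thesis by (simp add: T_def mult.commute[of _ "u _"])
  qed
  have Tm: "T \<in> borel_measurable sphere_vol"
    unfolding T_def
    using measurable_sphere_pair_continuous[OF KJc]
    by (intro sphere_vol.borel_measurable_lebesgue_integral) (simp add: case_prod_unfold)
  have "bounded ((\<lambda>p :: ('a \<times> 'b) \<times> ('a \<times> 'b). K (fst p \<bullet> snd p) * ?J i (snd p)) ` (sphere 0 1 \<times> sphere 0 1))"
    by (intro compact_imp_bounded compact_continuous_image compact_Times KJc) auto
  then obtain B where B0: "\<And>p. p \<in> sphere 0 1 \<times> sphere 0 1 \<Longrightarrow> \<bar>K (fst p \<bullet> snd p) * ?J i (snd p)\<bar> \<le> B"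
    unfolding bounded_iff by (metis (no_types, lifting) image_eqI real_norm_def)
  have B: "\<bar>K (z \<bullet> w) * ?J i w\<bar> \<le> B" if "z \<in> sphere 0 1" "w \<in> sphere 0 1" for z w
    using B0[of "(z, w)"] that by simp
  define B' where "B' = B * measure (sphere_vol :: ('a \<times> 'b) measure) (sphere 0 1)"
  have TB: "\<bar>T z\<bar> \<le> B'" if z: "z \<in> sphere 0 1" for z
  proof -
    have zc: "continuous_on (sphere 0 1) (\<lambda>w. K (z \<bullet> w) * ?J i w)"
      by (intro continuous_intros jacobi_fun_continuous continuous_on_zonal_slice K z)
    have "\<bar>T z\<bar> \<le> (LINT w|sphere_vol. \<bar>K (z \<bullet> w) * ?J i w\<bar>)"
      unfolding T_def by (rule integral_abs_bound)
    also have "\<dots> \<le> (LINT w|(sphere_vol :: ('a \<times> 'b) measure). B)"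
      using continuous_on_sphere_integrable[OF zc] B[OF z] by (intro integral_mono) auto
    finally show ?thesis by (simp add: B'_def mult.commute)
  qed
  have Ts: "sqint sphere_vol T"
    unfolding sqint_def
  proof (intro conjI Tm)
    show "integrable sphere_vol (\<lambda>z. (norm (T z))\<^sup>2)"
    proof (rule sphere_vol.integrable_const_bound[of _ "B'\<^sup>2"])
      show "AE z in sphere_vol. norm ((norm (T z))\<^sup>2) \<le> B'\<^sup>2"
      proof (rule AE_I2)
        fix z :: "'a \<times> 'b" assume "z \<in> space sphere_vol"
        hence "\<bar>T z\<bar> \<le> B'" by (intro TB) simp
        hence "\<bar>T z\<bar>\<^sup>2 \<le> B'\<^sup>2" by (intro power_mono) auto
        thus "norm ((norm (T z))\<^sup>2) \<le> B'\<^sup>2" by simp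
      qed
      show "(\<lambda>z. (norm (T z))\<^sup>2) \<in> borel_measurable sphere_vol" using Tm by simp
    qed
  qed
  have Tinv: "T (\<gamma> z) = T z" if \<gamma>: "\<gamma> \<in> OxO" and z: "z \<in> sphere 0 1" for \<gamma> z
  proof -
    note o = OxO_orthogonal[OF \<gamma>]
    have gz: "\<gamma> z \<in> sphere 0 1" using orthogonal_transformation_norm[OF o, of z] z by simp
    have "T (\<gamma> z) = (LINT w|sphere_vol. K (\<gamma> z \<bullet> \<gamma> w) * ?J i (\<gamma> w))"
      unfolding T_def
    proof (rule integral_sphere_vol_orthogonal[OF o, symmetric])
      show "(\<lambda>w. K (\<gamma> z \<bullet> w) * ?J i w) \<in> borel_measurable sphere_vol"
        by (intro continuous_on_sphere_measurable continuous_intros jacobi_fun_continuous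
            continuous_on_zonal_slice K gz)
    qed
    moreover have "\<gamma> z \<bullet> \<gamma> w = z \<bullet> w" for w using o unfolding orthogonal_transformation_def by blast
    ultimately show ?thesis by (simp add: T_def jacobi_fun_OxO[OF \<gamma>])
  qed
  define \<mu> where "\<mu> = jacobi_coeff T i"
  have "AE z in sphere_vol. T z - \<mu> * ?J i z = 0"
  proof (rule jacobi_fun_complete)
    have "sqint sphere_vol (\<lambda>z. T z - \<mu> * ?J i z)"
      using sqint_diff[OF Ts sqint_scale[OF jacobi_fun_sqint]] by simp
    thus "(\<lambda>z. T z - \<mu> * ?J i z) \<in> invariants OxO L2_sphere"
      by (auto simp: invariants_def L2_sphere_iff_sqint jacobi_fun_OxO Tinv intro!: AE_I2)
    fix j
    have "(LINT z|sphere_vol. (T z - \<mu> * ?J i z) * ?J j z) =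
      (LINT z|sphere_vol. T z * ?J j z) - \<mu> * (LINT z|sphere_vol. ?J i z * ?J j z)"
      using sqint_inner[OF Ts jacobi_fun_sqint, of j]
      by (simp add: left_diff_distrib mult.assoc jacobi_fun_mult_integrable)
    also have "\<dots> = 0"
    proof (cases "j = i")
      case True
      thus ?thesis using jacobi_coeff[of T i] by (simp add: \<mu>_def)
    next
      case False
      hence "jacobi_eig TYPE('a \<times> 'b) j \<noteq> jacobi_eig TYPE('a \<times> 'b) i" using jacobi_eig_inj by blast
      from zonal_eigenfunction_orthogonal[OF lb_eigenfunction_jacobi_fun lb_eigenfunction_jacobi_fun this K]
      have "(LINT z|sphere_vol. ?J j z * T z) = 0"
        using pair[OF continuous_on_sphere_integrable[OF jacobi_fun_continuous], of j] by simp
      thus ?thesis using False by (simp add: jacobi_fun_orthogonal mult.commute)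
    qed
    finally show "(LINT z|sphere_vol. (T z - \<mu> * ?J i z) * ?J j z) = 0" .
  qed
  hence T: "AE z in sphere_vol. T z = \<mu> * ?J i z" by eventually_elim simp
  have "(LINT z|sphere_vol. u z * T z) = \<mu> * (LINT z|sphere_vol. u z * ?J i z)" if u: "integrable sphere_vol u" for u
  proof -
    have um: "u \<in> borel_measurable sphere_vol" using u by auto
    have "(LINT z|sphere_vol. u z * T z) = (LINT z|sphere_vol. \<mu> * (u z * ?J i z))"
    proof (rule integral_cong_AE)
      show "(\<lambda>z. u z * T z) \<in> borel_measurable sphere_vol" using um Tm by simp
      show "(\<lambda>z. \<mu> * (u z * ?J i z)) \<in> borel_measurable sphere_vol"
        using integrable_mult_continuous_sphere[OF u jacobi_fun_continuous, of i] by auto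
      show "AE z in sphere_vol. u z * T z = \<mu> * (u z * ?J i z)" using T by eventually_elim simp
    qed
    thus ?thesis by simp
  qed
  thus ?thesis using that[of \<mu>] pair by simp
qed


section \<open>The fractional Sobolev space\<close>

lemma frac_c_pos: "0 < s \<Longrightarrow> s < 1 \<Longrightarrow> frac_c N s > 0"
  by (auto simp: frac_c_def intro!: mult_pos_pos divide_pos_pos Gamma_real_pos add_nonneg_pos)

text \<open>The bounds \<open>N \<ge> 2\<close> and \<open>s < 1\<close> keep the argument
  \<open>N / 2 - s\<close> of the Gamma function positive.\<close>

lemma frac_A_pos: "0 < s \<Longrightarrow> s < 1 \<Longrightarrow> N \<ge> 2 \<Longrightarrow> frac_A N s > 0"
  by (auto simp: frac_A_def intro!: divide_pos_pos Gamma_real_pos add_nonneg_pos)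

text \<open>The quotient whose square is the integrand of the energy; on the diagonal it is \<open>0\<close>.\<close>
definition Hs_diff :: "real \<Rightarrow> ('a::euclidean_space \<Rightarrow> real) \<Rightarrow> 'a \<times> 'a \<Rightarrow> real" where
  "Hs_diff s u p = (u (fst p) - u (snd p)) * norm (fst p - snd p) powr (- (real (DIM('a) - 1) + 2 * s) / 2)"

lemma Hs_diff_mult:
  fixes u v :: "'a::euclidean_space \<Rightarrow> real"
  shows "Hs_diff s u p * Hs_diff s v p =
    (u (fst p) - u (snd p)) * (v (fst p) - v (snd p)) / norm (fst p - snd p) powr (real (DIM('a) - 1) + 2 * s)"
proof -
  let ?q = "- (real (DIM('a) - 1) + 2 * s) / 2"
  have "norm (fst p - snd p) powr ?q * norm (fst p - snd p) powr ?q = norm (fst p - snd p) powr (?q + ?q)"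
    by (rule powr_add[symmetric])
  also have "?q + ?q = - (real (DIM('a) - 1) + 2 * s)" by simp
  also have "norm (fst p - snd p) powr \<dots> = inverse (norm (fst p - snd p) powr (real (DIM('a) - 1) + 2 * s))"
    by (rule powr_minus)
  finally have *: "norm (fst p - snd p) powr ?q * norm (fst p - snd p) powr ?q =
    inverse (norm (fst p - snd p) powr (real (DIM('a) - 1) + 2 * s))" .
  have "Hs_diff s u p * Hs_diff s v p = (u (fst p) - u (snd p)) * (v (fst p) - v (snd p)) *
      (norm (fst p - snd p) powr ?q * norm (fst p - snd p) powr ?q)"
    by (simp only: Hs_diff_def mult_ac)
  thus ?thesis unfolding * by (simp only: divide_inverse)
qed

lemma Hs_inner_eq:
  fixes u v :: "'a::euclidean_space \<Rightarrow> real"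
  shows "Hs_inner s u v = frac_c (DIM('a) - 1) s / 2 *
      (LINT p|sphere_vol2. Hs_diff s u p * Hs_diff s v p) +
    frac_A (DIM('a) - 1) s * (LINT z|sphere_vol. u z * v z)"
  by (simp add: Hs_inner_def Let_def case_prod_unfold Hs_diff_mult)

lemma Hs_diff_measurable:
  fixes u :: "'a::euclidean_space \<Rightarrow> real"
  assumes u: "u \<in> borel_measurable sphere_vol"
  shows "Hs_diff s u \<in> borel_measurable sphere_vol2"
proof -
  have "(\<lambda>p :: 'a \<times> 'a. norm (fst p - snd p) powr (- (real (DIM('a) - 1) + 2 * s) / 2))
      \<in> borel_measurable sphere_vol2"
    by (rule measurable_sphere_pair_borel) (simp add: borel_prod[symmetric])
  moreover have "(\<lambda>p :: 'a \<times> 'a. u (fst p)) \<in> borel_measurable sphere_vol2"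
    "(\<lambda>p :: 'a \<times> 'a. u (snd p)) \<in> borel_measurable sphere_vol2"
    by (rule measurable_compose[OF measurable_fst u] measurable_compose[OF measurable_snd u])+
  ultimately show ?thesis unfolding Hs_diff_def[abs_def] by simp
qed

lemma nn_integral_Hs_diff_sq:
  fixes u :: "'a::euclidean_space \<Rightarrow> real"
  shows "(\<integral>\<^sup>+ (z, w). ennreal ((u z - u w)\<^sup>2 / norm (z - w) powr (real (DIM('a) - 1) + 2 * s)) \<partial>sphere_vol2) =
    (\<integral>\<^sup>+ p. ennreal ((norm (Hs_diff s u p))\<^sup>2) \<partial>sphere_vol2)"
proof -
  have "(norm (Hs_diff s u p))\<^sup>2 = (u (fst p) - u (snd p))\<^sup>2 / norm (fst p - snd p) powr (real (DIM('a) - 1) + 2 * s)" for p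
    using Hs_diff_mult[of s u p u] by (simp add: power2_eq_square)
  thus ?thesis by (simp add: case_prod_unfold)
qed

lemma Hs_diff_sqint_iff:
  fixes u :: "'a::euclidean_space \<Rightarrow> real"
  assumes u: "u \<in> borel_measurable sphere_vol"
  shows "sqint sphere_vol2 (Hs_diff s u) \<longleftrightarrow>
    (\<integral>\<^sup>+ p. ennreal ((norm (Hs_diff s u p))\<^sup>2) \<partial>sphere_vol2) < \<infinity>"
  using Hs_diff_measurable[OF u, of s] by (auto simp: sqint_def integrable_iff_bounded)

text \<open>The Lipschitz bound gains two powers of the distance. The remaining exponent
  \<open>?N + 2 * s - 2\<close> is nonnegative, as \<open>?N \<ge> 2\<close>, and below
  \<open>?N\<close>, as \<open>s < 1\<close>.\<close>

lemma Hs_diff_sqint_smooth: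
  fixes u :: "'a::euclidean_space \<Rightarrow> real"
  assumes u: "smooth_on_sphere u" and s: "0 < s" "s < 1" and dim: "DIM('a) \<ge> 3"
  shows "sqint sphere_vol2 (Hs_diff s u)"
proof -
  let ?N = "real (DIM('a) - 1)"
  obtain L where L: "L > 0" "\<And>z w. z \<in> sphere 0 1 \<Longrightarrow> w \<in> sphere 0 1 \<Longrightarrow> \<bar>u z - u w\<bar> \<le> L * norm (z - w)"
    using smooth_on_sphere_Lipschitz[OF u] by blast
  have N: "?N \<ge> 2" using dim by (simp add: of_nat_diff)
  obtain C where C: "C > 0" "\<And>(z::'a) R. z \<in> sphere 0 1 \<Longrightarrow> R > 0 \<Longrightarrow>
    (\<integral>\<^sup>+w. ennreal (if norm (z - w) < R then norm (z - w) powr (- (?N + 2 * s - 2)) else 0) \<partial>sphere_vol)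
      \<le> ennreal (C * R powr (?N - (?N + 2 * s - 2)))"
    using riesz_integral_near[of "?N + 2 * s - 2", where 'a='a] s N by auto
  note um = continuous_on_sphere_measurable[OF smooth_on_sphere_continuous[OF u]]
  have "(\<integral>\<^sup>+ p. ennreal ((norm (Hs_diff s u p))\<^sup>2) \<partial>sphere_vol2) =
    (\<integral>\<^sup>+z. \<integral>\<^sup>+w. ennreal ((norm (Hs_diff s u (z, w)))\<^sup>2) \<partial>sphere_vol \<partial>sphere_vol)"
    using Hs_diff_measurable[OF um, of s] by (intro sphere_vol.nn_integral_fst[symmetric]) simp
  also have "\<dots> \<le> (\<integral>\<^sup>+z. ennreal (L\<^sup>2) * ennreal (C * 3 powr (?N - (?N + 2 * s - 2))) \<partial>(sphere_vol :: 'a measure))"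
  proof (rule nn_integral_mono)
    fix z :: 'a assume "z \<in> space sphere_vol"
    hence z: "z \<in> sphere 0 1" by simp
    let ?k = "\<lambda>w. if norm (z - w) < 3 then norm (z - w) powr (- (?N + 2 * s - 2)) else 0"
    have "(\<integral>\<^sup>+w. ennreal ((norm (Hs_diff s u (z, w)))\<^sup>2) \<partial>sphere_vol) \<le> (\<integral>\<^sup>+w. ennreal (L\<^sup>2) * ennreal (?k w) \<partial>sphere_vol)"
    proof (rule nn_integral_mono)
      fix w :: 'a assume "w \<in> space sphere_vol"
      hence w: "w \<in> sphere 0 1" by simp
      \<comment> \<open>The radius \<open>3\<close> exceeds the diameter of the sphere, so the
        cut-off in the Riesz integral is void.\<close>
      have d3: "norm (z - w) < 3" using norm_triangle_ineq4[of z w] z w by simp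
      have "(norm (Hs_diff s u (z, w)))\<^sup>2 \<le> L\<^sup>2 * ?k w"
      proof (cases "z = w")
        case True
        thus ?thesis by (simp add: Hs_diff_def)
      next
        case False
        hence d: "norm (z - w) > 0" by simp
        have "\<bar>u z - u w\<bar>\<^sup>2 \<le> (L * norm (z - w))\<^sup>2" using L(2)[OF z w] by (intro power_mono) auto
        hence "(u z - u w)\<^sup>2 / norm (z - w) powr (?N + 2 * s) \<le> (L * norm (z - w))\<^sup>2 / norm (z - w) powr (?N + 2 * s)"
          by (intro divide_right_mono) auto
        also have "\<dots> = L\<^sup>2 * (norm (z - w) powr 2 / norm (z - w) powr (?N + 2 * s))"
          using d by (simp add: power_mult_distrib)
        also have "norm (z - w) powr 2 / norm (z - w) powr (?N + 2 * s) = norm (z - w) powr (2 - (?N + 2 * s))"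
          by (rule powr_diff[symmetric])
        also have "2 - (?N + 2 * s) = - (?N + 2 * s - 2)" by simp
        finally show ?thesis
          using Hs_diff_mult[of s u "(z, w)" u] d3 by (simp add: power2_eq_square)
      qed
      thus "ennreal ((norm (Hs_diff s u (z, w)))\<^sup>2) \<le> ennreal (L\<^sup>2) * ennreal (?k w)"
        by (subst ennreal_mult[symmetric]) (auto intro: ennreal_leI)
    qed
    also have "\<dots> = ennreal (L\<^sup>2) * (\<integral>\<^sup>+w. ennreal (?k w) \<partial>sphere_vol)"
      by (intro nn_integral_cmult borel_measurable_sphere_vol) measurable
    also have "\<dots> \<le> ennreal (L\<^sup>2) * ennreal (C * 3 powr (?N - (?N + 2 * s - 2)))"
      by (intro mult_left_mono C z) auto
    finally show "(\<integral>\<^sup>+w. ennreal ((norm (Hs_diff s u (z, w)))\<^sup>2) \<partial>sphere_vol) \<le>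
      ennreal (L\<^sup>2) * ennreal (C * 3 powr (?N - (?N + 2 * s - 2)))" .
  qed
  also have "\<dots> < \<infinity>"
    using emeasure_sphere_vol_finite[where 'a='a] by (simp add: ennreal_mult_less_top)
  finally show ?thesis using Hs_diff_sqint_iff[OF um] by blast
qed

text \<open>By definition some smooth function is at finite distance from \<open>u\<close>, and
  smooth functions have finite energy.\<close>

lemma Hs_sphere_sqint:
  fixes u :: "'a::euclidean_space \<Rightarrow> real"
  assumes u: "u \<in> Hs_sphere s" and s: "0 < s" "s < 1" and dim: "DIM('a) \<ge> 3"
  shows "sqint sphere_vol2 (Hs_diff s u)"
proof -
  let ?M = "(sphere_vol2 :: ('a \<times> 'a) measure)"
  have us: "sqint sphere_vol u" using u by (auto simp: Hs_sphere_def L2_sphere_iff_sqint)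
  obtain w :: "nat \<Rightarrow> 'a \<Rightarrow> real" where w: "\<And>k. smooth_on_sphere (w k)"
    "(\<lambda>k. Hs_sqnorm s (\<lambda>z. u z - w k z)) \<longlonglongrightarrow> 0"
    using u by (auto simp: Hs_sphere_def)
  have "\<forall>\<^sub>F k in sequentially. Hs_sqnorm s (\<lambda>z. u z - w k z) < 1"
    by (rule order_tendstoD(2)[OF w(2)]) simp
  then obtain k where k: "Hs_sqnorm s (\<lambda>z. u z - w k z) < 1" by (auto simp: eventually_sequentially)
  define r where "r z = u z - w k z" for z
  have rm: "r \<in> borel_measurable sphere_vol"
    unfolding r_def using us continuous_on_sphere_measurable[OF smooth_on_sphere_continuous[OF w(1)]]
    by (auto simp: sqint_def)
  have "ennreal (frac_c (DIM('a) - 1) s / 2) * (\<integral>\<^sup>+ p. ennreal ((norm (Hs_diff s r p))\<^sup>2) \<partial>?M) \<le> Hs_sqnorm s r"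
    unfolding Hs_sqnorm_def Let_def nn_integral_Hs_diff_sq by (intro add_increasing2) auto
  also have "\<dots> < 1" using k by (simp add: r_def[abs_def])
  finally have "ennreal (frac_c (DIM('a) - 1) s / 2) * (\<integral>\<^sup>+ p. ennreal ((norm (Hs_diff s r p))\<^sup>2) \<partial>?M) < \<infinity>"
    using ennreal_one_less_top order.strict_trans by fastforce
  moreover have "ennreal (frac_c (DIM('a) - 1) s / 2) \<noteq> 0"
    using frac_c_pos[OF s, of "DIM('a) - 1"] by simp
  ultimately have "(\<integral>\<^sup>+ p. ennreal ((norm (Hs_diff s r p))\<^sup>2) \<partial>?M) < \<infinity>"
    by (auto simp: ennreal_mult_less_top)
  hence r: "sqint ?M (Hs_diff s r)" using Hs_diff_sqint_iff[OF rm] by blast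
  have "Hs_diff s u = (\<lambda>p. Hs_diff s r p + Hs_diff s (w k) p)"
    by (auto simp: Hs_diff_def r_def algebra_simps)
  thus ?thesis using sqint_add[OF r Hs_diff_sqint_smooth[OF w(1) s dim]] by simp
qed

lemma jacobi_fun_0: "jacobi_fun 0 (z :: 'a::euclidean_space \<times> 'b::euclidean_space) = 1"
proof -
  let ?J = "jacobi_poly 0 (real DIM('b) / 2 - 1) (real DIM('a) / 2 - 1)"
  have ab: "real DIM('b) / 2 - 1 > -1" "real DIM('a) / 2 - 1 > -1" by auto
  obtain c where "?J = [:c:]" using jacobi_poly(3)[OF ab, of 0] degree_eq_zeroE by blast
  thus ?thesis using jacobi_poly(1)[OF ab, of 0] by (simp add: jacobi_fun_def)
qed

lemma integral_sphere_pair_swap: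
  fixes F :: "'a::euclidean_space \<times> 'a \<Rightarrow> real"
  assumes "F \<in> borel_measurable sphere_vol2"
  shows "(LINT p|sphere_vol2. F (snd p, fst p)) = (LINT p|sphere_vol2. F p)"
  using sphere_pair.integral_product_swap[OF assms] by (simp add: case_prod_unfold)

text \<open>Expanding the product gives two diagonal and two mixed terms, equal in pairs by
  symmetry. The mixed ones are governed by the factor for index \<open>i\<close>, the diagonal ones
  by the factor for the constant function \<open>jacobi_fun 0\<close>. The terms can be separated
  only because \<open>K\<close> is bounded.\<close>

lemma jacobi_fun_zonal_difference:
  fixes K :: "real \<Rightarrow> real"
  assumes K: "continuous_on {-1..1} K"
  obtains \<kappa> where "\<And>u. integrable sphere_vol u \<Longrightarrow>
    (LINT p|sphere_vol2. K (fst p \<bullet> snd p) *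
      ((u (fst p) - u (snd p)) * (jacobi_fun i (fst p) - jacobi_fun i (snd p)))) =
     \<kappa> * (LINT z|sphere_vol. u z * jacobi_fun i (z :: 'a::euclidean_space \<times> 'b::euclidean_space))"
proof -
  let ?J = "\<lambda>i. jacobi_fun i :: 'a \<times> 'b \<Rightarrow> real"
  let ?M = "sphere_vol2 :: (('a \<times> 'b) \<times> ('a \<times> 'b)) measure"
  obtain \<mu> where \<mu>: "\<And>u. integrable sphere_vol u \<Longrightarrow>
    (LINT p|?M. K (fst p \<bullet> snd p) * (u (fst p) * ?J i (snd p))) = \<mu> * (LINT z|sphere_vol. u z * ?J i z)"
    using jacobi_fun_zonal[OF K, where 'a='a and 'b='b and i=i] by blast
  obtain \<mu>0 where \<mu>0: "\<And>u. integrable sphere_vol u \<Longrightarrow>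
    (LINT p|?M. K (fst p \<bullet> snd p) * (u (fst p) * ?J 0 (snd p))) = \<mu>0 * (LINT z|sphere_vol. u z * ?J 0 z)"
    using jacobi_fun_zonal[OF K, where 'a='a and 'b='b and i=0] by blast
  have "(LINT p|?M. K (fst p \<bullet> snd p) * ((u (fst p) - u (snd p)) * (?J i (fst p) - ?J i (snd p)))) =
     (2 * \<mu>0 - 2 * \<mu>) * (LINT z|sphere_vol. u z * ?J i z)" if u: "integrable sphere_vol u" for u
  proof -
    define F where "F p = K (fst p \<bullet> snd p) * (u (fst p) * ?J i (fst p))" for p
    define H where "H p = K (fst p \<bullet> snd p) * (u (fst p) * ?J i (snd p))" for p
    have ui: "integrable sphere_vol (\<lambda>z. u z * ?J i z)"
      by (rule integrable_mult_continuous_sphere[OF u jacobi_fun_continuous])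
    have Fi: "integrable ?M F" unfolding F_def
      by (intro integrable_sphere_pair_mult continuous_on_zonal K integrable_sphere_pair_fst[OF ui])
    have Hi: "integrable ?M H"
    proof -
      have "continuous_on (sphere 0 1 \<times> sphere 0 1) (\<lambda>p :: ('a \<times> 'b) \<times> ('a \<times> 'b). K (fst p \<bullet> snd p) * ?J i (snd p))"
        by (intro continuous_intros continuous_on_zonal K continuous_on_compose2[OF jacobi_fun_continuous]) auto
      from integrable_sphere_pair_mult[OF integrable_sphere_pair_fst[OF u] this]
      show ?thesis by (simp add: H_def[abs_def] mult_ac)
    qed
    have swap_int: "integrable ?M (\<lambda>p. G (snd p, fst p))" if "integrable ?M G" for G :: "_ \<Rightarrow> real"
      using sphere_pair.integrable_product_swap[OF that] by (simp add: case_prod_unfold)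
    have "(LINT p|?M. K (fst p \<bullet> snd p) * ((u (fst p) - u (snd p)) * (?J i (fst p) - ?J i (snd p)))) =
      (LINT p|?M. (F p + F (snd p, fst p)) - (H p + H (snd p, fst p)))"
      by (intro Bochner_Integration.integral_cong refl) (simp add: F_def H_def inner_commute algebra_simps)
    also have "\<dots> = ((LINT p|?M. F p) + (LINT p|?M. F (snd p, fst p))) - ((LINT p|?M. H p) + (LINT p|?M. H (snd p, fst p)))"
      using Fi Hi swap_int[OF Fi] swap_int[OF Hi] by simp
    also have "(LINT p|?M. F (snd p, fst p)) = (LINT p|?M. F p)" using Fi by (intro integral_sphere_pair_swap) auto
    also have "(LINT p|?M. H (snd p, fst p)) = (LINT p|?M. H p)" using Hi by (intro integral_sphere_pair_swap) auto
    also have "(LINT p|?M. H p) = \<mu> * (LINT z|sphere_vol. u z * ?J i z)" unfolding H_def by (rule \<mu>[OF u])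
    also have "(LINT p|?M. F p) = \<mu>0 * (LINT z|sphere_vol. u z * ?J i z)"
      using \<mu>0[OF ui] by (simp add: F_def jacobi_fun_0)
    finally show ?thesis by (simp add: algebra_simps)
  qed
  thus ?thesis using that by blast
qed

text \<open>For each regularised kernel the pairing is a multiple of the \<open>L^2\<close> inner
  product, with a factor independent of \<open>u\<close>; the singular kernel inherits this in the
  limit.\<close>

lemma jacobi_fun_energy:
  assumes s: "0 < s" "s < 1" and dim: "DIM('a::euclidean_space \<times> 'b::euclidean_space) \<ge> 3"
  obtains \<kappa> where "\<And>u :: 'a \<times> 'b \<Rightarrow> real. sqint sphere_vol u \<Longrightarrow> sqint sphere_vol2 (Hs_diff s u) \<Longrightarrow>
    (LINT p|sphere_vol2. Hs_diff s u p * Hs_diff s (jacobi_fun i) p) =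
     \<kappa> * (LINT z|sphere_vol. u z * jacobi_fun i z)"
proof -
  let ?J = "jacobi_fun i :: 'a \<times> 'b \<Rightarrow> real"
  let ?M = "sphere_vol2 :: (('a \<times> 'b) \<times> ('a \<times> 'b)) measure"
  let ?q = "real (DIM('a \<times> 'b) - 1) + 2 * s"
  have q: "?q > 0" using s by (intro add_nonneg_pos) auto
  \<comment> \<open>On the sphere \<open>2 - 2 * t\<close> is the squared distance of points with
    inner product \<open>t\<close>. The summand \<open>1 / Suc n\<close> keeps the base positive up
    to \<open>t = 1\<close> and thus makes the kernel continuous.\<close>
  define K where "K n t = (2 - 2 * t + 1 / Suc n) powr (- ?q / 2)" for n :: nat and t :: real
  have Kc: "continuous_on {-1..1} (K n)" for n
    unfolding K_def
  proof (intro continuous_intros ballI)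
    fix t :: real assume "t \<in> {-1..1}"
    moreover have "1 / real (Suc n) > 0" by simp
    ultimately have "2 - 2 * t + 1 / real (Suc n) > 0" unfolding atLeastAtMost_iff by linarith
    thus "2 - 2 * t + 1 / real (Suc n) \<noteq> 0" by simp
  qed
  have "\<exists>\<kappa>. \<forall>u. integrable sphere_vol u \<longrightarrow>
    (LINT p|?M. K n (fst p \<bullet> snd p) * ((u (fst p) - u (snd p)) * (?J (fst p) - ?J (snd p)))) =
     \<kappa> * (LINT z|sphere_vol. u z * ?J z)" for n
    by (rule jacobi_fun_zonal_difference[OF Kc, where 'a='a and 'b='b and i=i]) blast
  hence "\<exists>\<kappa>. \<forall>n u. integrable sphere_vol u \<longrightarrow>
    (LINT p|?M. K n (fst p \<bullet> snd p) * ((u (fst p) - u (snd p)) * (?J (fst p) - ?J (snd p)))) =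
     \<kappa> n * (LINT z|sphere_vol. u z * ?J z)" by (intro choice allI)
  then obtain \<kappa> where \<kappa>0: "\<forall>n u. integrable sphere_vol u \<longrightarrow>
    (LINT p|?M. K n (fst p \<bullet> snd p) * ((u (fst p) - u (snd p)) * (?J (fst p) - ?J (snd p)))) =
     \<kappa> n * (LINT z|sphere_vol. u z * ?J z)" ..
  have \<kappa>: "(LINT p|?M. K n (fst p \<bullet> snd p) * ((u (fst p) - u (snd p)) * (?J (fst p) - ?J (snd p)))) =
     \<kappa> n * (LINT z|sphere_vol. u z * ?J z)" if "integrable sphere_vol u" for n u using \<kappa>0 that by blast
  have Js: "sqint ?M (Hs_diff s ?J)" by (intro Hs_diff_sqint_smooth jacobi_fun_smooth s dim)
  have lim: "(\<lambda>n. \<kappa> n * (LINT z|sphere_vol. u z * ?J z)) \<longlonglongrightarrow> (LINT p|?M. Hs_diff s u p * Hs_diff s ?J p)"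
    if u: "sqint sphere_vol u" and us: "sqint ?M (Hs_diff s u)" for u
  proof -
    have ui: "integrable sphere_vol u" by (rule sqint_sphere_integrable[OF u])
    have um: "u \<in> borel_measurable sphere_vol" using ui by auto
    have ium: "integrable ?M (\<lambda>p. Hs_diff s u p * Hs_diff s ?J p)" using sqint_inner[OF us Js] by simp
    let ?f = "\<lambda>n p. K n (fst p \<bullet> snd p) * ((u (fst p) - u (snd p)) * (?J (fst p) - ?J (snd p)))"
    have base: "norm (fst p - snd p) powr - ?q = (2 - 2 * (fst p \<bullet> snd p)) powr (- ?q / 2)"
      if "fst p \<noteq> snd p" "fst p \<in> sphere 0 1" "snd p \<in> sphere 0 1" for p :: "('a \<times> 'b) \<times> ('a \<times> 'b)"
    proof -
      have "(norm (fst p - snd p))\<^sup>2 = 2 - 2 * (fst p \<bullet> snd p)"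
        using that(2,3) by (simp add: power2_norm_eq_inner inner_diff_left inner_diff_right inner_commute norm_eq_1)
      hence h: "2 - 2 * (fst p \<bullet> snd p) = norm (fst p - snd p) powr 2" using that(1) by simp
      have "(2 - 2 * (fst p \<bullet> snd p)) powr (- ?q / 2) = norm (fst p - snd p) powr (2 * (- ?q / 2))"
        by (simp only: h powr_powr)
      thus ?thesis by (simp only: times_divide_eq_right nonzero_mult_div_cancel_left[of "2::real"])
    qed
    have eq: "Hs_diff s u p * Hs_diff s ?J p = (2 - 2 * (fst p \<bullet> snd p)) powr (- ?q / 2) *
        ((u (fst p) - u (snd p)) * (?J (fst p) - ?J (snd p)))"
      if "fst p \<noteq> snd p" "fst p \<in> sphere 0 1" "snd p \<in> sphere 0 1" for p
      unfolding Hs_diff_mult base[OF that, symmetric] powr_minus by (simp add: divide_inverse)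
    have pos: "2 - 2 * (fst p \<bullet> snd p) > 0"
      if "fst p \<noteq> snd p" "fst p \<in> sphere 0 1" "snd p \<in> sphere 0 1" for p :: "('a \<times> 'b) \<times> ('a \<times> 'b)"
    proof -
      have "(fst p - snd p) \<bullet> (fst p - snd p) > 0" using that(1) by simp
      thus ?thesis using that(2,3) by (simp add: inner_diff_left inner_diff_right inner_commute norm_eq_1)
    qed
    have "(\<lambda>n. LINT p|?M. ?f n p) \<longlonglongrightarrow> (LINT p|?M. Hs_diff s u p * Hs_diff s ?J p)"
    \<comment> \<open>The regularised kernels lie below the singular one, so the energy integrand
      itself dominates; it is integrable as a product of square-integrable functions.\<close>
    proof (rule integral_dominated_convergence[where w="\<lambda>p. norm (Hs_diff s u p * Hs_diff s ?J p)"])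
      show "(\<lambda>p. Hs_diff s u p * Hs_diff s ?J p) \<in> borel_measurable ?M" using ium by auto
      show "integrable ?M (\<lambda>p. norm (Hs_diff s u p * Hs_diff s ?J p))" using ium by (rule integrable_norm)
      have Jm: "?J \<in> borel_measurable sphere_vol"
        by (intro continuous_on_sphere_measurable jacobi_fun_continuous)
      show "?f n \<in> borel_measurable ?M" for n
        by (intro borel_measurable_times borel_measurable_diff measurable_sphere_pair_continuous
            continuous_on_zonal Kc measurable_compose[OF measurable_fst um] measurable_compose[OF measurable_snd um]
            measurable_compose[OF measurable_fst Jm] measurable_compose[OF measurable_snd Jm])
      show "AE p in ?M. (\<lambda>n. ?f n p) \<longlonglongrightarrow> Hs_diff s u p * Hs_diff s ?J p"
      proof (rule AE_I2)
        fix p assume "p \<in> space ?M"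
        hence p: "fst p \<in> sphere 0 1" "snd p \<in> sphere 0 1" by (auto simp: space_pair_measure)
        show "(\<lambda>n. ?f n p) \<longlonglongrightarrow> Hs_diff s u p * Hs_diff s ?J p"
        proof (cases "fst p = snd p")
          case True
          thus ?thesis by (simp add: Hs_diff_def)
        next
          case False
          have "(\<lambda>n. K n (fst p \<bullet> snd p)) \<longlonglongrightarrow> (2 - 2 * (fst p \<bullet> snd p) + 0) powr (- ?q / 2)"
            unfolding K_def using pos[OF False p]
            by (intro tendsto_intros LIMSEQ_Suc[OF lim_1_over_n]) auto
          thus ?thesis unfolding eq[OF False p] by (intro tendsto_mult tendsto_const) simp
        qed
      qed
      show "AE p in ?M. norm (?f n p) \<le> norm (Hs_diff s u p * Hs_diff s ?J p)" for n
      proof (rule AE_I2)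
        fix p assume "p \<in> space ?M"
        hence p: "fst p \<in> sphere 0 1" "snd p \<in> sphere 0 1" by (auto simp: space_pair_measure)
        show "norm (?f n p) \<le> norm (Hs_diff s u p * Hs_diff s ?J p)"
        proof (cases "fst p = snd p")
          case False
          have "K n (fst p \<bullet> snd p) \<le> (2 - 2 * (fst p \<bullet> snd p)) powr (- ?q / 2)"
            unfolding K_def using pos[OF False p] q by (intro powr_mono2') auto
          hence "\<bar>K n (fst p \<bullet> snd p)\<bar> \<le> \<bar>(2 - 2 * (fst p \<bullet> snd p)) powr (- ?q / 2)\<bar>" by (simp add: K_def)
          thus ?thesis unfolding eq[OF False p] norm_mult by (intro mult_right_mono) auto
        qed simp
      qed
    qed
    thus ?thesis by (simp add: \<kappa>[OF ui])
  qed
  let ?n = "LINT z|sphere_vol. ?J z * ?J z"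
  have n: "?n \<noteq> 0" using jacobi_fun_sqnorm_pos[of i, where 'a='a and 'b='b] by simp
  define \<kappa>0 where "\<kappa>0 = (LINT p|?M. Hs_diff s ?J p * Hs_diff s ?J p) / ?n"
  \<comment> \<open>Taking \<open>u\<close> to be \<open>jacobi_fun i\<close> itself shows that the
    factors converge, because its \<open>L^2\<close> norm is not zero.\<close>
  have \<kappa>lim: "\<kappa> \<longlonglongrightarrow> \<kappa>0"
    using tendsto_divide[OF lim[OF jacobi_fun_sqint Js] tendsto_const n] n by (simp add: \<kappa>0_def)
  have "(LINT p|?M. Hs_diff s u p * Hs_diff s ?J p) = \<kappa>0 * (LINT z|sphere_vol. u z * ?J z)"
    if "sqint sphere_vol u" "sqint ?M (Hs_diff s u)" for u
    using LIMSEQ_unique[OF lim[OF that] tendsto_mult[OF \<kappa>lim tendsto_const]] .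
  thus ?thesis using that by blast
qed

lemma AE_sphere_pair_fst_snd:
  assumes "AE z in (sphere_vol :: 'a::euclidean_space measure). P z"
  shows "AE p in (sphere_vol2 :: ('a \<times> 'a) measure). P (fst p) \<and> P (snd p)"
proof -
  obtain N where N: "{z \<in> space sphere_vol. \<not> P z} \<subseteq> N" "emeasure sphere_vol N = 0" "N \<in> sets (sphere_vol :: 'a measure)"
    using assms by (rule AE_E)
  let ?S = "space (sphere_vol :: 'a measure)"
  have Stop: "?S \<in> sets (sphere_vol :: 'a measure)" by (rule sets.top)
  have "N \<times> ?S \<in> null_sets sphere_vol2" "?S \<times> N \<in> null_sets sphere_vol2"
    using N Stop sphere_vol.emeasure_pair_measure_Times[OF N(3) Stop]
      sphere_vol.emeasure_pair_measure_Times[OF Stop N(3)]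
    by (auto simp: null_sets_def simp del: space_sphere_vol)
  hence "N \<times> ?S \<union> ?S \<times> N \<in> null_sets sphere_vol2" by (rule null_sets.Un)
  thus ?thesis
    by (rule AE_I') (use N(1) in \<open>auto simp: space_pair_measure simp del: space_sphere_vol\<close>)
qed

text \<open>The linear map \<open>Hs_diff s\<close> carries the energy, up to a constant, to the
  \<open>L^2\<close> inner product on pairs of points, where the orthogonal series with the
  \<open>L^2\<close> coefficients converges.\<close>

theorem orthogonal_basis_Hs:
  assumes s: "0 < s" "s < 1" and dim: "DIM('a::euclidean_space \<times> 'b::euclidean_space) \<ge> 3"
  shows "orthogonal_basis (invariants OxO (Hs_sphere s)) (Hs_inner s) (jacobi_fun :: nat \<Rightarrow> 'a \<times> 'b \<Rightarrow> real)"
  unfolding orthogonal_basis_def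
proof (intro conjI allI ballI impI)
  let ?J = "jacobi_fun :: nat \<Rightarrow> 'a \<times> 'b \<Rightarrow> real"
  let ?M = "sphere_vol2 :: (('a \<times> 'b) \<times> ('a \<times> 'b)) measure"
  let ?c = "frac_c (DIM('a \<times> 'b) - 1) s" and ?A = "frac_A (DIM('a \<times> 'b) - 1) s"
  have c: "?c > 0" by (rule frac_c_pos[OF s])
  have A: "?A > 0" by (rule frac_A_pos[OF s]) (use dim in linarith)
  have "\<exists>\<kappa>. \<forall>u :: 'a \<times> 'b \<Rightarrow> real. sqint sphere_vol u \<longrightarrow> sqint ?M (Hs_diff s u) \<longrightarrow>
    (LINT p|?M. Hs_diff s u p * Hs_diff s (?J i) p) = \<kappa> * (LINT z|sphere_vol. u z * ?J i z)" for i
    by (rule jacobi_fun_energy[OF s dim, of i]) blast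
  hence "\<exists>\<kappa>. \<forall>i. \<forall>u :: 'a \<times> 'b \<Rightarrow> real. sqint sphere_vol u \<longrightarrow> sqint ?M (Hs_diff s u) \<longrightarrow>
    (LINT p|?M. Hs_diff s u p * Hs_diff s (?J i) p) = \<kappa> i * (LINT z|sphere_vol. u z * ?J i z)"
    by (intro choice allI)
  then obtain \<kappa> where \<kappa>0: "\<forall>i. \<forall>u :: 'a \<times> 'b \<Rightarrow> real. sqint sphere_vol u \<longrightarrow> sqint ?M (Hs_diff s u) \<longrightarrow>
    (LINT p|?M. Hs_diff s u p * Hs_diff s (?J i) p) = \<kappa> i * (LINT z|sphere_vol. u z * ?J i z)" ..
  have \<kappa>: "(LINT p|?M. Hs_diff s u p * Hs_diff s (?J i) p) = \<kappa> i * (LINT z|sphere_vol. u z * ?J i z)"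
    if "sqint sphere_vol u" "sqint ?M (Hs_diff s u)" for i u
    using \<kappa>0 that by blast
  have Js: "sqint ?M (Hs_diff s (?J i))" for i by (intro Hs_diff_sqint_smooth jacobi_fun_smooth s dim)
  have JJ: "(LINT p|?M. Hs_diff s (?J i) p * Hs_diff s (?J j) p) = \<kappa> j * (LINT z|sphere_vol. ?J i z * ?J j z)" for i j
    by (rule \<kappa>[OF jacobi_fun_sqint Js])
  {
    fix i
    \<comment> \<open>Membership in the closure is witnessed by the constant sequence.\<close>
    have "Hs_sqnorm s (\<lambda>z. ?J i z - ?J i z) = 0"
      by (simp add: Hs_sqnorm_def Let_def case_prod_unfold)
    hence "?J i \<in> Hs_sphere s"
      using jacobi_fun_sqint[of i] jacobi_fun_smooth[of i]
      by (auto simp: Hs_sphere_def L2_sphere_iff_sqint intro!: exI[of _ "\<lambda>_. ?J i"])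
    thus "?J i \<in> invariants OxO (Hs_sphere s)" by (auto simp: invariants_def jacobi_fun_OxO)
    have "(LINT p|?M. Hs_diff s (?J i) p * Hs_diff s (?J i) p) \<ge> 0" by (intro integral_nonneg_AE) auto
    hence "Hs_inner s (?J i) (?J i) > 0"
      unfolding Hs_inner_eq using c A jacobi_fun_sqnorm_pos[of i, where 'a='a and 'b='b]
      by (intro add_nonneg_pos mult_nonneg_nonneg mult_pos_pos) auto
    thus "Hs_inner s (?J i) (?J i) \<noteq> 0" by simp
  }
  {
    fix i j :: nat assume "i \<noteq> j"
    thus "Hs_inner s (?J i) (?J j) = 0" by (simp add: Hs_inner_eq JJ jacobi_fun_orthogonal)
  }
  fix u :: "'a \<times> 'b \<Rightarrow> real" assume uH: "u \<in> invariants OxO (Hs_sphere s)"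
  have uL: "u \<in> invariants OxO L2_sphere" using uH by (auto simp: invariants_def Hs_sphere_def)
  hence us: "sqint sphere_vol u" by (simp add: invariants_def L2_sphere_iff_sqint)
  have ud: "sqint ?M (Hs_diff s u)"
    using uH by (intro Hs_sphere_sqint s dim) (auto simp: invariants_def)
  let ?c' = "jacobi_coeff u"
  define S where "S k z = (\<Sum>i<k. ?c' i *\<^sub>R ?J i z)" for k z
  have S: "sqint sphere_vol (S k)" for k unfolding S_def by (intro sqint_sum sqint_scale jacobi_fun_sqint) auto
  have limu: "(\<lambda>k. LINT z|sphere_vol. (norm (S k z - u z))\<^sup>2) \<longlonglongrightarrow> 0"
    using jacobi_series_L2[OF uL] unfolding S_def .
  have dS: "(\<Sum>i<k. ?c' i *\<^sub>R Hs_diff s (?J i) p) = Hs_diff s (S k) p" for k p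
    by (simp add: Hs_diff_def S_def sum_subtractf[symmetric] sum_distrib_right left_diff_distrib right_diff_distrib mult_ac)
  have eo: "(LINT p|?M. Hs_diff s (?J i) p \<bullet> Hs_diff s (?J j) p) = 0" if "i \<noteq> j" for i j
    using that by (simp add: JJ jacobi_fun_orthogonal)
  have ec: "(LINT p|?M. Hs_diff s u p \<bullet> Hs_diff s (?J i) p) = ?c' i * (LINT p|?M. Hs_diff s (?J i) p \<bullet> Hs_diff s (?J i) p)" for i
    using jacobi_coeff[of u i] by (simp add: JJ \<kappa>[OF us ud])
  obtain W where W: "sqint ?M W" "(\<lambda>k. LINT p|?M. (norm (Hs_diff s (S k) p - W p))\<^sup>2) \<longlonglongrightarrow> 0"
    using orthogonal_series_converges[OF ud Js eo ec] unfolding dS[symmetric] .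
  have Sd: "sqint ?M (Hs_diff s (S k))" for k
    unfolding dS[symmetric, abs_def] by (intro sqint_sum sqint_scale Js) auto
  \<comment> \<open>The limit \<open>W\<close> is identified almost everywhere along a common
    subsequence: \<open>r\<close> serves the difference quotients, and \<open>r'\<close> inside it
    the partial sums themselves, whose limit is \<open>u\<close>.\<close>
  obtain r where r: "strict_mono r" "AE p in ?M. (\<lambda>n. Hs_diff s (S (r n)) p) \<longlonglongrightarrow> W p"
    using sqint_AE_subseq[of ?M "\<lambda>k. Hs_diff s (S k)" W, OF Sd W] .
  have limr: "(\<lambda>n. LINT z|sphere_vol. (norm (S (r n) z - u z))\<^sup>2) \<longlonglongrightarrow> 0"
    using LIMSEQ_subseq_LIMSEQ[OF limu r(1)] by (simp add: o_def)
  obtain r' where r': "strict_mono r'" "AE z in sphere_vol. (\<lambda>n. S (r (r' n)) z) \<longlonglongrightarrow> u z"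
    using sqint_AE_subseq[of sphere_vol "\<lambda>n. S (r n)" u, OF S us limr] .
  have WU: "AE p in ?M. W p = Hs_diff s u p"
    using r(2) AE_sphere_pair_fst_snd[OF r'(2)]
  proof eventually_elim
    case (elim p)
    have "(\<lambda>n. Hs_diff s (S (r (r' n))) p) \<longlonglongrightarrow> W p"
      using LIMSEQ_subseq_LIMSEQ[OF elim(1) r'(1)] by (simp add: o_def)
    moreover have "(\<lambda>n. Hs_diff s (S (r (r' n))) p) \<longlonglongrightarrow> Hs_diff s u p"
      unfolding Hs_diff_def using elim(2) by (intro tendsto_intros) auto
    ultimately show ?case by (rule LIMSEQ_unique)
  qed
  have "Hs_inner s (\<lambda>z. u z - S k z) (\<lambda>z. u z - S k z) =
    ?c / 2 * (LINT p|?M. (norm (Hs_diff s (S k) p - W p))\<^sup>2) + ?A * (LINT z|sphere_vol. (norm (S k z - u z))\<^sup>2)" for k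
  proof -
    have d: "Hs_diff s (\<lambda>z. u z - S k z) p = Hs_diff s u p - Hs_diff s (S k) p" for p
      by (simp add: Hs_diff_def algebra_simps)
    have "(LINT p|?M. Hs_diff s (\<lambda>z. u z - S k z) p * Hs_diff s (\<lambda>z. u z - S k z) p) =
      (LINT p|?M. (norm (Hs_diff s (S k) p - W p))\<^sup>2)"
    proof (rule integral_cong_AE)
      show "(\<lambda>p. Hs_diff s (\<lambda>z. u z - S k z) p * Hs_diff s (\<lambda>z. u z - S k z) p) \<in> borel_measurable ?M"
        unfolding d using sqint_inner[OF sqint_diff[OF ud Sd] sqint_diff[OF ud Sd], of k k] by auto
      show "(\<lambda>p. (norm (Hs_diff s (S k) p - W p))\<^sup>2) \<in> borel_measurable ?M"
        using sqint_integrable[OF sqint_diff[OF Sd W(1)]] by auto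
      show "AE p in ?M. Hs_diff s (\<lambda>z. u z - S k z) p * Hs_diff s (\<lambda>z. u z - S k z) p = (norm (Hs_diff s (S k) p - W p))\<^sup>2"
        using WU by eventually_elim (simp add: d power2_eq_square algebra_simps)
    qed
    moreover have "(LINT z|sphere_vol. (u z - S k z) * (u z - S k z)) = (LINT z|sphere_vol. (norm (S k z - u z))\<^sup>2)"
      by (simp add: power2_eq_square[symmetric] power2_commute)
    ultimately show ?thesis by (simp add: Hs_inner_eq)
  qed
  moreover have "(\<lambda>k. ?c / 2 * (LINT p|?M. (norm (Hs_diff s (S k) p - W p))\<^sup>2) +
      ?A * (LINT z|sphere_vol. (norm (S k z - u z))\<^sup>2)) \<longlonglongrightarrow> ?c / 2 * 0 + ?A * 0"
    by (intro tendsto_intros W(2) limu)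
  ultimately show "\<exists>c. (\<lambda>k. let r = \<lambda>z. u z - (\<Sum>i<k. c i * jacobi_fun i z) in Hs_inner s r r) \<longlonglongrightarrow> 0"
    by (intro exI[of _ ?c']) (simp add: Let_def S_def)
qed


section \<open>Growth of the Fourier symbol\<close>

text \<open>On the unit circle \<open>sqrt (1 - Re x)\<close> is a multiple of the sine of half the
  angle, and so subadditive under multiplication. The proof extends this to the disc by
  \<open>|1 - x|^2 \<le> 2 (1 - Re x)\<close>, without polar coordinates.\<close>

lemma one_minus_Re_mult:
  assumes "norm x \<le> 1" "norm y \<le> 1"
  shows "sqrt (1 - Re (x * y)) \<le> sqrt (1 - Re x) + sqrt (1 - Re y)"
proof -
  have sq: "norm (1 - x) \<le> sqrt 2 * sqrt (1 - Re x)" if "norm x \<le> 1" for x :: complex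
  proof -
    have "(norm (1 - x))\<^sup>2 = 1 - 2 * Re x + (norm x)\<^sup>2"
      unfolding cmod_power2 by (simp add: power2_eq_square algebra_simps)
    also have "\<dots> \<le> 2 * (1 - Re x)" using that power_le_one[of "norm x" 2] by simp
    finally have "norm (1 - x) \<le> sqrt (2 * (1 - Re x))" by (rule real_le_rsqrt)
    thus ?thesis by (simp only: real_sqrt_mult)
  qed
  have pos: "0 \<le> 1 - Re x" "0 \<le> 1 - Re y"
    using assms complex_Re_le_cmod[of x] complex_Re_le_cmod[of y] by linarith+
  have "1 - Re (x * y) = (1 - Re x) + (1 - Re y) - Re ((1 - x) * (1 - y))" by (simp add: algebra_simps)
  also have "\<dots> \<le> (1 - Re x) + (1 - Re y) + norm (1 - x) * norm (1 - y)"
    using complex_Re_le_cmod[of "- ((1 - x) * (1 - y))"] by (simp add: norm_mult)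
  also have "norm (1 - x) * norm (1 - y) \<le> (sqrt 2 * sqrt (1 - Re x)) * (sqrt 2 * sqrt (1 - Re y))"
    using pos by (intro mult_mono sq assms) auto
  also have "(1 - Re x) + (1 - Re y) + \<dots> = (sqrt (1 - Re x) + sqrt (1 - Re y))\<^sup>2"
    using pos by (simp add: power2_sum)
  finally have "1 - Re (x * y) \<le> (sqrt (1 - Re x) + sqrt (1 - Re y))\<^sup>2" by simp
  thus ?thesis using pos by (intro real_le_lsqrt) auto
qed

text \<open>By subadditivity \<open>sqrt (1 - Re x)\<close> grows at most linearly under powers;
  squaring gives the factor \<open>k^2\<close>.\<close>

lemma one_minus_Re_power_le:
  assumes "norm x \<le> 1"
  shows "1 - Re (x ^ k) \<le> (real k)\<^sup>2 * (1 - Re x)"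
proof -
  have pos: "0 \<le> 1 - Re y" if "norm y \<le> 1" for y
    using that complex_Re_le_cmod[of y] by linarith
  have nk: "norm (x ^ k) \<le> 1" for k using assms by (simp add: norm_power power_le_one)
  have "sqrt (1 - Re (x ^ k)) \<le> real k * sqrt (1 - Re x)"
  proof (induction k)
    case (Suc k)
    have "sqrt (1 - Re (x * x ^ k)) \<le> sqrt (1 - Re x) + sqrt (1 - Re (x ^ k))"
      by (rule one_minus_Re_mult[OF assms nk])
    thus ?case using Suc by (simp add: distrib_right)
  qed simp
  hence "(sqrt (1 - Re (x ^ k)))\<^sup>2 \<le> (real k * sqrt (1 - Re x))\<^sup>2"
    using pos[OF nk] by (intro power_mono) auto
  thus ?thesis using pos[OF nk] pos[OF assms] by (simp add: power_mult_distrib)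
qed

section \<open>A set of controlled size on which the power stays away from its maximum\<close>

lemma arctan_bounds:
  assumes "0 \<le> (t::real)" "t \<le> 1"
  shows "t / 2 \<le> arctan t" "arctan t \<le> t"
proof -
  have "t / 2 \<le> arctan t \<and> arctan t \<le> t"
  proof (cases "t = 0")
    case False
    hence "\<exists>\<xi>>0. \<xi> < t \<and> arctan t - arctan 0 = (t - 0) * inverse (1 + \<xi>\<^sup>2)"
      using assms by (intro MVT2) (auto intro!: DERIV_arctan)
    then obtain \<xi> where \<xi>: "\<xi> > 0" "\<xi> < t" "arctan t = t * inverse (1 + \<xi>\<^sup>2)" by auto
    have "\<xi>\<^sup>2 \<le> 1" using \<xi> assms by (intro power_le_one) auto
    moreover have "0 \<le> \<xi>\<^sup>2" by simp
    ultimately have "inverse 2 \<le> inverse (1 + \<xi>\<^sup>2)" "inverse (1 + \<xi>\<^sup>2) \<le> inverse 1"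
      using le_imp_inverse_le[of "1 + \<xi>\<^sup>2" 2] le_imp_inverse_le[of 1 "1 + \<xi>\<^sup>2"] by linarith+
    hence "t * inverse 2 \<le> t * inverse (1 + \<xi>\<^sup>2)" "t * inverse (1 + \<xi>\<^sup>2) \<le> t * inverse 1"
      using assms(1) by (blast intro: mult_left_mono)+
    moreover have "t / 2 = t * inverse 2" "t = t * inverse 1" by simp_all
    ultimately show ?thesis unfolding \<xi>(3) by linarith
  qed simp
  thus "t / 2 \<le> arctan t" "arctan t \<le> t" by auto
qed

text \<open>The slope bounds put \<open>k\<close> times the argument of \<open>w\<close> between
  \<open>1 / 8\<close> and \<open>1\<close>, since \<open>arctan \<tau>\<close> lies between
  \<open>\<tau> / 2\<close> and \<open>\<tau>\<close>. There the cosine decreases, and a modulus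
  below \<open>1\<close> can only lower the bound because
  \<open>cos (1 / 8) \<ge> 0\<close>.\<close>

lemma Re_power_le_in_sector:
  fixes w :: complex
  assumes w: "norm w \<le> 1" "Re w > 0" and k: "k > 0"
    and t: "1 / (4 * real k) \<le> Im w / Re w" "Im w / Re w \<le> 1 / real k"
  shows "Re (w ^ k) \<le> cos (1 / 8)"
proof -
  define \<tau> where "\<tau> = Im w / Re w"
  define \<theta> where "\<theta> = arctan \<tau>"
  have \<tau>: "1 / (4 * real k) \<le> \<tau>" "\<tau> \<le> 1 / real k" using t by (simp_all add: \<tau>_def)
  have "1 / real k \<le> 1" using k by simp
  moreover have "0 \<le> 1 / (4 * real k)" by simp
  ultimately have \<tau>01: "0 \<le> \<tau>" "\<tau> \<le> 1" using \<tau> by linarith+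
  have "\<tau> / 2 \<le> \<theta>" "\<theta> \<le> \<tau>" using arctan_bounds[OF \<tau>01] by (simp_all add: \<theta>_def)
  moreover have "1 / (4 * real k) / 2 \<le> \<tau> / 2" using \<tau>(1) by (rule divide_right_mono) simp
  ultimately have \<theta>: "1 / (4 * real k) / 2 \<le> \<theta>" "\<theta> \<le> 1 / real k"
    using \<tau>(2) by (blast intro: order_trans)+
  have "real k * (1 / (4 * real k) / 2) \<le> real k * \<theta>" "real k * \<theta> \<le> real k * (1 / real k)"
    by (rule mult_left_mono[OF \<theta>(1)] mult_left_mono[OF \<theta>(2)], simp)+
  hence k\<theta>: "1 / 8 \<le> real k * \<theta>" "real k * \<theta> \<le> 1" using k by simp_all
  have sq: "sqrt (1 + \<tau>\<^sup>2) > 0" by (simp add: add_pos_nonneg)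
  have polar: "w = of_real (Re w * sqrt (1 + \<tau>\<^sup>2)) * cis \<theta>"
    using w(2) sq by (simp add: complex_eq_iff \<theta>_def cos_arctan sin_arctan \<tau>_def)
  define \<rho> where "\<rho> = Re w * sqrt (1 + \<tau>\<^sup>2)"
  have wp: "w = of_real \<rho> * cis \<theta>" using polar by (simp only: \<rho>_def)
  have \<rho>: "0 \<le> \<rho>" using w(2) sq by (simp add: \<rho>_def)
  have "norm w = \<rho>" using \<rho> by (subst wp) (simp add: norm_mult)
  hence "\<rho> \<le> 1" using w(1) by simp
  have "Re (w ^ k) = \<rho> ^ k * cos (real k * \<theta>)"
  proof -
    have "w ^ k = of_real (\<rho> ^ k) * cis (real k * \<theta>)"
      by (subst wp) (simp only: power_mult_distrib Complex.DeMoivre of_real_power)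
    thus ?thesis by simp
  qed
  also have "\<dots> \<le> \<rho> ^ k * cos (1 / 8)"
    using k\<theta> pi_gt3 \<rho> by (intro mult_left_mono cos_monotone_0_pi_le) auto
  also have "\<dots> \<le> 1 * cos (1 / 8)"
    using \<rho> \<open>\<rho> \<le> 1\<close> pi_gt3 by (intro mult_right_mono power_le_one cos_ge_zero) auto
  finally show ?thesis by simp
qed

text \<open>Both the deviation of \<open>x\<close> from \<open>t *\<^sub>R a\<close> and the
  difference of \<open>norm x\<close> and \<open>t\<close> are at most
  \<open>norm (x - t *\<^sub>R a)\<close>, hence the factor \<open>2\<close>.\<close>

lemma norm_sgn_diff_le:
  fixes x a :: "'a::real_normed_vector"
  assumes "norm a = 1" "t > 0" "x \<noteq> 0" "t \<le> norm x"
  shows "norm (sgn x - a) \<le> 2 * norm (x - t *\<^sub>R a) / norm x"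
proof -
  have "norm x \<le> norm (t *\<^sub>R a) + norm (x - t *\<^sub>R a)" by (metis add.commute diff_add_cancel norm_triangle_ineq)
  hence 1: "norm x - t \<le> norm (x - t *\<^sub>R a)" using assms by simp
  have "norm (x - norm x *\<^sub>R a) = norm ((x - t *\<^sub>R a) + (t - norm x) *\<^sub>R a)" by (simp add: algebra_simps)
  also have "\<dots> \<le> norm (x - t *\<^sub>R a) + \<bar>t - norm x\<bar>"
    using norm_triangle_ineq[of "x - t *\<^sub>R a" "(t - norm x) *\<^sub>R a"] assms by simp
  also have "\<dots> \<le> 2 * norm (x - t *\<^sub>R a)" using 1 assms by simp
  finally have "norm (x - norm x *\<^sub>R a) \<le> 2 * norm (x - t *\<^sub>R a)" .
  moreover have "sgn x - a = (1 / norm x) *\<^sub>R (x - norm x *\<^sub>R a)"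
    using assms by (simp add: sgn_div_norm scaleR_diff_right inverse_eq_divide)
  ultimately show ?thesis using assms by (simp add: divide_right_mono)
qed

text \<open>The cone over this set contains a box with one side of length \<open>1 / 4\<close> in the direction of \<open>a\<close>
  and all other sides of order \<open>1 / k\<close>.\<close>
lemma sphere_vol_sector_lower_bound:
  fixes a b :: "'a::euclidean_space"
  assumes a: "a \<in> Basis" and b: "b \<in> Basis" and ab: "a \<noteq> b" and k: "k > 0"
  defines "R \<equiv> {z \<in> sphere 0 1. 1 - cos (1 / 8) \<le> 1 - Re (Complex (z \<bullet> a) (z \<bullet> b) ^ k) \<and>
      1 / (8 * real k) \<le> norm (a - z) \<and> norm (a - z) \<le> 4 / real k}"
  shows "R \<in> sets sphere_vol"
    and "emeasure sphere_vol R \<ge> ennreal (real DIM('a) / 32 * (1 / (4 * real DIM('a))) ^ (DIM('a) - 2) / real k ^ (DIM('a) - 1))"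
proof -
  let ?D = "DIM('a)"
  have kp: "real k > 0" "real k \<ge> 1" using k by simp_all
  have Dp: "real ?D > 0" by simp
  have uc: "continuous_on UNIV (\<lambda>z. Re (Complex (z \<bullet> a) (z \<bullet> b) ^ k))"
    using real_polynomial_function_Complex_power by (intro continuous_on_real_polynomial_function) blast
  have "closed {z. 1 - cos (1 / 8) \<le> 1 - Re (Complex (z \<bullet> a) (z \<bullet> b) ^ k)}"
    "closed {z. 1 / (8 * real k) \<le> norm (a - z)}" "closed {z. norm (a - z) \<le> 4 / real k}"
    by (intro closed_Collect_le continuous_intros uc)+
  hence cl: "closed (sphere 0 1 \<inter> {z. 1 - cos (1 / 8) \<le> 1 - Re (Complex (z \<bullet> a) (z \<bullet> b) ^ k)} \<inter>
     {z. 1 / (8 * real k) \<le> norm (a - z)} \<inter> {z. norm (a - z) \<le> 4 / real k})"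
    by (intro closed_Int) auto
  have "closed R"
    by (rule back_subst[of closed, OF cl]) (auto simp: R_def)
  hence Rb: "R \<in> sets borel" by simp
  have RS: "R \<subseteq> sphere 0 1" unfolding R_def by blast
  show "R \<in> sets sphere_vol" by (rule sets_sphere_volI[OF Rb RS])
  \<comment> \<open>So small that \<open>DIM('a)\<close> coordinates of size \<open>h\<close> add up
    to \<open>1 / (8 k)\<close> only.\<close>
  define h where "h = 1 / (8 * real ?D * real k)"
  have h: "h > 0" using kp Dp by (simp add: h_def)
  \<comment> \<open>The sides along \<open>a\<close> and \<open>b\<close> are chosen so that the
    quotient of these coordinates ranges over the interval from \<open>1 / (4 k)\<close> to
    \<open>1 / k\<close> required by \<open>Re_power_le_in_sector\<close>.\<close>
  define l where "l = (\<Sum>c\<in>Basis. (if c = a then 1 / 4 else if c = b then 1 / (8 * real k) else - h) *\<^sub>R c)"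
  define m where "m = (\<Sum>c\<in>Basis. (if c = a then 1 / 2 else if c = b then 1 / (4 * real k) else h) *\<^sub>R c)"
  have l: "l \<bullet> c = (if c = a then 1 / 4 else if c = b then 1 / (8 * real k) else - h)"
    and m: "m \<bullet> c = (if c = a then 1 / 2 else if c = b then 1 / (4 * real k) else h)" if "c \<in> Basis" for c
    using that by (simp_all add: l_def m_def)
  have incl: "cbox l m \<subseteq> {x \<in> ball 0 1 - {0}. sgn x \<in> R}"
  proof
    fix x assume "x \<in> cbox l m"
    hence x: "l \<bullet> c \<le> x \<bullet> c" "x \<bullet> c \<le> m \<bullet> c" if "c \<in> Basis" for c using that by (auto simp: mem_box)
    have xa: "1 / 4 \<le> x \<bullet> a" "x \<bullet> a \<le> 1 / 2" using x[OF a] l[OF a] m[OF a] by auto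
    have xb: "1 / (8 * real k) \<le> x \<bullet> b" "x \<bullet> b \<le> 1 / (4 * real k)" using x[OF b] l[OF b] m[OF b] ab by auto
    have xc: "\<bar>x \<bullet> c\<bar> \<le> h" if "c \<in> Basis" "c \<noteq> a" "c \<noteq> b" for c
      using x[OF that(1)] l[OF that(1)] m[OF that(1)] that by auto
    have x0: "x \<noteq> 0" using xa by auto
    have xn: "x \<bullet> a \<le> norm x" using Basis_le_norm[OF a, of x] by linarith
    hence xn4: "norm x \<ge> 1 / 4" using xa by linarith
    define y where "y = x - (x \<bullet> a) *\<^sub>R a"
    have "norm y \<le> (\<Sum>c\<in>Basis. \<bar>y \<bullet> c\<bar>)" by (rule norm_le_l1)
    also have "\<dots> \<le> (\<Sum>c\<in>Basis. (if c = b then 1 / (4 * real k) else 0) + h)"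
    proof (rule sum_mono)
      fix c :: 'a assume c: "c \<in> Basis"
      have "0 \<le> 1 / (8 * real k)" by simp
      thus "\<bar>y \<bullet> c\<bar> \<le> (if c = b then 1 / (4 * real k) else 0) + h"
        using xb xc[OF c] h a c ab by (auto simp: y_def inner_diff_left inner_Basis)
    qed
    also have "\<dots> = 1 / (4 * real k) + real ?D * h" using b by (simp add: sum.distrib)
    also have "real ?D * h = 1 / (8 * real k)" using Dp by (simp add: h_def)
    also have "1 / (4 * real k) + 1 / (8 * real k) = 3 / (8 * real k)" using kp by (simp add: field_simps)
    finally have y: "norm y \<le> 3 / (8 * real k)" .
    \<comment> \<open>Together with \<open>x \<bullet> a \<le> 1 / 2\<close> this keeps the box
      inside the unit ball.\<close>
    have "3 / (8 * real k) \<le> 3 / 8" using kp by (intro divide_left_mono) auto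
    hence "norm y \<le> 3 / 8" using y by linarith
    moreover have "norm x \<le> norm y + norm ((x \<bullet> a) *\<^sub>R a)"
      unfolding y_def by (metis diff_add_cancel norm_triangle_ineq)
    hence "norm x \<le> norm y + x \<bullet> a" using xa a by simp
    ultimately have xl1: "norm x < 1" using xa by linarith
    let ?z = "sgn x"
    have z: "norm ?z = 1" using x0 by (simp add: norm_sgn)
    have za: "?z \<bullet> a = (x \<bullet> a) / norm x" and zb: "?z \<bullet> b = (x \<bullet> b) / norm x"
      by (simp_all add: sgn_div_norm divide_inverse mult.commute)
    have zb_lower: "1 / (8 * real k) \<le> ?z \<bullet> b"
    proof -
      have "x \<bullet> b \<ge> 0" using xb(1) kp by (smt (verit) divide_nonneg_nonneg)
      hence "x \<bullet> b \<le> (x \<bullet> b) / norm x" using xl1 x0 by (simp add: field_simps mult_left_le_one_le)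
      thus ?thesis using xb(1) zb by linarith
    qed
    have "\<bar>(a - ?z) \<bullet> b\<bar> \<le> norm (a - ?z)" using b by (rule Basis_le_norm)
    moreover have "(a - ?z) \<bullet> b = - (?z \<bullet> b)" using a b ab by (simp add: inner_diff_left inner_Basis)
    ultimately have d1: "1 / (8 * real k) \<le> norm (a - ?z)" using zb_lower by linarith
    have "norm (?z - a) \<le> 2 * norm (x - (x \<bullet> a) *\<^sub>R a) / norm x"
      using a xa xn x0 by (intro norm_sgn_diff_le) auto
    also have "\<dots> \<le> 2 * (3 / (8 * real k)) / (1 / 4)"
      using y xn4 by (intro frac_le) (auto simp: y_def)
    also have "\<dots> \<le> 4 / real k" using kp by (simp add: field_simps)
    finally have d2: "norm (a - ?z) \<le> 4 / real k" by (simp add: norm_minus_commute)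
    have "Re (Complex (?z \<bullet> a) (?z \<bullet> b) ^ k) \<le> cos (1 / 8)"
    proof (rule Re_power_le_in_sector[OF _ _ k])
      have "(?z \<bullet> a)\<^sup>2 + (?z \<bullet> b)\<^sup>2 = (\<Sum>c\<in>{a, b}. (?z \<bullet> c) * (?z \<bullet> c))" using ab by (simp add: power2_eq_square)
      also have "\<dots> \<le> (\<Sum>c\<in>Basis. (?z \<bullet> c) * (?z \<bullet> c))" using a b by (intro sum_mono2) auto
      also have "\<dots> = 1" using z euclidean_inner[of ?z ?z] by (simp add: norm_eq_1)
      finally show "norm (Complex (?z \<bullet> a) (?z \<bullet> b)) \<le> 1" by (simp add: cmod_def)
      show "Re (Complex (?z \<bullet> a) (?z \<bullet> b)) > 0" using xa x0 za by simp
      have q: "Im (Complex (?z \<bullet> a) (?z \<bullet> b)) / Re (Complex (?z \<bullet> a) (?z \<bullet> b)) = (x \<bullet> b) / (x \<bullet> a)"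
        using x0 by (simp add: za zb)
      have "1 / (8 * real k) / (1 / 2) \<le> (x \<bullet> b) / (x \<bullet> a)"
        using xa xb kp by (intro frac_le) (auto intro: order_trans[rotated, OF xb(1)])
      thus "1 / (4 * real k) \<le> Im (Complex (?z \<bullet> a) (?z \<bullet> b)) / Re (Complex (?z \<bullet> a) (?z \<bullet> b))"
        unfolding q by simp
      have "(x \<bullet> b) / (x \<bullet> a) \<le> 1 / (4 * real k) / (1 / 4)"
        using xa xb kp by (intro frac_le) auto
      thus "Im (Complex (?z \<bullet> a) (?z \<bullet> b)) / Re (Complex (?z \<bullet> a) (?z \<bullet> b)) \<le> 1 / real k"
        unfolding q by simp
    qed
    hence "?z \<in> R" using z d1 d2 by (simp add: R_def)
    thus "x \<in> {x \<in> ball 0 1 - {0}. sgn x \<in> R}" using xl1 x0 by simp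
  qed
  have sgnR: "{x \<in> ball 0 1 - {0}. sgn x \<in> R} \<in> sets borel"
  proof -
    have "sgn -` R \<inter> space borel \<in> sets borel" by (rule measurable_sets[OF sgn_borel_measurable Rb])
    moreover have "{x \<in> ball 0 1 - {0}. sgn x \<in> R} = (ball 0 1 - {0}) \<inter> (sgn -` R \<inter> space borel)" by auto
    ultimately show ?thesis by simp
  qed
  have "emeasure lborel (cbox l m) = ennreal (\<Prod>c\<in>Basis. (m - l) \<bullet> c)"
  proof -
    have "l \<bullet> c \<le> m \<bullet> c" if "c \<in> Basis" for c
      using h kp by (auto simp: l[OF that] m[OF that] field_simps)
    thus ?thesis by (simp add: emeasure_lborel_cbox_eq)
  qed
  also have "(\<Prod>c\<in>Basis. (m - l) \<bullet> c) = ((m - l) \<bullet> a) * (((m - l) \<bullet> b) * (\<Prod>c\<in>Basis - {a} - {b}. (m - l) \<bullet> c))"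
    using a b ab by (subst prod.remove[of _ a], simp, simp, subst prod.remove[of _ b]) auto
  also have "(\<Prod>c\<in>Basis - {a} - {b}. (m - l) \<bullet> c) = (\<Prod>c\<in>Basis - {a} - {b}. 2 * h)"
    by (intro prod.cong refl) (auto simp: inner_diff_left l m)
  also have "\<dots> = (2 * h) ^ (?D - 2)"
    using a b ab by (simp add: card_Diff_singleton numeral_2_eq_2)
  also have "(m - l) \<bullet> a = 1 / 4" using l[OF a] m[OF a] by (simp add: inner_diff_left)
  also have "(m - l) \<bullet> b = 1 / (8 * real k)" using l[OF b] m[OF b] ab kp by (simp add: inner_diff_left field_simps)
  also have "1 / 4 * (1 / (8 * real k) * (2 * h) ^ (?D - 2)) = 1 / 32 * (1 / (4 * real ?D)) ^ (?D - 2) / real k ^ (?D - 1)"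
  proof -
    have "card {a, b} \<le> ?D" using a b by (intro card_mono) auto
    hence "?D \<ge> 2" using ab by simp
    hence "?D - 1 = Suc (?D - 2)" by linarith
    moreover have "2 * h = 1 / (4 * real ?D) / real k" by (simp add: h_def)
    ultimately show ?thesis by (simp add: power_divide power_mult_distrib)
  qed
  finally have vol: "emeasure lborel (cbox l m) = ennreal (1 / 32 * (1 / (4 * real ?D)) ^ (?D - 2) / real k ^ (?D - 1))" .
  have "emeasure sphere_vol R = of_nat ?D * emeasure lborel {x \<in> ball 0 1 - {0}. sgn x \<in> R}"
    by (rule emeasure_sphere_vol[OF Rb RS])
  also have "\<dots> \<ge> of_nat ?D * emeasure lborel (cbox l m)"
    using sgnR by (intro mult_left_mono emeasure_mono incl) auto
  also have "of_nat ?D * emeasure lborel (cbox l m) =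
      ennreal (real ?D / 32 * (1 / (4 * real ?D)) ^ (?D - 2) / real k ^ (?D - 1))"
    unfolding vol by (simp add: ennreal_of_nat_eq_real_of_nat ennreal_mult'[symmetric])
  finally show "emeasure sphere_vol R \<ge> ennreal (real ?D / 32 * (1 / (4 * real ?D)) ^ (?D - 2) / real k ^ (?D - 1))" .
qed

lemma fourier_symbol_growth:
  assumes sym: "is_fourier_symbol TYPE('a::euclidean_space) s \<phi>" and s: "0 < s" "s < 1" and dim: "DIM('a) \<ge> 3"
  obtains c C where "c > 0" "C > 0" "\<And>k::nat. k > 0 \<Longrightarrow>
    c * real k powr (2 * s) \<le> \<phi> (real k * (real k + real DIM('a) - 2)) \<and>
    \<phi> (real k * (real k + real DIM('a) - 2)) \<le> C * real k powr (2 * s)"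
proof -
  let ?D = "DIM('a)"
  let ?N = "real (?D - 1)"
  let ?c = "frac_c (?D - 1) s" and ?A = "frac_A (?D - 1) s"
  have cpos: "?c > 0" by (rule frac_c_pos[OF s])
  have Apos: "?A > 0" by (rule frac_A_pos[OF s]) (use dim in linarith)
  have N: "?N \<ge> 2" using dim by (simp add: of_nat_diff)
  obtain a :: 'a where a: "a \<in> Basis" by (meson nonempty_Basis ex_in_conv)
  have "Basis - {a} \<noteq> {}"
  proof
    assume "Basis - {a} = {}"
    hence "?D \<le> card {a}" by (intro card_mono) auto
    thus False using dim by simp
  qed
  then obtain b where b: "b \<in> Basis" "a \<noteq> b" by blast
  have ip: "a \<bullet> a = 1" "a \<bullet> b = 0" "norm a = 1" using a b by (auto simp: inner_Basis)
  obtain C1 where C1: "C1 > 0" "\<And>(z::'a) R. z \<in> sphere 0 1 \<Longrightarrow> R > 0 \<Longrightarrow>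
    (\<integral>\<^sup>+w. ennreal (if norm (z - w) < R then norm (z - w) powr (- (?N + 2 * s - 2)) else 0) \<partial>sphere_vol)
      \<le> ennreal (C1 * R powr (?N - (?N + 2 * s - 2)))"
    using riesz_integral_near[of "?N + 2 * s - 2", where 'a='a] s N by auto
  obtain C2 where C2: "C2 > 0" "\<And>(z::'a) R. z \<in> sphere 0 1 \<Longrightarrow> R > 0 \<Longrightarrow>
    (\<integral>\<^sup>+w. ennreal (if norm (z - w) \<ge> R then norm (z - w) powr (- (?N + 2 * s)) else 0) \<partial>sphere_vol)
      \<le> ennreal (C2 * R powr (?N - (?N + 2 * s)))"
    using riesz_integral_far[of "?N + 2 * s", where 'a='a] s by auto
  \<comment> \<open>The quadratic bound with its factor \<open>1 / 2\<close> is used near the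
    maximum and the bound \<open>2\<close> far from it.\<close>
  define B where "B = C1 / 2 + 2 * C2"
  define V where "V = real ?D / 32 * (1 / (4 * real ?D)) ^ (?D - 2)"
  have V: "V > 0" using dim by (simp add: V_def)
  \<comment> \<open>The product of the lower bounds on the sector set: for \<open>1 - u\<close>, for
    the kernel at distance at most \<open>4 / k\<close>, and for the measure, with the powers of
    \<open>k\<close> split off.\<close>
  define b0 where "b0 = (1 - cos (1 / 8)) * 4 powr (- (?N + 2 * s)) * V"
  have "cos (1 / 8) < cos (0::real)" using pi_gt3 by (intro cos_monotone_0_pi) auto
  hence cos8: "1 - cos (1 / 8 :: real) > 0" by simp
  hence b0: "b0 > 0" using V by (simp add: b0_def)
  have B: "B > 0" using C1 C2 by (simp add: B_def)
  have main: "?c * (b0 * real k powr (2 * s)) + ?A \<le> \<phi> (real k * (real k + real ?D - 2)) \<and>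
    \<phi> (real k * (real k + real ?D - 2)) \<le> ?c * (B * real k powr (2 * s)) + ?A" if k: "k > 0" for k :: nat
  proof -
    let ?\<phi> = "\<phi> (real k * (real k + real ?D - 2))"
    have kp: "real k > 0" "real k \<ge> 1" using k by simp_all
    define u where "u z = Re (Complex (z \<bullet> a) (z \<bullet> b) ^ k)" for z :: 'a
    have ua: "u a = 1" by (simp add: u_def ip Complex_eq)
    have uc: "continuous_on UNIV u"
      unfolding u_def using real_polynomial_function_Complex_power by (intro continuous_on_real_polynomial_function) blast
    hence um[measurable]: "u \<in> borel_measurable borel" by (rule borel_measurable_continuous_onI)
    have u_bounds: "0 \<le> 1 - u z" "1 - u z \<le> 2" "1 - u z \<le> (real k)\<^sup>2 / 2 * (norm (a - z))\<^sup>2"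
      if z: "z \<in> sphere 0 1" for z
    proof -
      let ?w = "Complex (z \<bullet> a) (z \<bullet> b)"
      have zz: "z \<bullet> z = 1" using z by (simp add: norm_eq_1)
      have "(z \<bullet> a)\<^sup>2 + (z \<bullet> b)\<^sup>2 = (\<Sum>c\<in>{a, b}. (z \<bullet> c) * (z \<bullet> c))" using b by (simp add: power2_eq_square)
      also have "\<dots> \<le> (\<Sum>c\<in>Basis. (z \<bullet> c) * (z \<bullet> c))" using a b by (intro sum_mono2) auto
      also have "\<dots> = 1" using zz euclidean_inner[of z z] by simp
      finally have w1: "norm ?w \<le> 1" by (simp add: cmod_def)
      have wk: "norm (?w ^ k) \<le> 1" using w1 by (simp only: norm_power power_le_one norm_ge_zero)
      show "0 \<le> 1 - u z" "1 - u z \<le> 2"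
        using wk abs_Re_le_cmod[of "?w ^ k"] unfolding u_def by linarith+
      have "1 - u z \<le> (real k)\<^sup>2 * (1 - Re ?w)" unfolding u_def by (rule one_minus_Re_power_le[OF w1])
      also have "1 - Re ?w = (norm (a - z))\<^sup>2 / 2"
        using zz ip by (simp add: power2_norm_eq_inner inner_diff_left inner_diff_right inner_commute)
      finally show "1 - u z \<le> (real k)\<^sup>2 / 2 * (norm (a - z))\<^sup>2" by simp
    qed
    define f where "f \<epsilon> z = indicator {z \<in> sphere 0 1. \<epsilon> < norm (a - z)} z * ((1 - u z) / norm (a - z) powr (?N + 2 * s))"
      for \<epsilon> :: real and z
    have f_nonneg: "0 \<le> f \<epsilon> z" if "z \<in> sphere 0 1" for \<epsilon> z
      unfolding f_def using u_bounds(1)[OF that] by (intro mult_nonneg_nonneg divide_nonneg_nonneg) auto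
    have fm: "f \<epsilon> \<in> borel_measurable sphere_vol" for \<epsilon>
    proof -
      have "indicator {z \<in> sphere 0 1. \<epsilon> < norm (a - z)} \<in> borel_measurable (sphere_vol :: 'a measure)"
        by (intro borel_measurable_indicator sets_sphere_volI) auto
      moreover have "(\<lambda>z. (1 - u z) / norm (a - z) powr (?N + 2 * s)) \<in> borel_measurable sphere_vol"
        by (rule borel_measurable_sphere_vol) measurable
      ultimately show ?thesis unfolding f_def by (rule borel_measurable_times)
    qed
    \<comment> \<open>Nonnegativity allows passing to extended integrals, where integrability need
      not be known beforehand.\<close>
    have I_eq: "(LINT z|sphere_vol. f \<epsilon> z) = enn2real (\<integral>\<^sup>+z. ennreal (f \<epsilon> z) \<partial>sphere_vol)" for \<epsilon>
      using f_nonneg by (intro integral_eq_nn_integral fm AE_I2) auto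
    have upper: "(\<integral>\<^sup>+z. ennreal (f \<epsilon> z) \<partial>sphere_vol) \<le> ennreal (B * real k powr (2 * s))" if \<epsilon>: "\<epsilon> > 0" for \<epsilon>
    proof -
      \<comment> \<open>At this distance the bounds \<open>k^2 d^2 / 2\<close> and \<open>2\<close>
        are of the same order, so both parts contribute the same power of \<open>k\<close>.\<close>
      let ?R = "1 / real k"
      have ennreal_combine: "ennreal (p * x + q * y) = ennreal p * ennreal x + ennreal q * ennreal y"
        if "0 \<le> p" "0 \<le> x" "0 \<le> q" "0 \<le> y" for p q x y :: real
        using that by (simp add: ennreal_plus ennreal_mult)
      let ?g1 = "\<lambda>z. if norm (a - z) < ?R then norm (a - z) powr (- (?N + 2 * s - 2)) else 0"
      let ?g2 = "\<lambda>z. if norm (a - z) \<ge> ?R then norm (a - z) powr (- (?N + 2 * s)) else 0"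
      have "(\<integral>\<^sup>+z. ennreal (f \<epsilon> z) \<partial>sphere_vol) \<le>
        (\<integral>\<^sup>+z. ennreal ((real k)\<^sup>2 / 2) * ennreal (?g1 z) + ennreal 2 * ennreal (?g2 z) \<partial>sphere_vol)"
      proof (rule nn_integral_mono)
        fix z :: 'a assume "z \<in> space sphere_vol"
        hence z: "z \<in> sphere 0 1" by simp
        have "f \<epsilon> z \<le> (real k)\<^sup>2 / 2 * ?g1 z + 2 * ?g2 z"
        proof (cases "\<epsilon> < norm (a - z)")
          case False
          hence "f \<epsilon> z = 0" by (simp add: f_def)
          thus ?thesis by simp
        next
          case True
          hence d: "norm (a - z) > 0" using \<epsilon> by linarith
          have fz: "f \<epsilon> z = (1 - u z) * norm (a - z) powr (- (?N + 2 * s))"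
          proof -
            have "z \<in> {z \<in> sphere 0 1. \<epsilon> < norm (a - z)}" using z True by blast
            thus ?thesis unfolding f_def powr_minus by (simp only: indicator_simps mult_1_left divide_inverse)
          qed
          show ?thesis
          proof (cases "norm (a - z) < ?R")
            case True
            have "f \<epsilon> z \<le> ((real k)\<^sup>2 / 2 * (norm (a - z))\<^sup>2) * norm (a - z) powr (- (?N + 2 * s))"
              unfolding fz using u_bounds(3)[OF z] by (intro mult_right_mono) auto
            also have "\<dots> = (real k)\<^sup>2 / 2 * (norm (a - z) powr 2 * norm (a - z) powr (- (?N + 2 * s)))"
              using d by simp
            also have "norm (a - z) powr 2 * norm (a - z) powr (- (?N + 2 * s)) = norm (a - z) powr (2 + - (?N + 2 * s))"
              by (rule powr_add[symmetric])
            also have "2 + - (?N + 2 * s) = - (?N + 2 * s - 2)" by simp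
            finally show ?thesis using True by simp
          next
            case False
            have "f \<epsilon> z \<le> 2 * norm (a - z) powr (- (?N + 2 * s))"
              unfolding fz using u_bounds(2)[OF z] by (intro mult_right_mono) auto
            thus ?thesis using False by simp
          qed
        qed
        hence "ennreal (f \<epsilon> z) \<le> ennreal ((real k)\<^sup>2 / 2 * ?g1 z + 2 * ?g2 z)" by (rule ennreal_leI)
        also have "\<dots> = ennreal ((real k)\<^sup>2 / 2) * ennreal (?g1 z) + ennreal 2 * ennreal (?g2 z)"
          by (rule ennreal_combine) auto
        finally show "ennreal (f \<epsilon> z) \<le> \<dots>" .
      qed
      also have "\<dots> = ennreal ((real k)\<^sup>2 / 2) * (\<integral>\<^sup>+z. ennreal (?g1 z) \<partial>sphere_vol) +
          ennreal 2 * (\<integral>\<^sup>+z. ennreal (?g2 z) \<partial>sphere_vol)"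
      proof -
        have m: "(\<lambda>z. ennreal (?g1 z)) \<in> borel_measurable sphere_vol" "(\<lambda>z. ennreal (?g2 z)) \<in> borel_measurable sphere_vol"
          by (rule borel_measurable_sphere_vol, measurable)+
        show ?thesis using m by (subst nn_integral_add) (auto simp: nn_integral_cmult)
      qed
      also have "\<dots> \<le> ennreal ((real k)\<^sup>2 / 2) * ennreal (C1 * ?R powr (?N - (?N + 2 * s - 2))) +
          ennreal 2 * ennreal (C2 * ?R powr (?N - (?N + 2 * s)))"
        using kp ip by (intro add_mono mult_left_mono C1 C2) auto
      also have "\<dots> = ennreal ((real k)\<^sup>2 / 2 * (C1 * ?R powr (?N - (?N + 2 * s - 2))) + 2 * (C2 * ?R powr (?N - (?N + 2 * s))))"
        by (rule ennreal_combine[symmetric]) (use C1(1) C2(1) in auto)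
      also have "(real k)\<^sup>2 / 2 * (C1 * ?R powr (?N - (?N + 2 * s - 2))) + 2 * (C2 * ?R powr (?N - (?N + 2 * s))) = B * real k powr (2 * s)"
      proof -
        have R: "?R powr x = real k powr (- x)" for x by (simp add: inverse_eq_divide[symmetric] inverse_powr powr_minus)
        have "(real k)\<^sup>2 * ?R powr (?N - (?N + 2 * s - 2)) = real k powr 2 * real k powr (- (?N - (?N + 2 * s - 2)))"
          unfolding R using kp by simp
        also have "\<dots> = real k powr (2 + - (?N - (?N + 2 * s - 2)))" by (rule powr_add[symmetric])
        also have "2 + - (?N - (?N + 2 * s - 2)) = 2 * s" by simp
        finally have 1: "(real k)\<^sup>2 * ?R powr (?N - (?N + 2 * s - 2)) = real k powr (2 * s)" .
        have 2: "?R powr (?N - (?N + 2 * s)) = real k powr (2 * s)" unfolding R by simp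
        have "(real k)\<^sup>2 / 2 * (C1 * ?R powr (?N - (?N + 2 * s - 2))) =
          C1 / 2 * ((real k)\<^sup>2 * ?R powr (?N - (?N + 2 * s - 2)))" by simp
        thus ?thesis unfolding 1 2 B_def by (simp add: distrib_right)
      qed
      finally show ?thesis .
    qed
    \<comment> \<open>For such small \<open>\<epsilon>\<close> the truncation does not touch the
      sector set, so the bound is uniform.\<close>
    have lower: "ennreal (b0 * real k powr (2 * s)) \<le> (\<integral>\<^sup>+z. ennreal (f \<epsilon> z) \<partial>sphere_vol)"
      if \<epsilon>: "\<epsilon> < 1 / (8 * real k)" for \<epsilon>
    proof -
      define R where "R = {z \<in> sphere 0 1. 1 - cos (1 / 8) \<le> 1 - Re (Complex (z \<bullet> a) (z \<bullet> b) ^ k) \<and>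
        1 / (8 * real k) \<le> norm (a - z) \<and> norm (a - z) \<le> 4 / real k}"
      note R = sphere_vol_sector_lower_bound[OF a b k, folded R_def]
      let ?m = "(1 - cos (1 / 8)) * (4 / real k) powr (- (?N + 2 * s))"
      have "ennreal (b0 * real k powr (2 * s)) = ennreal ?m * ennreal (V / real k ^ (?D - 1))"
      proof -
        have "(4 / real k) powr (- (?N + 2 * s)) = 4 powr (- (?N + 2 * s)) * real k powr (?N + 2 * s)"
          unfolding powr_divide powr_minus[of "real k"] by (simp only: divide_inverse inverse_inverse_eq)
        also have "real k powr (?N + 2 * s) = real k ^ (?D - 1) * real k powr (2 * s)"
          by (simp only: powr_add powr_realpow[OF kp(1)])
        finally have "?m * (V / real k ^ (?D - 1)) = b0 * real k powr (2 * s)"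
          using kp by (simp add: b0_def)
        thus ?thesis using cos8 by (subst ennreal_mult'[symmetric]) (auto simp: mult_nonneg_nonneg)
      qed
      also have "\<dots> \<le> ennreal ?m * emeasure sphere_vol R"
        using R(2) by (intro mult_left_mono) (simp_all add: V_def)
      also have "\<dots> = (\<integral>\<^sup>+z. ennreal ?m * indicator R z \<partial>sphere_vol)"
        using R(1) by (rule nn_integral_cmult_indicator[symmetric])
      also have "\<dots> \<le> (\<integral>\<^sup>+z. ennreal (f \<epsilon> z) \<partial>sphere_vol)"
      proof (rule nn_integral_mono)
        fix z :: 'a
        show "ennreal ?m * indicator R z \<le> ennreal (f \<epsilon> z)"
        proof (cases "z \<in> R")
          case True
          hence z: "z \<in> sphere 0 1" "1 - cos (1 / 8) \<le> 1 - u z" "1 / (8 * real k) \<le> norm (a - z)" "norm (a - z) \<le> 4 / real k"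
            by (auto simp: R_def u_def)
          have "0 < 1 / (8 * real k)" using kp by simp
          hence d: "0 < norm (a - z)" using z(3) by linarith
          have fz: "f \<epsilon> z = (1 - u z) * norm (a - z) powr (- (?N + 2 * s))"
          proof -
            have "z \<in> {z \<in> sphere 0 1. \<epsilon> < norm (a - z)}" using z(1,3) \<epsilon> by (simp del: mem_sphere_0)
            thus ?thesis unfolding f_def powr_minus by (simp only: indicator_simps mult_1_left divide_inverse)
          qed
          have "0 \<le> ?N + 2 * s" using N s by linarith
          hence "(4 / real k) powr (- (?N + 2 * s)) \<le> norm (a - z) powr (- (?N + 2 * s))"
            using d z(4) by (intro powr_mono2') auto
          hence "?m \<le> f \<epsilon> z" unfolding fz using z(2) cos8 by (intro mult_mono) auto
          thus ?thesis using True by (simp add: ennreal_leI)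
        qed simp
      qed
      finally show ?thesis .
    qed
    have "lb_eigenfunction (real k * (real k + real ?D - 2)) u"
      unfolding u_def by (rule lb_eigenfunction_Re_power[OF a b])
    \<comment> \<open>As \<open>u a = 1\<close>, the value of the operator at \<open>a\<close> is
      the symbol itself.\<close>
    hence "has_conf_frac_lap s u a (?\<phi> * u a)"
      using sym ip unfolding is_fourier_symbol_def by auto
    hence lim: "((\<lambda>\<epsilon>. ?c * (LINT z|sphere_vol. f \<epsilon> z) + ?A) \<longlongrightarrow> ?\<phi>) (at_right 0)"
      unfolding has_conf_frac_lap_def Let_def ua set_lebesgue_integral_def f_def
      by (simp only: real_scaleR_def mult_1_right)
    have ev: "\<forall>\<^sub>F \<epsilon> in at_right 0. 0 < \<epsilon> \<and> \<epsilon> < 1 / (8 * real k)"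
      using kp by (auto simp: eventually_at_right_field intro!: exI[of _ "1 / (8 * real k)"])
    have "?\<phi> \<le> ?c * (B * real k powr (2 * s)) + ?A"
    proof (rule tendsto_upperbound[OF lim])
      show "\<forall>\<^sub>F \<epsilon> in at_right 0. ?c * (LINT z|sphere_vol. f \<epsilon> z) + ?A \<le> ?c * (B * real k powr (2 * s)) + ?A"
        using ev
      proof eventually_elim
        case (elim \<epsilon>)
        have "(LINT z|sphere_vol. f \<epsilon> z) \<le> B * real k powr (2 * s)"
          unfolding I_eq using upper[of \<epsilon>] elim B by (intro enn2real_leI) auto
        thus ?case using cpos by simp
      qed
    qed simp
    moreover have "?c * (b0 * real k powr (2 * s)) + ?A \<le> ?\<phi>"
    proof (rule tendsto_lowerbound[OF lim])
      show "\<forall>\<^sub>F \<epsilon> in at_right 0. ?c * (b0 * real k powr (2 * s)) + ?A \<le> ?c * (LINT z|sphere_vol. f \<epsilon> z) + ?A"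
        using ev
      proof eventually_elim
        case (elim \<epsilon>)
        have "(\<integral>\<^sup>+z. ennreal (f \<epsilon> z) \<partial>sphere_vol) < top"
          using upper[of \<epsilon>] elim by (auto intro: le_less_trans)
        hence "enn2real (ennreal (b0 * real k powr (2 * s))) \<le> (LINT z|sphere_vol. f \<epsilon> z)"
          unfolding I_eq using lower[of \<epsilon>] elim by (intro enn2real_mono) auto
        moreover have "enn2real (ennreal (b0 * real k powr (2 * s))) = b0 * real k powr (2 * s)"
          using b0 by simp
        ultimately show ?case using cpos by simp
      qed
    qed simp
    ultimately show ?thesis by blast
  qed
  show ?thesis
  proof (rule that[of "?c * b0" "?c * B + ?A"])
    show "?c * b0 > 0" using cpos b0 by simp
    show "?c * B + ?A > 0" using cpos B Apos by (simp add: add_pos_pos)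
    fix k :: nat assume k: "k > 0"
    \<comment> \<open>This absorbs the zeroth-order term \<open>?A\<close> into the upper bound; in
      the lower bound it is dropped as positive.\<close>
    have "1 \<le> real k powr (2 * s)" using k s by (intro ge_one_powr_ge_zero) auto
    hence "?A \<le> ?A * real k powr (2 * s)" using Apos by simp
    thus "?c * b0 * real k powr (2 * s) \<le> \<phi> (real k * (real k + real ?D - 2)) \<and>
      \<phi> (real k * (real k + real ?D - 2)) \<le> (?c * B + ?A) * real k powr (2 * s)"
      using main[OF k] Apos unfolding distrib_right mult.assoc by linarith
  qed
qed

text \<open>With \<open>k = 2 i\<close> the eigenvalue is \<open>k (k + ?D - 2)\<close>, which lies
  between \<open>k^2\<close> and \<open>(?D - 1) k^2\<close> for \<open>k \<ge> 1\<close>; so its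
  power \<open>s\<close> is comparable to \<open>k powr (2 * s)\<close>.\<close>

lemma fourier_symbol_jacobi_growth:
  assumes sym: "is_fourier_symbol TYPE('a::euclidean_space \<times> 'b::euclidean_space) s \<phi>" and s: "0 < s" "s < 1"
    and dim: "DIM('a \<times> 'b) \<ge> 3"
  shows "\<exists>C>1. \<forall>i. inverse C * (1 + jacobi_eig TYPE('a \<times> 'b) i powr s) \<le> \<phi> (jacobi_eig TYPE('a \<times> 'b) i) \<and>
    \<phi> (jacobi_eig TYPE('a \<times> 'b) i) \<le> C * (1 + jacobi_eig TYPE('a \<times> 'b) i powr s)"
proof -
  let ?lam = "jacobi_eig TYPE('a \<times> 'b)"
  let ?D = "real DIM('a \<times> 'b)"
  obtain c C where c: "c > 0" and C: "C > 0" and cC: "\<And>k::nat. k > 0 \<Longrightarrow>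
    c * real k powr (2 * s) \<le> \<phi> (real k * (real k + ?D - 2)) \<and>
    \<phi> (real k * (real k + ?D - 2)) \<le> C * real k powr (2 * s)"
    by (rule fourier_symbol_growth[OF sym s dim]) blast
  have p0: "\<phi> 0 > 0" using sym by (simp add: is_fourier_symbol_def)
  have D: "?D \<ge> 3" using dim by linarith
  \<comment> \<open>One summand for each requirement: \<open>2\<close> for \<open>M > 1\<close>,
    then \<open>C\<close> and \<open>?D / c\<close> for the two bounds at \<open>i > 0\<close>, and
    \<open>\<phi> 0\<close> with its inverse for the eigenvalue \<open>0\<close>, which the growth
    estimate does not cover.\<close>
  define M where "M = 2 + C + ?D / c + \<phi> 0 + 1 / \<phi> 0"
  have terms: "0 < ?D / c" "0 < 1 / \<phi> 0" using c p0 D by (auto intro: divide_pos_pos)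
  hence M: "M > 1" "C \<le> M" "?D / c \<le> M" "\<phi> 0 \<le> M" "1 / \<phi> 0 \<le> M"
    using C p0 unfolding M_def by linarith+
  have "inverse M * (1 + ?lam i powr s) \<le> \<phi> (?lam i) \<and> \<phi> (?lam i) \<le> M * (1 + ?lam i powr s)" for i
  proof (cases "i = 0")
    case True
    hence l: "?lam i = 0" by (simp add: jacobi_eig_def)
    have "1 \<le> \<phi> 0 * M" using M(5) p0 by (simp add: field_simps)
    hence "inverse M \<le> \<phi> 0" using M(1) by (simp add: field_simps)
    thus ?thesis using M(4) by (simp add: l)
  next
    case False
    define k where "k = 2 * i"
    have k: "k > 0" "real k \<ge> 1" using False by (auto simp: k_def)
    have l: "?lam i = real k * (real k + ?D - 2)" by (simp add: jacobi_eig_def k_def)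
    let ?P = "real k powr (2 * s)"
    have P: "(real k)\<^sup>2 powr s = ?P"
    proof -
      have "(real k)\<^sup>2 = real k powr 2" using k by simp
      thus ?thesis by (simp only: powr_powr)
    qed
    have P1: "1 \<le> ?P" using k s by (intro ge_one_powr_ge_zero) auto
    have "real k * real k \<le> real k * (real k + ?D - 2)" using D by (intro mult_left_mono) auto
    hence lo: "(real k)\<^sup>2 \<le> ?lam i" by (simp only: l power2_eq_square)
    have "real k + ?D - 2 \<le> (?D - 1) * real k"
    proof -
      have "0 \<le> (?D - 2) * (real k - 1)" using D k by (intro mult_nonneg_nonneg) auto
      thus ?thesis by (simp add: algebra_simps)
    qed
    hence "real k * (real k + ?D - 2) \<le> real k * ((?D - 1) * real k)" by (intro mult_left_mono) auto
    hence hi: "?lam i \<le> (?D - 1) * (real k)\<^sup>2" by (simp only: l power2_eq_square mult_ac)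
    have "(real k)\<^sup>2 powr s \<le> ?lam i powr s" using lo s by (intro powr_mono2) auto
    hence lo': "?P \<le> ?lam i powr s" by (simp only: P)
    have "?lam i powr s \<le> ((?D - 1) * (real k)\<^sup>2) powr s" using hi s jacobi_eig_nonneg by (intro powr_mono2) auto
    also have "\<dots> = (?D - 1) powr s * ?P" unfolding powr_mult P ..
    also have "(?D - 1) powr s \<le> (?D - 1) powr 1" using D s by (intro powr_mono) auto
    also have "(?D - 1) powr 1 = ?D - 1" using D by simp
    finally have hi': "?lam i powr s \<le> (?D - 1) * ?P" by (simp add: mult_right_mono)
    have b: "c * ?P \<le> \<phi> (?lam i)" "\<phi> (?lam i) \<le> C * ?P" using cC[OF k(1)] by (simp_all only: l)
    have "\<phi> (?lam i) \<le> C * (1 + ?lam i powr s)"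
      using b(2) lo' C by (intro order_trans[OF b(2)] mult_left_mono) auto
    also have "\<dots> \<le> M * (1 + ?lam i powr s)" using M(2) by (intro mult_right_mono) auto
    finally have up: "\<phi> (?lam i) \<le> M * (1 + ?lam i powr s)" .
    have "1 + ?lam i powr s \<le> ?P + (?D - 1) * ?P" using hi' P1 by linarith
    also have "\<dots> = ?D * ?P" by (simp only: left_diff_distrib mult_1_left)
    also have "\<dots> = ?D / c * (c * ?P)" using c by simp
    also have "\<dots> \<le> M * \<phi> (?lam i)" using M(1,3) b(1) c by (intro mult_mono) auto
    finally have "inverse M * (1 + ?lam i powr s) \<le> \<phi> (?lam i)" using M(1) by (simp add: field_simps)
    thus ?thesis using up by blast
  qed
  thus ?thesis using M(1) by blast
qed


theorem proposition1p6:
  fixes N :: nat and \<alpha> \<beta> :: real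
    and G :: "((real^'m::finite) \<times> (real^'n::finite) \<Rightarrow> (real^'m) \<times> (real^'n)) set"
    and \<Phi> :: "nat \<Rightarrow> (real^'m) \<times> (real^'n) \<Rightarrow> real"
    and lam :: "nat \<Rightarrow> real"
  assumes "N \<ge> 3" and "CARD('m) \<ge> 2" and "CARD('n) \<ge> 2" and "CARD('m) + CARD('n) = N + 1"
    and "G = OxO"
    and "\<alpha> = real CARD('m) / 2 - 1" and "\<beta> = real CARD('n) / 2 - 1"
    and "\<And>i z. \<Phi> i z = poly (jacobi_poly i \<beta> \<alpha>) (sqnorm_diff z)"
    and "\<And>i. lam i = 2 * real i * (real N - 1 + 2 * real i)"
  shows "orthogonal_basis (invariants G L2_sphere) L2_inner \<Phi> \<and>
    orthogonal_basis (invariants G H1_sphere) H1_inner \<Phi> \<and>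
    (\<forall>i. invariant_on_sphere G (\<Phi> i) \<and> lb_eigenfunction (lam i) (\<Phi> i) \<and>
       (\<forall>u. lb_eigenfunction (lam i) u \<and> invariant_on_sphere G u \<longrightarrow>
          (\<exists>c. \<forall>z\<in>sphere 0 1. u z = c * \<Phi> i z))) \<and>
    (\<forall>s\<in>{0<..<1}.
       orthogonal_basis (invariants G (Hs_sphere s)) (Hs_inner s) \<Phi> \<and>
       (\<forall>\<phi>. is_fourier_symbol TYPE((real^'m) \<times> (real^'n)) s \<phi> \<longrightarrow>
          (\<forall>i. \<forall>z\<in>sphere 0 1. has_conf_frac_lap s (\<Phi> i) z (\<phi> (lam i) * \<Phi> i z)) \<and>
          (\<exists>C>1. \<forall>i. inverse C * (1 + lam i powr s) \<le> \<phi> (lam i) \<and>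
                       \<phi> (lam i) \<le> C * (1 + lam i powr s))))"
proof -
  have dim: "DIM((real^'m) \<times> (real^'n)) = N + 1" using assms(4) by simp
  have dim3: "DIM((real^'m) \<times> (real^'n)) \<ge> 3" using dim assms(1) by linarith
  have \<Phi>: "\<Phi> = jacobi_fun"
    using assms(8) by (intro ext) (simp add: jacobi_fun_def assms(6,7))
  have lam: "lam = jacobi_eig TYPE((real^'m) \<times> (real^'n))"
  proof
    fix i
    have "real CARD('m) + real CARD('n) = real N + 1" using assms(4) by linarith
    thus "lam i = jacobi_eig TYPE((real^'m) \<times> (real^'n)) i"
      using assms(9)[of i] by (simp add: jacobi_eig_def)
  qed
  have simple: "\<exists>c. \<forall>z\<in>sphere 0 1. u z = c * jacobi_fun i z"
    if "lb_eigenfunction (lam i) u" "invariant_on_sphere OxO u" for i and u :: "(real^'m) \<times> (real^'n) \<Rightarrow> real"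
    using jacobi_eigenvalue_simple that unfolding lam by blast
  have frac: "has_conf_frac_lap s (jacobi_fun i) z (\<phi> (lam i) * jacobi_fun i z)"
    if "is_fourier_symbol TYPE((real^'m) \<times> (real^'n)) s \<phi>" "z \<in> sphere 0 1"
    for s \<phi> i and z :: "(real^'m) \<times> (real^'n)"
    using that lb_eigenfunction_jacobi_fun[of i, where 'a="real^'m" and 'b="real^'n"]
    unfolding is_fourier_symbol_def lam by blast
  show ?thesis
    unfolding \<Phi> assms(5)
    using orthogonal_basis_L2 orthogonal_basis_H1 orthogonal_basis_Hs[OF _ _ dim3] simple frac
      fourier_symbol_jacobi_growth[OF _ _ _ dim3]
      lb_eigenfunction_jacobi_fun[where 'a="real^'m" and 'b="real^'n"]
    by (auto simp: lam invariant_on_sphere_def jacobi_fun_OxO)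
qed

end
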